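(* The weighted projective stack $[X]=[\mathbb{P}(V)]$ with weights $d_0,\dots,d_n$ is D-affine if and only if $\gcd(d_0,\dots,d_n)=1$.
   Context: $\mathbb{K}$ is an algebraically closed field of characteristic zero; $n\geq1$ and $0<d_0\leq d_1\leq\dots\leq d_n$ are integers. $[X]=[\mathbb{P}(V)]=[(V\setminus\{0\})/\mathbb{G}_m]$, where $V=\mathbb{K}^{n+1}$ and $\mathbb{G}_m$ acts on the $i$-th coordinate vector with weight $d_i$. $\mathbb{A}=\mathbb{K}[x_0,\dots,x_n]$ is graded by $\deg x_i=d_i$, and $\mathbb{D}=\mathbb{K}\langle x_0,\dots,x_n,\partial_0,\dots,\partial_n\rangle$ is the Weyl algebra graded by $\deg x_i=d_i$, $\deg\partial_i=-d_i$, with Euler field $\mathbf{E}=\sum_id_ix_i\partial_i\in\mathbb{D}_0$. For a left $\mathbb{D}$-module $M$ and $\mu\in\mathbb{K}$ let $M^\mu=\{m\in M:\mathbf{E}m=\mu m\}$. $M$ is $0$-Euler if $M=\bigoplus_{k\in\mathbb{Z}}M^{k}$; it is then $\mathbb{Z}$-graded by $M_k=M^{k}$. A graded $\mathbb{A}$-module $M$ is torsion if for every $m\in M$ there is $N$ with $\mathbb{A}_km=0$ for all $k>N$. $\mathbb{D}\text{-Grmod}^0$ is the category of $0$-Euler $\mathbb{D}$-modules and $\mathbb{D}\text{-Tors}^0$ its full subcategory of modules that are torsion over $\mathbb{A}$. The category of quasicoherent D-modules on $[X]$ (quasicoherent strongly $\mathbb{G}_m$-equivariant D-modules on $V\setminus\{0\}$)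 is identified with $\mathcal{D}^0_{[X]}\text{-Qcoh}=\mathbb{D}\text{-Grmod}^0/\mathbb{D}\text{-Tors}^0$. The quotient functor $\pi^0_{\mathbb{D}}:\mathbb{D}\text{-Grmod}^0\to\mathcal{D}^0_{[X]}\text{-Qcoh}$ has a right adjoint $\omega^0_{\mathbb{D}}$. Since $\mathbf{E}$ is central in $\mathbb{D}_0$, the degree zero part $(D^0_{[X]})_0=\mathbb{D}_0/\mathbb{D}_0\mathbf{E}$ of $D^0_{[X]}=\mathbb{D}/\mathbb{D}\mathbf{E}$ is an algebra. The global sections functor is $\Gamma_0:\mathcal{D}^0_{[X]}\text{-Qcoh}\to(D^0_{[X]})_0\text{-Mod}$, $\Gamma_0(\mathcal{M})=\omega^0_{\mathbb{D}}(\mathcal{M})_0=\omega^0_{\mathbb{D}}(\mathcal{M})^0$. The stack $[X]$ is D-affine if $\Gamma_0$ is an equivalence of categories. *)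

theory Defs
  imports "HOL-Algebra.QuotRing" "HOL-Algebra.Module" "HOL-Library.FuncSet"
    "HOL-Computational_Algebra.Polynomial"
begin

hide_const (open) Multiset.mult Polynomial.smult

section \<open>Categories, functors, equivalences, adjunctions\<close>

text \<open>Hom-sets need not be disjoint, so composition and the action of a functor on arrows take
  the objects as arguments: \<open>Comp C x y z g f\<close> is the composite of
  \<open>f : x \<rightarrow> y\<close> and \<open>g : y \<rightarrow> z\<close>.\<close>

record ('o, 'a) cat =
  Obj :: "'o set"
  Hom :: "'o \<Rightarrow> 'o \<Rightarrow> 'a set"
  Id :: "'o \<Rightarrow> 'a"
  Comp :: "'o \<Rightarrow> 'o \<Rightarrow> 'o \<Rightarrow> 'a \<Rightarrow> 'a \<Rightarrow> 'a"

definition is_category :: "('o, 'a) cat \<Rightarrow> bool" where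
  "is_category C \<longleftrightarrow>
     (\<forall>x\<in>Obj C. Id C x \<in> Hom C x x) \<and>
     (\<forall>x\<in>Obj C. \<forall>y\<in>Obj C. \<forall>z\<in>Obj C. \<forall>f\<in>Hom C x y. \<forall>g\<in>Hom C y z.
        Comp C x y z g f \<in> Hom C x z) \<and>
     (\<forall>x\<in>Obj C. \<forall>y\<in>Obj C. \<forall>f\<in>Hom C x y.
        Comp C x y y (Id C y) f = f \<and> Comp C x x y f (Id C x) = f) \<and>
     (\<forall>w\<in>Obj C. \<forall>x\<in>Obj C. \<forall>y\<in>Obj C. \<forall>z\<in>Obj C.
        \<forall>f\<in>Hom C w x. \<forall>g\<in>Hom C x y. \<forall>h\<in>Hom C y z.
        Comp C w y z h (Comp C w x y g f) = Comp C w x z (Comp C x y z h g) f)"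

definition is_iso :: "('o, 'a) cat \<Rightarrow> 'o \<Rightarrow> 'o \<Rightarrow> 'a \<Rightarrow> bool" where
  "is_iso C x y f \<longleftrightarrow> f \<in> Hom C x y \<and>
     (\<exists>g\<in>Hom C y x. Comp C x y x g f = Id C x \<and> Comp C y x y f g = Id C y)"

record ('o, 'a, 'p, 'b) func =
  omap :: "'o \<Rightarrow> 'p"
  amap :: "'o \<Rightarrow> 'o \<Rightarrow> 'a \<Rightarrow> 'b"

definition is_functor ::
    "('o, 'a) cat \<Rightarrow> ('p, 'b) cat \<Rightarrow> ('o, 'a, 'p, 'b) func \<Rightarrow> bool" where
  "is_functor C D F \<longleftrightarrow> is_category C \<and> is_category D \<and>
     (\<forall>x\<in>Obj C. omap F x \<in> Obj D) \<and>
     (\<forall>x\<in>Obj C. \<forall>y\<in>Obj C. \<forall>f\<in>Hom C x y. amap F x y f \<in> Hom D (omap F x) (omap F y)) \<and>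
     (\<forall>x\<in>Obj C. amap F x x (Id C x) = Id D (omap F x)) \<and>
     (\<forall>x\<in>Obj C. \<forall>y\<in>Obj C. \<forall>z\<in>Obj C. \<forall>f\<in>Hom C x y. \<forall>g\<in>Hom C y z.
        amap F x z (Comp C x y z g f) =
          Comp D (omap F x) (omap F y) (omap F z) (amap F y z g) (amap F x y f))"

definition id_func :: "('o, 'a, 'o, 'a) func" where
  "id_func = \<lparr>omap = (\<lambda>x. x), amap = (\<lambda>x y f. f)\<rparr>"

definition comp_func ::
    "('p, 'b, 'q, 'c) func \<Rightarrow> ('o, 'a, 'p, 'b) func \<Rightarrow> ('o, 'a, 'q, 'c) func" where
  "comp_func G F = \<lparr>omap = (\<lambda>x. omap G (omap F x)),
     amap = (\<lambda>x y f. amap G (omap F x) (omap F y) (amap F x y f))\<rparr>"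

definition nat_iso ::
    "('o, 'a) cat \<Rightarrow> ('p, 'b) cat \<Rightarrow> ('o, 'a, 'p, 'b) func \<Rightarrow> ('o, 'a, 'p, 'b) func
      \<Rightarrow> ('o \<Rightarrow> 'b) \<Rightarrow> bool" where
  "nat_iso C D F G \<eta> \<longleftrightarrow>
     (\<forall>x\<in>Obj C. is_iso D (omap F x) (omap G x) (\<eta> x)) \<and>
     (\<forall>x\<in>Obj C. \<forall>y\<in>Obj C. \<forall>f\<in>Hom C x y.
        Comp D (omap F x) (omap F y) (omap G y) (\<eta> y) (amap F x y f) =
        Comp D (omap F x) (omap G x) (omap G y) (amap G x y f) (\<eta> x))"

definition is_equivalence ::
    "('o, 'a) cat \<Rightarrow> ('p, 'b) cat \<Rightarrow> ('o, 'a, 'p, 'b) func \<Rightarrow> bool" where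
  "is_equivalence C D F \<longleftrightarrow> is_functor C D F \<and>
     (\<exists>G. is_functor D C G \<and>
        (\<exists>\<eta>. nat_iso C C id_func (comp_func G F) \<eta>) \<and>
        (\<exists>\<epsilon>. nat_iso D D (comp_func F G) id_func \<epsilon>))"

definition is_right_adjoint ::
    "('o, 'a) cat \<Rightarrow> ('p, 'b) cat \<Rightarrow> ('o, 'a, 'p, 'b) func \<Rightarrow> ('p, 'b, 'o, 'a) func \<Rightarrow> bool" where
  "is_right_adjoint C D F G \<longleftrightarrow> is_functor C D F \<and> is_functor D C G \<and>
     (\<exists>\<phi>.
        (\<forall>x\<in>Obj C. \<forall>y\<in>Obj D. bij_betw (\<phi> x y) (Hom D (omap F x) y) (Hom C x (omap G y))) \<and>
        (\<forall>x'\<in>Obj C. \<forall>x\<in>Obj C. \<forall>y\<in>Obj D. \<forall>y'\<in>Obj D.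
           \<forall>h\<in>Hom C x' x. \<forall>g\<in>Hom D (omap F x) y. \<forall>k\<in>Hom D y y'.
           \<phi> x' y' (Comp D (omap F x') y y' k (Comp D (omap F x') (omap F x) y g (amap F x' x h))) =
           Comp C x' (omap G y) (omap G y') (amap G y y' k) (Comp C x' x (omap G y) (\<phi> x y g) h)))"


section \<open>Left modules over a not necessarily commutative ring\<close>

text \<open>The library's record of modules is reused; its locale \<^locale>\<open>module\<close> requires a commutative
  ring of scalars. The fields \<open>mult\<close> and \<open>one\<close>, which the record inherits from rings,
  carry no information.\<close>

locale left_module = R?: ring R + M?: abelian_group M
  for R (structure) and M :: "('a, 'b, 'c) module_scheme" (structure) +
  assumes smult_closed [simp, intro]:
      "\<lbrakk>a \<in> carrier R; x \<in> carrier M\<rbrakk> \<Longrightarrow> a \<odot>\<^bsub>M\<^esub> x \<in> carrier M"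
    and smult_l_distr:
      "\<lbrakk>a \<in> carrier R; b \<in> carrier R; x \<in> carrier M\<rbrakk> \<Longrightarrow>
      (a \<oplus> b) \<odot>\<^bsub>M\<^esub> x = a \<odot>\<^bsub>M\<^esub> x \<oplus>\<^bsub>M\<^esub> b \<odot>\<^bsub>M\<^esub> x"
    and smult_r_distr:
      "\<lbrakk>a \<in> carrier R; x \<in> carrier M; y \<in> carrier M\<rbrakk> \<Longrightarrow>
      a \<odot>\<^bsub>M\<^esub> (x \<oplus>\<^bsub>M\<^esub> y) = a \<odot>\<^bsub>M\<^esub> x \<oplus>\<^bsub>M\<^esub> a \<odot>\<^bsub>M\<^esub> y"
    and smult_assoc1:
      "\<lbrakk>a \<in> carrier R; b \<in> carrier R; x \<in> carrier M\<rbrakk> \<Longrightarrow>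
      (a \<otimes> b) \<odot>\<^bsub>M\<^esub> x = a \<odot>\<^bsub>M\<^esub> (b \<odot>\<^bsub>M\<^esub> x)"
    and smult_one [simp]:
      "x \<in> carrier M \<Longrightarrow> \<one> \<odot>\<^bsub>M\<^esub> x = x"

text \<open>Homomorphisms are extensional functions, so that equal homomorphisms are equal functions.\<close>

definition mod_homs :: "'r ring \<Rightarrow> ('r, 'u) module \<Rightarrow> ('r, 'v) module \<Rightarrow> ('u \<Rightarrow> 'v) set" where
  "mod_homs R M N = {f \<in> carrier M \<rightarrow>\<^sub>E carrier N.
     (\<forall>x\<in>carrier M. \<forall>y\<in>carrier M. f (x \<oplus>\<^bsub>M\<^esub> y) = f x \<oplus>\<^bsub>N\<^esub> f y) \<and>
     (\<forall>r\<in>carrier R. \<forall>x\<in>carrier M. f (r \<odot>\<^bsub>M\<^esub> x) = r \<odot>\<^bsub>N\<^esub> f x)}"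

definition quot_mod :: "('r, 'u) module \<Rightarrow> 'u set \<Rightarrow> ('r, 'u set) module" where
  "quot_mod M H = \<lparr>carrier = a_rcosets\<^bsub>M\<^esub> H, mult = undefined, one = undefined,
     zero = H, add = set_add M, smult = (\<lambda>r S. \<Union>s\<in>S. H +>\<^bsub>M\<^esub> (r \<odot>\<^bsub>M\<^esub> s))\<rparr>"

text \<open>Full categories of modules. The carriers are subsets of the type \<open>'u\<close>, which plays the role
  of the universe of small sets.\<close>

definition full_mod_cat :: "'r ring \<Rightarrow> ('r, 'u) module set \<Rightarrow> (('r, 'u) module, 'u \<Rightarrow> 'u) cat" where
  "full_mod_cat R Ms = \<lparr>Obj = Ms, Hom = mod_homs R, Id = (\<lambda>M. restrict (\<lambda>x. x) (carrier M)),
     Comp = (\<lambda>M N P g f. compose (carrier M) g f)\<rparr>"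

definition mod_cat :: "'r ring \<Rightarrow> (('r, 'u) module, 'u \<Rightarrow> 'u) cat" where
  "mod_cat R = full_mod_cat R {M. left_module R M}"


section \<open>The Weyl algebra\<close>

text \<open>The free algebra on the letters \<open>x\<^sub>i\<close>, \<open>\<partial>\<^sub>i\<close> (\<open>i \<le> n\<close>): finitely supported coefficient
  functions on words.\<close>

datatype letter = Lx nat | Ld nat

type_synonym 'k weyl = "(letter list \<Rightarrow> 'k) set"
type_synonym ('k, 'u) dmod = "('k weyl, 'u) module"

definition letters :: "nat \<Rightarrow> letter set" where
  "letters n = Lx ` {..n} \<union> Ld ` {..n}"

definition free_alg :: "nat \<Rightarrow> (letter list \<Rightarrow> 'k::field) ring" where
  "free_alg n = \<lparr>carrier = {f. finite {w. f w \<noteq> 0} \<and> {w. f w \<noteq> 0} \<subseteq> lists (letters n)},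
     mult = (\<lambda>f g w. \<Sum>i\<le>length w. f (take i w) * g (drop i w)),
     one = (\<lambda>w. if w = [] then 1 else 0),
     zero = (\<lambda>w. 0),
     add = (\<lambda>f g w. f w + g w)\<rparr>"

definition word :: "letter list \<Rightarrow> letter list \<Rightarrow> 'k::field" where
  "word v = (\<lambda>w. if w = v then 1 else 0)"

definition weyl_rels :: "nat \<Rightarrow> (letter list \<Rightarrow> 'k::field) set" where
  "weyl_rels n =
     {(\<lambda>w. word [Lx i, Lx j] w - word [Lx j, Lx i] w) | i j. i \<le> n \<and> j \<le> n} \<union>
     {(\<lambda>w. word [Ld i, Ld j] w - word [Ld j, Ld i] w) | i j. i \<le> n \<and> j \<le> n} \<union>
     {(\<lambda>w. word [Ld i, Lx j] w - word [Lx j, Ld i] w - (if i = j then word [] w else 0))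
       | i j. i \<le> n \<and> j \<le> n}"

definition weyl_ideal :: "nat \<Rightarrow> (letter list \<Rightarrow> 'k::field) set" where
  "weyl_ideal n = Idl\<^bsub>free_alg n\<^esub> (weyl_rels n)"

definition weyl :: "nat \<Rightarrow> 'k::field weyl ring" where
  "weyl n = free_alg n Quot weyl_ideal n"

definition weyl_class :: "nat \<Rightarrow> (letter list \<Rightarrow> 'k::field) \<Rightarrow> 'k weyl" where
  "weyl_class n f = weyl_ideal n +>\<^bsub>free_alg n\<^esub> f"

definition weyl_const :: "nat \<Rightarrow> 'k::field \<Rightarrow> 'k weyl" where
  "weyl_const n c = weyl_class n (\<lambda>w. if w = [] then c else 0)"

definition weyl_x :: "nat \<Rightarrow> nat \<Rightarrow> 'k::field weyl" where
  "weyl_x n i = weyl_class n (word [Lx i])"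

definition weyl_d :: "nat \<Rightarrow> nat \<Rightarrow> 'k::field weyl" where
  "weyl_d n i = weyl_class n (word [Ld i])"

fun letter_deg :: "(nat \<Rightarrow> nat) \<Rightarrow> letter \<Rightarrow> int" where
  "letter_deg d (Lx i) = int (d i)"
| "letter_deg d (Ld i) = - int (d i)"

definition word_deg :: "(nat \<Rightarrow> nat) \<Rightarrow> letter list \<Rightarrow> int" where
  "word_deg d w = sum_list (map (letter_deg d) w)"

definition weyl_part :: "nat \<Rightarrow> (nat \<Rightarrow> nat) \<Rightarrow> int \<Rightarrow> 'k::field weyl set" where
  "weyl_part n d k =
     weyl_class n ` {f \<in> carrier (free_alg n). \<forall>w. f w \<noteq> 0 \<longrightarrow> word_deg d w = k}"

text \<open>The polynomial ring \<open>\<bbbA>\<close> is the subalgebra of the Weyl algebra generated by the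
  \<open>x\<^sub>i\<close>; this is its part of degree \<open>k\<close>.\<close>

definition poly_part :: "nat \<Rightarrow> (nat \<Rightarrow> nat) \<Rightarrow> int \<Rightarrow> 'k::field weyl set" where
  "poly_part n d k =
     weyl_class n ` {f \<in> carrier (free_alg n).
       \<forall>w. f w \<noteq> 0 \<longrightarrow> w \<in> lists (range Lx) \<and> word_deg d w = k}"

definition euler :: "nat \<Rightarrow> (nat \<Rightarrow> nat) \<Rightarrow> 'k::field weyl" where
  "euler n d = (\<Oplus>\<^bsub>weyl n\<^esub>i\<in>{..n}.
     weyl_const n (of_nat (d i)) \<otimes>\<^bsub>weyl n\<^esub> (weyl_x n i \<otimes>\<^bsub>weyl n\<^esub> weyl_d n i))"

definition weyl0 :: "nat \<Rightarrow> (nat \<Rightarrow> nat) \<Rightarrow> 'k::field weyl ring" where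
  "weyl0 n d = weyl n\<lparr>carrier := weyl_part n d 0\<rparr>"

text \<open>Here \<open>PIdl\<close> denotes the left ideal \<open>\<bbbD>\<^sub>0\<^bold>E\<close>, which is two-sided since \<open>\<^bold>E\<close> is central
  in \<open>\<bbbD>\<^sub>0\<close>.\<close>

definition weyl0_mod_euler :: "nat \<Rightarrow> (nat \<Rightarrow> nat) \<Rightarrow> 'k::field weyl set ring" where
  "weyl0_mod_euler n d = weyl0 n d Quot (PIdl\<^bsub>weyl0 n d\<^esub> (euler n d))"


section \<open>Euler modules and torsion modules\<close>

definition eigenspace :: "nat \<Rightarrow> (nat \<Rightarrow> nat) \<Rightarrow> ('k::field, 'u) dmod \<Rightarrow> 'k \<Rightarrow> 'u set" where
  "eigenspace n d M \<mu> = {m \<in> carrier M. euler n d \<odot>\<^bsub>M\<^esub> m = weyl_const n \<mu> \<odot>\<^bsub>M\<^esub> m}"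

text \<open>Unique decomposition \<open>m = \<Sum>\<^sub>k c k\<close> with \<open>c k \<in> M\<^sup>k\<close> and almost all \<open>c k\<close> zero.\<close>

definition euler0 :: "nat \<Rightarrow> (nat \<Rightarrow> nat) \<Rightarrow> ('k::field, 'u) dmod \<Rightarrow> bool" where
  "euler0 n d M \<longleftrightarrow> left_module (weyl n) M \<and>
     (\<forall>m\<in>carrier M. \<exists>!c :: int \<Rightarrow> 'u.
        (\<forall>k. c k \<in> eigenspace n d M (of_int k)) \<and> finite {k. c k \<noteq> \<zero>\<^bsub>M\<^esub>} \<and>
        m = (\<Oplus>\<^bsub>M\<^esub>k\<in>{k. c k \<noteq> \<zero>\<^bsub>M\<^esub>}. c k))"

definition torsion :: "nat \<Rightarrow> (nat \<Rightarrow> nat) \<Rightarrow> ('k::field, 'u) dmod \<Rightarrow> bool" where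
  "torsion n d M \<longleftrightarrow>
     (\<forall>m\<in>carrier M. \<exists>N::int. \<forall>k>N. \<forall>a\<in>poly_part n d k. a \<odot>\<^bsub>M\<^esub> m = \<zero>\<^bsub>M\<^esub>)"

definition tors0 :: "nat \<Rightarrow> (nat \<Rightarrow> nat) \<Rightarrow> ('k::field, 'u) dmod \<Rightarrow> bool" where
  "tors0 n d M \<longleftrightarrow> euler0 n d M \<and> torsion n d M"

definition grmod0 :: "nat \<Rightarrow> (nat \<Rightarrow> nat) \<Rightarrow> (('k::field, 'u) dmod, 'u \<Rightarrow> 'u) cat" where
  "grmod0 n d = full_mod_cat (weyl n) {M. euler0 n d M}"


section \<open>The quotient category\<close>

text \<open>Gabriel's construction: the arrows \<open>M \<rightarrow> N\<close> of the quotient are the elements of the filtered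
  colimit of the groups \<open>Hom(M', N/N')\<close> over all submodules \<open>M' \<subseteq> M\<close> and \<open>N' \<subseteq> N\<close>
  such that \<open>M/M'\<close> and \<open>N'\<close> are torsion. An element of the colimit is a class of triples
  \<open>(M', N', f)\<close>; the values of \<open>f\<close> are cosets of \<open>N'\<close>.\<close>

type_synonym 'u frac = "'u set \<times> 'u set \<times> ('u \<Rightarrow> 'u set)"

definition cotors_sub :: "nat \<Rightarrow> (nat \<Rightarrow> nat) \<Rightarrow> ('k::field, 'u) dmod \<Rightarrow> 'u set \<Rightarrow> bool" where
  "cotors_sub n d M M' \<longleftrightarrow> submodule M' (weyl n) M \<and> tors0 n d (quot_mod M M')"

definition tors_sub :: "nat \<Rightarrow> (nat \<Rightarrow> nat) \<Rightarrow> ('k::field, 'u) dmod \<Rightarrow> 'u set \<Rightarrow> bool" where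
  "tors_sub n d N N' \<longleftrightarrow> submodule N' (weyl n) N \<and> tors0 n d (N\<lparr>carrier := N'\<rparr>)"

definition fracs ::
    "nat \<Rightarrow> (nat \<Rightarrow> nat) \<Rightarrow> ('k::field, 'u) dmod \<Rightarrow> ('k, 'u) dmod \<Rightarrow> 'u frac set" where
  "fracs n d M N = {(M', N', f). cotors_sub n d M M' \<and> tors_sub n d N N' \<and>
     f \<in> mod_homs (weyl n) (M\<lparr>carrier := M'\<rparr>) (quot_mod N N')}"

text \<open>Two triples are equal in the colimit if they agree in \<open>Hom(M\<^sub>3, N/N\<^sub>3)\<close> for some
  \<open>M\<^sub>3 \<subseteq> M\<^sub>1 \<inter> M\<^sub>2\<close> and \<open>N\<^sub>3 \<supseteq> N\<^sub>1 \<union> N\<^sub>2\<close>. The image of a coset \<open>f x\<close> of \<open>N\<^sub>1\<close> under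
  \<open>N/N\<^sub>1 \<rightarrow> N/N\<^sub>3\<close> is \<open>N\<^sub>3 + f x\<close>.\<close>

definition frac_eq ::
    "nat \<Rightarrow> (nat \<Rightarrow> nat) \<Rightarrow> ('k::field, 'u) dmod \<Rightarrow> ('k, 'u) dmod \<Rightarrow> ('u frac \<times> 'u frac) set" where
  "frac_eq n d M N = {((M1, N1, f), (M2, N2, g)).
     (M1, N1, f) \<in> fracs n d M N \<and> (M2, N2, g) \<in> fracs n d M N \<and>
     (\<exists>M3 N3. cotors_sub n d M M3 \<and> tors_sub n d N N3 \<and> M3 \<subseteq> M1 \<inter> M2 \<and> N1 \<union> N2 \<subseteq> N3 \<and>
        (\<forall>x\<in>M3. N3 <+>\<^bsub>N\<^esub> f x = N3 <+>\<^bsub>N\<^esub> g x))}"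

text \<open>The composite of \<open>f : M' \<rightarrow> N/N'\<close> and \<open>g : N'' \<rightarrow> P/P'\<close> is defined on
  \<open>M'' = f\<^sup>-\<^sup>1((N'' + N')/N')\<close> and has values in \<open>P/P''\<close>, where \<open>P''/P' = g(N' \<inter> N'')\<close>. It is
  \<open>M'' \<rightarrow> (N'' + N')/N' \<cong> N''/(N' \<inter> N'') \<rightarrow> P/P''\<close>.\<close>

fun frac_comp :: "('k, 'u) dmod \<Rightarrow> 'u frac \<Rightarrow> 'u frac \<Rightarrow> 'u frac" where
  "frac_comp M (N'', P', g) (M', N', f) =
     (let M'' = {x \<in> M'. f x \<inter> N'' \<noteq> {}} in
      (M'', \<Union>y\<in>N' \<inter> N''. g y, \<lambda>x\<in>M''. \<Union>y\<in>f x \<inter> N''. g y))"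

definition frac_of_hom :: "('k, 'u) dmod \<Rightarrow> ('k, 'u) dmod \<Rightarrow> ('u \<Rightarrow> 'u) \<Rightarrow> 'u frac" where
  "frac_of_hom M N f = (carrier M, {\<zero>\<^bsub>N\<^esub>}, \<lambda>x\<in>carrier M. {f x})"

definition qcoh :: "nat \<Rightarrow> (nat \<Rightarrow> nat) \<Rightarrow> (('k::field, 'u) dmod, 'u frac set) cat" where
  "qcoh n d = \<lparr>Obj = {M. euler0 n d M},
     Hom = (\<lambda>M N. fracs n d M N // frac_eq n d M N),
     Id = (\<lambda>M. frac_eq n d M M `` {frac_of_hom M M (\<lambda>x. x)}),
     Comp = (\<lambda>M N P G F. \<Union>g\<in>G. \<Union>f\<in>F. frac_eq n d M P `` {frac_comp M g f})\<rparr>"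

definition pi0 ::
    "nat \<Rightarrow> (nat \<Rightarrow> nat) \<Rightarrow> (('k::field, 'u) dmod, 'u \<Rightarrow> 'u, ('k, 'u) dmod, 'u frac set) func" where
  "pi0 n d = \<lparr>omap = (\<lambda>M. M),
     amap = (\<lambda>M N f. frac_eq n d M N `` {frac_of_hom M N f})\<rparr>"

text \<open>A right adjoint of the quotient functor, which is unique up to natural isomorphism.\<close>

definition omega0 ::
    "nat \<Rightarrow> (nat \<Rightarrow> nat) \<Rightarrow> (('k::field, 'u) dmod, 'u frac set, ('k, 'u) dmod, 'u \<Rightarrow> 'u) func" where
  "omega0 n d = (SOME \<omega>. is_right_adjoint (grmod0 n d) (qcoh n d) (pi0 n d) \<omega>)"


section \<open>Global sections\<close>

text \<open>The degree zero part \<open>M\<^sup>0\<close> is a module over \<open>\<bbbD>\<^sub>0\<close> annihilated by \<open>\<bbbD>\<^sub>0\<^bold>E\<close>; a coset acts through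
  any of its representatives.\<close>

definition deg0_mod ::
    "nat \<Rightarrow> (nat \<Rightarrow> nat) \<Rightarrow> ('k::field, 'u) dmod \<Rightarrow> ('k weyl set, 'u) module" where
  "deg0_mod n d M = \<lparr>carrier = eigenspace n d M 0, mult = undefined, one = undefined,
     zero = \<zero>\<^bsub>M\<^esub>, add = add M, smult = (\<lambda>S m. (SOME r. r \<in> S) \<odot>\<^bsub>M\<^esub> m)\<rparr>"

definition gamma0 ::
    "nat \<Rightarrow> (nat \<Rightarrow> nat) \<Rightarrow>
     (('k::field, 'u) dmod, 'u frac set, ('k weyl set, 'u) module, 'u \<Rightarrow> 'u) func" where
  "gamma0 n d = \<lparr>omap = (\<lambda>M. deg0_mod n d (omap (omega0 n d) M)),
     amap = (\<lambda>M N f. restrict (amap (omega0 n d) M N f)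
                       (eigenspace n d (omap (omega0 n d) M) 0))\<rparr>"

text \<open>D-affinity over the field \<open>'k\<close>, for modules whose carriers are subsets of \<open>'u\<close>. This is
  meaningful only if \<open>'u\<close> is at least as large as \<open>'k\<close>: if \<open>'u\<close> is too small there may be no
  modules besides zero. If it is, the modules over the Weyl algebra and over \<open>\<bbbD>\<^sub>0/\<bbbD>\<^sub>0\<^bold>E\<close> of
  cardinality at most that of \<open>'u\<close> are closed under the constructions used here.\<close>

definition D_affine :: "'k::field itself \<Rightarrow> 'u itself \<Rightarrow> nat \<Rightarrow> (nat \<Rightarrow> nat) \<Rightarrow> bool" where
  "D_affine K U n d \<longleftrightarrow>
     is_equivalence (qcoh n d :: (('k, 'u) dmod, 'u frac set) cat)
       (mod_cat (weyl0_mod_euler n d) :: (('k weyl set, 'u) module, 'u \<Rightarrow> 'u) cat)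
       (gamma0 n d)"

end

theory Submission
  imports Defs "HOL-Library.Countable_Set"
begin

text \<open>A morphism \<open>M \<rightarrow> N\<close> of the quotient category is the same thing as a family of maps \<open>M\<^sub>j \<rightarrow> N\<^sub>j\<close>,
  \<open>j \<ge> 0\<close>, compatible with all homogeneous operators: an Euler module is torsion iff it vanishes in
  degrees \<open>j \<ge> 0\<close>, because a vector killed by all \<open>x\<^sub>i\<close> has weight \<open>-\<Sum>\<^sub>i d\<^sub>i < 0\<close>. Hence the right adjoint
  of the quotient functor is coinduction from the degrees \<open>j \<ge> 0\<close>, it does not change \<open>M\<^sub>0\<close>, and
  \<open>\<Gamma>\<^sub>0\<close> is isomorphic to the functor \<open>M \<mapsto> M\<^sub>0\<close>.

  If the weights are coprime, then for \<open>k \<ge> 0\<close> the operators between the degrees \<open>0\<close> and \<open>k\<close> detect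
  and generate \<open>M\<^sub>k\<close>: from a vector killed by all operators of degree \<open>-k\<close> one obtains a joint eigenvector
  of the \<open>x\<^sub>i\<partial>\<^sub>i\<close> with integral eigenvalues \<open>t\<^sub>i\<close>, \<open>\<Sum>\<^sub>i d\<^sub>i t\<^sub>i = k\<close>, and by coprimality some word of degree \<open>-k\<close>
  together with its dual acts on it by a nonzero scalar. So \<open>M \<mapsto> M\<^sub>0\<close> is fully faithful, and
  coinduction from the degree \<open>0\<close> shows that it is essentially surjective.

  If \<open>g = gcd(d\<^sub>0, \<dots>, d\<^sub>n) > 1\<close>, the monomials \<open>x\<^sub>0\<^bsup>1/d\<^sub>0\<^esup> x\<^sup>a\<close>, \<open>a\<close> integral, have weights in
  \<open>1 + g\<int>\<close>. They span a module without weight \<open>0\<close> that is nonzero in degree \<open>1\<close>, hence a nonzero object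
  that \<open>\<Gamma>\<^sub>0\<close> sends to zero.\<close>

text \<open>All modules must have carriers in the fixed type \<open>'u\<close>, so each construction
  is followed by a size bound and a transport of structure. For coinduction from the degrees j \<ge>
  0 the bound comes from torsion-freeness: a vector of negative weight is determined by its images
  under the x_i. For coinduction from degree 0 the submodule generated by the degree 0 part is taken
  instead; essential surjectivity therefore holds for all positive weights, and coprimality is what
  makes \<open>delta\<close> full and faithful. \<open>omega0\<close> is an arbitrary choice and is
  never computed; only its adjointness and the invertibility of its counit enter, the latter because
  explicit couniversal arrows are invertible. Colimit classes are avoided by replacing a fraction by
  a submodule of the product and by keeping a set \<open>J\<close> of degrees as a parameter:
  \<open>J = {0..}\<close> describes the arrows of the quotient, \<open>J = {0}\<close> compares
  them with maps of degree zero parts.\<close>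

definition mono :: "'k \<Rightarrow> letter list \<Rightarrow> letter list \<Rightarrow> 'k::field" where
  "mono c w = (\<lambda>v. if v = w then c else 0)"

section \<open>The free algebra as a convolution ring\<close>

lemma free_alg_carrier:
  "f \<in> carrier (free_alg n) \<longleftrightarrow> finite {w. f w \<noteq> 0} \<and> {w. f w \<noteq> 0} \<subseteq> lists (letters n)"
  by (simp add: free_alg_def)

lemma free_alg_simps:
  "f \<otimes>\<^bsub>free_alg n\<^esub> g = (\<lambda>w. \<Sum>i\<le>length w. f (take i w) * g (drop i w))"
  "\<one>\<^bsub>free_alg n\<^esub> = (\<lambda>w. if w = [] then 1 else 0)"
  "\<zero>\<^bsub>free_alg n\<^esub> = (\<lambda>w. 0)"
  "f \<oplus>\<^bsub>free_alg n\<^esub> g = (\<lambda>w. f w + g w)"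
  by (simp_all add: free_alg_def)

lemma mono_carrier: "w \<in> lists (letters n) \<Longrightarrow> mono c w \<in> carrier (free_alg n)"
  by (auto simp: free_alg_carrier mono_def)

lemma conv_support:
  fixes f g :: "letter list \<Rightarrow> 'k::field"
  assumes "(\<Sum>i\<le>length w. f (take i w) * g (drop i w)) \<noteq> 0"
  obtains u v where "w = u @ v" "f u \<noteq> 0" "g v \<noteq> 0"
proof -
  obtain i where "f (take i w) * g (drop i w) \<noteq> 0"
    using assms by (meson sum.not_neutral_contains_not_neutral)
  then show thesis using that[of "take i w" "drop i w"] by auto
qed

lemma free_alg_mult_closed:
  assumes "f \<in> carrier (free_alg n)" "g \<in> carrier (free_alg n)"
  shows "f \<otimes>\<^bsub>free_alg n\<^esub> g \<in> carrier (free_alg n)"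
proof -
  have sub: "{w. (f \<otimes>\<^bsub>free_alg n\<^esub> g) w \<noteq> 0}
      \<subseteq> (\<lambda>(u, v). u @ v) ` ({w. f w \<noteq> 0} \<times> {w. g w \<noteq> 0})"
    by (auto simp: free_alg_simps elim!: conv_support)
  have "finite ((\<lambda>(u, v). u @ v) ` ({w. f w \<noteq> 0} \<times> {w. g w \<noteq> 0}))"
    using assms by (auto simp: free_alg_carrier)
  moreover have "(\<lambda>(u, v). u @ v) ` ({w. f w \<noteq> 0} \<times> {w. g w \<noteq> 0}) \<subseteq> lists (letters n)"
  proof -
    have "u \<in> lists (letters n)" "v \<in> lists (letters n)" if "f u \<noteq> 0" "g v \<noteq> 0" for u v
      using assms that unfolding free_alg_carrier by blast+
    then show ?thesis by (simp add: image_subset_iff del: in_lists_conv_set)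
  qed
  ultimately show ?thesis
    using sub unfolding free_alg_carrier by (meson finite_subset subset_trans)
qed

text \<open>Both sides run over all factorizations of \<open>w\<close> into three subwords;
  \<open>t j k\<close> is the term whose first two factors have lengths j and k.\<close>

lemma conv_assoc:
  fixes f g h :: "letter list \<Rightarrow> 'k::field"
  shows "(\<Sum>i\<le>length w. (\<Sum>j\<le>length (take i w). f (take j (take i w)) * g (drop j (take i w))) * h (drop i w))
    = (\<Sum>i\<le>length w. f (take i w) * (\<Sum>j\<le>length (drop i w). g (take j (drop i w)) * h (drop j (drop i w))))"
    (is "?l = ?r")
proof -
  define t where "t j k = f (take j w) * g (take k (drop j w)) * h (drop (j + k) w)" for j k
  have "?l = (\<Sum>i\<le>length w. \<Sum>j\<le>i. t j (i - j))"
    by (intro sum.cong refl) (auto simp: sum_distrib_right t_def take_drop min_def intro!: sum.cong)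
  also have "\<dots> = (\<Sum>(j, k)\<in>{(j, k). j + k \<le> length w}. t j k)"
    by (rule sum.triangle_reindex_eq[symmetric])
  also have "{(j, k). j + k \<le> length w} = Sigma {..length w} (\<lambda>j. {..length w - j})"
    by auto
  also have "(\<Sum>(j, k)\<in>Sigma {..length w} (\<lambda>j. {..length w - j}). t j k)
      = (\<Sum>j\<le>length w. \<Sum>k\<le>length w - j. t j k)"
    by (rule sum.Sigma[symmetric]) auto
  also have "\<dots> = ?r"
    by (intro sum.cong refl) (auto simp: sum_distrib_left t_def mult.assoc add.commute intro!: sum.cong)
  finally show ?thesis .
qed

lemma conv_one_left:
  fixes f :: "letter list \<Rightarrow> 'k::field"
  shows "(\<Sum>i\<le>length w. (if take i w = [] then 1 else 0) * f (drop i w)) = f w"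
proof (cases w)
  case (Cons a v)
  have "(\<Sum>i\<le>length w. (if take i w = [] then 1 else 0) * f (drop i w))
      = (\<Sum>i\<le>length w. if i = 0 then f w else 0)"
    using Cons by (intro sum.cong) auto
  then show ?thesis by simp
qed auto

lemma conv_one_right:
  fixes f :: "letter list \<Rightarrow> 'k::field"
  shows "(\<Sum>i\<le>length w. f (take i w) * (if drop i w = [] then 1 else 0)) = f w"
proof -
  have "(\<Sum>i\<le>length w. f (take i w) * (if drop i w = [] then 1 else 0))
      = (\<Sum>i\<le>length w. if i = length w then f w else 0)"
    by (intro sum.cong) auto
  then show ?thesis by simp
qed

lemma ring_free_alg: "ring (free_alg n :: (letter list \<Rightarrow> 'k::field) ring)"
proof (rule ringI)
  show "abelian_group (free_alg n :: (letter list \<Rightarrow> 'k) ring)"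
  proof (rule abelian_groupI)
    fix x y :: "letter list \<Rightarrow> 'k"
    assume "x \<in> carrier (free_alg n)" "y \<in> carrier (free_alg n)"
    moreover have "{w. x w + y w \<noteq> 0} \<subseteq> {w. x w \<noteq> 0} \<union> {w. y w \<noteq> 0}" by auto
    ultimately show "x \<oplus>\<^bsub>free_alg n\<^esub> y \<in> carrier (free_alg n)"
      unfolding free_alg_simps free_alg_carrier by (meson finite_UnI finite_subset subset_trans Un_least)
  next
    fix x :: "letter list \<Rightarrow> 'k"
    assume "x \<in> carrier (free_alg n)"
    then have "(\<lambda>w. - x w) \<in> carrier (free_alg n)" by (simp add: free_alg_carrier)
    moreover have "(\<lambda>w. - x w) \<oplus>\<^bsub>free_alg n\<^esub> x = \<zero>\<^bsub>free_alg n\<^esub>"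
      by (simp add: free_alg_simps)
    ultimately show "\<exists>y\<in>carrier (free_alg n). y \<oplus>\<^bsub>free_alg n\<^esub> x = \<zero>\<^bsub>free_alg n\<^esub>" by blast
  qed (auto simp: free_alg_simps free_alg_carrier add_ac)
  show "Group.monoid (free_alg n :: (letter list \<Rightarrow> 'k) ring)"
  proof (rule monoidI)
    show "\<one>\<^bsub>free_alg n\<^esub> \<in> carrier (free_alg n :: (letter list \<Rightarrow> 'k) ring)"
      by (auto simp: free_alg_simps free_alg_carrier)
  next
    fix x y z :: "letter list \<Rightarrow> 'k"
    show "x \<otimes>\<^bsub>free_alg n\<^esub> y \<otimes>\<^bsub>free_alg n\<^esub> z
      = x \<otimes>\<^bsub>free_alg n\<^esub> (y \<otimes>\<^bsub>free_alg n\<^esub> z)"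
      unfolding free_alg_simps by (rule ext) (rule conv_assoc)
  next
    fix x :: "letter list \<Rightarrow> 'k"
    show "\<one>\<^bsub>free_alg n\<^esub> \<otimes>\<^bsub>free_alg n\<^esub> x = x"
      unfolding free_alg_simps by (rule ext) (rule conv_one_left)
    show "x \<otimes>\<^bsub>free_alg n\<^esub> \<one>\<^bsub>free_alg n\<^esub> = x"
      unfolding free_alg_simps by (rule ext) (rule conv_one_right)
  qed (rule free_alg_mult_closed)
qed (simp_all add: free_alg_simps algebra_simps sum.distrib)

lemma mono_mult:
  "mono a u \<otimes>\<^bsub>free_alg n\<^esub> mono b v = mono (a * b :: 'k::field) (u @ v)"
proof
  fix w
  have "(\<Sum>i\<le>length w. mono a u (take i w) * mono b v (drop i w))
      = (\<Sum>i\<le>length w. if i = length u \<and> w = u @ v then a * b else 0)"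
  proof (intro sum.cong refl)
    fix i assume i: "i \<in> {..length w}"
    show "mono a u (take i w) * mono b v (drop i w) = (if i = length u \<and> w = u @ v then a * b else 0)"
    proof (cases "take i w = u \<and> drop i w = v")
      case True
      then have "w = u @ v" "i = length u" using i by (auto simp: min_def)
      then show ?thesis by (simp add: mono_def)
    next
      case False
      then show ?thesis by (auto simp: mono_def)
    qed
  qed
  also have "\<dots> = mono (a * b) (u @ v) w" by (auto simp: mono_def)
  finally show "(mono a u \<otimes>\<^bsub>free_alg n\<^esub> mono b v) w = mono (a * b) (u @ v) w"
    by (simp add: free_alg_simps)
qed

lemma word_eq_mono: "word v = mono 1 v"
  by (simp add: word_def mono_def fun_eq_iff)

text \<open>The terms of \<open>f\<close> are added one at a time. That \<open>g\<close> agrees with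
  \<open>f\<close> on its support is kept as a premise so that conditions on the words of
  \<open>f\<close>, such as a fixed degree, pass to \<open>g\<close> in the induction step.\<close>

lemma free_alg_induct [consumes 1, case_names zero add]:
  assumes f: "f \<in> carrier (free_alg n :: (letter list \<Rightarrow> 'k::field) ring)"
    and zero: "Q (\<lambda>w. 0)"
    and add: "\<And>w g. \<lbrakk>w \<in> lists (letters n); f w \<noteq> 0; g \<in> carrier (free_alg n);
       \<And>v. g v \<noteq> 0 \<Longrightarrow> g v = f v; Q g\<rbrakk> \<Longrightarrow> Q (mono (f w) w \<oplus>\<^bsub>free_alg n\<^esub> g)"
  shows "Q f"
proof -
  have "F \<subseteq> {w. f w \<noteq> 0} \<Longrightarrow> Q (\<lambda>w. if w \<in> F then f w else 0)" if "finite F" for F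
    using that
  proof (induction F rule: finite_induct)
    case empty
    then show ?case using zero by simp
  next
    case (insert w F)
    let ?g = "\<lambda>w. if w \<in> F then f w else 0"
    have "w \<in> lists (letters n)" "f w \<noteq> 0"
      using f insert.prems by (auto simp: free_alg_carrier)
    moreover have "?g \<in> carrier (free_alg n)"
      using insert.prems insert.hyps f by (auto simp: free_alg_carrier)
    ultimately have "Q (mono (f w) w \<oplus>\<^bsub>free_alg n\<^esub> ?g)"
      using insert by (intro add) auto
    moreover have "mono (f w) w \<oplus>\<^bsub>free_alg n\<^esub> ?g
        = (\<lambda>v. if v \<in> insert w F then f v else 0)"
      using insert.hyps by (auto simp: free_alg_simps mono_def fun_eq_iff)
    ultimately show ?case by simp
  qed
  then have "Q (\<lambda>w. if w \<in> {w. f w \<noteq> 0} then f w else 0)"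
    using f by (simp only: free_alg_carrier subset_refl)
  moreover have "(\<lambda>w. if w \<in> {w. f w \<noteq> 0} then f w else 0) = f" by auto
  ultimately show ?thesis by simp
qed

section \<open>The Weyl algebra: constants, generators and relations\<close>

lemma weyl_rels_carrier: "weyl_rels n \<subseteq> carrier (free_alg n :: (letter list \<Rightarrow> 'k::field) ring)"
proof -
  interpret ring "free_alg n :: (letter list \<Rightarrow> 'k) ring" by (rule ring_free_alg)
  have w: "word v \<in> carrier (free_alg n :: (letter list \<Rightarrow> 'k) ring)" if "v \<in> lists (letters n)" for v
    using mono_carrier[OF that] by (simp add: word_eq_mono)
  have minus: "(\<lambda>w. f w - g w) \<in> carrier (free_alg n)"
    if "f \<in> carrier (free_alg n)" "g \<in> carrier (free_alg n)" for f g :: "letter list \<Rightarrow> 'k"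
  proof -
    have "{w. f w - g w \<noteq> 0} \<subseteq> {w. f w \<noteq> 0} \<union> {w. g w \<noteq> 0}" by auto
    then show ?thesis using that
      unfolding free_alg_carrier by (meson finite_UnI finite_subset subset_trans Un_least)
  qed
  have cond: "(\<lambda>w. if b then f w else 0) \<in> carrier (free_alg n)"
    if "f \<in> carrier (free_alg n)" for b and f :: "letter list \<Rightarrow> 'k"
    using that by (cases b) (auto simp: free_alg_carrier)
  show ?thesis
    unfolding weyl_rels_def
    apply safe
      apply (rule minus; rule w; simp add: letters_def)
     apply (rule minus; rule w; simp add: letters_def)
    apply (rule minus[OF minus cond]; rule w; simp add: letters_def)
    done
qed

lemma ideal_weyl_ideal: "ideal (weyl_ideal n) (free_alg n :: (letter list \<Rightarrow> 'k::field) ring)"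
  unfolding weyl_ideal_def
  by (intro ring.genideal_ideal ring_free_alg weyl_rels_carrier)

lemma ring_weyl: "ring (weyl n :: 'k::field weyl ring)"
  unfolding weyl_def by (rule ideal.quotient_is_ring) (rule ideal_weyl_ideal)

lemma weyl_class_hom: "ring_hom_ring (free_alg n) (weyl n :: 'k::field weyl ring) (weyl_class n)"
  using ideal.rcos_ring_hom_ring[OF ideal_weyl_ideal, of n]
  unfolding weyl_def weyl_class_def .

lemma weyl_class_closed:
  "f \<in> carrier (free_alg n) \<Longrightarrow> weyl_class n f \<in> carrier (weyl n :: 'k::field weyl ring)"
  using ring_hom_closed[OF ring_hom_ring.homh[OF weyl_class_hom]] .

lemma weyl_class_add:
  "\<lbrakk>f \<in> carrier (free_alg n); g \<in> carrier (free_alg n)\<rbrakk> \<Longrightarrow>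
   weyl_class n (\<lambda>w. f w + g w) = weyl_class n f \<oplus>\<^bsub>weyl n\<^esub> (weyl_class n g :: 'k::field weyl)"
  using ring_hom_ring.homh[OF weyl_class_hom, THEN ring_hom_add, of f n g] by (simp add: free_alg_simps)

lemma weyl_class_mult:
  "\<lbrakk>f \<in> carrier (free_alg n); g \<in> carrier (free_alg n)\<rbrakk> \<Longrightarrow>
   weyl_class n (f \<otimes>\<^bsub>free_alg n\<^esub> g) = weyl_class n f \<otimes>\<^bsub>weyl n\<^esub> (weyl_class n g :: 'k::field weyl)"
  using ring_hom_ring.homh[OF weyl_class_hom, THEN ring_hom_mult, of f n g] by simp

lemma weyl_class_zero: "weyl_class n (\<lambda>w. 0) = (\<zero>\<^bsub>weyl n\<^esub> :: 'k::field weyl)"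
  using ring_hom_zero[OF ring_hom_ring.homh[OF weyl_class_hom] ring_free_alg ring_weyl, of n]
  by (simp add: free_alg_simps)

lemma weyl_class_surj:
  assumes "P \<in> carrier (weyl n :: 'k::field weyl ring)"
  obtains f where "f \<in> carrier (free_alg n)" "P = weyl_class n f"
  using assms unfolding weyl_def weyl_class_def by (auto simp: FactRing_def A_RCOSETS_def')

lemma weyl_class_eq_iff:
  assumes "f \<in> carrier (free_alg n)" "g \<in> carrier (free_alg n)"
  shows "(weyl_class n f :: 'k::field weyl) = weyl_class n g \<longleftrightarrow>
    (\<lambda>w. f w - g w) \<in> weyl_ideal n"
proof -
  interpret ideal "weyl_ideal n" "free_alg n :: (letter list \<Rightarrow> 'k) ring" by (rule ideal_weyl_ideal)
  have minus: "f \<ominus>\<^bsub>free_alg n\<^esub> g = (\<lambda>w. f w - g w)"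
  proof -
    have "(\<lambda>w. - g w) \<in> carrier (free_alg n)" using assms(2) by (simp add: free_alg_carrier)
    then have "\<ominus>\<^bsub>free_alg n\<^esub> g = (\<lambda>w. - g w)"
      by (intro minus_equality) (auto simp: free_alg_simps assms)
    then show ?thesis unfolding a_minus_def by (simp add: free_alg_simps)
  qed
  show ?thesis
    using quotient_eq_iff_same_a_r_cos[OF ideal_weyl_ideal assms] minus
    by (simp add: weyl_class_def)
qed

abbreviation wl :: "nat \<Rightarrow> letter \<Rightarrow> 'k::field weyl" where
  "wl n l \<equiv> weyl_class n (word [l])"

lemma wl_closed: "l \<in> letters n \<Longrightarrow> wl n l \<in> carrier (weyl n :: 'k::field weyl ring)"
  by (intro weyl_class_closed) (simp add: word_eq_mono mono_carrier)

lemma weyl_const_eq: "weyl_const n c = weyl_class n (mono c [])"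
  by (simp add: weyl_const_def mono_def)

lemma weyl_const_closed: "weyl_const n c \<in> carrier (weyl n :: 'k::field weyl ring)"
  unfolding weyl_const_eq by (intro weyl_class_closed mono_carrier) simp

lemma weyl_x_closed: "i \<le> n \<Longrightarrow> weyl_x n i \<in> carrier (weyl n :: 'k::field weyl ring)"
  unfolding weyl_x_def by (intro wl_closed) (simp add: letters_def)

lemma weyl_d_closed: "i \<le> n \<Longrightarrow> weyl_d n i \<in> carrier (weyl n :: 'k::field weyl ring)"
  unfolding weyl_d_def by (intro wl_closed) (simp add: letters_def)

lemma weyl_const_add:
  "weyl_const n (a + b) = weyl_const n a \<oplus>\<^bsub>weyl n\<^esub> (weyl_const n b :: 'k::field weyl)"
proof -
  have "mono (a + b) [] = (\<lambda>w. mono a [] w + mono b [] w)" by (auto simp: mono_def)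
  then show ?thesis unfolding weyl_const_eq by (simp add: weyl_class_add mono_carrier)
qed

lemma weyl_const_mult:
  "weyl_const n (a * b) = weyl_const n a \<otimes>\<^bsub>weyl n\<^esub> (weyl_const n b :: 'k::field weyl)"
  unfolding weyl_const_eq by (simp add: weyl_class_mult[symmetric] mono_carrier mono_mult)

lemma weyl_const_0: "weyl_const n 0 = (\<zero>\<^bsub>weyl n\<^esub> :: 'k::field weyl)"
  unfolding weyl_const_def by (simp add: weyl_class_zero)

lemma weyl_const_1: "weyl_const n 1 = (\<one>\<^bsub>weyl n\<^esub> :: 'k::field weyl)"
  using ring_hom_ring.homh[OF weyl_class_hom, THEN ring_hom_one, of n]
  by (simp add: free_alg_simps weyl_const_def)

text \<open>Convolution with a multiple of the empty word, on either side, merely scales a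
  coefficient function.\<close>

lemma weyl_const_comm:
  assumes "P \<in> carrier (weyl n :: 'k::field weyl ring)"
  shows "weyl_const n c \<otimes>\<^bsub>weyl n\<^esub> P = P \<otimes>\<^bsub>weyl n\<^esub> weyl_const n c"
proof -
  obtain f where f: "f \<in> carrier (free_alg n)" "P = weyl_class n f"
    using weyl_class_surj[OF assms] .
  have "mono c [] \<otimes>\<^bsub>free_alg n\<^esub> f = f \<otimes>\<^bsub>free_alg n\<^esub> mono c []"
  proof
    fix w
    have "(\<Sum>i\<le>length w. mono c [] (take i w) * f (drop i w)) = c * f w"
      using conv_one_left[of w f] by (simp add: mono_def sum_distrib_left[symmetric]
          if_distrib[of "\<lambda>x. c * x"] flip: conv_one_left[of w f])
        (auto simp: sum_distrib_left intro!: sum.cong)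
    moreover have "(\<Sum>i\<le>length w. f (take i w) * mono c [] (drop i w)) = c * f w"
      by (subst (2) conv_one_right[symmetric]) (auto simp: mono_def sum_distrib_left intro!: sum.cong)
    ultimately show "(mono c [] \<otimes>\<^bsub>free_alg n\<^esub> f) w = (f \<otimes>\<^bsub>free_alg n\<^esub> mono c []) w"
      by (simp add: free_alg_simps)
  qed
  then show ?thesis using f
    by (simp add: weyl_const_eq weyl_class_mult[symmetric] mono_carrier)
qed

lemma weyl_class_word_rel:
  assumes "(\<lambda>w. f w - g w) \<in> weyl_rels n" "f \<in> carrier (free_alg n)" "g \<in> carrier (free_alg n)"
  shows "weyl_class n f = (weyl_class n g :: 'k::field weyl)"
proof -
  have "(\<lambda>w. f w - g w) \<in> weyl_ideal n"
    unfolding weyl_ideal_def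
    using ring.genideal_self[OF ring_free_alg weyl_rels_carrier] assms(1) by blast
  then show ?thesis using assms by (simp add: weyl_class_eq_iff)
qed

lemma word_letters_closed: "set w \<subseteq> letters n \<Longrightarrow> word w \<in> carrier (free_alg n)"
  unfolding word_eq_mono by (rule mono_carrier) auto

lemma wl_mult:
  assumes "a \<in> letters n" "b \<in> letters n"
  shows "wl n a \<otimes>\<^bsub>weyl n\<^esub> (wl n b :: 'k::field weyl) = weyl_class n (word [a, b])"
  using assms
  by (simp add: word_letters_closed flip: weyl_class_mult) (simp add: word_eq_mono mono_mult)

lemma weyl_xx:
  assumes "i \<le> n" "j \<le> n"
  shows "weyl_x n i \<otimes>\<^bsub>weyl n\<^esub> weyl_x n j = weyl_x n j \<otimes>\<^bsub>weyl n\<^esub> (weyl_x n i :: 'k::field weyl)"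
proof -
  have "(weyl_class n (word [Lx i, Lx j]) :: 'k weyl) = weyl_class n (word [Lx j, Lx i])"
    using assms
    by (intro weyl_class_word_rel word_letters_closed) (auto simp: letters_def weyl_rels_def)
  then show ?thesis using assms by (simp add: weyl_x_def wl_mult letters_def)
qed

lemma weyl_dd:
  assumes "i \<le> n" "j \<le> n"
  shows "weyl_d n i \<otimes>\<^bsub>weyl n\<^esub> weyl_d n j = weyl_d n j \<otimes>\<^bsub>weyl n\<^esub> (weyl_d n i :: 'k::field weyl)"
proof -
  have "(weyl_class n (word [Ld i, Ld j]) :: 'k weyl) = weyl_class n (word [Ld j, Ld i])"
    using assms
    by (intro weyl_class_word_rel word_letters_closed) (auto simp: letters_def weyl_rels_def)
  then show ?thesis using assms by (simp add: weyl_d_def wl_mult letters_def)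
qed

lemma weyl_dx:
  assumes "i \<le> n" "j \<le> n"
  shows "weyl_d n i \<otimes>\<^bsub>weyl n\<^esub> weyl_x n j =
    weyl_x n j \<otimes>\<^bsub>weyl n\<^esub> weyl_d n i \<oplus>\<^bsub>weyl n\<^esub> (weyl_const n (if i = j then 1 else 0) :: 'k::field weyl)"
proof -
  let ?b = "\<lambda>w. if i = j then word [] w else (0 :: 'k)"
  have c: "word [Ld i, Lx j] \<in> carrier (free_alg n)" "word [Lx j, Ld i] \<in> carrier (free_alg n)"
    using assms by (auto simp: letters_def intro!: word_letters_closed)
  have b: "?b = mono (if i = j then 1 else 0) []"
    by (simp add: word_eq_mono mono_def fun_eq_iff)
  then have cb: "?b \<in> carrier (free_alg n)"
    by (simp add: mono_carrier)
  have "(\<lambda>w. word [Ld i, Lx j] w - (word [Lx j, Ld i] w + ?b w)) \<in> (weyl_rels n :: (letter list \<Rightarrow> 'k) set)"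
    using assms unfolding weyl_rels_def diff_diff_eq[symmetric] by blast
  moreover have "(\<lambda>w. word [Lx j, Ld i] w + ?b w) \<in> carrier (free_alg n :: (letter list \<Rightarrow> 'k) ring)"
    using ring.ring_simprules(1)[OF ring_free_alg c(2) cb] by (simp add: free_alg_simps)
  ultimately have "(weyl_class n (word [Ld i, Lx j]) :: 'k weyl) = weyl_class n (\<lambda>w. word [Lx j, Ld i] w + ?b w)"
    by (intro weyl_class_word_rel c)
  also have "\<dots> = weyl_class n (word [Lx j, Ld i]) \<oplus>\<^bsub>weyl n\<^esub> weyl_class n ?b"
    by (rule weyl_class_add[OF c(2) cb])
  finally show ?thesis
    using assms unfolding b by (simp add: weyl_x_def weyl_d_def weyl_const_eq wl_mult letters_def)
qed

section \<open>Homogeneous parts of the Weyl algebra\<close>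

lemma letters_cases:
  assumes "l \<in> letters n"
  obtains i where "i \<le> n" "l = Lx i" | i where "i \<le> n" "l = Ld i"
  using assms by (auto simp: letters_def)

lemma mono_Cons:
  assumes "l \<in> letters n" "w \<in> lists (letters n)"
  shows "weyl_class n (mono c (l # w)) = wl n l \<otimes>\<^bsub>weyl n\<^esub> (weyl_class n (mono c w) :: 'k::field weyl)"
proof -
  have "mono c (l # w) = mono 1 [l] \<otimes>\<^bsub>free_alg n\<^esub> mono c w" by (simp add: mono_mult)
  then show ?thesis using assms by (simp add: weyl_class_mult mono_carrier word_eq_mono)
qed

lemma mono_part:
  assumes "w \<in> lists (letters n)"
  shows "weyl_class n (mono c w) \<in> (weyl_part n d (word_deg d w) :: 'k::field weyl set)"
  unfolding weyl_part_def using mono_carrier[OF assms, of c]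
  by (intro imageI) (simp add: mono_def)

text \<open>The degree is carried along so that the same induction serves the whole algebra and its
  graded parts.\<close>

lemma weyl_part_induct [consumes 1, case_names zero const letter add]:
  assumes P: "P \<in> weyl_part n d k"
    and zero: "\<And>k. Q k (\<zero>\<^bsub>weyl n\<^esub> :: 'k::field weyl)"
    and const: "\<And>c. Q 0 (weyl_const n c)"
    and letter: "\<And>l k a. \<lbrakk>l \<in> letters n; a \<in> weyl_part n d k; Q k a\<rbrakk> \<Longrightarrow>
      Q (letter_deg d l + k) (wl n l \<otimes>\<^bsub>weyl n\<^esub> a)"
    and add: "\<And>k a b. \<lbrakk>a \<in> weyl_part n d k; b \<in> weyl_part n d k; Q k a; Q k b\<rbrakk> \<Longrightarrow>
      Q k (a \<oplus>\<^bsub>weyl n\<^esub> b)"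
  shows "Q k P"
proof -
  obtain f where f: "f \<in> carrier (free_alg n)" "P = weyl_class n f" "\<And>w. f w \<noteq> 0 \<Longrightarrow> word_deg d w = k"
    using P unfolding weyl_part_def by blast
  note part = mono_part
  have word: "Q (word_deg d w) (weyl_class n (mono c w))" if "w \<in> lists (letters n)" for w and c :: 'k
    using that
  proof (induction w)
    case Nil
    then show ?case using const by (simp add: word_deg_def weyl_const_eq)
  next
    case (Cons l w)
    then have "Q (letter_deg d l + word_deg d w) (wl n l \<otimes>\<^bsub>weyl n\<^esub> weyl_class n (mono c w))"
      by (intro letter part) auto
    then show ?case using Cons by (simp add: mono_Cons word_deg_def)
  qed
  have "Q k (weyl_class n f)" using f(1)
  proof (induction f rule: free_alg_induct)
    case zero
    then show ?case using assms(2) by (simp add: weyl_class_zero)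
  next
    case (add w g)
    have k: "word_deg d w = k" by (rule f(3)[OF add(2)])
    have "Q k (weyl_class n (mono (f w) w))" using word[OF add(1)] k by metis
    moreover have "weyl_class n (mono (f w) w) \<in> weyl_part n d k" using part[OF add(1)] k by metis
    moreover have "weyl_class n g \<in> weyl_part n d k"
      unfolding weyl_part_def using add(3,4) f(3) by (intro imageI) force
    ultimately show ?case using add assms(5)
      by (simp add: mono_carrier weyl_class_add free_alg_simps)
  qed
  then show ?thesis using f by simp
qed

lemma weyl_part_carrier: "P \<in> weyl_part n d k \<Longrightarrow> P \<in> carrier (weyl n :: 'k::field weyl ring)"
  unfolding weyl_part_def by (auto simp: weyl_class_closed)

lemma weyl_part_zero: "\<zero>\<^bsub>weyl n\<^esub> \<in> (weyl_part n d k :: 'k::field weyl set)"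
  unfolding weyl_part_def weyl_class_zero[symmetric] by (intro imageI) (auto simp: free_alg_carrier)

lemma weyl_part_add:
  assumes "P \<in> weyl_part n d k" "Q \<in> weyl_part n d k"
  shows "P \<oplus>\<^bsub>weyl n\<^esub> Q \<in> (weyl_part n d k :: 'k::field weyl set)"
proof -
  obtain f g where f: "f \<in> carrier (free_alg n)" "P = weyl_class n f" "\<And>w. f w \<noteq> 0 \<Longrightarrow> word_deg d w = k"
    and g: "g \<in> carrier (free_alg n)" "Q = weyl_class n g" "\<And>w. g w \<noteq> 0 \<Longrightarrow> word_deg d w = k"
    using assms unfolding weyl_part_def by blast
  have "(\<lambda>w. f w + g w) \<in> carrier (free_alg n)"
    using ring.ring_simprules(1)[OF ring_free_alg f(1) g(1)] by (simp add: free_alg_simps)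
  moreover have "word_deg d w = k" if "f w + g w \<noteq> 0" for w
    using f(3)[of w] g(3)[of w] that by fastforce
  ultimately show ?thesis
    unfolding f(2) g(2) weyl_class_add[OF f(1) g(1), symmetric] unfolding weyl_part_def by blast
qed

lemma weyl_part_mult:
  assumes "P \<in> weyl_part n d j" "Q \<in> weyl_part n d k"
  shows "P \<otimes>\<^bsub>weyl n\<^esub> Q \<in> (weyl_part n d (j + k) :: 'k::field weyl set)"
proof -
  obtain f g where f: "f \<in> carrier (free_alg n)" "P = weyl_class n f" "\<And>w. f w \<noteq> 0 \<Longrightarrow> word_deg d w = j"
    and g: "g \<in> carrier (free_alg n)" "Q = weyl_class n g" "\<And>w. g w \<noteq> 0 \<Longrightarrow> word_deg d w = k"
    using assms unfolding weyl_part_def by blast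
  have "word_deg d w = j + k" if "(f \<otimes>\<^bsub>free_alg n\<^esub> g) w \<noteq> 0" for w
    using that f(3) g(3) unfolding free_alg_simps
    by (elim conv_support) (auto simp: word_deg_def)
  then show ?thesis
    unfolding f(2) g(2) weyl_class_mult[OF f(1) g(1), symmetric]
    using free_alg_mult_closed[OF f(1) g(1)] unfolding weyl_part_def by blast
qed

lemma weyl_part_const: "weyl_const n c \<in> (weyl_part n d 0 :: 'k::field weyl set)"
  using mono_part[of "[]" n c d] by (simp add: weyl_const_eq word_deg_def)

lemma weyl_part_one: "\<one>\<^bsub>weyl n\<^esub> \<in> (weyl_part n d 0 :: 'k::field weyl set)"
  using weyl_part_const[of n 1 d] by (simp add: weyl_const_1)

lemma weyl_part_wl: "l \<in> letters n \<Longrightarrow> wl n l \<in> (weyl_part n d (letter_deg d l) :: 'k::field weyl set)"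
  using mono_part[of "[l]" n 1 d] by (simp add: word_eq_mono word_deg_def)

lemma weyl_part_x: "i \<le> n \<Longrightarrow> weyl_x n i \<in> (weyl_part n d (int (d i)) :: 'k::field weyl set)"
  using weyl_part_wl[of "Lx i" n d] by (simp add: weyl_x_def letters_def)

lemma weyl_part_d: "i \<le> n \<Longrightarrow> weyl_d n i \<in> (weyl_part n d (- int (d i)) :: 'k::field weyl set)"
  using weyl_part_wl[of "Ld i" n d] by (simp add: weyl_d_def letters_def)

text \<open>Negation is multiplication by a constant, so closure under operators already gives
  closure under negation, for homogeneous parts as well as for submodules.\<close>

lemma weyl_minus_eq:
  assumes "P \<in> carrier (weyl n)"
  shows "\<ominus>\<^bsub>weyl n\<^esub> P = weyl_const n (- 1) \<otimes>\<^bsub>weyl n\<^esub> (P :: 'k::field weyl)"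
proof -
  interpret ring "weyl n :: 'k weyl ring" by (rule ring_weyl)
  have "weyl_const n (- 1) \<otimes>\<^bsub>weyl n\<^esub> P \<oplus>\<^bsub>weyl n\<^esub> P = weyl_const n (- 1 + 1) \<otimes>\<^bsub>weyl n\<^esub> P"
    unfolding weyl_const_add using assms by (simp add: l_distr weyl_const_closed weyl_const_1)
  also have "\<dots> = \<zero>\<^bsub>weyl n\<^esub>" using assms by (simp add: weyl_const_0)
  finally show ?thesis using assms by (intro minus_equality) (auto simp: weyl_const_closed)
qed

lemma weyl_part_minus:
  "P \<in> weyl_part n d k \<Longrightarrow> \<ominus>\<^bsub>weyl n\<^esub> P \<in> (weyl_part n d k :: 'k::field weyl set)"
  using weyl_part_mult[OF weyl_part_const[of n "- 1" d], of P k]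
  by (simp add: weyl_minus_eq weyl_part_carrier)

text \<open>Words are homogeneous, so an additive statement about operators need only be checked on
  homogeneous ones.\<close>

lemma weyl_induct_part [consumes 1, case_names part add]:
  assumes P: "P \<in> carrier (weyl n :: 'k::field weyl ring)"
    and part: "\<And>k P. P \<in> weyl_part n d k \<Longrightarrow> Q P"
    and add: "\<And>P P'. \<lbrakk>P \<in> carrier (weyl n); P' \<in> carrier (weyl n); Q P; Q P'\<rbrakk> \<Longrightarrow> Q (P \<oplus>\<^bsub>weyl n\<^esub> P')"
  shows "Q P"
proof -
  obtain f where f: "f \<in> carrier (free_alg n)" "P = weyl_class n f"
    using weyl_class_surj[OF P] .
  have "Q (weyl_class n f)" using f(1)
  proof (induction f rule: free_alg_induct)
    case zero
    then show ?case using part weyl_part_zero by (metis weyl_class_zero)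
  next
    case (add w g)
    have "weyl_class n (mono (f w) w) \<in> weyl_part n d (word_deg d w)"
      using add(1) by (rule mono_part)
    then have "Q (weyl_class n (mono (f w) w))" by (rule part)
    then show ?case using add assms(3)
      by (simp add: mono_carrier weyl_class_add weyl_class_closed free_alg_simps)
  qed
  then show ?thesis using f by simp
qed

subsection \<open>The Euler field\<close>

lemma finsum_closed_pred:
  assumes "abelian_monoid G" "finite A" "\<And>i. i \<in> A \<Longrightarrow> f i \<in> H" "H \<subseteq> carrier G"
    and "\<zero>\<^bsub>G\<^esub> \<in> H" "\<And>x y. \<lbrakk>x \<in> H; y \<in> H\<rbrakk> \<Longrightarrow> x \<oplus>\<^bsub>G\<^esub> y \<in> H"
  shows "finsum G f A \<in> H"
proof -
  interpret abelian_monoid G by fact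
  show ?thesis using assms(2,3)
  proof (induction A rule: finite_induct)
    case (insert a A)
    then have "f \<in> A \<rightarrow> carrier G" "f a \<in> carrier G" using assms(4) by auto
    then show ?case using insert assms(6) by simp
  qed (use assms in simp)
qed

lemma euler_part: "euler n d \<in> (weyl_part n d 0 :: 'k::field weyl set)"
proof -
  interpret ring "weyl n :: 'k weyl ring" by (rule ring_weyl)
  have "weyl_const n (of_nat (d i)) \<otimes>\<^bsub>weyl n\<^esub> (weyl_x n i \<otimes>\<^bsub>weyl n\<^esub> weyl_d n i)
      \<in> (weyl_part n d 0 :: 'k weyl set)" if "i \<le> n" for i
    using weyl_part_mult[OF weyl_part_const weyl_part_mult[OF weyl_part_x[OF that] weyl_part_d[OF that]]]
    by simp
  then show ?thesis
    unfolding euler_def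
    by (intro finsum_closed_pred abelian_monoid_axioms)
      (auto simp: weyl_part_zero weyl_part_add weyl_part_carrier)
qed

lemma euler_closed: "euler n d \<in> carrier (weyl n :: 'k::field weyl ring)"
  using euler_part weyl_part_carrier by blast

text \<open>The summand of index j commutes with the letter unless j is the index of the letter. In
  that case the relation between \<partial>_i and x_i leaves the letter itself, scaled by its
  degree.\<close>

lemma euler_wl_comm:
  assumes l: "l \<in> letters n"
  shows "euler n d \<otimes>\<^bsub>weyl n\<^esub> wl n l =
    wl n l \<otimes>\<^bsub>weyl n\<^esub> euler n d \<oplus>\<^bsub>weyl n\<^esub> (weyl_const n (of_int (letter_deg d l)) \<otimes>\<^bsub>weyl n\<^esub> wl n l :: 'k::field weyl)"
proof -
  interpret ring "weyl n :: 'k weyl ring" by (rule ring_weyl)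
  let ?D = "weyl n :: 'k weyl ring"
  let ?c = "\<lambda>i. weyl_const n (of_nat (d i)) :: 'k weyl"
  let ?x = "\<lambda>i. weyl_x n i :: 'k weyl"
  let ?y = "\<lambda>i. weyl_d n i :: 'k weyl"
  let ?t = "\<lambda>i. ?c i \<otimes>\<^bsub>?D\<^esub> (?x i \<otimes>\<^bsub>?D\<^esub> ?y i)"
  let ?i = "case l of Lx i \<Rightarrow> i | Ld i \<Rightarrow> i"
  let ?r = "weyl_const n (of_int (letter_deg d l)) \<otimes>\<^bsub>?D\<^esub> wl n l"
  have li: "?i \<le> n" using l by (auto simp: letters_def)
  have cl: "?t \<in> {..n} \<rightarrow> carrier ?D"
    by (auto intro!: m_closed weyl_const_closed weyl_x_closed weyl_d_closed)
  have lc: "wl n l \<in> carrier ?D" by (rule wl_closed[OF l])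
  have rc: "?r \<in> carrier ?D" by (simp add: weyl_const_closed lc)
  \<comment> \<open>Summed over j, the correction term survives once, at the index \<open>?i\<close>
    of the letter.\<close>
  have comm: "?t j \<otimes>\<^bsub>?D\<^esub> wl n l = wl n l \<otimes>\<^bsub>?D\<^esub> ?t j \<oplus>\<^bsub>?D\<^esub> (if ?i = j then ?r else \<zero>\<^bsub>?D\<^esub>)"
    if j: "j \<le> n" for j
  proof -
    note c = weyl_const_closed weyl_x_closed[OF j] weyl_d_closed[OF j]
    from l show ?thesis
    proof (cases rule: letters_cases)
      case (1 i)
      have w: "wl n l = ?x i" using 1 by (simp add: weyl_x_def)
      note c = c weyl_x_closed[OF 1(1)]
      have "?t j \<otimes>\<^bsub>?D\<^esub> ?x i = ?c j \<otimes>\<^bsub>?D\<^esub> (?x j \<otimes>\<^bsub>?D\<^esub> (?y j \<otimes>\<^bsub>?D\<^esub> ?x i))"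
        by (simp add: c m_assoc)
      also have "\<dots> = ?c j \<otimes>\<^bsub>?D\<^esub> (?x j \<otimes>\<^bsub>?D\<^esub> (?x i \<otimes>\<^bsub>?D\<^esub> ?y j))
          \<oplus>\<^bsub>?D\<^esub> ?c j \<otimes>\<^bsub>?D\<^esub> (?x j \<otimes>\<^bsub>?D\<^esub> weyl_const n (if j = i then 1 else 0))"
        unfolding weyl_dx[OF j 1(1)] by (simp add: c r_distr)
      also have "?c j \<otimes>\<^bsub>?D\<^esub> (?x j \<otimes>\<^bsub>?D\<^esub> (?x i \<otimes>\<^bsub>?D\<^esub> ?y j)) = ?c j \<otimes>\<^bsub>?D\<^esub> (?x i \<otimes>\<^bsub>?D\<^esub> (?x j \<otimes>\<^bsub>?D\<^esub> ?y j))"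
        using weyl_xx[OF j 1(1), where 'k='k] by (simp add: c flip: m_assoc)
      also have "\<dots> = ?x i \<otimes>\<^bsub>?D\<^esub> ?t j"
        using weyl_const_comm[of "?x i" n] by (simp add: c flip: m_assoc)
      also have "?c j \<otimes>\<^bsub>?D\<^esub> (?x j \<otimes>\<^bsub>?D\<^esub> weyl_const n (if j = i then 1 else 0)) = (if ?i = j then ?r else \<zero>\<^bsub>?D\<^esub>)"
        using 1 by (cases "i = j") (simp_all add: c w 1(2) weyl_x_def[symmetric] weyl_const_1 weyl_const_0)
      finally show ?thesis by (simp add: w)
    next
      case (2 i)
      have w: "wl n l = ?y i" using 2 by (simp add: weyl_d_def)
      note c = c weyl_d_closed[OF 2(1)]
      have xd: "?y i \<otimes>\<^bsub>?D\<^esub> ?x j = ?x j \<otimes>\<^bsub>?D\<^esub> ?y i \<oplus>\<^bsub>?D\<^esub> weyl_const n (if i = j then 1 else 0)"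
        by (rule weyl_dx[OF 2(1) j])
      have "?y i \<otimes>\<^bsub>?D\<^esub> ?t j = ?c j \<otimes>\<^bsub>?D\<^esub> (?y i \<otimes>\<^bsub>?D\<^esub> ?x j) \<otimes>\<^bsub>?D\<^esub> ?y j"
        using weyl_const_comm[of "?y i" n] by (simp add: c flip: m_assoc)
      also have "\<dots> = ?c j \<otimes>\<^bsub>?D\<^esub> (?x j \<otimes>\<^bsub>?D\<^esub> ?y i \<otimes>\<^bsub>?D\<^esub> ?y j)
          \<oplus>\<^bsub>?D\<^esub> ?c j \<otimes>\<^bsub>?D\<^esub> (weyl_const n (if i = j then 1 else 0) \<otimes>\<^bsub>?D\<^esub> ?y j)"
        unfolding xd by (simp add: c r_distr l_distr m_assoc)
      also have "?c j \<otimes>\<^bsub>?D\<^esub> (?x j \<otimes>\<^bsub>?D\<^esub> ?y i \<otimes>\<^bsub>?D\<^esub> ?y j) = ?t j \<otimes>\<^bsub>?D\<^esub> ?y i"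
        using weyl_dd[OF 2(1) j, where 'k='k] by (simp add: c add: m_assoc)
      finally have eq: "?y i \<otimes>\<^bsub>?D\<^esub> ?t j = ?t j \<otimes>\<^bsub>?D\<^esub> ?y i
          \<oplus>\<^bsub>?D\<^esub> ?c j \<otimes>\<^bsub>?D\<^esub> (weyl_const n (if i = j then 1 else 0) \<otimes>\<^bsub>?D\<^esub> ?y j)" .
      show ?thesis
      proof (cases "i = j")
        case True
        have r: "?r = weyl_const n (- of_nat (d j)) \<otimes>\<^bsub>?D\<^esub> ?y j"
          using 2 True by (simp add: weyl_d_def)
        have cc: "?c j \<otimes>\<^bsub>?D\<^esub> ?y j \<in> carrier ?D" by (simp add: c)
        have "?r = \<ominus>\<^bsub>?D\<^esub> (?c j \<otimes>\<^bsub>?D\<^esub> ?y j)"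
          unfolding r weyl_minus_eq[OF cc] by (simp add: c flip: m_assoc weyl_const_mult)
        then show ?thesis
          using eq True by (simp add: weyl_d_def[symmetric] c w 2 weyl_const_1 a_assoc r_neg)
      next
        case False
        then show ?thesis using eq by (simp add: weyl_d_def[symmetric] c w 2 weyl_const_0)
      qed
    qed
  qed
  have "euler n d \<otimes>\<^bsub>?D\<^esub> wl n l = finsum ?D (\<lambda>j. ?t j \<otimes>\<^bsub>?D\<^esub> wl n l) {..n}"
    unfolding euler_def using cl lc by (simp add: finsum_ldistr)
  also have "\<dots> = finsum ?D (\<lambda>j. wl n l \<otimes>\<^bsub>?D\<^esub> ?t j \<oplus>\<^bsub>?D\<^esub> (if ?i = j then ?r else \<zero>\<^bsub>?D\<^esub>)) {..n}"
    using cl lc rc by (intro finsum_cong') (auto simp: comm[symmetric] Pi_def)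
  also have "\<dots> = finsum ?D (\<lambda>j. wl n l \<otimes>\<^bsub>?D\<^esub> ?t j) {..n}
      \<oplus>\<^bsub>?D\<^esub> finsum ?D (\<lambda>j. if ?i = j then ?r else \<zero>\<^bsub>?D\<^esub>) {..n}"
    using cl lc rc by (intro finsum_addf) auto
  also have "finsum ?D (\<lambda>j. if ?i = j then ?r else \<zero>\<^bsub>?D\<^esub>) {..n} = ?r"
    using li rc by (intro finsum_singleton) auto
  also have "finsum ?D (\<lambda>j. wl n l \<otimes>\<^bsub>?D\<^esub> ?t j) {..n} = wl n l \<otimes>\<^bsub>?D\<^esub> euler n d"
    unfolding euler_def using cl lc by (simp add: finsum_rdistr)
  finally show ?thesis .
qed

text \<open>Taking commutators with E is a derivation, so the case of a letter extends to words, the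
  degrees adding up along the word.\<close>

lemma euler_comm:
  assumes "P \<in> weyl_part n d k"
  shows "euler n d \<otimes>\<^bsub>weyl n\<^esub> P =
    P \<otimes>\<^bsub>weyl n\<^esub> euler n d \<oplus>\<^bsub>weyl n\<^esub> (weyl_const n (of_int k) \<otimes>\<^bsub>weyl n\<^esub> P :: 'k::field weyl)"
  using assms
proof (induction rule: weyl_part_induct)
  case (zero k)
  interpret ring "weyl n :: 'k weyl ring" by (rule ring_weyl)
  show ?case by (simp add: euler_closed weyl_const_closed)
next
  case (const c)
  interpret ring "weyl n :: 'k weyl ring" by (rule ring_weyl)
  show ?case by (simp add: weyl_const_comm[OF euler_closed] weyl_const_0 euler_closed weyl_const_closed)
next
  case (letter l k a)
  interpret ring "weyl n :: 'k weyl ring" by (rule ring_weyl)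
  let ?D = "weyl n :: 'k weyl ring" and ?E = "euler n d :: 'k weyl"
  note c = euler_closed[of n d, where 'k='k] wl_closed[OF letter(1), where 'k='k]
    weyl_part_carrier[OF letter(2)] weyl_const_closed
  have "?E \<otimes>\<^bsub>?D\<^esub> (wl n l \<otimes>\<^bsub>?D\<^esub> a) = (?E \<otimes>\<^bsub>?D\<^esub> wl n l) \<otimes>\<^bsub>?D\<^esub> a"
    by (simp add: c m_assoc)
  also have "\<dots> = wl n l \<otimes>\<^bsub>?D\<^esub> (?E \<otimes>\<^bsub>?D\<^esub> a) \<oplus>\<^bsub>?D\<^esub> weyl_const n (of_int (letter_deg d l)) \<otimes>\<^bsub>?D\<^esub> (wl n l \<otimes>\<^bsub>?D\<^esub> a)"
    unfolding euler_wl_comm[OF letter(1)] by (simp add: c l_distr m_assoc)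
  also have "wl n l \<otimes>\<^bsub>?D\<^esub> (?E \<otimes>\<^bsub>?D\<^esub> a) = wl n l \<otimes>\<^bsub>?D\<^esub> a \<otimes>\<^bsub>?D\<^esub> ?E \<oplus>\<^bsub>?D\<^esub> wl n l \<otimes>\<^bsub>?D\<^esub> (weyl_const n (of_int k) \<otimes>\<^bsub>?D\<^esub> a)"
    unfolding letter(3) by (simp add: c r_distr m_assoc)
  also have "wl n l \<otimes>\<^bsub>?D\<^esub> (weyl_const n (of_int k) \<otimes>\<^bsub>?D\<^esub> a) = weyl_const n (of_int k) \<otimes>\<^bsub>?D\<^esub> (wl n l \<otimes>\<^bsub>?D\<^esub> a)"
    using weyl_const_comm[OF c(2)] by (simp add: c flip: m_assoc)
  finally show ?case
    by (simp add: c weyl_const_add l_distr a_ac)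
next
  case (add k a b)
  interpret ring "weyl n :: 'k weyl ring" by (rule ring_weyl)
  note c = euler_closed[of n d, where 'k='k] weyl_part_carrier[OF add(1)] weyl_part_carrier[OF add(2)] weyl_const_closed
  show ?case by (simp add: c r_distr l_distr add a_ac)
qed

lemma weyl_const_inverse:
  "c \<noteq> 0 \<Longrightarrow> weyl_const n (inverse c) \<otimes>\<^bsub>weyl n\<^esub> weyl_const n c = (\<one>\<^bsub>weyl n\<^esub> :: 'k::field weyl)"
  by (simp add: weyl_const_1 flip: weyl_const_mult)

section \<open>Gradings\<close>

text \<open>Sums of homogeneous elements are generated inductively, so that spanning can be proved
  by closure without exhibiting a decomposition.\<close>

inductive_set gspan :: "('a, 'b) ring_scheme \<Rightarrow> (int \<Rightarrow> 'a set) \<Rightarrow> 'a set"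
  for G (structure) and V where
  zero: "\<zero> \<in> gspan G V"
| part: "v \<in> V k \<Longrightarrow> v \<in> gspan G V"
| add: "\<lbrakk>x \<in> gspan G V; y \<in> gspan G V\<rbrakk> \<Longrightarrow> x \<oplus> y \<in> gspan G V"

text \<open>Spelled exactly like the condition in \<open>euler0\<close>, so that an Euler module is,
  by mere unfolding, a module graded by its integral eigenspaces.\<close>

definition decomposes :: "('a, 'b) ring_scheme \<Rightarrow> (int \<Rightarrow> 'a set) \<Rightarrow> 'a \<Rightarrow> (int \<Rightarrow> 'a) \<Rightarrow> bool" where
  "decomposes G V m c \<longleftrightarrow> (\<forall>k. c k \<in> V k) \<and> finite {k. c k \<noteq> \<zero>\<^bsub>G\<^esub>} \<and>
     m = (\<Oplus>\<^bsub>G\<^esub>k\<in>{k. c k \<noteq> \<zero>\<^bsub>G\<^esub>}. c k)"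

definition gcomp :: "('a, 'b) ring_scheme \<Rightarrow> (int \<Rightarrow> 'a set) \<Rightarrow> 'a \<Rightarrow> int \<Rightarrow> 'a" where
  "gcomp G V m = (THE c. decomposes G V m c)"

locale graded_group = abelian_group G for G (structure) +
  fixes V :: "int \<Rightarrow> 'a set"
  assumes subgroup_V: "additive_subgroup (V k) G"
    and decomposition: "m \<in> carrier G \<Longrightarrow> \<exists>!c. decomposes G V m c"
begin

lemma V_carrier: "v \<in> V k \<Longrightarrow> v \<in> carrier G"
  using additive_subgroup.a_subset[OF subgroup_V] by blast

lemma V_zero: "\<zero> \<in> V k"
  by (rule additive_subgroup.zero_closed[OF subgroup_V])

lemma V_add: "\<lbrakk>x \<in> V k; y \<in> V k\<rbrakk> \<Longrightarrow> x \<oplus> y \<in> V k"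
  by (rule additive_subgroup.a_closed[OF subgroup_V])

lemma decomposes_gcomp: "m \<in> carrier G \<Longrightarrow> decomposes G V m (gcomp G V m)"
  unfolding gcomp_def by (rule theI'[OF decomposition])

lemma gcomp_in: "m \<in> carrier G \<Longrightarrow> gcomp G V m k \<in> V k"
  using decomposes_gcomp by (simp add: decomposes_def)

lemma finite_gcomp: "m \<in> carrier G \<Longrightarrow> finite {k. gcomp G V m k \<noteq> \<zero>}"
  using decomposes_gcomp by (simp add: decomposes_def)

lemma gcomp_carrier: "m \<in> carrier G \<Longrightarrow> gcomp G V m k \<in> carrier G"
  using gcomp_in V_carrier by blast

text \<open>The exact support may be replaced by any larger finite set; two decompositions can then
  be summed over a common index set.\<close>

lemma decomposes_iff:
  assumes "finite F" "\<And>k. k \<notin> F \<Longrightarrow> c k = \<zero>" "\<And>k. c k \<in> V k"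
  shows "decomposes G V m c \<longleftrightarrow> m = finsum G c F"
proof -
  have "{k. c k \<noteq> \<zero>} \<subseteq> F" using assms(2) by auto
  moreover from this assms(1) have "finite {k. c k \<noteq> \<zero>}" by (rule finite_subset)
  moreover have "finsum G c {k. c k \<noteq> \<zero>} = finsum G c F"
    using calculation assms(1,2) V_carrier[OF assms(3)] by (intro add.finprod_mono_neutral_cong_left) auto
  ultimately show ?thesis using assms by (auto simp: decomposes_def)
qed

lemma gcomp_unique:
  assumes "m \<in> carrier G" "decomposes G V m c"
  shows "gcomp G V m = c"
  using decomposition[OF assms(1)] assms(2) decomposes_gcomp[OF assms(1)] by blast

lemma gcomp_V:
  assumes "v \<in> V j"
  shows "gcomp G V v k = (if k = j then v else \<zero>)"
proof -
  have "decomposes G V v (\<lambda>k. if k = j then v else \<zero>)"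
    using assms V_carrier[OF assms] V_zero by (subst decomposes_iff[of "{j}"]) auto
  then show ?thesis by (simp add: gcomp_unique[OF V_carrier[OF assms]])
qed

lemma gcomp_add:
  assumes "x \<in> carrier G" "y \<in> carrier G"
  shows "gcomp G V (x \<oplus> y) k = gcomp G V x k \<oplus> gcomp G V y k"
proof -
  let ?F = "{k. gcomp G V x k \<noteq> \<zero>} \<union> {k. gcomp G V y k \<noteq> \<zero>}"
  have fin: "finite ?F" using assms finite_gcomp by simp
  have "x = finsum G (gcomp G V x) ?F"
    using assms decomposes_gcomp by (intro decomposes_iff[THEN iffD1, OF fin]) (auto simp: gcomp_in)
  moreover have "y = finsum G (gcomp G V y) ?F"
    using assms decomposes_gcomp by (intro decomposes_iff[THEN iffD1, OF fin]) (auto simp: gcomp_in)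
  ultimately have "x \<oplus> y = finsum G (gcomp G V x) ?F \<oplus> finsum G (gcomp G V y) ?F" by simp
  also have "\<dots> = finsum G (\<lambda>k. gcomp G V x k \<oplus> gcomp G V y k) ?F"
    using assms gcomp_carrier by (intro finsum_addf[symmetric]) auto
  finally have "decomposes G V (x \<oplus> y) (\<lambda>k. gcomp G V x k \<oplus> gcomp G V y k)"
    using assms gcomp_in by (subst decomposes_iff[OF fin]) (auto intro: V_add)
  then show ?thesis using assms by (simp add: gcomp_unique)
qed

lemma gcomp_zero: "gcomp G V \<zero> k = \<zero>"
  using gcomp_V[OF V_zero, of k k] by simp

lemma graded_induct [consumes 1, case_names zero part add]:
  assumes m: "m \<in> carrier G" and zero: "Q \<zero>" and part: "\<And>k v. v \<in> V k \<Longrightarrow> Q v"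
    and add: "\<And>x y. \<lbrakk>x \<in> carrier G; y \<in> carrier G; Q x; Q y\<rbrakk> \<Longrightarrow> Q (x \<oplus> y)"
  shows "Q m"
proof -
  let ?c = "gcomp G V m"
  have "finsum G ?c {k. ?c k \<noteq> \<zero>} \<in> {x \<in> carrier G. Q x}"
    using finite_gcomp[OF m] part[OF gcomp_in[OF m]] gcomp_carrier[OF m] zero add
    by (intro finsum_closed_pred abelian_monoid_axioms) auto
  then show ?thesis using decomposes_gcomp[OF m] by (simp add: decomposes_def)
qed

lemma gcomp_inject:
  assumes "x \<in> carrier G" "y \<in> carrier G" "\<And>k. gcomp G V x k = gcomp G V y k"
  shows "x = y"
proof -
  have "gcomp G V x = gcomp G V y" using assms(3) by blast
  then show ?thesis using decomposes_gcomp[OF assms(1)] decomposes_gcomp[OF assms(2)]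
    by (simp add: decomposes_def)
qed

end

text \<open>Only additivity and the degree shift matter, so one statement covers homogeneous
  operators, module homomorphisms, quotient maps and multiplication inside the Weyl algebra.\<close>

lemma gcomp_map:
  assumes "graded_group G V" "graded_group H W" "m \<in> carrier G"
    and f: "\<And>x. x \<in> carrier G \<Longrightarrow> f x \<in> carrier H"
    and add: "\<And>x y. \<lbrakk>x \<in> carrier G; y \<in> carrier G\<rbrakk> \<Longrightarrow> f (x \<oplus>\<^bsub>G\<^esub> y) = f x \<oplus>\<^bsub>H\<^esub> f y"
    and deg: "\<And>k x. x \<in> V k \<Longrightarrow> f x \<in> W (q + k)"
  shows "gcomp H W (f m) (q + k) = f (gcomp G V m k)"
proof -
  interpret G: graded_group G V by fact
  interpret H: graded_group H W by fact
  have "f \<zero>\<^bsub>G\<^esub> \<oplus>\<^bsub>H\<^esub> f \<zero>\<^bsub>G\<^esub> = f \<zero>\<^bsub>G\<^esub>" using add[of "\<zero>\<^bsub>G\<^esub>" "\<zero>\<^bsub>G\<^esub>"] by simp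
  then have f0: "f \<zero>\<^bsub>G\<^esub> = \<zero>\<^bsub>H\<^esub>" using f[of "\<zero>\<^bsub>G\<^esub>"] by (metis G.zero_closed H.add.l_cancel_one')
  show ?thesis using assms(3)
  proof (induction m rule: G.graded_induct)
    case (part j v)
    then show ?case using H.gcomp_V[OF deg[OF part]] G.gcomp_V[OF part] by (auto simp: f0)
  next
    case (add x y)
    then show ?case using f assms(5) by (simp add: G.gcomp_add H.gcomp_add G.gcomp_carrier)
  qed (simp add: f0 G.gcomp_zero H.gcomp_zero)
qed

text \<open>The difference of two decompositions is a relation between homogeneous elements, so
  independence gives uniqueness.\<close>

lemma graded_groupI:
  assumes G: "abelian_group G" and sub: "\<And>k. additive_subgroup (V k) G"
    and indep: "\<And>F c k. \<lbrakk>finite F; \<And>k. k \<in> F \<Longrightarrow> c k \<in> V k; finsum G c F = \<zero>\<^bsub>G\<^esub>; k \<in> F\<rbrakk> \<Longrightarrow> c k = \<zero>\<^bsub>G\<^esub>"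
    and span: "\<And>m. m \<in> carrier G \<Longrightarrow> m \<in> gspan G V"
  shows "graded_group G V"
proof -
  interpret abelian_group G by fact
  have Vc: "v \<in> carrier G" if "v \<in> V k" for v k
    using additive_subgroup.a_subset[OF sub] that by blast
  have V0: "\<zero>\<^bsub>G\<^esub> \<in> V k" for k by (rule additive_subgroup.zero_closed[OF sub])
  have Va: "x \<oplus>\<^bsub>G\<^esub> y \<in> V k" if "x \<in> V k" "y \<in> V k" for x y k
    by (rule additive_subgroup.a_closed[OF sub that])
  have Vm: "\<ominus>\<^bsub>G\<^esub> x \<in> V k" if "x \<in> V k" for x k
    by (rule additive_subgroup.a_inv_closed[OF sub that])
  have mono: "finsum G c {k. c k \<noteq> \<zero>\<^bsub>G\<^esub>} = finsum G c F"
    if "finite F" "\<And>k. k \<notin> F \<Longrightarrow> c k = \<zero>\<^bsub>G\<^esub>" "\<And>k. c k \<in> V k" for F c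
    using that Vc by (intro add.finprod_mono_neutral_cong_left) auto
  have ex: "\<exists>F c. finite F \<and> (\<forall>k. k \<notin> F \<longrightarrow> c k = \<zero>\<^bsub>G\<^esub>) \<and> (\<forall>k. c k \<in> V k) \<and> m = finsum G c F"
    if "m \<in> gspan G V" for m
    using that
  proof induction
    case zero
    show ?case using V0 by (intro exI[of _ "{}"] exI[of _ "\<lambda>_. \<zero>\<^bsub>G\<^esub>"]) simp
  next
    case (part v j)
    then show ?case using V0 Vc[OF part]
      by (intro exI[of _ "{j}"] exI[of _ "\<lambda>k. if k = j then v else \<zero>\<^bsub>G\<^esub>"]) simp
  next
    case (add x y)
    then obtain F c F' c' where
      c: "finite F" "\<And>k. k \<notin> F \<Longrightarrow> c k = \<zero>\<^bsub>G\<^esub>" "\<And>k. c k \<in> V k" "x = finsum G c F" and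
      c': "finite F'" "\<And>k. k \<notin> F' \<Longrightarrow> c' k = \<zero>\<^bsub>G\<^esub>" "\<And>k. c' k \<in> V k" "y = finsum G c' F'"
      by blast
    let ?F = "F \<union> F'"
    have "x = finsum G c ?F" "y = finsum G c' ?F"
      unfolding c(4) c'(4) using c(1,2) c'(1,2) Vc[OF c(3)] Vc[OF c'(3)]
      by (auto intro!: add.finprod_mono_neutral_cong_left)
    then have "x \<oplus>\<^bsub>G\<^esub> y = finsum G (\<lambda>k. c k \<oplus>\<^bsub>G\<^esub> c' k) ?F"
      using Vc[OF c(3)] Vc[OF c'(3)] by (simp add: finsum_addf Pi_def)
    then show ?case using c c' Va
      by (intro exI[of _ ?F] exI[of _ "\<lambda>k. c k \<oplus>\<^bsub>G\<^esub> c' k"]) auto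
  qed
  show ?thesis
  proof (intro graded_group.intro graded_group_axioms.intro abelian_group_axioms sub)
    fix m assume "m \<in> carrier G"
    from ex[OF span[OF this]] obtain F c where
      c: "finite F" "\<And>k. k \<notin> F \<Longrightarrow> c k = \<zero>\<^bsub>G\<^esub>" "\<And>k. c k \<in> V k" "m = finsum G c F" by blast
    show "\<exists>!c. decomposes G V m c"
    proof
      have "{k. c k \<noteq> \<zero>\<^bsub>G\<^esub>} \<subseteq> F" using c(2) by auto
      then show "decomposes G V m c"
        unfolding decomposes_def using c mono[OF c(1-3)] finite_subset by auto
    next
      fix c' assume c': "decomposes G V m c'"
      let ?F = "{k. c' k \<noteq> \<zero>\<^bsub>G\<^esub>} \<union> F"
      have fin: "finite ?F" using c' c(1) by (simp add: decomposes_def)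
      have V': "c' k \<in> V k" for k using c' by (simp add: decomposes_def)
      have "m = finsum G c' ?F"
        using c' mono[OF fin, of c'] V' by (simp add: decomposes_def)
      moreover have "m = finsum G c ?F"
        unfolding c(4) using c fin Vc by (intro add.finprod_mono_neutral_cong_left) auto
      moreover have "finsum G (\<lambda>k. c' k \<oplus>\<^bsub>G\<^esub> \<ominus>\<^bsub>G\<^esub> c k) ?F \<oplus>\<^bsub>G\<^esub> finsum G c ?F
          = finsum G (\<lambda>k. (c' k \<oplus>\<^bsub>G\<^esub> \<ominus>\<^bsub>G\<^esub> c k) \<oplus>\<^bsub>G\<^esub> c k) ?F"
        using Vc[OF c(3)] Vc[OF V'] by (intro finsum_addf[symmetric]) auto
      moreover have "\<dots> = finsum G c' ?F"
        using Vc[OF c(3)] Vc[OF V'] by (intro finsum_cong') (auto simp: a_assoc l_neg)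
      ultimately have "finsum G (\<lambda>k. c' k \<oplus>\<^bsub>G\<^esub> \<ominus>\<^bsub>G\<^esub> c k) ?F = \<zero>\<^bsub>G\<^esub>"
        using Vc[OF c(3)] Vc[OF V'] \<open>m \<in> carrier G\<close> by (simp add: Pi_def)
      from indep[OF fin _ this] have diff: "c' k \<oplus>\<^bsub>G\<^esub> \<ominus>\<^bsub>G\<^esub> c k = \<zero>\<^bsub>G\<^esub>" if "k \<in> ?F" for k
        using that c(3) V' Va Vm by blast
      have "c' k = c k" for k
      proof (cases "k \<in> ?F")
        case True
        then show ?thesis using diff[OF True] Vc[OF V'[of k]] Vc[OF c(3)[of k]]
          by (metis add.inv_equality minus_minus a_inv_closed)
      next
        case False
        then show ?thesis using c(2) by simp
      qed
      then show "c' = c" by blast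
    qed
  qed
qed

lemma additive_subgroupI':
  assumes "abelian_group G" "H \<subseteq> carrier G" "\<zero>\<^bsub>G\<^esub> \<in> H"
    and "\<And>x y. \<lbrakk>x \<in> H; y \<in> H\<rbrakk> \<Longrightarrow> x \<oplus>\<^bsub>G\<^esub> y \<in> H" "\<And>x. x \<in> H \<Longrightarrow> \<ominus>\<^bsub>G\<^esub> x \<in> H"
  shows "additive_subgroup H G"
proof -
  interpret abelian_group G by fact
  show ?thesis
    using assms by (intro additive_subgroup.intro subgroup.intro) (auto simp: a_inv_def)
qed

lemma (in abelian_group) add_cancel_conj:
  "\<lbrakk>x \<in> carrier G; y \<in> carrier G\<rbrakk> \<Longrightarrow> x \<oplus> (y \<oplus> \<ominus> x) = y"
  by (metis a_inv_closed a_lcomm add.m_closed r_neg r_zero)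

text \<open>No basis of the Weyl algebra enters. The map P \<mapsto> [E, P] - jP kills degree j and
  multiplies degree i by i - j, which is invertible in characteristic zero; applied to a relation
  between degrees it removes one term, and induction finishes.\<close>

lemma graded_weyl: "graded_group (weyl n :: 'k::field_char_0 weyl ring) (weyl_part n d)"
proof (rule graded_groupI)
  let ?D = "weyl n :: 'k weyl ring"
  interpret ring ?D by (rule ring_weyl)
  show "abelian_group ?D" by (rule abelian_group_axioms)
  show sub: "additive_subgroup (weyl_part n d k) ?D" for k
    by (rule additive_subgroupI'[OF abelian_group_axioms])
      (auto simp: weyl_part_carrier weyl_part_zero weyl_part_add weyl_part_minus)
  show "m \<in> gspan ?D (weyl_part n d)" if "m \<in> carrier ?D" for m
    using that by (induction m rule: weyl_induct_part[where d = d]) (auto intro: gspan.intros)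
  fix F :: "int set" and c :: "int \<Rightarrow> 'k weyl" and k
  assume "finite F" "\<And>k. k \<in> F \<Longrightarrow> c k \<in> weyl_part n d k" "finsum ?D c F = \<zero>\<^bsub>?D\<^esub>" "k \<in> F"
  then show "c k = \<zero>\<^bsub>?D\<^esub>"
  proof (induction F arbitrary: c k rule: finite_induct)
    case (insert j F)
    have cp: "c i \<in> weyl_part n d i" if "i \<in> insert j F" for i using insert.prems(1) that by blast
    then have cc: "c i \<in> carrier ?D" if "i \<in> insert j F" for i using that weyl_part_carrier by blast
    let ?a = "\<lambda>i. weyl_const n (of_int (i - j)) :: 'k weyl"
    let ?E = "euler n d :: 'k weyl"
    let ?C = "weyl_const n (- of_int j) :: 'k weyl"
    have ad: "?E \<otimes>\<^bsub>?D\<^esub> P \<oplus>\<^bsub>?D\<^esub> ?C \<otimes>\<^bsub>?D\<^esub> P \<oplus>\<^bsub>?D\<^esub> \<ominus>\<^bsub>?D\<^esub> (P \<otimes>\<^bsub>?D\<^esub> ?E) = ?a i \<otimes>\<^bsub>?D\<^esub> P"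
      if "P \<in> weyl_part n d i" for P i
    proof -
      note P = weyl_part_carrier[OF that] euler_closed weyl_const_closed
      have a: "?a i = weyl_const n (of_int i) \<oplus>\<^bsub>?D\<^esub> ?C" by (simp flip: weyl_const_add)
      have "?E \<otimes>\<^bsub>?D\<^esub> P \<oplus>\<^bsub>?D\<^esub> ?C \<otimes>\<^bsub>?D\<^esub> P \<oplus>\<^bsub>?D\<^esub> \<ominus>\<^bsub>?D\<^esub> (P \<otimes>\<^bsub>?D\<^esub> ?E)
        = P \<otimes>\<^bsub>?D\<^esub> ?E \<oplus>\<^bsub>?D\<^esub> ((weyl_const n (of_int i) \<otimes>\<^bsub>?D\<^esub> P \<oplus>\<^bsub>?D\<^esub> ?C \<otimes>\<^bsub>?D\<^esub> P) \<oplus>\<^bsub>?D\<^esub> \<ominus>\<^bsub>?D\<^esub> (P \<otimes>\<^bsub>?D\<^esub> ?E))"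
        unfolding euler_comm[OF that] by (simp add: P a_assoc)
      also have "\<dots> = weyl_const n (of_int i) \<otimes>\<^bsub>?D\<^esub> P \<oplus>\<^bsub>?D\<^esub> ?C \<otimes>\<^bsub>?D\<^esub> P"
        by (rule add_cancel_conj) (simp_all add: P)
      finally show ?thesis by (simp add: P l_distr a del: of_int_diff)
    qed
    let ?ad = "\<lambda>P. ?E \<otimes>\<^bsub>?D\<^esub> P \<oplus>\<^bsub>?D\<^esub> ?C \<otimes>\<^bsub>?D\<^esub> P \<oplus>\<^bsub>?D\<^esub> \<ominus>\<^bsub>?D\<^esub> (P \<otimes>\<^bsub>?D\<^esub> ?E)"
    have ad_add: "?ad (P \<oplus>\<^bsub>?D\<^esub> Q) = ?ad P \<oplus>\<^bsub>?D\<^esub> ?ad Q" if "P \<in> carrier ?D" "Q \<in> carrier ?D" for P Q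
      using that by (simp add: euler_closed weyl_const_closed r_distr l_distr minus_add a_ac)
    have ad_sum: "?ad (finsum ?D c A) = finsum ?D (\<lambda>i. ?a i \<otimes>\<^bsub>?D\<^esub> c i) A" if "finite A" "A \<subseteq> insert j F" for A
      using that
    proof (induction A rule: finite_induct)
      case empty
      then show ?case by (simp add: euler_closed weyl_const_closed)
    next
      case (insert i A)
      have "c \<in> A \<rightarrow> carrier ?D" "c i \<in> carrier ?D" using insert.prems cc by auto
      moreover have "(\<lambda>i. ?a i \<otimes>\<^bsub>?D\<^esub> c i) \<in> A \<rightarrow> carrier ?D"
        using insert.prems cc by (auto simp: weyl_const_closed)
      moreover have "c i \<in> weyl_part n d i" using insert.prems cp by auto
      ultimately show ?case
        using insert.hyps insert.IH insert.prems ad_add[of "c i" "finsum ?D c A"] ad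
        by (simp add: weyl_const_closed)
    qed
    have "finsum ?D (\<lambda>i. ?a i \<otimes>\<^bsub>?D\<^esub> c i) (insert j F) = \<zero>\<^bsub>?D\<^esub>"
      using ad_sum[of "insert j F"] insert.hyps insert.prems(2)
      by (simp add: euler_closed weyl_const_closed)
    then have "finsum ?D (\<lambda>i. ?a i \<otimes>\<^bsub>?D\<^esub> c i) F = \<zero>\<^bsub>?D\<^esub>"
      using insert.hyps cc by (simp add: weyl_const_closed weyl_const_0 Pi_def)
    then have z: "?a i \<otimes>\<^bsub>?D\<^esub> c i = \<zero>\<^bsub>?D\<^esub>" if "i \<in> F" for i
      using insert.IH[of "\<lambda>i. ?a i \<otimes>\<^bsub>?D\<^esub> c i" i] that cp
        weyl_part_mult[OF weyl_part_const, of "c _" n d] by force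
    have cz: "c i = \<zero>\<^bsub>?D\<^esub>" if "i \<in> F" for i
    proof -
      have "of_int (i - j) \<noteq> (0 :: 'k)" using that insert.hyps by (metis eq_iff_diff_eq_0 of_int_eq_0_iff)
      then have "c i = weyl_const n (inverse (of_int (i - j))) \<otimes>\<^bsub>?D\<^esub> ?a i \<otimes>\<^bsub>?D\<^esub> c i"
        using cc[of i] that by (simp add: weyl_const_inverse del: of_int_diff)
      also have "\<dots> = \<zero>\<^bsub>?D\<^esub>" using cc z[OF that] that by (simp add: m_assoc weyl_const_closed)
      finally show ?thesis .
    qed
    then have "finsum ?D c F = \<zero>\<^bsub>?D\<^esub>" by (simp add: add.finprod_one_eqI)
    then have "c j = \<zero>\<^bsub>?D\<^esub>" using insert.prems(2) insert.hyps cc by (simp add: Pi_def)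
    then show ?case using cz insert.prems(3) by blast
  qed simp
qed

section \<open>Modules over the Weyl algebra\<close>

context left_module
begin

lemma smult_l_null [simp]: "x \<in> carrier M \<Longrightarrow> \<zero> \<odot>\<^bsub>M\<^esub> x = \<zero>\<^bsub>M\<^esub>"
  by (metis R.l_zero R.zero_closed M.add.l_cancel_one' smult_closed smult_l_distr)

lemma smult_r_null [simp]: "a \<in> carrier R \<Longrightarrow> a \<odot>\<^bsub>M\<^esub> \<zero>\<^bsub>M\<^esub> = \<zero>\<^bsub>M\<^esub>"
  by (metis M.l_zero M.zero_closed M.add.l_cancel_one' smult_closed smult_r_distr)

lemma smult_r_minus: "\<lbrakk>a \<in> carrier R; x \<in> carrier M\<rbrakk> \<Longrightarrow> a \<odot>\<^bsub>M\<^esub> (\<ominus>\<^bsub>M\<^esub> x) = \<ominus>\<^bsub>M\<^esub> (a \<odot>\<^bsub>M\<^esub> x)"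
  by (metis M.a_inv_closed M.l_neg M.minus_equality smult_closed smult_r_distr smult_r_null)

lemma smult_l_minus: "\<lbrakk>a \<in> carrier R; x \<in> carrier M\<rbrakk> \<Longrightarrow> (\<ominus> a) \<odot>\<^bsub>M\<^esub> x = \<ominus>\<^bsub>M\<^esub> (a \<odot>\<^bsub>M\<^esub> x)"
  by (metis R.a_inv_closed R.l_neg M.minus_equality smult_closed smult_l_distr smult_l_null)

lemma smult_finsum:
  assumes "a \<in> carrier R" "f \<in> A \<rightarrow> carrier M"
  shows "a \<odot>\<^bsub>M\<^esub> finsum M f A = finsum M (\<lambda>i. a \<odot>\<^bsub>M\<^esub> f i) A"
  using assms(2)
proof (induction A rule: infinite_finite_induct)
  case (infinite A)
  then show ?case using assms by (simp add: M.finsum_infinite)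
next
  case (insert x F)
  then have "f \<in> F \<rightarrow> carrier M" "f x \<in> carrier M" by auto
  moreover have "(\<lambda>i. a \<odot>\<^bsub>M\<^esub> f i) \<in> F \<rightarrow> carrier M" using calculation assms by auto
  ultimately show ?case using insert assms by (simp add: smult_r_distr)
qed (use assms in simp)

end

lemma submodule_facts:
  assumes "left_module R M" "submodule H R M"
  shows "H \<subseteq> carrier M" "\<zero>\<^bsub>M\<^esub> \<in> H" "\<And>x y. \<lbrakk>x \<in> H; y \<in> H\<rbrakk> \<Longrightarrow> x \<oplus>\<^bsub>M\<^esub> y \<in> H"
    "\<And>x. x \<in> H \<Longrightarrow> \<ominus>\<^bsub>M\<^esub> x \<in> H" "\<And>r x. \<lbrakk>r \<in> carrier R; x \<in> H\<rbrakk> \<Longrightarrow> r \<odot>\<^bsub>M\<^esub> x \<in> H"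
    "abelian_subgroup H M"
proof -
  interpret left_module R M by fact
  interpret H: submodule H R M by fact
  interpret additive_subgroup H M by (rule additive_subgroup.intro) (rule H.subgroup_axioms)
  show "H \<subseteq> carrier M" "\<zero>\<^bsub>M\<^esub> \<in> H" "\<And>x y. \<lbrakk>x \<in> H; y \<in> H\<rbrakk> \<Longrightarrow> x \<oplus>\<^bsub>M\<^esub> y \<in> H"
    "\<And>x. x \<in> H \<Longrightarrow> \<ominus>\<^bsub>M\<^esub> x \<in> H" "\<And>r x. \<lbrakk>r \<in> carrier R; x \<in> H\<rbrakk> \<Longrightarrow> r \<odot>\<^bsub>M\<^esub> x \<in> H"
    using a_subset by auto
  show "abelian_subgroup H M"
    by (intro abelian_subgroupI3 is_additive_subgroup M.abelian_group_axioms)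
qed

lemma submoduleI':
  assumes "left_module (weyl n :: 'k::field weyl ring) M" "H \<subseteq> carrier M" "\<zero>\<^bsub>M\<^esub> \<in> H"
    and "\<And>x y. \<lbrakk>x \<in> H; y \<in> H\<rbrakk> \<Longrightarrow> x \<oplus>\<^bsub>M\<^esub> y \<in> H"
    and s: "\<And>r x. \<lbrakk>r \<in> carrier (weyl n); x \<in> H\<rbrakk> \<Longrightarrow> r \<odot>\<^bsub>M\<^esub> x \<in> H"
  shows "submodule H (weyl n) M"
proof -
  interpret left_module "weyl n" M by fact
  have "\<ominus>\<^bsub>M\<^esub> x = weyl_const n (- 1) \<odot>\<^bsub>M\<^esub> x" if "x \<in> carrier M" for x
    using that smult_l_minus[OF R.one_closed that] weyl_minus_eq[OF R.one_closed]
    by (simp add: weyl_const_closed)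
  then have "\<ominus>\<^bsub>M\<^esub> x \<in> H" if "x \<in> H" for x
    using that assms(2) s[OF weyl_const_closed] by auto
  then have "additive_subgroup H M"
    using assms by (intro additive_subgroupI' M.abelian_group_axioms)
  then show ?thesis using s by (intro submodule.intro submodule_axioms.intro) (auto simp: additive_subgroup_def)
qed

lemma left_module_restrict:
  assumes "left_module R M" "submodule H R M"
  shows "left_module R (M\<lparr>carrier := H\<rparr>)"
proof -
  interpret left_module R M by fact
  note H = submodule_facts[OF assms]
  show ?thesis
  proof (intro left_module.intro left_module_axioms.intro R.ring_axioms)
    show "abelian_group (M\<lparr>carrier := H\<rparr>)"
    proof (rule abelian_groupI, goal_cases)
      case (6 x)
      then show ?case using H(1) H(4)[of x] by (auto intro!: bexI[of _ "\<ominus>\<^bsub>M\<^esub> x"] simp: M.l_neg subset_iff)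
    qed (use H in \<open>auto simp: subset_iff M.a_assoc intro: M.a_comm\<close>)
  qed (use H in \<open>auto simp: subset_iff smult_l_distr smult_r_distr smult_assoc1\<close>)
qed

lemma quot_mod_simps:
  "carrier (quot_mod M H) = a_rcosets\<^bsub>M\<^esub> H" "\<zero>\<^bsub>quot_mod M H\<^esub> = H"
  "add (quot_mod M H) = set_add M"
  "r \<odot>\<^bsub>quot_mod M H\<^esub> S = (\<Union>s\<in>S. H +>\<^bsub>M\<^esub> (r \<odot>\<^bsub>M\<^esub> s))"
  by (simp_all add: quot_mod_def)

lemma coset_cases:
  assumes "S \<in> a_rcosets\<^bsub>M\<^esub> H"
  obtains x where "x \<in> carrier M" "S = H +>\<^bsub>M\<^esub> x"
  using assms by (auto simp: A_RCOSETS_def')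

text \<open>The action on a quotient is defined as a union over all representatives; since
  \<open>H\<close> is stable under \<open>r\<close>, each representative contributes the same
  coset.\<close>

lemma quot_smult:
  assumes "left_module R M" "submodule H R M" "r \<in> carrier R" "x \<in> carrier M"
  shows "r \<odot>\<^bsub>quot_mod M H\<^esub> (H +>\<^bsub>M\<^esub> x) = H +>\<^bsub>M\<^esub> (r \<odot>\<^bsub>M\<^esub> x)"
proof -
  interpret left_module R M by fact
  note H = submodule_facts[OF assms(1,2)]
  interpret abelian_subgroup H M by (rule H(6))
  have "H +>\<^bsub>M\<^esub> (r \<odot>\<^bsub>M\<^esub> s) = H +>\<^bsub>M\<^esub> (r \<odot>\<^bsub>M\<^esub> x)" if s: "s \<in> H +>\<^bsub>M\<^esub> x" for s
  proof -
    obtain h where h: "h \<in> H" "s = h \<oplus>\<^bsub>M\<^esub> x" using s by (auto simp: a_r_coset_def')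
    then have "r \<odot>\<^bsub>M\<^esub> s = r \<odot>\<^bsub>M\<^esub> h \<oplus>\<^bsub>M\<^esub> r \<odot>\<^bsub>M\<^esub> x"
      using H(1) assms by (auto simp: smult_r_distr)
    then have "r \<odot>\<^bsub>M\<^esub> s \<in> H +>\<^bsub>M\<^esub> (r \<odot>\<^bsub>M\<^esub> x)"
      using H(5)[OF assms(3) h(1)] by (auto simp: a_r_coset_def')
    then show ?thesis using M.a_repr_independence[OF _ _ a_subgroup] assms(3,4) by auto
  qed
  moreover have "x \<in> H +>\<^bsub>M\<^esub> x" by (rule a_rcos_self[OF assms(4)])
  ultimately show ?thesis unfolding quot_mod_simps by blast
qed

lemma left_module_quot:
  assumes "left_module R M" "submodule H R M"
  shows "left_module R (quot_mod M H)"
proof -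
  interpret left_module R M by fact
  note H = submodule_facts[OF assms]
  interpret abelian_subgroup H M by (rule H(6))
  show ?thesis
  proof (intro left_module.intro left_module_axioms.intro R.ring_axioms)
    show "abelian_group (quot_mod M H)"
    proof (rule abelian_groupI, goal_cases)
      case (6 S)
      then obtain x where x: "x \<in> carrier M" "S = H +>\<^bsub>M\<^esub> x" by (auto simp: quot_mod_simps elim: coset_cases)
      then have "(H +>\<^bsub>M\<^esub> \<ominus>\<^bsub>M\<^esub> x) <+>\<^bsub>M\<^esub> S = H" by (simp add: a_rcos_sum M.l_neg H(1))
      then show ?case using x by (auto simp: quot_mod_simps intro!: bexI[of _ "H +>\<^bsub>M\<^esub> \<ominus>\<^bsub>M\<^esub> x"] a_rcosetsI H(1))
    next
      case 2
      have "H +>\<^bsub>M\<^esub> \<zero>\<^bsub>M\<^esub> = H" by (simp add: H(1))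
      then show ?case using a_rcosetsI[OF H(1) M.zero_closed] by (simp add: quot_mod_simps)
    next
      case (5 S)
      then obtain x where x: "x \<in> carrier M" "S = H +>\<^bsub>M\<^esub> x" by (auto simp: quot_mod_simps elim: coset_cases)
      have "(H +>\<^bsub>M\<^esub> \<zero>\<^bsub>M\<^esub>) <+>\<^bsub>M\<^esub> (H +>\<^bsub>M\<^esub> x) = H +>\<^bsub>M\<^esub> x" using x by (simp add: a_rcos_sum del: a_coset_add_zero)
      then show ?case using x by (simp add: H(1) quot_mod_simps)
    next
      case (4 S T)
      then show ?case by (auto simp only: quot_mod_simps a_rcos_sum M.a_comm elim!: coset_cases)
    qed (auto simp: quot_mod_simps a_rcos_sum M.a_assoc elim!: coset_cases intro!: a_rcosetsI H(1))
  qed (auto simp: quot_mod_simps(1,3) quot_smult[OF assms] a_rcos_sum smult_l_distr smult_r_distr smult_assoc1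
      elim!: coset_cases intro!: a_rcosetsI H(1))
qed

section \<open>Weights\<close>

abbreviation eig :: "nat \<Rightarrow> (nat \<Rightarrow> nat) \<Rightarrow> ('k::field_char_0, 'u) dmod \<Rightarrow> int \<Rightarrow> 'u set" where
  "eig n d M k \<equiv> eigenspace n d M (of_int k)"

abbreviation wt :: "nat \<Rightarrow> (nat \<Rightarrow> nat) \<Rightarrow> ('k::field_char_0, 'u) dmod \<Rightarrow> 'u \<Rightarrow> int \<Rightarrow> 'u" where
  "wt n d M \<equiv> gcomp M (eig n d M)"

lemma eig_iff: "m \<in> eigenspace n d M \<mu> \<longleftrightarrow> m \<in> carrier M \<and> euler n d \<odot>\<^bsub>M\<^esub> m = weyl_const n \<mu> \<odot>\<^bsub>M\<^esub> m"
  by (simp add: eigenspace_def)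

lemma const_smult_comm:
  assumes "left_module (weyl n) M" "r \<in> carrier (weyl n :: 'k::field weyl ring)" "x \<in> carrier M"
  shows "r \<odot>\<^bsub>M\<^esub> (weyl_const n c \<odot>\<^bsub>M\<^esub> x) = weyl_const n c \<odot>\<^bsub>M\<^esub> (r \<odot>\<^bsub>M\<^esub> x)"
proof -
  interpret left_module "weyl n" M by fact
  show ?thesis using assms(2,3) weyl_const_comm[OF assms(2), of c]
    by (simp add: weyl_const_closed flip: smult_assoc1)
qed

lemma const_smult_cancel:
  assumes "left_module (weyl n) M" "x \<in> carrier M" "c \<noteq> 0" "weyl_const n (c :: 'k::field) \<odot>\<^bsub>M\<^esub> x = \<zero>\<^bsub>M\<^esub>"
  shows "x = \<zero>\<^bsub>M\<^esub>"
proof -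
  interpret left_module "weyl n" M by fact
  have "x = (weyl_const n (inverse c) \<otimes>\<^bsub>weyl n\<^esub> weyl_const n c) \<odot>\<^bsub>M\<^esub> x"
    using assms(2,3) by (simp add: weyl_const_inverse)
  also have "\<dots> = \<zero>\<^bsub>M\<^esub>" using assms(2,4) by (simp add: smult_assoc1 weyl_const_closed)
  finally show ?thesis .
qed

lemma eig_subgroup:
  assumes "left_module (weyl n) M"
  shows "additive_subgroup (eigenspace n d M (\<mu> :: 'k::field)) M"
proof -
  interpret left_module "weyl n" M by fact
  show ?thesis
    by (rule additive_subgroupI'[OF M.abelian_group_axioms])
      (auto simp: eig_iff euler_closed weyl_const_closed smult_r_distr smult_r_minus)
qed

text \<open>This is the relation E P = P E + q P applied to a vector of weight k.\<close>

lemma eig_part: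
  assumes "left_module (weyl n) M" "P \<in> weyl_part n d q" "m \<in> eig n d M k"
  shows "P \<odot>\<^bsub>M\<^esub> m \<in> eig n d M (q + k)"
proof -
  interpret left_module "weyl n" M by fact
  have P: "P \<in> carrier (weyl n)" by (rule weyl_part_carrier[OF assms(2)])
  have m: "m \<in> carrier M" "euler n d \<odot>\<^bsub>M\<^esub> m = weyl_const n (of_int k) \<odot>\<^bsub>M\<^esub> m"
    using assms(3) by (auto simp: eig_iff)
  have "euler n d \<odot>\<^bsub>M\<^esub> (P \<odot>\<^bsub>M\<^esub> m) = (euler n d \<otimes>\<^bsub>weyl n\<^esub> P) \<odot>\<^bsub>M\<^esub> m"
    using P m(1) by (simp add: smult_assoc1 euler_closed)
  also have "\<dots> = P \<odot>\<^bsub>M\<^esub> (weyl_const n (of_int k) \<odot>\<^bsub>M\<^esub> m) \<oplus>\<^bsub>M\<^esub> weyl_const n (of_int q) \<odot>\<^bsub>M\<^esub> (P \<odot>\<^bsub>M\<^esub> m)"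
    unfolding euler_comm[OF assms(2)]
    using P m by (simp add: smult_l_distr smult_assoc1 euler_closed weyl_const_closed)
  also have "P \<odot>\<^bsub>M\<^esub> (weyl_const n (of_int k) \<odot>\<^bsub>M\<^esub> m) = weyl_const n (of_int k) \<odot>\<^bsub>M\<^esub> (P \<odot>\<^bsub>M\<^esub> m)"
    by (rule const_smult_comm[OF assms(1) P m(1)])
  also have "\<dots> \<oplus>\<^bsub>M\<^esub> weyl_const n (of_int q) \<odot>\<^bsub>M\<^esub> (P \<odot>\<^bsub>M\<^esub> m) = weyl_const n (of_int (q + k)) \<odot>\<^bsub>M\<^esub> (P \<odot>\<^bsub>M\<^esub> m)"
    using P m(1) by (simp add: weyl_const_add smult_l_distr weyl_const_closed M.a_comm)
  finally show ?thesis using P m(1) by (simp add: eig_iff)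
qed

text \<open>A polynomial in \<open>\<^bold>E\<close> that is \<open>1\<close> at \<open>k\<close> and vanishes on the list. It picks out weight
  components, so submodules, relations and homomorphisms are automatically homogeneous.\<close>

primrec wproj :: "nat \<Rightarrow> (nat \<Rightarrow> nat) \<Rightarrow> int \<Rightarrow> int list \<Rightarrow> 'k::field_char_0 weyl" where
  "wproj n d k [] = \<one>\<^bsub>weyl n\<^esub>"
| "wproj n d k (j # js) = wproj n d k js \<otimes>\<^bsub>weyl n\<^esub> (weyl_const n (inverse (of_int (k - j))) \<otimes>\<^bsub>weyl n\<^esub>
     (euler n d \<oplus>\<^bsub>weyl n\<^esub> weyl_const n (- of_int j)))"

lemma wproj_closed: "wproj n d k js \<in> carrier (weyl n :: 'k::field_char_0 weyl ring)"
proof -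
  interpret ring "weyl n :: 'k weyl ring" by (rule ring_weyl)
  show ?thesis by (induction js) (auto simp: weyl_const_closed euler_closed)
qed

text \<open>The factor for j acts on weight i by (i - j) / (k - j): it vanishes for i = j and is 1
  for i = k.\<close>

lemma wproj_eig:
  assumes "left_module (weyl n) (M :: ('k::field_char_0, 'u) dmod)" "m \<in> eig n d M i" "k \<notin> set js" "i = k \<or> i \<in> set js"
  shows "wproj n d k js \<odot>\<^bsub>M\<^esub> m = (if i = k then m else \<zero>\<^bsub>M\<^esub>)"
  using assms(2-4)
proof -
  interpret left_module "weyl n" M by fact
  have m: "m \<in> carrier M" "euler n d \<odot>\<^bsub>M\<^esub> m = weyl_const n (of_int i) \<odot>\<^bsub>M\<^esub> m"
    using assms(2) by (auto simp: eig_iff)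
  have step: "wproj n d k (j # js) \<odot>\<^bsub>M\<^esub> m = weyl_const n (of_int (i - j) / of_int (k - j)) \<odot>\<^bsub>M\<^esub> (wproj n d k js \<odot>\<^bsub>M\<^esub> m)"
    for j js
  proof -
    have "(euler n d \<oplus>\<^bsub>weyl n\<^esub> weyl_const n (- of_int j)) \<odot>\<^bsub>M\<^esub> m = weyl_const n (of_int (i - j)) \<odot>\<^bsub>M\<^esub> m"
      using m by (simp add: smult_l_distr euler_closed weyl_const_closed flip: weyl_const_add)
        (simp add: weyl_const_closed flip: smult_l_distr weyl_const_add)
    moreover have "weyl_const n (inverse (of_int (k - j))) \<odot>\<^bsub>M\<^esub> (weyl_const n (of_int (i - j)) \<odot>\<^bsub>M\<^esub> m)
        = weyl_const n (of_int (i - j) / of_int (k - j)) \<odot>\<^bsub>M\<^esub> m"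
      using m by (simp add: divide_inverse mult.commute weyl_const_closed flip: smult_assoc1 weyl_const_mult)
    ultimately have "wproj n d k (j # js) \<odot>\<^bsub>M\<^esub> m = wproj n d k js \<odot>\<^bsub>M\<^esub> (weyl_const n (of_int (i - j) / of_int (k - j)) \<odot>\<^bsub>M\<^esub> m)"
      using m by (simp add: smult_assoc1 euler_closed weyl_const_closed wproj_closed)
    then show ?thesis using const_smult_comm[OF assms(1) wproj_closed m(1)] by simp
  qed
  show ?thesis using assms(3,4)
  proof (induction js)
    case Nil
    then show ?case using m by simp
  next
    case (Cons j js)
    show ?case
    proof (cases "i = j")
      case True
      then show ?thesis using m Cons.prems unfolding step
        by (simp add: weyl_const_0 wproj_closed)
    next
      case False
      then have IH: "wproj n d k js \<odot>\<^bsub>M\<^esub> m = (if i = k then m else \<zero>\<^bsub>M\<^esub>)" using Cons by auto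
      have "of_int (k - j) \<noteq> (0 :: 'k)" using Cons.prems by (metis diff_eq_eq add_0 list.set_intros(1) of_int_eq_0_iff)
      then show ?thesis using m unfolding step IH
        by (auto simp: weyl_const_closed weyl_const_1 simp del: of_int_diff)
    qed
  qed
qed

text \<open>Applying \<open>wproj\<close> to a relation between eigenvectors isolates a single term,
  so independence is automatic and only spanning remains as a condition.\<close>

lemma graded_eig:
  assumes "left_module (weyl n) M" "\<And>m. m \<in> carrier M \<Longrightarrow> m \<in> gspan M (eig n d M)"
  shows "graded_group M (eig n d (M :: ('k::field_char_0, 'u) dmod))"
proof (rule graded_groupI)
  interpret left_module "weyl n" M by fact
  show "abelian_group M" by (rule M.abelian_group_axioms)
  show "additive_subgroup (eig n d M k) M" for k by (rule eig_subgroup[OF assms(1)])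
  fix F :: "int set" and c k
  assume F: "finite F" and c: "\<And>k. k \<in> F \<Longrightarrow> c k \<in> eig n d M k" and sum: "finsum M c F = \<zero>\<^bsub>M\<^esub>" and k: "k \<in> F"
  obtain js where js: "set js = F - {k}" using finite_list[OF finite_Diff[OF F]] by blast
  have cc: "c i \<in> carrier M" if "i \<in> F" for i using c[OF that] by (simp add: eig_iff)
  have "\<zero>\<^bsub>M\<^esub> = wproj n d k js \<odot>\<^bsub>M\<^esub> finsum M c F" by (simp add: sum wproj_closed)
  also have "\<dots> = finsum M (\<lambda>i. wproj n d k js \<odot>\<^bsub>M\<^esub> c i) F" using cc by (intro smult_finsum wproj_closed) auto
  also have "\<dots> = finsum M (\<lambda>i. if k = i then c i else \<zero>\<^bsub>M\<^esub>) F"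
    using cc js c wproj_closed by (intro M.finsum_cong') (auto simp: wproj_eig[OF assms(1) c])
  also have "\<dots> = c k" using F k cc by (intro M.finsum_singleton) auto
  finally show "c k = \<zero>\<^bsub>M\<^esub>" by simp
qed (rule assms(2))

lemma euler0_iff_graded:
  "euler0 n d M \<longleftrightarrow> left_module (weyl n) M \<and> graded_group M (eig n d (M :: ('k::field_char_0, 'u) dmod))"
proof -
  have "euler0 n d M \<longleftrightarrow> left_module (weyl n) M \<and> (\<forall>m\<in>carrier M. \<exists>!c. decomposes M (eig n d M) m c)"
    unfolding euler0_def decomposes_def by simp
  moreover have "graded_group M (eig n d M) \<longleftrightarrow> (\<forall>m\<in>carrier M. \<exists>!c. decomposes M (eig n d M) m c)"
    if "left_module (weyl n) M"
    using eig_subgroup[OF that] that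
    unfolding graded_group_def graded_group_axioms_def left_module_def by blast
  ultimately show ?thesis by blast
qed

lemma euler0I:
  assumes "left_module (weyl n) M" "\<And>m. m \<in> carrier M \<Longrightarrow> m \<in> gspan M (eig n d M)"
  shows "euler0 n d (M :: ('k::field_char_0, 'u) dmod)"
  using graded_eig[OF assms] assms(1) by (simp add: euler0_iff_graded)

lemma euler0D:
  assumes "euler0 n d (M :: ('k::field_char_0, 'u) dmod)"
  shows "left_module (weyl n) M" "graded_group M (eig n d M)"
  using assms by (auto simp: euler0_iff_graded)

text \<open>The projector to weight i that vanishes on weight j both fixes and kills
  \<open>m\<close>.\<close>

lemma eig_disjoint:
  assumes M: "left_module (weyl n) M" and m: "m \<in> eig n d M i" "m \<in> eig n d M j" "i \<noteq> j"
  shows "m = \<zero>\<^bsub>(M :: ('k::field_char_0, 'u) dmod)\<^esub>"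
  using wproj_eig[OF M m(1), of i "[j]"] wproj_eig[OF M m(2), of i "[j]"] m(3) by simp

lemma wt_smult:
  assumes "euler0 n d (M :: ('k::field_char_0, 'u) dmod)" "P \<in> weyl_part n d q" "m \<in> carrier M"
  shows "wt n d M (P \<odot>\<^bsub>M\<^esub> m) (q + k) = P \<odot>\<^bsub>M\<^esub> wt n d M m k"
proof -
  interpret left_module "weyl n" M by (rule euler0D[OF assms(1)])
  note P = weyl_part_carrier[OF assms(2)]
  show ?thesis
    using euler0D[OF assms(1)] assms(3) P eig_part[OF euler0D(1)[OF assms(1)] assms(2)]
    by (intro gcomp_map) (auto simp: smult_r_distr)
qed

lemma wt_proj:
  assumes "euler0 n d (M :: ('k::field_char_0, 'u) dmod)" "m \<in> carrier M"
    and "finite F" "{i. wt n d M m i \<noteq> \<zero>\<^bsub>M\<^esub>} \<subseteq> F" "set js = F - {k}"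
  shows "wproj n d k js \<odot>\<^bsub>M\<^esub> m = wt n d M m k"
proof -
  interpret left_module "weyl n" M by (rule euler0D[OF assms(1)])
  interpret graded_group M "eig n d M" by (rule euler0D[OF assms(1)])
  let ?F = "insert k F"
  have "m = finsum M (wt n d M m) ?F"
    using assms decomposes_gcomp[OF assms(2)] gcomp_in[OF assms(2)]
    by (intro decomposes_iff[THEN iffD1]) auto
  then have "wproj n d k js \<odot>\<^bsub>M\<^esub> m = wproj n d k js \<odot>\<^bsub>M\<^esub> finsum M (wt n d M m) ?F" by simp
  also have "\<dots> = finsum M (\<lambda>i. wproj n d k js \<odot>\<^bsub>M\<^esub> wt n d M m i) ?F"
    using gcomp_carrier[OF assms(2)] by (intro smult_finsum wproj_closed) auto
  also have "\<dots> = finsum M (\<lambda>i. if k = i then wt n d M m i else \<zero>\<^bsub>M\<^esub>) ?F"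
    using assms gcomp_carrier[OF assms(2)]
    by (intro M.finsum_cong') (auto simp: wproj_eig[OF euler0D(1)[OF assms(1)] gcomp_in[OF assms(2)]])
  also have "\<dots> = wt n d M m k"
    using assms gcomp_carrier[OF assms(2)] by (intro M.finsum_singleton) auto
  finally show ?thesis .
qed

text \<open>One operator extracts the components of weight k from two vectors in two modules at
  once, because its list of weights covers both supports. Submodules of a product thereby contain
  the weight components of their elements.\<close>

lemma wt_proj_ex:
  assumes "euler0 n d (M :: ('k::field_char_0, 'u) dmod)" "m \<in> carrier M"
    and "euler0 n d (N :: ('k, 'v) dmod)" "y \<in> carrier N"
  obtains P where "P \<in> carrier (weyl n)" "P \<odot>\<^bsub>M\<^esub> m = wt n d M m k" "P \<odot>\<^bsub>N\<^esub> y = wt n d N y k"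
proof -
  let ?F = "{i. wt n d M m i \<noteq> \<zero>\<^bsub>M\<^esub>} \<union> {i. wt n d N y i \<noteq> \<zero>\<^bsub>N\<^esub>}"
  have fin: "finite ?F"
    using graded_group.finite_gcomp[OF euler0D(2)[OF assms(1)] assms(2)]
      graded_group.finite_gcomp[OF euler0D(2)[OF assms(3)] assms(4)] by simp
  obtain js where js: "set js = ?F - {k}" using finite_list[OF finite_Diff[OF fin]] by blast
  show thesis
    using wt_proj[OF assms(1,2) fin _ js] wt_proj[OF assms(3,4) fin _ js] by (intro that[OF wproj_closed]) auto
qed

lemma wt_submodule:
  assumes "euler0 n d (M :: ('k::field_char_0, 'u) dmod)" "submodule H (weyl n) M" "m \<in> H"
  shows "wt n d M m k \<in> H"
proof -
  note H = submodule_facts[OF euler0D(1)[OF assms(1)] assms(2)]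
  have "m \<in> carrier M" using H(1) assms(3) by blast
  then obtain P where "P \<in> carrier (weyl n)" "P \<odot>\<^bsub>M\<^esub> m = wt n d M m k"
    using wt_proj_ex[OF assms(1) _ assms(1)] by metis
  then show ?thesis using H(5)[of P m] assms(3) by simp
qed

lemma restrict_mod_simps [simp]:
  "carrier (M\<lparr>carrier := H\<rparr>) = H" "add (M\<lparr>carrier := H\<rparr>) = add M"
  "zero (M\<lparr>carrier := H\<rparr>) = zero M" "smult (M\<lparr>carrier := H\<rparr>) = smult M"
  for M :: "('a, 'b) module"
  by simp_all

lemma eig_restrict:
  assumes "H \<subseteq> carrier M"
  shows "eigenspace n d (M\<lparr>carrier := H\<rparr>) \<mu> = eigenspace n d M \<mu> \<inter> H"
  using assms by (auto simp: eig_iff)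

lemma gspan_restrict:
  assumes "left_module (weyl n) M" "submodule H (weyl n) M"
    and "m \<in> carrier M" "finite {k. c k \<noteq> \<zero>\<^bsub>M\<^esub>}" "\<And>k. c k \<in> V k \<inter> H" "m = (\<Oplus>\<^bsub>M\<^esub>k\<in>{k. c k \<noteq> \<zero>\<^bsub>M\<^esub>}. c k)"
  shows "m \<in> gspan (M\<lparr>carrier := H\<rparr> :: ('k::field, 'u) dmod) (\<lambda>k. V k \<inter> H)"
proof -
  note H = submodule_facts[OF assms(1,2)]
  interpret left_module "weyl n" M by fact
  let ?N = "M\<lparr>carrier := H\<rparr>"
  have "finsum M c {k. c k \<noteq> \<zero>\<^bsub>M\<^esub>} \<in> gspan ?N (\<lambda>k. V k \<inter> H) \<inter> H"
    using assms(4,5) H(1-3) gspan.zero[of ?N] gspan.add[of _ ?N]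
    by (intro finsum_closed_pred M.abelian_monoid_axioms) (auto intro: gspan.part)
  then show ?thesis using assms(6) by simp
qed

lemma euler0_restrict:
  assumes "euler0 n d (M :: ('k::field_char_0, 'u) dmod)" "submodule H (weyl n) M"
  shows "euler0 n d (M\<lparr>carrier := H\<rparr>)"
proof (rule euler0I)
  note M = euler0D[OF assms(1)]
  note H = submodule_facts[OF M(1) assms(2)]
  interpret graded_group M "eig n d M" by (rule M)
  show "left_module (weyl n) (M\<lparr>carrier := H\<rparr>)" by (rule left_module_restrict[OF M(1) assms(2)])
  fix m assume "m \<in> carrier (M\<lparr>carrier := H\<rparr>)"
  then have m: "m \<in> H" "m \<in> carrier M" using H(1) by auto
  have "m \<in> gspan (M\<lparr>carrier := H\<rparr>) (\<lambda>k. eig n d M k \<inter> H)"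
    using decomposes_gcomp[OF m(2)] wt_submodule[OF assms m(1)] m
    by (intro gspan_restrict[OF M(1) assms(2), where c = "wt n d M m"]) (auto simp: decomposes_def)
  then show "m \<in> gspan (M\<lparr>carrier := H\<rparr>) (eig n d (M\<lparr>carrier := H\<rparr>))"
    by (simp only: eig_restrict[OF H(1)])
qed

lemma eig_quot:
  assumes "left_module (weyl n) M" "submodule H (weyl n) M" "x \<in> eigenspace n d (M :: ('k::field, 'u) dmod) \<mu>"
  shows "H +>\<^bsub>M\<^esub> x \<in> eigenspace n d (quot_mod M H) \<mu>"
proof -
  note H = submodule_facts[OF assms(1,2)]
  interpret abelian_subgroup H M by (rule H(6))
  show ?thesis using assms(3)
    by (auto simp: eig_iff quot_smult[OF assms(1,2)] euler_closed weyl_const_closed quot_mod_simps(1) intro!: a_rcosetsI H(1))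
qed

lemma euler0_quot:
  assumes "euler0 n d (M :: ('k::field_char_0, 'u) dmod)" "submodule H (weyl n) M"
  shows "euler0 n d (quot_mod M H)"
proof (rule euler0I)
  note M = euler0D[OF assms(1)]
  note H = submodule_facts[OF M(1) assms(2)]
  interpret graded_group M "eig n d M" by (rule M)
  interpret abelian_subgroup H M by (rule H(6))
  let ?Q = "quot_mod M H"
  show "left_module (weyl n) ?Q" by (rule left_module_quot[OF M(1) assms(2)])
  have "H +>\<^bsub>M\<^esub> x \<in> gspan ?Q (eig n d ?Q)" if "x \<in> carrier M" for x
    using that
  proof (induction x rule: graded_induct)
    case zero
    then show ?case using gspan.zero[of ?Q] by (simp add: quot_mod_simps H(1))
  next
    case (part k v)
    then show ?case by (intro gspan.part[of _ _ k] eig_quot M(1) assms(2))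
  next
    case (add x y)
    then show ?case using gspan.add[OF add(3,4)] by (simp add: quot_mod_simps a_rcos_sum)
  qed
  then show "S \<in> gspan ?Q (eig n d ?Q)" if "S \<in> carrier ?Q" for S
    using that by (auto simp: quot_mod_simps elim!: coset_cases)
qed

text \<open>The projection respects weight components, so the component of weight k of any
  representative is again a representative.\<close>

lemma eig_quotE:
  assumes "euler0 n d (M :: ('k::field_char_0, 'u) dmod)" "submodule H (weyl n) M"
    and "S \<in> eig n d (quot_mod M H) k"
  obtains y where "y \<in> eig n d M k" "S = H +>\<^bsub>M\<^esub> y"
proof -
  note M = euler0D[OF assms(1)]
  note H = submodule_facts[OF M(1) assms(2)]
  interpret M: graded_group M "eig n d M" by (rule M)
  interpret abelian_subgroup H M by (rule H(6))
  interpret Q: graded_group "quot_mod M H" "eig n d (quot_mod M H)"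
    by (rule euler0D[OF euler0_quot[OF assms(1,2)]])
  obtain x where x: "x \<in> carrier M" "S = H +>\<^bsub>M\<^esub> x"
    using assms(3) by (auto simp: eig_iff quot_mod_simps elim: coset_cases)
  have "gcomp (quot_mod M H) (eig n d (quot_mod M H)) (H +>\<^bsub>M\<^esub> x) (0 + k) = H +>\<^bsub>M\<^esub> wt n d M x k"
    using x(1) eig_quot[OF M(1) assms(2)]
    by (intro gcomp_map M.graded_group_axioms Q.graded_group_axioms)
      (auto simp: quot_mod_simps a_rcos_sum intro!: M.a_rcosetsI H(1))
  then have "S = H +>\<^bsub>M\<^esub> wt n d M x k" using Q.gcomp_V[OF assms(3)] x(2) by simp
  then show thesis using that M.gcomp_in[OF x(1)] by blast
qed

section \<open>Torsion\<close>

text \<open>The vectors killed by all products of N of the x_i; the recursion lets degree arguments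
  peel off one factor at a time.\<close>

primrec xnil :: "nat \<Rightarrow> ('k::field, 'u) dmod \<Rightarrow> nat \<Rightarrow> 'u set" where
  "xnil n M 0 = {\<zero>\<^bsub>M\<^esub>}"
| "xnil n M (Suc N) = {m \<in> carrier M. \<forall>i\<le>n. weyl_x n i \<odot>\<^bsub>M\<^esub> m \<in> xnil n M N}"

lemma euler_smult:
  assumes "left_module (weyl n) M" "m \<in> carrier M"
  shows "euler n d \<odot>\<^bsub>M\<^esub> m = finsum M (\<lambda>i. weyl_const n (of_nat (d i) :: 'k::field) \<odot>\<^bsub>M\<^esub>
    (weyl_x n i \<odot>\<^bsub>M\<^esub> (weyl_d n i \<odot>\<^bsub>M\<^esub> m))) {..n}"
proof -
  interpret left_module "weyl n" M by fact
  have sum: "finsum (weyl n) f A \<odot>\<^bsub>M\<^esub> m = finsum M (\<lambda>i. f i \<odot>\<^bsub>M\<^esub> m) A"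
    if "finite A" "f \<in> A \<rightarrow> carrier (weyl n)" for f and A :: "nat set"
    using that
  proof (induction A rule: finite_induct)
    case (insert a A)
    then have "f \<in> A \<rightarrow> carrier (weyl n)" "f a \<in> carrier (weyl n)" "(\<lambda>i. f i \<odot>\<^bsub>M\<^esub> m) \<in> A \<rightarrow> carrier M"
      using assms(2) by auto
    then show ?case using insert assms(2) by (simp add: smult_l_distr)
  qed (use assms(2) in simp)
  show ?thesis
    unfolding euler_def using assms(2)
    by (subst sum) (auto simp: weyl_const_closed weyl_x_closed weyl_d_closed smult_assoc1 intro!: M.finsum_cong')
qed

lemma dx_smult:
  assumes "left_module (weyl n) M" "m \<in> carrier M" "i \<le> n" "j \<le> n"
  shows "weyl_d n i \<odot>\<^bsub>M\<^esub> (weyl_x n j \<odot>\<^bsub>M\<^esub> m) = weyl_x n j \<odot>\<^bsub>M\<^esub> (weyl_d n i \<odot>\<^bsub>M\<^esub> m)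
    \<oplus>\<^bsub>M\<^esub> (if i = j then m else \<zero>\<^bsub>(M :: ('k::field, 'u) dmod)\<^esub>)"
proof -
  interpret left_module "weyl n" M by fact
  note c = weyl_x_closed[OF assms(4)] weyl_d_closed[OF assms(3)] assms(2) weyl_const_closed
  have "weyl_d n i \<odot>\<^bsub>M\<^esub> (weyl_x n j \<odot>\<^bsub>M\<^esub> m) = (weyl_d n i \<otimes>\<^bsub>weyl n\<^esub> weyl_x n j) \<odot>\<^bsub>M\<^esub> m"
    by (simp add: c smult_assoc1)
  then show ?thesis
    unfolding weyl_dx[OF assms(3,4)]
    by (simp add: c smult_assoc1 smult_l_distr weyl_const_0 weyl_const_1)
qed

text \<open>Such an element has weight \<open>-\<Sum>\<^sub>i d\<^sub>i\<close>, since
  \<open>\<^bold>E = \<Sum>\<^sub>i d\<^sub>i (\<partial>\<^sub>i x\<^sub>i - 1)\<close>.\<close>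

lemma killed_by_x_weight:
  assumes M: "left_module (weyl n) (M :: ('k::field_char_0, 'u) dmod)" and m: "m \<in> eig n d M k"
    and "\<And>i. i \<le> n \<Longrightarrow> weyl_x n i \<odot>\<^bsub>M\<^esub> m = \<zero>\<^bsub>M\<^esub>" "k \<ge> 0" "0 < d 0"
  shows "m = \<zero>\<^bsub>M\<^esub>"
proof -
  interpret left_module "weyl n" M by fact
  have mc: "m \<in> carrier M" using m by (simp add: eig_iff)
  have xd: "weyl_x n i \<odot>\<^bsub>M\<^esub> (weyl_d n i \<odot>\<^bsub>M\<^esub> m) = weyl_const n (- 1) \<odot>\<^bsub>M\<^esub> m" if "i \<le> n" for i
  proof -
    have "weyl_x n i \<odot>\<^bsub>M\<^esub> (weyl_d n i \<odot>\<^bsub>M\<^esub> m) \<oplus>\<^bsub>M\<^esub> m = \<zero>\<^bsub>M\<^esub>"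
      using dx_smult[OF M mc that that] assms(3)[OF that] weyl_d_closed[OF that, where 'k = 'k] by simp
    moreover have "weyl_const n (- 1) \<odot>\<^bsub>M\<^esub> m \<oplus>\<^bsub>M\<^esub> m = (weyl_const n (- 1) \<oplus>\<^bsub>weyl n\<^esub> weyl_const n 1) \<odot>\<^bsub>M\<^esub> m"
      using mc by (simp add: smult_l_distr weyl_const_closed weyl_const_1)
    moreover have "\<dots> = \<zero>\<^bsub>M\<^esub>" using mc by (simp add: weyl_const_0 flip: weyl_const_add)
    ultimately have "weyl_x n i \<odot>\<^bsub>M\<^esub> (weyl_d n i \<odot>\<^bsub>M\<^esub> m) \<oplus>\<^bsub>M\<^esub> m = weyl_const n (- 1) \<odot>\<^bsub>M\<^esub> m \<oplus>\<^bsub>M\<^esub> m" by simp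
    then show ?thesis
      using mc weyl_x_closed[OF that] weyl_d_closed[OF that]
      by (subst (asm) M.add.right_cancel) (auto simp: weyl_const_closed)
  qed
  have csum: "finsum M (\<lambda>i. weyl_const n (f i) \<odot>\<^bsub>M\<^esub> m) A = weyl_const n (sum f A) \<odot>\<^bsub>M\<^esub> m"
    if "finite A" for f :: "nat \<Rightarrow> 'k" and A
    using that
  proof (induction A rule: finite_induct)
    case (insert a A)
    then show ?case using mc by (simp add: weyl_const_add smult_l_distr weyl_const_closed Pi_def)
  qed (use mc in \<open>simp add: weyl_const_0\<close>)
  have "euler n d \<odot>\<^bsub>M\<^esub> m = finsum M (\<lambda>i. weyl_const n (- of_nat (d i)) \<odot>\<^bsub>M\<^esub> m) {..n}"
    unfolding euler_smult[OF M mc]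
  proof (intro M.finsum_cong')
    fix i assume "i \<in> {..n}"
    then show "weyl_const n (of_nat (d i)) \<odot>\<^bsub>M\<^esub> (weyl_x n i \<odot>\<^bsub>M\<^esub> (weyl_d n i \<odot>\<^bsub>M\<^esub> m)) = weyl_const n (- of_nat (d i)) \<odot>\<^bsub>M\<^esub> m"
      using xd mc by (simp add: weyl_const_closed flip: smult_assoc1 weyl_const_mult)
  qed (use mc in \<open>auto simp: weyl_const_closed\<close>)
  also have "\<dots> = weyl_const n (\<Sum>i\<le>n. - of_nat (d i)) \<odot>\<^bsub>M\<^esub> m" by (rule csum) simp
  also have "(\<Sum>i\<le>n. - of_nat (d i)) = (of_int (- (\<Sum>i\<le>n. int (d i))) :: 'k)"
    by (simp add: sum_negf)
  finally have "m \<in> eig n d M (- (\<Sum>i\<le>n. int (d i)))" using mc by (simp add: eig_iff)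
  moreover have "- (\<Sum>i\<le>n. int (d i)) < 0"
  proof -
    have "int (d 0) \<le> (\<Sum>i\<le>n. int (d i))" by (rule member_le_sum) auto
    then show ?thesis using assms(5) by linarith
  qed
  ultimately show ?thesis using eig_disjoint[OF M m] assms(4) by fastforce
qed

text \<open>Multiplication by x_i raises the weight, so by induction all x_i m vanish, their weights
  still being nonnegative; then \<open>killed_by_x_weight\<close> applies to
  \<open>m\<close>.\<close>

lemma xnil_weight:
  assumes M: "left_module (weyl n) (M :: ('k::field_char_0, 'u) dmod)" and "0 < d 0"
    and "m \<in> eig n d M k" "m \<in> xnil n M N" "k \<ge> 0"
  shows "m = \<zero>\<^bsub>M\<^esub>"
  using assms(3-5)
proof (induction N arbitrary: m k)
  case (Suc N)
  show ?case
  proof (rule killed_by_x_weight[OF M Suc.prems(1) _ Suc.prems(3) assms(2)])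
    fix i assume i: "i \<le> n"
    show "weyl_x n i \<odot>\<^bsub>M\<^esub> m = \<zero>\<^bsub>M\<^esub>"
      using Suc.prems i by (intro Suc.IH[of _ "int (d i) + k"] eig_part[OF M weyl_part_x]) auto
  qed
qed simp

lemma poly_part_sub: "poly_part n d k \<subseteq> (weyl_part n d k :: 'k::field weyl set)"
  unfolding poly_part_def weyl_part_def by blast

lemma poly_part_mult_x:
  assumes "a \<in> poly_part n d k" "i \<le> n"
  shows "a \<otimes>\<^bsub>weyl n\<^esub> weyl_x n i \<in> (poly_part n d (k + int (d i)) :: 'k::field weyl set)"
proof -
  obtain f where f: "f \<in> carrier (free_alg n)" "a = weyl_class n f"
      "\<And>w. f w \<noteq> 0 \<Longrightarrow> w \<in> lists (range Lx) \<and> word_deg d w = k"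
    using assms(1) unfolding poly_part_def by blast
  have x: "word [Lx i] \<in> carrier (free_alg n :: (letter list \<Rightarrow> 'k) ring)"
    using assms(2) by (intro word_letters_closed) (auto simp: letters_def)
  have "w \<in> lists (range Lx) \<and> word_deg d w = k + int (d i)"
    if "(f \<otimes>\<^bsub>free_alg n\<^esub> word [Lx i]) w \<noteq> 0" for w
    using that unfolding free_alg_simps
  proof (elim conv_support)
    fix u v assume uv: "w = u @ v" "f u \<noteq> 0" "word [Lx i] v \<noteq> (0 :: 'k)"
    then have "v = [Lx i]" by (auto simp: word_def split: if_splits)
    then show ?thesis using f(3)[OF uv(2)] uv(1) by (auto simp: word_deg_def)
  qed
  then show ?thesis
    unfolding f(2) weyl_x_def weyl_class_mult[OF f(1) x, symmetric]
    using free_alg_mult_closed[OF f(1) x] unfolding poly_part_def by blast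
qed

lemma poly_part_one: "\<one>\<^bsub>weyl n\<^esub> \<in> (poly_part n d 0 :: 'k::field weyl set)"
proof -
  have "mono (1 :: 'k) [] \<in> carrier (free_alg n)" by (rule mono_carrier) simp
  then show ?thesis
    unfolding poly_part_def weyl_const_1[symmetric] weyl_const_eq
    by (intro imageI) (auto simp: word_deg_def mono_def)
qed

text \<open>Each x_i uses up at least one degree because the weights are positive, so a degree bound
  for the annihilating polynomials turns into nilpotence.\<close>

lemma torsion_xnil:
  assumes M: "left_module (weyl n) (M :: ('k::field_char_0, 'u) dmod)" and "m \<in> carrier M" and pos: "\<And>i. i \<le> n \<Longrightarrow> 0 < d i"
    and "\<And>k a. \<lbrakk>k > int N - 1; a \<in> poly_part n d k\<rbrakk> \<Longrightarrow> a \<odot>\<^bsub>M\<^esub> m = \<zero>\<^bsub>M\<^esub>"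
  shows "m \<in> xnil n M N"
  using assms(2,4)
proof (induction N arbitrary: m)
  interpret left_module "weyl n" M by fact
  \<comment> \<open>The bound is -1 here, so degree 0 is included and already the unit kills
    \<open>m\<close>.\<close>
  case 0
  then show ?case using poly_part_one[of n d, where 'k = 'k] by force
next
  interpret left_module "weyl n" M by fact
  case (Suc N)
  have "weyl_x n i \<odot>\<^bsub>M\<^esub> m \<in> xnil n M N" if i: "i \<le> n" for i
  proof (rule Suc.IH)
    fix k and a :: "'k weyl" assume a: "k > int N - 1" "a \<in> poly_part n d k"
    then have "a \<in> carrier (weyl n)" using poly_part_sub weyl_part_carrier by blast
    then have "a \<odot>\<^bsub>M\<^esub> (weyl_x n i \<odot>\<^bsub>M\<^esub> m) = (a \<otimes>\<^bsub>weyl n\<^esub> weyl_x n i) \<odot>\<^bsub>M\<^esub> m"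
      using Suc.prems(1) by (simp add: smult_assoc1 weyl_x_closed[OF i])
    also have "\<dots> = \<zero>\<^bsub>M\<^esub>"
      using pos[OF i] a(1) by (intro Suc.prems(2)[OF _ poly_part_mult_x[OF a(2) i]]) auto
    finally show "a \<odot>\<^bsub>M\<^esub> (weyl_x n i \<odot>\<^bsub>M\<^esub> m) = \<zero>\<^bsub>M\<^esub>" .
  qed (use Suc.prems(1) weyl_x_closed[OF i] in auto)
  then show ?case using Suc.prems(1) by simp
qed

text \<open>Torsion vectors are x-nilpotent, hence zero in nonnegative weights. Conversely a
  polynomial of degree above -k sends weight k to a positive weight, where nothing is left.\<close>

lemma torsion_iff:
  assumes "euler0 n d (M :: ('k::field_char_0, 'u) dmod)" and pos: "\<And>i. i \<le> n \<Longrightarrow> 0 < d i"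
  shows "torsion n d M \<longleftrightarrow> (\<forall>k\<ge>0. eig n d M k \<subseteq> {\<zero>\<^bsub>M\<^esub>})"
proof
  note M = euler0D[OF assms(1)]
  assume t: "torsion n d M"
  show "\<forall>k\<ge>0. eig n d M k \<subseteq> {\<zero>\<^bsub>M\<^esub>}"
  proof (intro allI impI subsetI)
    fix k m assume k: "k \<ge> 0" and m: "m \<in> eig n d M k"
    then have mc: "m \<in> carrier M" by (simp add: eig_iff)
    then obtain N where N: "\<And>k a. \<lbrakk>k > N; a \<in> poly_part n d k\<rbrakk> \<Longrightarrow> a \<odot>\<^bsub>M\<^esub> m = \<zero>\<^bsub>M\<^esub>"
      using t unfolding torsion_def by blast
    have "m \<in> xnil n M (nat (N + 1))"
    proof (rule torsion_xnil[OF M(1) mc pos])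
      show "a \<odot>\<^bsub>M\<^esub> m = \<zero>\<^bsub>M\<^esub>" if "k > int (nat (N + 1)) - 1" "a \<in> poly_part n d k" for k a
        using that by (intro N[of k a]; linarith)
    qed
    then show "m \<in> {\<zero>\<^bsub>M\<^esub>}" using xnil_weight[OF M(1) _ m _ k] pos[of 0] by simp
  qed
next
  note M = euler0D[OF assms(1)]
  interpret left_module "weyl n" M by (rule M)
  interpret graded_group M "eig n d M" by (rule M)
  assume z: "\<forall>k\<ge>0. eig n d M k \<subseteq> {\<zero>\<^bsub>M\<^esub>}"
  show "torsion n d M"
    unfolding torsion_def
  proof
    fix m assume "m \<in> carrier M"
    then show "\<exists>N. \<forall>k>N. \<forall>a\<in>poly_part n d k. a \<odot>\<^bsub>M\<^esub> m = \<zero>\<^bsub>M\<^esub>"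
    proof (induction m rule: graded_induct)
      case zero
      then show ?case using poly_part_sub weyl_part_carrier by (metis smult_r_null subsetD)
    next
      case (part k v)
      have "a \<odot>\<^bsub>M\<^esub> v = \<zero>\<^bsub>M\<^esub>" if "j > - k" "a \<in> poly_part n d j" for j a
      proof -
        have "0 \<le> j + k" using that(1) by simp
        then show ?thesis using eig_part[OF M(1) subsetD[OF poly_part_sub that(2)] part] z by blast
      qed
      then show ?case by blast
    next
      case (add x y)
      then obtain N N' where N: "\<And>k a. \<lbrakk>k > N; a \<in> poly_part n d k\<rbrakk> \<Longrightarrow> a \<odot>\<^bsub>M\<^esub> x = \<zero>\<^bsub>M\<^esub>"
        "\<And>k a. \<lbrakk>k > N'; a \<in> poly_part n d k\<rbrakk> \<Longrightarrow> a \<odot>\<^bsub>M\<^esub> y = \<zero>\<^bsub>M\<^esub>" by blast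
      have "a \<odot>\<^bsub>M\<^esub> (x \<oplus>\<^bsub>M\<^esub> y) = \<zero>\<^bsub>M\<^esub>" if "k > max N N'" "a \<in> poly_part n d k" for k a
      proof -
        have "a \<in> carrier (weyl n)" using poly_part_sub weyl_part_carrier that(2) by blast
        moreover have "a \<odot>\<^bsub>M\<^esub> x = \<zero>\<^bsub>M\<^esub>" "a \<odot>\<^bsub>M\<^esub> y = \<zero>\<^bsub>M\<^esub>"
          using N[of k a] that by auto
        ultimately show ?thesis using add(1,2) by (simp add: smult_r_distr)
      qed
      then show ?case by blast
    qed
  qed
qed

text \<open>Weight vectors descend to the quotient and lift from it, so the quotient vanishes in a
  nonnegative weight exactly when \<open>H\<close> contains the weight space of
  \<open>M\<close>.\<close>

lemma cotors_sub_iff: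
  assumes M: "euler0 n d (M :: ('k::field_char_0, 'u) dmod)" and pos: "\<And>i. i \<le> n \<Longrightarrow> 0 < d i"
  shows "cotors_sub n d M H \<longleftrightarrow> submodule H (weyl n) M \<and> (\<forall>k\<ge>0. eig n d M k \<subseteq> H)"
proof -
  have "tors0 n d (quot_mod M H) \<longleftrightarrow> (\<forall>k\<ge>0. eig n d M k \<subseteq> H)" if H: "submodule H (weyl n) M"
  proof -
    note Hf = submodule_facts[OF euler0D(1)[OF M] H]
    interpret abelian_subgroup H M by (rule Hf(6))
    have "tors0 n d (quot_mod M H) \<longleftrightarrow> (\<forall>k\<ge>0. eig n d (quot_mod M H) k \<subseteq> {H})"
      using euler0_quot[OF M H] torsion_iff[OF euler0_quot[OF M H] pos] by (simp add: tors0_def quot_mod_simps)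
    moreover have "eig n d (quot_mod M H) k \<subseteq> {H} \<longleftrightarrow> eig n d M k \<subseteq> H" for k
    proof
      assume l: "eig n d (quot_mod M H) k \<subseteq> {H}"
      show "eig n d M k \<subseteq> H"
      proof
        fix x assume x: "x \<in> eig n d M k"
        then have "H +>\<^bsub>M\<^esub> x = H" using eig_quot[OF euler0D(1)[OF M] H] l by blast
        then show "x \<in> H" using a_rcos_self x by (metis eig_iff)
      qed
    next
      assume r: "eig n d M k \<subseteq> H"
      show "eig n d (quot_mod M H) k \<subseteq> {H}"
      proof
        fix S assume "S \<in> eig n d (quot_mod M H) k"
        then obtain y where "y \<in> eig n d M k" "S = H +>\<^bsub>M\<^esub> y" using eig_quotE[OF M H] by metis
        then show "S \<in> {H}" using r a_rcos_const by auto
      qed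
    qed
    ultimately show ?thesis by simp
  qed
  then show ?thesis unfolding cotors_sub_def by blast
qed

lemma tors_sub_iff:
  assumes M: "euler0 n d (M :: ('k::field_char_0, 'u) dmod)" and pos: "\<And>i. i \<le> n \<Longrightarrow> 0 < d i"
  shows "tors_sub n d M H \<longleftrightarrow> submodule H (weyl n) M \<and> (\<forall>k\<ge>0. eig n d M k \<inter> H \<subseteq> {\<zero>\<^bsub>M\<^esub>})"
proof -
  have "tors0 n d (M\<lparr>carrier := H\<rparr>) \<longleftrightarrow> (\<forall>k\<ge>0. eig n d M k \<inter> H \<subseteq> {\<zero>\<^bsub>M\<^esub>})" if H: "submodule H (weyl n) M"
    using euler0_restrict[OF M H] torsion_iff[OF euler0_restrict[OF M H] pos]
      eig_restrict[OF submodule_facts(1)[OF euler0D(1)[OF M] H], of n d]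
    by (simp add: tors0_def)
  then show ?thesis unfolding tors_sub_def by blast
qed

section \<open>Adjoints and equivalences\<close>

locale cat =
  fixes C :: "('o, 'a) cat"
  assumes is_category: "is_category C"
begin

lemma id_hom: "x \<in> Obj C \<Longrightarrow> Id C x \<in> Hom C x x"
  using is_category by (simp add: is_category_def)

lemma comp_hom:
  "\<lbrakk>x \<in> Obj C; y \<in> Obj C; z \<in> Obj C; f \<in> Hom C x y; g \<in> Hom C y z\<rbrakk> \<Longrightarrow> Comp C x y z g f \<in> Hom C x z"
  using is_category by (simp add: is_category_def)

lemma comp_id_left: "\<lbrakk>x \<in> Obj C; y \<in> Obj C; f \<in> Hom C x y\<rbrakk> \<Longrightarrow> Comp C x y y (Id C y) f = f"
  using is_category by (simp add: is_category_def)

lemma comp_id_right: "\<lbrakk>x \<in> Obj C; y \<in> Obj C; f \<in> Hom C x y\<rbrakk> \<Longrightarrow> Comp C x x y f (Id C x) = f"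
  using is_category by (simp add: is_category_def)

lemma comp_assoc:
  "\<lbrakk>w \<in> Obj C; x \<in> Obj C; y \<in> Obj C; z \<in> Obj C; f \<in> Hom C w x; g \<in> Hom C x y; h \<in> Hom C y z\<rbrakk> \<Longrightarrow>
   Comp C w y z h (Comp C w x y g f) = Comp C w x z (Comp C x y z h g) f"
  using is_category by (simp add: is_category_def)

lemma isoD: "is_iso C x y f \<Longrightarrow> f \<in> Hom C x y"
  by (simp add: is_iso_def)

lemma iso_inverse:
  assumes "is_iso C x y f"
  obtains g where "g \<in> Hom C y x" "Comp C x y x g f = Id C x" "Comp C y x y f g = Id C y" "is_iso C y x g"
  using assms unfolding is_iso_def by blast

lemma iso_comp:
  assumes "x \<in> Obj C" "y \<in> Obj C" "z \<in> Obj C" "is_iso C x y f" "is_iso C y z g"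
  shows "is_iso C x z (Comp C x y z g f)"
proof -
  note O = assms(1-3)
  obtain f' where f': "f' \<in> Hom C y x" "Comp C x y x f' f = Id C x" "Comp C y x y f f' = Id C y"
    using iso_inverse[OF assms(4)] by blast
  obtain g' where g': "g' \<in> Hom C z y" "Comp C y z y g' g = Id C y" "Comp C z y z g g' = Id C z"
    using iso_inverse[OF assms(5)] by blast
  note h = isoD[OF assms(4)] isoD[OF assms(5)] f'(1) g'(1)
  note c = comp_hom[OF O h(1,2)] comp_hom[OF O(3,2,1) h(4,3)]
  have "Comp C x z x (Comp C z y x f' g') (Comp C x y z g f) = Comp C x y x (Comp C y z x (Comp C z y x f' g') g) f"
    using O h c by (intro comp_assoc)
  also have "Comp C y z x (Comp C z y x f' g') g = f'"
    using comp_assoc[OF O(2,3,2,1) h(2,4,3)] O h g' by (simp add: comp_id_right)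
  finally have 1: "Comp C x z x (Comp C z y x f' g') (Comp C x y z g f) = Id C x" using f' by simp
  have "Comp C z x z (Comp C x y z g f) (Comp C z y x f' g') = Comp C z y z (Comp C y x z (Comp C x y z g f) f') g'"
    using O h c by (intro comp_assoc)
  also have "Comp C y x z (Comp C x y z g f) f' = g"
    using comp_assoc[OF O(2,1,2,3) h(3,1,2)] O h f' by (simp add: comp_id_right)
  finally have "Comp C z x z (Comp C x y z g f) (Comp C z y x f' g') = Id C z" using g' by simp
  then show ?thesis unfolding is_iso_def using c 1 by blast
qed

lemma iso_cancel_left:
  assumes "x \<in> Obj C" "y \<in> Obj C" "z \<in> Obj C" "is_iso C y z e" "f \<in> Hom C x y" "g \<in> Hom C x y"
    and "Comp C x y z e f = Comp C x y z e g"
  shows "f = g"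
proof -
  obtain e' where e': "e' \<in> Hom C z y" "Comp C y z y e' e = Id C y" using iso_inverse[OF assms(4)] by blast
  have "Comp C x z y e' (Comp C x y z e h) = h" if "h \<in> Hom C x y" for h
    using comp_assoc[OF assms(1,2,3,2) that isoD[OF assms(4)] e'(1)] e'(2) assms(1,2) that
    by (simp add: comp_id_left)
  then show ?thesis using assms(5-7) by metis
qed

lemma iso_cancel_right:
  assumes "x \<in> Obj C" "y \<in> Obj C" "z \<in> Obj C" "is_iso C x y e" "f \<in> Hom C y z" "g \<in> Hom C y z"
    and "Comp C x y z f e = Comp C x y z g e"
  shows "f = g"
proof -
  obtain e' where e': "e' \<in> Hom C y x" "Comp C y x y e e' = Id C y" using iso_inverse[OF assms(4)] by blast
  have "Comp C y x z (Comp C x y z h e) e' = h" if "h \<in> Hom C y z" for h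
    using comp_assoc[OF assms(2,1,2,3) e'(1) isoD[OF assms(4)] that] e'(2) assms(2,3) that
    by (simp add: comp_id_right)
  then show ?thesis using assms(5-7) by metis
qed

end

lemma bij_betw_ex: "\<lbrakk>bij_betw f A B; y \<in> B\<rbrakk> \<Longrightarrow> \<exists>x\<in>A. f x = y"
  by (auto simp: bij_betw_def)

section \<open>Functors, couniversal arrows and equivalences\<close>

locale functr =
  fixes C :: "('o, 'a) cat" and D :: "('p, 'b) cat" and F :: "('o, 'a, 'p, 'b) func"
  assumes is_functor: "is_functor C D F"
begin

sublocale C: cat C using is_functor by unfold_locales (simp add: is_functor_def)
sublocale D: cat D using is_functor by unfold_locales (simp add: is_functor_def)

lemma obj: "x \<in> Obj C \<Longrightarrow> omap F x \<in> Obj D"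
  using is_functor by (simp add: is_functor_def)

lemma hom: "\<lbrakk>x \<in> Obj C; y \<in> Obj C; f \<in> Hom C x y\<rbrakk> \<Longrightarrow> amap F x y f \<in> Hom D (omap F x) (omap F y)"
  using is_functor by (simp add: is_functor_def)

lemma map_id: "x \<in> Obj C \<Longrightarrow> amap F x x (Id C x) = Id D (omap F x)"
  using is_functor by (simp add: is_functor_def)

lemma map_comp:
  "\<lbrakk>x \<in> Obj C; y \<in> Obj C; z \<in> Obj C; f \<in> Hom C x y; g \<in> Hom C y z\<rbrakk> \<Longrightarrow>
   amap F x z (Comp C x y z g f) =
   Comp D (omap F x) (omap F y) (omap F z) (amap F y z g) (amap F x y f)"
  using is_functor by (simp add: is_functor_def)

lemma map_iso:
  assumes "x \<in> Obj C" "y \<in> Obj C" "is_iso C x y f"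
  shows "is_iso D (omap F x) (omap F y) (amap F x y f)"
proof -
  obtain g where g: "g \<in> Hom C y x" "Comp C x y x g f = Id C x" "Comp C y x y f g = Id C y"
    using C.iso_inverse[OF assms(3)] by blast
  note f = C.isoD[OF assms(3)]
  show ?thesis
    unfolding is_iso_def
    using map_comp[OF assms(1,2,1) f g(1)] map_comp[OF assms(2,1,2) g(1) f] g assms f
    by (auto simp: map_id hom intro!: bexI[of _ "amap F y x g"])
qed

end

text \<open>A terminal object of the comma category of \<open>F\<close> over \<open>y\<close>: the
  counit of a right adjoint at the single object \<open>y\<close>.\<close>

definition couniversal ::
    "('o, 'a) cat \<Rightarrow> ('p, 'b) cat \<Rightarrow> ('o, 'a, 'p, 'b) func \<Rightarrow> 'p \<Rightarrow> 'o \<Rightarrow> 'b \<Rightarrow> bool" where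
  "couniversal C D F y w u \<longleftrightarrow> w \<in> Obj C \<and> u \<in> Hom D (omap F w) y \<and>
     (\<forall>x\<in>Obj C. \<forall>g\<in>Hom D (omap F x) y.
        \<exists>!h. h \<in> Hom C x w \<and> Comp D (omap F x) (omap F w) y u (amap F x w h) = g)"

context functr
begin

lemma couniversal_comp:
  assumes "x' \<in> Obj C" "x \<in> Obj C" "w \<in> Obj C" "y \<in> Obj D" "h' \<in> Hom C x' x" "h \<in> Hom C x w"
    "u \<in> Hom D (omap F w) y"
  shows "Comp D (omap F x') (omap F w) y u (amap F x' w (Comp C x' x w h h')) =
    Comp D (omap F x') (omap F x) y (Comp D (omap F x) (omap F w) y u (amap F x w h)) (amap F x' x h')"
  using assms by (simp add: map_comp D.comp_assoc[symmetric] obj hom)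

text \<open>The adjunction bijection is the inverse of composition with the couniversal arrows, and
  it forces the values of the adjoint on arrows.\<close>

lemma right_adjointI:
  assumes "\<And>y. y \<in> Obj D \<Longrightarrow> \<exists>w u. couniversal C D F y w u"
  shows "\<exists>G. is_right_adjoint C D F G"
proof -
  obtain w u where cu: "couniversal C D F y (w y) (u y)" if "y \<in> Obj D" for y
    using assms by metis
  have w: "w y \<in> Obj C" and u: "u y \<in> Hom D (omap F (w y)) y" if "y \<in> Obj D" for y
    using cu[OF that] by (auto simp: couniversal_def)
  define \<phi> where "\<phi> x y g = (THE h. h \<in> Hom C x (w y) \<and>
    Comp D (omap F x) (omap F (w y)) y (u y) (amap F x (w y) h) = g)" for x y g
  have \<phi>: "\<phi> x y g \<in> Hom C x (w y)"
      "Comp D (omap F x) (omap F (w y)) y (u y) (amap F x (w y) (\<phi> x y g)) = g"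
    if "x \<in> Obj C" "y \<in> Obj D" "g \<in> Hom D (omap F x) y" for x y g
  proof -
    have "\<exists>!h. h \<in> Hom C x (w y) \<and> Comp D (omap F x) (omap F (w y)) y (u y) (amap F x (w y) h) = g"
      using cu[OF that(2)] that(1,3) unfolding couniversal_def by blast
    from theI'[OF this] show "\<phi> x y g \<in> Hom C x (w y)"
      "Comp D (omap F x) (omap F (w y)) y (u y) (amap F x (w y) (\<phi> x y g)) = g"
      unfolding \<phi>_def by auto
  qed
  have \<phi>_unique: "h = h'"
    if "x \<in> Obj C" "y \<in> Obj D" "h \<in> Hom C x (w y)" "h' \<in> Hom C x (w y)"
      "Comp D (omap F x) (omap F (w y)) y (u y) (amap F x (w y) h) =
       Comp D (omap F x) (omap F (w y)) y (u y) (amap F x (w y) h')" for x y h h'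
  proof -
    have "Comp D (omap F x) (omap F (w y)) y (u y) (amap F x (w y) h) \<in> Hom D (omap F x) y"
      using that w u obj hom by (intro D.comp_hom) auto
    then show ?thesis using cu[OF that(2)] that unfolding couniversal_def by metis
  qed
  define G where "G = \<lparr>omap = w, amap = (\<lambda>y y' k. \<phi> (w y) y' (Comp D (omap F (w y)) y y' k (u y)))\<rparr>"
  have G: "amap G y y' k \<in> Hom C (w y) (w y')"
      "Comp D (omap F (w y)) (omap F (w y')) y' (u y') (amap F (w y) (w y') (amap G y y' k)) =
       Comp D (omap F (w y)) y y' k (u y)"
    if "y \<in> Obj D" "y' \<in> Obj D" "k \<in> Hom D y y'" for y y' k
  proof -
    have "Comp D (omap F (w y)) y y' k (u y) \<in> Hom D (omap F (w y)) y'"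
      using that w u obj by (intro D.comp_hom) auto
    then show "amap G y y' k \<in> Hom C (w y) (w y')"
      "Comp D (omap F (w y)) (omap F (w y')) y' (u y') (amap F (w y) (w y') (amap G y y' k)) =
       Comp D (omap F (w y)) y y' k (u y)"
      using \<phi>[OF w[OF that(1)] that(2)] by (auto simp: G_def)
  qed
  have oG: "omap G = w" by (simp add: G_def)
  have G_natural: "Comp D (omap F x) (omap F (w y')) y' (u y') (amap F x (w y') (Comp C x (w y) (w y') (amap G y y' k) h)) =
      Comp D (omap F x) y y' k (Comp D (omap F x) (omap F (w y)) y (u y) (amap F x (w y) h))"
    if "x \<in> Obj C" "y \<in> Obj D" "y' \<in> Obj D" "k \<in> Hom D y y'" "h \<in> Hom C x (w y)" for x y y' k h
    using that w u obj hom
    by (simp add: couniversal_comp[OF that(1) w[OF that(2)] w[OF that(3)] that(3) that(5) G(1)[OF that(2-4)] u[OF that(3)]] G(2)[OF that(2-4)] D.comp_assoc)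
  have "is_functor D C G"
    unfolding is_functor_def oG
  proof (intro conjI ballI)
    fix y assume y: "y \<in> Obj D"
    show "amap G y y (Id D y) = Id C (w y)"
      by (rule \<phi>_unique[OF w[OF y] y]; use y w[OF y] u[OF y] obj in \<open>auto simp: G D.id_hom C.id_hom map_id D.comp_id_left D.comp_id_right\<close>)
  next
    fix x y z f g assume O: "x \<in> Obj D" "y \<in> Obj D" "z \<in> Obj D" and f: "f \<in> Hom D x y" "g \<in> Hom D y z"
    have c: "Comp D x y z g f \<in> Hom D x z" using O f by (rule D.comp_hom)
    show "amap G x z (Comp D x y z g f) = Comp C (w x) (w y) (w z) (amap G y z g) (amap G x y f)"
      by (rule \<phi>_unique[OF w[OF O(1)] O(3)]; use O f c w u obj in \<open>auto simp: G G_natural C.comp_hom D.comp_assoc\<close>)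
  qed (use w G C.is_category D.is_category in auto)
  moreover have "bij_betw (\<phi> x y) (Hom D (omap F x) y) (Hom C x (w y))" if "x \<in> Obj C" "y \<in> Obj D" for x y
  proof (rule bij_betw_byWitness[where f' = "\<lambda>h. Comp D (omap F x) (omap F (w y)) y (u y) (amap F x (w y) h)"])
    have c: "Comp D (omap F x) (omap F (w y)) y (u y) (amap F x (w y) h) \<in> Hom D (omap F x) y"
      if "h \<in> Hom C x (w y)" for h
      using \<open>x \<in> Obj C\<close> \<open>y \<in> Obj D\<close> that w u obj hom by (intro D.comp_hom) auto
    then show "(\<lambda>h. Comp D (omap F x) (omap F (w y)) y (u y) (amap F x (w y) h)) ` Hom C x (w y) \<subseteq> Hom D (omap F x) y"
      by blast
    show "\<forall>h\<in>Hom C x (w y). \<phi> x y (Comp D (omap F x) (omap F (w y)) y (u y) (amap F x (w y) h)) = h"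
      by (intro ballI, rule \<phi>_unique[OF that]; use that c in \<open>auto simp: \<phi>\<close>)
  qed (use that \<phi> in auto)
  moreover have "\<phi> x' y' (Comp D (omap F x') y y' k (Comp D (omap F x') (omap F x) y g (amap F x' x h))) =
      Comp C x' (w y) (w y') (amap G y y' k) (Comp C x' x (w y) (\<phi> x y g) h)"
    if O: "x' \<in> Obj C" "x \<in> Obj C" "y \<in> Obj D" "y' \<in> Obj D" and
      f: "h \<in> Hom C x' x" "g \<in> Hom D (omap F x) y" "k \<in> Hom D y y'" for x' x y y' h g k
  proof -
    have c1: "Comp D (omap F x') (omap F x) y g (amap F x' x h) \<in> Hom D (omap F x') y"
      using O f obj hom by (intro D.comp_hom) auto
    have c2: "Comp D (omap F x') y y' k (Comp D (omap F x') (omap F x) y g (amap F x' x h)) \<in> Hom D (omap F x') y'"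
      using O f obj hom c1 by (intro D.comp_hom) auto
    have c3: "Comp C x' x (w y) (\<phi> x y g) h \<in> Hom C x' (w y)"
      using O f w \<phi> by (intro C.comp_hom) auto
    show ?thesis
    proof (rule \<phi>_unique[OF O(1,4)])
      show "Comp C x' (w y) (w y') (amap G y y' k) (Comp C x' x (w y) (\<phi> x y g) h) \<in> Hom C x' (w y')"
        using O f w G \<phi> c3 by (intro C.comp_hom) auto
    qed (use O f w u c1 c2 c3 in \<open>auto simp: \<phi> G_natural couniversal_comp\<close>)
  qed
  ultimately have "is_right_adjoint C D F G"
    unfolding is_right_adjoint_def oG using is_functor by blast
  then show ?thesis by blast
qed

text \<open>The counit of any adjunction factors through any other couniversal arrow by an isomorphism.\<close>

lemma counit_iso:
  assumes adj: "is_right_adjoint C D F G"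
    and cu: "\<And>y. y \<in> Obj D \<Longrightarrow> \<exists>w u. couniversal C D F y w u \<and> is_iso D (omap F w) y u"
  shows "\<exists>\<epsilon>. nat_iso D D (comp_func F G) id_func \<epsilon>"
proof -
  interpret G: functr D C G using adj by unfold_locales (simp add: is_right_adjoint_def)
  obtain \<phi> where bij: "\<And>x y. \<lbrakk>x \<in> Obj C; y \<in> Obj D\<rbrakk> \<Longrightarrow> bij_betw (\<phi> x y) (Hom D (omap F x) y) (Hom C x (omap G y))"
    and nat: "\<And>x' x y y' h g k. \<lbrakk>x' \<in> Obj C; x \<in> Obj C; y \<in> Obj D; y' \<in> Obj D; h \<in> Hom C x' x;
       g \<in> Hom D (omap F x) y; k \<in> Hom D y y'\<rbrakk> \<Longrightarrow>
       \<phi> x' y' (Comp D (omap F x') y y' k (Comp D (omap F x') (omap F x) y g (amap F x' x h))) =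
           Comp C x' (omap G y) (omap G y') (amap G y y' k) (Comp C x' x (omap G y) (\<phi> x y g) h)"
    using adj unfolding is_right_adjoint_def by blast
  \<comment> \<open>The counit is recovered from the adjunction bijection as the arrow that
    corresponds to the identity.\<close>
  define \<epsilon> where "\<epsilon> y = inv_into (Hom D (omap F (omap G y)) y) (\<phi> (omap G y) y) (Id C (omap G y))" for y
  have \<epsilon>: "\<epsilon> y \<in> Hom D (omap F (omap G y)) y" "\<phi> (omap G y) y (\<epsilon> y) = Id C (omap G y)" if "y \<in> Obj D" for y
    unfolding \<epsilon>_def using bij[OF G.obj[OF that] that] C.id_hom[OF G.obj[OF that]]
    by (auto simp: bij_betw_def intro: inv_into_into f_inv_into_f)
  have counit: "\<phi> x y (Comp D (omap F x) (omap F (omap G y)) y (\<epsilon> y) (amap F x (omap G y) h)) = h"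
    if "x \<in> Obj C" "y \<in> Obj D" "h \<in> Hom C x (omap G y)" for x y h
  proof -
    have "Comp D (omap F x) (omap F (omap G y)) y (\<epsilon> y) (amap F x (omap G y) h) \<in> Hom D (omap F x) y"
      using that \<epsilon> obj hom G.obj by (intro D.comp_hom) auto
    then show ?thesis
      using nat[OF that(1) G.obj[OF that(2)] that(2,2,3) \<epsilon>(1)[OF that(2)] D.id_hom[OF that(2)]] that \<epsilon> obj G.obj
      by (simp add: D.comp_id_left C.comp_id_left G.map_id)
  qed
  have comp\<epsilon>: "Comp D (omap F x) (omap F (omap G y)) y (\<epsilon> y) (amap F x (omap G y) h) \<in> Hom D (omap F x) y"
    if "x \<in> Obj C" "y \<in> Obj D" "h \<in> Hom C x (omap G y)" for x y h
    using that \<epsilon> obj hom G.obj by (intro D.comp_hom) auto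
  have iso: "is_iso D (omap F (omap G y)) y (\<epsilon> y)" if y: "y \<in> Obj D" for y
  proof -
    obtain w u where "couniversal C D F y w u" and iu: "is_iso D (omap F w) y u" using cu[OF y] by blast
    then have w: "w \<in> Obj C" and u: "u \<in> Hom D (omap F w) y" and
      un: "\<And>x g. \<lbrakk>x \<in> Obj C; g \<in> Hom D (omap F x) y\<rbrakk> \<Longrightarrow>
        \<exists>!h. h \<in> Hom C x w \<and> Comp D (omap F x) (omap F w) y u (amap F x w h) = g"
      unfolding couniversal_def by auto
    let ?g = "omap G y"
    have g: "?g \<in> Obj C" by (rule G.obj[OF y])
    \<comment> \<open>\<open>h'\<close> and \<open>h\<close> compare the counit with the given
      couniversal arrow; one composite is absorbed by \<open>\<epsilon> y\<close>, the other by
      \<open>u\<close>, so both are identities.\<close>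
    obtain h' where h': "h' \<in> Hom C ?g w" "Comp D (omap F ?g) (omap F w) y u (amap F ?g w h') = \<epsilon> y"
      using un[OF g \<epsilon>(1)[OF y]] by blast
    define h where "h = \<phi> w y u"
    have h: "h \<in> Hom C w ?g" using bij[OF w y] u unfolding h_def bij_betw_def by blast
    have hu: "Comp D (omap F w) (omap F ?g) y (\<epsilon> y) (amap F w ?g h) = u"
      using counit[OF w y h] bij[OF w y] u comp\<epsilon>[OF w y h] unfolding bij_betw_def h_def inj_on_def by blast
    have 1: "Comp C ?g w ?g h h' = Id C ?g"
    proof -
      have c: "Comp C ?g w ?g h h' \<in> Hom C ?g ?g" using g w h h' by (intro C.comp_hom)
      have "Comp D (omap F ?g) (omap F ?g) y (\<epsilon> y) (amap F ?g ?g (Comp C ?g w ?g h h')) = \<epsilon> y"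
        using couniversal_comp[OF g w g y h'(1) h \<epsilon>(1)[OF y]] hu h' by simp
      also have "\<dots> = Comp D (omap F ?g) (omap F ?g) y (\<epsilon> y) (amap F ?g ?g (Id C ?g))"
        using \<epsilon>[OF y] g y obj by (simp add: map_id D.comp_id_right)
      finally show ?thesis using counit[OF g y c] counit[OF g y C.id_hom[OF g]] by metis
    qed
    have 2: "Comp C w ?g w h' h = Id C w"
    proof -
      have c: "Comp C w ?g w h' h \<in> Hom C w w" using g w h h' by (intro C.comp_hom)
      have "Comp D (omap F w) (omap F w) y u (amap F w w (Comp C w ?g w h' h)) = u"
        using couniversal_comp[OF w g w y h h'(1) u] hu h' by simp
      moreover have "Comp D (omap F w) (omap F w) y u (amap F w w (Id C w)) = u"
        using u w y obj by (simp add: map_id D.comp_id_right)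
      ultimately show ?thesis using un[OF w u] c C.id_hom[OF w] by blast
    qed
    have "is_iso C ?g w h'" unfolding is_iso_def using h h' 1 2 by blast
    from map_iso[OF g w this] show ?thesis
      using D.iso_comp[OF obj[OF g] obj[OF w] y _ iu] h'(2) by metis
  qed
  have "Comp D (omap F (omap G y)) (omap F (omap G y')) y' (\<epsilon> y') (amap F (omap G y) (omap G y') (amap G y y' k)) =
      Comp D (omap F (omap G y)) y y' k (\<epsilon> y)" if y: "y \<in> Obj D" "y' \<in> Obj D" "k \<in> Hom D y y'" for y y' k
  proof -
    let ?g = "omap G y"
    have g: "?g \<in> Obj C" by (rule G.obj[OF y(1)])
    have Gk: "amap G y y' k \<in> Hom C ?g (omap G y')" by (rule G.hom[OF y])
    have c: "Comp D (omap F ?g) y y' k (\<epsilon> y) \<in> Hom D (omap F ?g) y'"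
      using y g obj \<epsilon> by (intro D.comp_hom) auto
    have "\<phi> ?g y' (Comp D (omap F ?g) y y' k (\<epsilon> y)) = amap G y y' k"
      using nat[OF g g y(1,2) C.id_hom[OF g] \<epsilon>(1)[OF y(1)] y(3)] \<epsilon>[OF y(1)] y g Gk obj G.obj
      by (simp add: map_id D.comp_id_right C.comp_id_right C.id_hom)
    then show ?thesis
      using counit[OF g y(2) Gk] comp\<epsilon>[OF g y(2) Gk] c bij[OF g y(2)] unfolding bij_betw_def inj_on_def by metis
  qed
  then have "nat_iso D D (comp_func F G) id_func \<epsilon>"
    unfolding nat_iso_def comp_func_def id_func_def using iso by simp
  then show ?thesis by blast
qed

text \<open>A quasi-inverse is chosen on objects by essential surjectivity; on arrows it is forced
  by the requirement that the chosen isomorphisms \<open>e\<close> be natural.\<close>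

lemma equivalenceI:
  assumes bij: "\<And>x y. \<lbrakk>x \<in> Obj C; y \<in> Obj C\<rbrakk> \<Longrightarrow> bij_betw (amap F x y) (Hom C x y) (Hom D (omap F x) (omap F y))"
    and eso: "\<And>y. y \<in> Obj D \<Longrightarrow> \<exists>x\<in>Obj C. \<exists>e. is_iso D (omap F x) y e"
  shows "is_equivalence C D F"
proof -
  obtain w e where w: "\<And>y. y \<in> Obj D \<Longrightarrow> w y \<in> Obj C" and e: "\<And>y. y \<in> Obj D \<Longrightarrow> is_iso D (omap F (w y)) y (e y)"
    using eso by metis
  note eh = D.isoD[OF e]
  define G where "G = \<lparr>omap = w, amap = (\<lambda>y y' k. THE f. f \<in> Hom C (w y) (w y') \<and>
     Comp D (omap F (w y)) (omap F (w y')) y' (e y') (amap F (w y) (w y') f) = Comp D (omap F (w y)) y y' k (e y))\<rparr>"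
  have oG: "omap G = w" by (simp add: G_def)
  have faithful: "f = f'" if "x \<in> Obj C" "y \<in> Obj D" "f \<in> Hom C x (w y)" "f' \<in> Hom C x (w y)"
     "Comp D (omap F x) (omap F (w y)) y (e y) (amap F x (w y) f) = Comp D (omap F x) (omap F (w y)) y (e y) (amap F x (w y) f')"
    for x y f f'
  proof -
    have "amap F x (w y) f = amap F x (w y) f'"
      by - (rule D.iso_cancel_left[OF _ _ _ e]; use that w obj hom in \<open>auto\<close>)
    then show ?thesis using bij[OF that(1) w[OF that(2)]] that by (auto simp: bij_betw_def inj_on_def)
  qed
  have full: "\<exists>f\<in>Hom C x (w y). Comp D (omap F x) (omap F (w y)) y (e y) (amap F x (w y) f) = k"
    if xyk: "x \<in> Obj C" "y \<in> Obj D" "k \<in> Hom D (omap F x) y" for x y k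
  proof -
    obtain e' where e': "e' \<in> Hom D y (omap F (w y))" "Comp D y (omap F (w y)) y (e y) e' = Id D y"
      using D.iso_inverse[OF e[OF xyk(2)]] by blast
    have "Comp D (omap F x) y (omap F (w y)) e' k \<in> Hom D (omap F x) (omap F (w y))"
      using xyk e' w obj by (intro D.comp_hom) auto
    then obtain f where "f \<in> Hom C x (w y)" "amap F x (w y) f = Comp D (omap F x) y (omap F (w y)) e' k"
      using bij_betw_ex[OF bij[OF xyk(1) w[OF xyk(2)]]] by blast
    moreover have "Comp D (omap F x) (omap F (w y)) y (e y) (Comp D (omap F x) y (omap F (w y)) e' k) = k"
      using D.comp_assoc[OF obj[OF xyk(1)] xyk(2) obj[OF w[OF xyk(2)]] xyk(2) xyk(3) e'(1) eh[OF xyk(2)]] e' xyk obj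
      by (simp add: D.comp_id_left)
    ultimately show ?thesis by (intro bexI[of _ f]) simp_all
  qed
  have G: "amap G y y' k \<in> Hom C (w y) (w y')"
     "Comp D (omap F (w y)) (omap F (w y')) y' (e y') (amap F (w y) (w y') (amap G y y' k)) = Comp D (omap F (w y)) y y' k (e y)"
    if "y \<in> Obj D" "y' \<in> Obj D" "k \<in> Hom D y y'" for y y' k
  proof -
    have "Comp D (omap F (w y)) y y' k (e y) \<in> Hom D (omap F (w y)) y'"
      using that eh w obj by (intro D.comp_hom) auto
    then have "\<exists>!f. f \<in> Hom C (w y) (w y') \<and>
       Comp D (omap F (w y)) (omap F (w y')) y' (e y') (amap F (w y) (w y') f) = Comp D (omap F (w y)) y y' k (e y)"
      using full[OF w[OF that(1)] that(2)] faithful[OF w[OF that(1)] that(2)] by metis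
    from theI'[OF this] show "amap G y y' k \<in> Hom C (w y) (w y')"
     "Comp D (omap F (w y)) (omap F (w y')) y' (e y') (amap F (w y) (w y') (amap G y y' k)) = Comp D (omap F (w y)) y y' k (e y)"
      by (auto simp: G_def)
  qed
  have fG: "is_functor D C G"
    unfolding is_functor_def oG
  proof (intro conjI ballI)
    fix y assume y: "y \<in> Obj D"
    show "amap G y y (Id D y) = Id C (w y)"
      by (rule faithful[OF w[OF y] y]; use y w[OF y] eh[OF y] obj in \<open>auto simp: G D.id_hom C.id_hom map_id D.comp_id_left D.comp_id_right\<close>)
  next
    fix x y z f g assume O: "x \<in> Obj D" "y \<in> Obj D" "z \<in> Obj D" and f: "f \<in> Hom D x y" "g \<in> Hom D y z"
    note c = D.comp_hom[OF O f]
    note o = obj[OF w[OF O(1)]] obj[OF w[OF O(2)]] obj[OF w[OF O(3)]]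
    have Gc: "Comp C (w x) (w y) (w z) (amap G y z g) (amap G x y f) \<in> Hom C (w x) (w z)"
      using O f w G by (intro C.comp_hom) auto
    have "Comp D (omap F (w x)) (omap F (w z)) z (e z) (amap F (w x) (w z) (Comp C (w x) (w y) (w z) (amap G y z g) (amap G x y f)))
      = Comp D (omap F (w x)) (omap F (w y)) z (Comp D (omap F (w y)) y z g (e y)) (amap F (w x) (w y) (amap G x y f))"
      using O f w G eh by (simp add: couniversal_comp)
    also have "\<dots> = Comp D (omap F (w x)) y z g (Comp D (omap F (w x)) (omap F (w y)) y (e y) (amap F (w x) (w y) (amap G x y f)))"
      using O f w G eh o hom by (intro D.comp_assoc[symmetric]) auto
    also have "\<dots> = Comp D (omap F (w x)) x z (Comp D x y z g f) (e x)"
      using O f w G eh o by (simp add: D.comp_assoc)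
    finally show "amap G x z (Comp D x y z g f) = Comp C (w x) (w y) (w z) (amap G y z g) (amap G x y f)"
      by - (rule faithful[OF w[OF O(1)] O(3)]; use O f c w G Gc in \<open>auto\<close>)
  qed (use w G C.is_category D.is_category in auto)
  have \<epsilon>: "nat_iso D D (comp_func F G) id_func e"
    unfolding nat_iso_def comp_func_def id_func_def oG using e G by simp
  define \<eta> where "\<eta> x = (SOME f. f \<in> Hom C x (w (omap F x)) \<and>
      Comp D (omap F x) (omap F (w (omap F x))) (omap F x) (e (omap F x)) (amap F x (w (omap F x)) f) = Id D (omap F x))" for x
  have \<eta>: "\<eta> x \<in> Hom C x (w (omap F x))"
      "Comp D (omap F x) (omap F (w (omap F x))) (omap F x) (e (omap F x)) (amap F x (w (omap F x)) (\<eta> x)) = Id D (omap F x)"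
    if "x \<in> Obj C" for x
  proof -
    have "\<exists>f. f \<in> Hom C x (w (omap F x)) \<and>
      Comp D (omap F x) (omap F (w (omap F x))) (omap F x) (e (omap F x)) (amap F x (w (omap F x)) f) = Id D (omap F x)"
      using full[OF that obj[OF that] D.id_hom[OF obj[OF that]]] by blast
    from someI_ex[OF this] show "\<eta> x \<in> Hom C x (w (omap F x))"
      "Comp D (omap F x) (omap F (w (omap F x))) (omap F x) (e (omap F x)) (amap F x (w (omap F x)) (\<eta> x)) = Id D (omap F x)"
      unfolding \<eta>_def by auto
  qed
  have "nat_iso C C id_func (comp_func G F) \<eta>"
    unfolding nat_iso_def comp_func_def id_func_def oG
  proof (simp, intro conjI ballI)
    fix x assume x: "x \<in> Obj C"
    let ?w = "w (omap F x)"
    have ww: "?w \<in> Obj C" using w obj x by blast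
    note o = obj[OF x] obj[OF ww] and ef = eh[OF obj[OF x]]
    obtain f where f: "f \<in> Hom C ?w x" "amap F ?w x f = e (omap F x)"
      using bij_betw_ex[OF bij[OF ww x] ef] by blast
    have "amap F x x (Comp C x ?w x f (\<eta> x)) = amap F x x (Id C x)"
      using map_comp[OF x ww x \<eta>(1)[OF x] f(1)] f \<eta>[OF x] x by (simp add: map_id)
    moreover have "Comp C x ?w x f (\<eta> x) \<in> Hom C x x" using x ww \<eta> f by (intro C.comp_hom) auto
    ultimately have 1: "Comp C x ?w x f (\<eta> x) = Id C x"
      using bij[OF x x] C.id_hom[OF x] unfolding bij_betw_def inj_on_def by blast
    have c: "Comp C ?w x ?w (\<eta> x) f \<in> Hom C ?w ?w" using x ww \<eta> f by (intro C.comp_hom) auto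
    have "Comp D (omap F ?w) (omap F ?w) (omap F x) (e (omap F x)) (amap F ?w ?w (Comp C ?w x ?w (\<eta> x) f))
        = Comp D (omap F ?w) (omap F x) (omap F x) (Id D (omap F x)) (e (omap F x))"
      using couniversal_comp[OF ww x ww o(1) f(1) \<eta>(1)[OF x] ef] \<eta>[OF x] f by simp
    also have "\<dots> = Comp D (omap F ?w) (omap F ?w) (omap F x) (e (omap F x)) (amap F ?w ?w (Id C ?w))"
      using o ef ww by (simp add: map_id D.comp_id_left D.comp_id_right)
    finally have 2: "Comp C ?w x ?w (\<eta> x) f = Id C ?w"
      using faithful[OF ww o(1) c C.id_hom[OF ww]] by blast
    show "is_iso C x ?w (\<eta> x)" unfolding is_iso_def using \<eta>[OF x] f 1 2 by blast
  next
    fix x y f assume O: "x \<in> Obj C" "y \<in> Obj C" and f: "f \<in> Hom C x y"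
    let ?w = "w (omap F x)" and ?w' = "w (omap F y)"
    have ww: "?w \<in> Obj C" "?w' \<in> Obj C" using w obj O by auto
    note o = obj[OF O(1)] obj[OF O(2)] obj[OF ww(1)] obj[OF ww(2)]
    note Ff = hom[OF O f] and GF = G[OF o(1,2) hom[OF O f]]
    have "Comp D (omap F x) (omap F ?w') (omap F y) (e (omap F y)) (amap F x ?w' (Comp C x y ?w' (\<eta> y) f)) = amap F x y f"
      using couniversal_comp[OF O ww(2) o(2) f \<eta>(1)[OF O(2)] eh[OF o(2)]] \<eta>[OF O(2)] o Ff by (simp add: D.comp_id_left)
    moreover have "Comp D (omap F x) (omap F ?w') (omap F y) (e (omap F y))
        (amap F x ?w' (Comp C x ?w ?w' (amap G (omap F x) (omap F y) (amap F x y f)) (\<eta> x))) = amap F x y f"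
      using couniversal_comp[OF O(1) ww o(2) \<eta>(1)[OF O(1)] GF(1) eh[OF o(2)]] GF(2) \<eta>[OF O(1)] o Ff
        D.comp_assoc[OF o(1,3,1,2) hom[OF O(1) ww(1) \<eta>(1)[OF O(1)]] eh[OF o(1)] Ff]
      by (simp add: D.comp_id_right)
    ultimately show "Comp C x y ?w' (\<eta> y) f = Comp C x ?w ?w' (amap G (omap F x) (omap F y) (amap F x y f)) (\<eta> x)"
      using O ww o \<eta> f GF by (auto intro!: faithful[OF O(1) o(2)] C.comp_hom)
  qed
  then show ?thesis unfolding is_equivalence_def using is_functor fG \<epsilon> by blast
qed

end

text \<open>If two arrows have the same image, naturality of the unit makes them agree after
  composition with an isomorphism, which cancels.\<close>

lemma equivalence_faithful:
  assumes "is_equivalence C D F" "x \<in> Obj C" "y \<in> Obj C"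
  shows "inj_on (amap F x y) (Hom C x y)"
proof -
  from assms(1) obtain G \<eta> where "is_functor C D F" "is_functor D C G" and \<eta>: "nat_iso C C id_func (comp_func G F) \<eta>"
    unfolding is_equivalence_def by blast
  then interpret F: functr C D F + G: functr D C G by unfold_locales
  show ?thesis
  proof
    fix f g assume f: "f \<in> Hom C x y" "g \<in> Hom C x y" and eq: "amap F x y f = amap F x y g"
    have "Comp C x y (omap G (omap F y)) (\<eta> y) f = Comp C x y (omap G (omap F y)) (\<eta> y) g"
      using \<eta> assms(2,3) f eq unfolding nat_iso_def id_func_def comp_func_def by (metis (no_types, lifting) func.simps(1,2))
    moreover have "is_iso C y (omap G (omap F y)) (\<eta> y)"
      using \<eta> assms(3) unfolding nat_iso_def id_func_def comp_func_def by simp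
    ultimately show "f = g"
      by - (rule F.C.iso_cancel_left[of x y _ "\<eta> y"]; use assms(2,3) f F.obj G.obj in \<open>auto\<close>)
  qed
qed

lemma nat_iso_faithful:
  assumes "is_functor C D F" "is_functor C D G" "nat_iso C D F G \<alpha>" "x \<in> Obj C" "y \<in> Obj C"
    and "inj_on (amap F x y) (Hom C x y)"
  shows "inj_on (amap G x y) (Hom C x y)"
proof
  interpret F: functr C D F + G: functr C D G using assms by unfold_locales
  have \<alpha>: "is_iso D (omap F x) (omap G x) (\<alpha> x)" if "x \<in> Obj C" for x
    using assms(3) that by (simp add: nat_iso_def)
  fix f g assume f: "f \<in> Hom C x y" "g \<in> Hom C x y" and eq: "amap G x y f = amap G x y g"
  have "Comp D (omap F x) (omap F y) (omap G y) (\<alpha> y) (amap F x y f) = Comp D (omap F x) (omap F y) (omap G y) (\<alpha> y) (amap F x y g)"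
    using assms(3-5) f eq unfolding nat_iso_def by metis
  then have "amap F x y f = amap F x y g"
    by - (rule F.D.iso_cancel_left[OF _ _ _ \<alpha>[OF assms(5)]]; use assms(4,5) f F.obj G.obj F.hom in \<open>auto\<close>)
  then show "f = g" using assms(6) f by (auto simp: inj_on_def)
qed

text \<open>\<open>gamma0\<close> contains an arbitrarily chosen adjoint; this moves the
  verification of an equivalence to an isomorphic functor that is explicit.\<close>

lemma nat_iso_equivalence:
  assumes "is_functor C D F" "is_functor C D G" "nat_iso C D F G \<alpha>"
    and bij: "\<And>x y. \<lbrakk>x \<in> Obj C; y \<in> Obj C\<rbrakk> \<Longrightarrow> bij_betw (amap G x y) (Hom C x y) (Hom D (omap G x) (omap G y))"
    and eso: "\<And>y. y \<in> Obj D \<Longrightarrow> \<exists>x\<in>Obj C. \<exists>e. is_iso D (omap G x) y e"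
  shows "is_equivalence C D F"
proof -
  interpret F: functr C D F + G: functr C D G using assms by unfold_locales
  have \<alpha>: "is_iso D (omap F x) (omap G x) (\<alpha> x)" if "x \<in> Obj C" for x
    using assms(3) that by (simp add: nat_iso_def)
  have \<alpha>n: "Comp D (omap F x) (omap F y) (omap G y) (\<alpha> y) (amap F x y f) = Comp D (omap F x) (omap G x) (omap G y) (amap G x y f) (\<alpha> x)"
    if "x \<in> Obj C" "y \<in> Obj C" "f \<in> Hom C x y" for x y f
    using assms(3) that by (simp add: nat_iso_def)
  show ?thesis
  proof (rule F.equivalenceI)
    fix x y assume O: "x \<in> Obj C" "y \<in> Obj C"
    note o = F.obj[OF O(1)] F.obj[OF O(2)] G.obj[OF O(1)] G.obj[OF O(2)]
    show "bij_betw (amap F x y) (Hom C x y) (Hom D (omap F x) (omap F y))"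
      unfolding bij_betw_def
    proof
      show "inj_on (amap F x y) (Hom C x y)"
      proof
        fix f g assume f: "f \<in> Hom C x y" "g \<in> Hom C x y" and eq: "amap F x y f = amap F x y g"
        have "Comp D (omap F x) (omap G x) (omap G y) (amap G x y f) (\<alpha> x) = Comp D (omap F x) (omap G x) (omap G y) (amap G x y g) (\<alpha> x)"
          using \<alpha>n[OF O f(1)] \<alpha>n[OF O f(2)] eq by simp
        then have "amap G x y f = amap G x y g"
          by - (rule F.D.iso_cancel_right[OF _ _ _ \<alpha>[OF O(1)]]; use o f G.hom O in \<open>auto\<close>)
        then show "f = g" using bij[OF O] f by (auto simp: bij_betw_def inj_on_def)
      qed
      show "amap F x y ` Hom C x y = Hom D (omap F x) (omap F y)"
      proof
        show "Hom D (omap F x) (omap F y) \<subseteq> amap F x y ` Hom C x y"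
        proof
          fix k assume k: "k \<in> Hom D (omap F x) (omap F y)"
          obtain a where a: "a \<in> Hom D (omap G x) (omap F x)" "Comp D (omap F x) (omap G x) (omap F x) a (\<alpha> x) = Id D (omap F x)"
            using F.D.iso_inverse[OF \<alpha>[OF O(1)]] by blast
          have \<alpha>h: "\<alpha> x \<in> Hom D (omap F x) (omap G x)" "\<alpha> y \<in> Hom D (omap F y) (omap G y)"
            using F.D.isoD[OF \<alpha>] O by auto
          let ?k = "Comp D (omap F x) (omap F y) (omap G y) (\<alpha> y) k"
          have k1: "?k \<in> Hom D (omap F x) (omap G y)" using o k \<alpha>h by (intro F.D.comp_hom) auto
          have "Comp D (omap G x) (omap F x) (omap G y) ?k a \<in> Hom D (omap G x) (omap G y)"
            using o k1 a k \<alpha>h by (intro F.D.comp_hom) auto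
          then obtain f where f: "f \<in> Hom C x y" "amap G x y f = Comp D (omap G x) (omap F x) (omap G y) ?k a"
            using bij_betw_ex[OF bij[OF O]] by blast
          have "Comp D (omap F x) (omap F y) (omap G y) (\<alpha> y) (amap F x y f) = ?k"
            using \<alpha>n[OF O f(1)] f(2) F.D.comp_assoc[OF o(1,3,1,4) \<alpha>h(1) a(1) k1] a(2) k1 o
            by (simp add: F.D.comp_id_right)
          then have "amap F x y f = k"
            by - (rule F.D.iso_cancel_left[OF _ _ _ \<alpha>[OF O(2)]]; use o k F.hom O f in \<open>auto\<close>)
          then show "k \<in> amap F x y ` Hom C x y" using f by blast
        qed
      qed (use F.hom O in auto)
    qed
  next
    fix y assume y: "y \<in> Obj D"
    obtain x e where x: "x \<in> Obj C" "is_iso D (omap G x) y e" using eso[OF y] by blast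
    have "is_iso D (omap F x) y (Comp D (omap F x) (omap G x) y e (\<alpha> x))"
      using F.obj G.obj x y \<alpha> by (intro F.D.iso_comp) auto
    then show "\<exists>x\<in>Obj C. \<exists>e. is_iso D (omap F x) y e" using x by blast
  qed
qed

section \<open>Fractions as relations\<close>

text \<open>A triple \<open>(M', N', f)\<close> is the same thing as a submodule of \<open>M \<times> N\<close>, and the
  composition of triples is the composition of relations.\<close>

definition subrel :: "nat \<Rightarrow> ('k::field, 'u) dmod \<Rightarrow> ('k, 'v) dmod \<Rightarrow> ('u \<times> 'v) set \<Rightarrow> bool" where
  "subrel n M N R \<longleftrightarrow> R \<subseteq> carrier M \<times> carrier N \<and> (\<zero>\<^bsub>M\<^esub>, \<zero>\<^bsub>N\<^esub>) \<in> R \<and>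
     (\<forall>(x, y)\<in>R. \<forall>(x', y')\<in>R. (x \<oplus>\<^bsub>M\<^esub> x', y \<oplus>\<^bsub>N\<^esub> y') \<in> R) \<and>
     (\<forall>r\<in>carrier (weyl n). \<forall>(x, y)\<in>R. (r \<odot>\<^bsub>M\<^esub> x, r \<odot>\<^bsub>N\<^esub> y) \<in> R)"

definition rel_frac :: "('k, 'u) dmod \<Rightarrow> ('u \<times> 'u) set \<Rightarrow> 'u frac" where
  "rel_frac M R = (Domain R, R `` {\<zero>\<^bsub>M\<^esub>}, \<lambda>x\<in>Domain R. R `` {x})"

fun frac_rel :: "'u frac \<Rightarrow> ('u \<times> 'u) set" where
  "frac_rel (M', N', f) = {(x, y). x \<in> M' \<and> y \<in> f x}"

lemma frac_rel_rel_frac [simp]: "frac_rel (rel_frac M R) = R"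
  by (auto simp: rel_frac_def split: if_splits)

lemma subrelD:
  assumes "subrel n M N R"
  shows "(x, y) \<in> R \<Longrightarrow> x \<in> carrier M" "(x, y) \<in> R \<Longrightarrow> y \<in> carrier N" "(\<zero>\<^bsub>M\<^esub>, \<zero>\<^bsub>N\<^esub>) \<in> R"
    "\<lbrakk>(x, y) \<in> R; (x', y') \<in> R\<rbrakk> \<Longrightarrow> (x \<oplus>\<^bsub>M\<^esub> x', y \<oplus>\<^bsub>N\<^esub> y') \<in> R"
    "\<lbrakk>r \<in> carrier (weyl n); (x, y) \<in> R\<rbrakk> \<Longrightarrow> (r \<odot>\<^bsub>M\<^esub> x, r \<odot>\<^bsub>N\<^esub> y) \<in> R"
  using assms unfolding subrel_def by fast+

lemma subrelI:
  assumes "R \<subseteq> carrier M \<times> carrier N" "(\<zero>\<^bsub>M\<^esub>, \<zero>\<^bsub>N\<^esub>) \<in> R"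
    and "\<And>x y x' y'. \<lbrakk>(x, y) \<in> R; (x', y') \<in> R\<rbrakk> \<Longrightarrow> (x \<oplus>\<^bsub>M\<^esub> x', y \<oplus>\<^bsub>N\<^esub> y') \<in> R"
    and "\<And>r x y. \<lbrakk>r \<in> carrier (weyl n); (x, y) \<in> R\<rbrakk> \<Longrightarrow> (r \<odot>\<^bsub>M\<^esub> x, r \<odot>\<^bsub>N\<^esub> y) \<in> R"
  shows "subrel n M N R"
  using assms unfolding subrel_def by fast

lemma minus_smult:
  assumes "left_module (weyl n) (M :: ('k::field, 'u) dmod)" "x \<in> carrier M"
  shows "\<ominus>\<^bsub>M\<^esub> x = weyl_const n (- 1) \<odot>\<^bsub>M\<^esub> x"
proof -
  interpret left_module "weyl n" M by fact
  show ?thesis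
    using assms(2) smult_l_minus[OF R.one_closed assms(2)] weyl_minus_eq[OF R.one_closed]
    by (simp add: weyl_const_closed)
qed

lemma subrel_minus:
  assumes "left_module (weyl n) M" "left_module (weyl n) N" "subrel n M N R" "(x, y) \<in> R"
  shows "(\<ominus>\<^bsub>M\<^esub> x, \<ominus>\<^bsub>N\<^esub> y) \<in> R"
  using subrelD(5)[OF assms(3) weyl_const_closed assms(4), of "- 1"] subrelD(1,2)[OF assms(3,4)] minus_smult assms
  by metis

lemma subrel_Domain:
  assumes "left_module (weyl n) M" "subrel n M N R"
  shows "submodule (Domain R) (weyl n) M"
  using assms(1) subrelD[OF assms(2)] by (intro submoduleI') (blast intro: DomainI)+

lemma subrel_Image0:
  assumes "left_module (weyl n) M" "left_module (weyl n) N" "subrel n M N R"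
  shows "submodule (R `` {\<zero>\<^bsub>M\<^esub>}) (weyl n) N"
proof (rule submoduleI'[OF assms(2)])
  interpret left_module "weyl n" M by fact
  show "x \<oplus>\<^bsub>N\<^esub> y \<in> R `` {\<zero>\<^bsub>M\<^esub>}" if "x \<in> R `` {\<zero>\<^bsub>M\<^esub>}" "y \<in> R `` {\<zero>\<^bsub>M\<^esub>}" for x y
    using subrelD(4)[OF assms(3), of "\<zero>\<^bsub>M\<^esub>" x "\<zero>\<^bsub>M\<^esub>" y] that by simp
  show "r \<odot>\<^bsub>N\<^esub> x \<in> R `` {\<zero>\<^bsub>M\<^esub>}" if "r \<in> carrier (weyl n)" "x \<in> R `` {\<zero>\<^bsub>M\<^esub>}" for r x
    using subrelD(5)[OF assms(3) that(1), of "\<zero>\<^bsub>M\<^esub>" x] that by simp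
qed (use subrelD[OF assms(3)] in auto)

text \<open>Fibres of an additive relation are translates of the fibre over zero, which is why a
  relation defines a map into the quotient by that fibre.\<close>

lemma subrel_Image:
  assumes "left_module (weyl n) M" "left_module (weyl n) N" "subrel n M N R" "(x, y) \<in> R"
  shows "R `` {x} = R `` {\<zero>\<^bsub>M\<^esub>} +>\<^bsub>N\<^esub> y"
proof -
  interpret M: left_module "weyl n" M by fact
  interpret N: left_module "weyl n" N by fact
  note R = subrelD[OF assms(3)]
  have c: "x \<in> carrier M" "y \<in> carrier N" using R assms(4) by auto
  show ?thesis
  proof
    show "R `` {x} \<subseteq> R `` {\<zero>\<^bsub>M\<^esub>} +>\<^bsub>N\<^esub> y"
    proof
      fix z assume "z \<in> R `` {x}"
      then have z: "(x, z) \<in> R" by simp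
      have "(x \<oplus>\<^bsub>M\<^esub> \<ominus>\<^bsub>M\<^esub> x, z \<oplus>\<^bsub>N\<^esub> \<ominus>\<^bsub>N\<^esub> y) \<in> R"
        by (rule R(4)[OF z subrel_minus[OF assms]])
      then have "z \<oplus>\<^bsub>N\<^esub> \<ominus>\<^bsub>N\<^esub> y \<in> R `` {\<zero>\<^bsub>M\<^esub>}" using c by (simp add: M.M.r_neg)
      moreover have "z = (z \<oplus>\<^bsub>N\<^esub> \<ominus>\<^bsub>N\<^esub> y) \<oplus>\<^bsub>N\<^esub> y" using c R(2)[OF z] by (simp add: N.M.a_assoc N.M.l_neg)
      ultimately show "z \<in> R `` {\<zero>\<^bsub>M\<^esub>} +>\<^bsub>N\<^esub> y" unfolding a_r_coset_def' by blast
    qed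
    show "R `` {\<zero>\<^bsub>M\<^esub>} +>\<^bsub>N\<^esub> y \<subseteq> R `` {x}"
      using R(4)[OF _ assms(4), of "\<zero>\<^bsub>M\<^esub>"] c by (auto simp: a_r_coset_def')
  qed
qed

lemma rel_frac_hom:
  assumes M: "left_module (weyl n) (M :: ('k::field, 'u) dmod)" and N: "left_module (weyl n) (N :: ('k, 'v) dmod)"
    and R: "subrel n M N R"
  shows "(\<lambda>x\<in>Domain R. R `` {x}) \<in> mod_homs (weyl n) (M\<lparr>carrier := Domain R\<rparr>) (quot_mod N (R `` {\<zero>\<^bsub>M\<^esub>}))"
proof -
  note N0 = subrel_Image0[OF assms]
  note H = submodule_facts[OF N N0]
  interpret abelian_subgroup "R `` {\<zero>\<^bsub>M\<^esub>}" N by (rule H(6))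
  note I = subrel_Image[OF assms] and R' = subrelD[OF R]
  show ?thesis
    unfolding mod_homs_def
  proof (intro CollectI conjI ballI)
    show "(\<lambda>x\<in>Domain R. R `` {x}) \<in> carrier (M\<lparr>carrier := Domain R\<rparr>) \<rightarrow>\<^sub>E carrier (quot_mod N (R `` {\<zero>\<^bsub>M\<^esub>}))"
      using I R'(2) by (auto simp: quot_mod_simps intro!: a_rcosetsI H(1))
  next
    fix x x' assume "x \<in> carrier (M\<lparr>carrier := Domain R\<rparr>)" "x' \<in> carrier (M\<lparr>carrier := Domain R\<rparr>)"
    then obtain y y' where y: "(x, y) \<in> R" "(x', y') \<in> R" by auto
    then show "(\<lambda>x\<in>Domain R. R `` {x}) (x \<oplus>\<^bsub>M\<lparr>carrier := Domain R\<rparr>\<^esub> x') =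
        (\<lambda>x\<in>Domain R. R `` {x}) x \<oplus>\<^bsub>quot_mod N (R `` {\<zero>\<^bsub>M\<^esub>})\<^esub> (\<lambda>x\<in>Domain R. R `` {x}) x'"
      using R'(2)[OF y(1)] R'(2)[OF y(2)] R'(4)[OF y] DomainI
      by (auto simp only: restrict_apply' DomainI restrict_mod_simps quot_mod_simps I a_rcos_sum)
  next
    fix r :: "'k weyl" and x assume r: "r \<in> carrier (weyl n)" and "x \<in> carrier (M\<lparr>carrier := Domain R\<rparr>)"
    then obtain y where y: "(x, y) \<in> R" by auto
    have "(\<lambda>x\<in>Domain R. R `` {x}) (r \<odot>\<^bsub>M\<^esub> x) = R `` {\<zero>\<^bsub>M\<^esub>} +>\<^bsub>N\<^esub> (r \<odot>\<^bsub>N\<^esub> y)"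
      using I[OF R'(5)[OF r y]] DomainI[OF R'(5)[OF r y]] by (simp only: restrict_apply')
    also have "\<dots> = r \<odot>\<^bsub>quot_mod N (R `` {\<zero>\<^bsub>M\<^esub>})\<^esub> (\<lambda>x\<in>Domain R. R `` {x}) x"
      using quot_smult[OF N N0 r R'(2)[OF y]] I[OF y] DomainI[OF y] by (simp only: restrict_apply')
    finally show "(\<lambda>x\<in>Domain R. R `` {x}) (r \<odot>\<^bsub>M\<lparr>carrier := Domain R\<rparr>\<^esub> x) = \<dots>" by simp
  qed
qed

text \<open>The relation consists of all pairs of a point and a member of its coset; its domain and
  its fibre over zero give back the two submodules, so the round trip does not change the
  triple.\<close>

lemma hom_frac_rel:
  assumes M: "left_module (weyl n) (M :: ('k::field, 'u) dmod)" and N: "left_module (weyl n) (N :: ('k, 'u) dmod)"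
    and M': "submodule M' (weyl n) M" and N': "submodule N' (weyl n) N"
    and f: "f \<in> mod_homs (weyl n) (M\<lparr>carrier := M'\<rparr>) (quot_mod N N')"
  shows "subrel n M N (frac_rel (M', N', f))" "rel_frac M (frac_rel (M', N', f)) = (M', N', f)"
proof -
  note H = submodule_facts[OF N N'] and H' = submodule_facts[OF M M']
  interpret M: left_module "weyl n" M by fact
  interpret N: left_module "weyl n" N by fact
  interpret Q: left_module "weyl n" "quot_mod N N'" by (rule left_module_quot[OF N N'])
  interpret abelian_subgroup N' N by (rule H(6))
  have fE: "f \<in> M' \<rightarrow>\<^sub>E a_rcosets\<^bsub>N\<^esub> N'" and
    fa: "\<And>x y. \<lbrakk>x \<in> M'; y \<in> M'\<rbrakk> \<Longrightarrow> f (x \<oplus>\<^bsub>M\<^esub> y) = f x <+>\<^bsub>N\<^esub> f y" and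
    fs: "\<And>(r :: 'k weyl) x. \<lbrakk>r \<in> carrier (weyl n); x \<in> M'\<rbrakk> \<Longrightarrow> f (r \<odot>\<^bsub>M\<^esub> x) = r \<odot>\<^bsub>quot_mod N N'\<^esub> f x"
    using f unfolding mod_homs_def by (auto simp: quot_mod_simps)
  have fc: "f x \<in> a_rcosets\<^bsub>N\<^esub> N'" if "x \<in> M'" for x using fE that by blast
  have sub: "f x \<subseteq> carrier N" if "x \<in> M'" for x
    using fc[OF that] a_rcosets_carrier by blast
  have "f (\<zero>\<^bsub>weyl n\<^esub> \<odot>\<^bsub>M\<^esub> \<zero>\<^bsub>M\<^esub>) = \<zero>\<^bsub>weyl n\<^esub> \<odot>\<^bsub>quot_mod N N'\<^esub> f \<zero>\<^bsub>M\<^esub>"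
    using H'(2) by (intro fs) auto
  also have "\<dots> = N'"
    using Q.smult_l_null[of "f \<zero>\<^bsub>M\<^esub>"] fc[OF H'(2)] by (simp add: quot_mod_simps(1,2))
  finally have f0: "f \<zero>\<^bsub>M\<^esub> = N'" by simp
  have ne: "\<exists>y. y \<in> f x" if "x \<in> M'" for x
    using fc[OF that] by (auto elim!: coset_cases intro: a_rcos_self)
  show "subrel n M N (frac_rel (M', N', f))"
  proof (rule subrelI)
    show "frac_rel (M', N', f) \<subseteq> carrier M \<times> carrier N" using sub H'(1) by auto
    show "(\<zero>\<^bsub>M\<^esub>, \<zero>\<^bsub>N\<^esub>) \<in> frac_rel (M', N', f)" using H'(2) H(2) f0 by simp
  next
    fix x y x' y' assume xy: "(x, y) \<in> frac_rel (M', N', f)" "(x', y') \<in> frac_rel (M', N', f)"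
    then have "y \<oplus>\<^bsub>N\<^esub> y' \<in> f x <+>\<^bsub>N\<^esub> f x'" by (auto simp: set_add_def')
    then show "(x \<oplus>\<^bsub>M\<^esub> x', y \<oplus>\<^bsub>N\<^esub> y') \<in> frac_rel (M', N', f)"
      using xy fa H'(3) by simp
  next
    fix r :: "'k weyl" and x y assume r: "r \<in> carrier (weyl n)" and xy: "(x, y) \<in> frac_rel (M', N', f)"
    have "y \<in> carrier N" using xy sub by auto
    then have "r \<odot>\<^bsub>N\<^esub> y \<in> N' +>\<^bsub>N\<^esub> (r \<odot>\<^bsub>N\<^esub> y)" using r by (intro a_rcos_self) auto
    then have "r \<odot>\<^bsub>N\<^esub> y \<in> f (r \<odot>\<^bsub>M\<^esub> x)" using xy r by (auto simp: fs quot_mod_simps)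
    then show "(r \<odot>\<^bsub>M\<^esub> x, r \<odot>\<^bsub>N\<^esub> y) \<in> frac_rel (M', N', f)"
      using xy r H'(5) by simp
  qed
  have "Domain (frac_rel (M', N', f)) = M'" using ne by auto
  moreover have "frac_rel (M', N', f) `` {x} = f x" if "x \<in> M'" for x using that by auto
  moreover have "(\<lambda>x\<in>M'. frac_rel (M', N', f) `` {x}) = f"
    using fE by (auto simp: fun_eq_iff restrict_def PiE_def extensional_def)
  ultimately show "rel_frac M (frac_rel (M', N', f)) = (M', N', f)"
    using H'(2) f0 by (simp add: rel_frac_def)
qed

text \<open>The pair is multiplied by one operator that projects both entries to weight k.\<close>

lemma subrel_wt:
  assumes "euler0 n d (M :: ('k::field_char_0, 'u) dmod)" "euler0 n d N" "subrel n M N R" "(x, y) \<in> R"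
  shows "(wt n d M x k, wt n d N y k) \<in> R"
proof -
  obtain P where "P \<in> carrier (weyl n)" "P \<odot>\<^bsub>M\<^esub> x = wt n d M x k" "P \<odot>\<^bsub>N\<^esub> y = wt n d N y k"
    using wt_proj_ex[OF assms(1) _ assms(2), of x y k] subrelD(1,2)[OF assms(3,4)] by metis
  then show ?thesis using subrelD(5)[OF assms(3) _ assms(4)] by metis
qed

lemma subrel_comp:
  assumes "subrel n M N R" "subrel n N P S"
  shows "subrel n M P (R O S)"
proof (rule subrelI)
  note R = subrelD[OF assms(1)] and S = subrelD[OF assms(2)]
  show "R O S \<subseteq> carrier M \<times> carrier P" using R S by blast
  show "(\<zero>\<^bsub>M\<^esub>, \<zero>\<^bsub>P\<^esub>) \<in> R O S" using R S by blast
  show "(x \<oplus>\<^bsub>M\<^esub> x', y \<oplus>\<^bsub>P\<^esub> y') \<in> R O S" if "(x, y) \<in> R O S" "(x', y') \<in> R O S" for x y x' y'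
    using that by (elim relcompE) (auto intro: relcompI[OF R(4) S(4)])
  show "(r \<odot>\<^bsub>M\<^esub> x, r \<odot>\<^bsub>P\<^esub> y) \<in> R O S" if "r \<in> carrier (weyl n)" "(x, y) \<in> R O S" for r x y
    using that by (elim relcompE) (auto intro: relcompI[OF R(5) S(5)])
qed

text \<open>The last two conditions are what a domain with torsion quotient and a torsion fibre over
  zero amount to once torsion is detected by nonnegative weights.\<close>

definition good_rel :: "nat \<Rightarrow> (nat \<Rightarrow> nat) \<Rightarrow> ('k::field_char_0, 'u) dmod \<Rightarrow> ('k, 'u) dmod \<Rightarrow> ('u \<times> 'u) set \<Rightarrow> bool" where
  "good_rel n d M N R \<longleftrightarrow> subrel n M N R \<and> (\<forall>k\<ge>0. eig n d M k \<subseteq> Domain R) \<and>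
     (\<forall>k\<ge>0. eig n d N k \<inter> R `` {\<zero>\<^bsub>M\<^esub>} \<subseteq> {\<zero>\<^bsub>N\<^esub>})"

lemma good_relD:
  assumes "good_rel n d M N R"
  shows "subrel n M N R" "\<lbrakk>k \<ge> 0; x \<in> eig n d M k\<rbrakk> \<Longrightarrow> x \<in> Domain R"
    "\<lbrakk>k \<ge> 0; y \<in> eig n d N k; (\<zero>\<^bsub>M\<^esub>, y) \<in> R\<rbrakk> \<Longrightarrow> y = \<zero>\<^bsub>N\<^esub>"
  using assms unfolding good_rel_def by blast+

locale weights =
  fixes n :: nat and d :: "nat \<Rightarrow> nat"
  assumes pos: "i \<le> n \<Longrightarrow> 0 < d i"
begin

lemma cotors_iff:
  "euler0 n d (M :: ('k::field_char_0, 'u) dmod) \<Longrightarrow>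
    cotors_sub n d M H \<longleftrightarrow> submodule H (weyl n) M \<and> (\<forall>k\<ge>0. eig n d M k \<subseteq> H)"
  using cotors_sub_iff pos by blast

lemma tors_iff:
  "euler0 n d (M :: ('k::field_char_0, 'u) dmod) \<Longrightarrow>
    tors_sub n d M H \<longleftrightarrow> submodule H (weyl n) M \<and> (\<forall>k\<ge>0. eig n d M k \<inter> H \<subseteq> {\<zero>\<^bsub>M\<^esub>})"
  using tors_sub_iff pos by blast

lemma rel_frac_fracs:
  assumes M: "euler0 n d (M :: ('k::field_char_0, 'u) dmod)" and N: "euler0 n d N"
  shows "fracs n d M N = rel_frac M ` {R. good_rel n d M N R}"
proof (intro equalityI subsetI)
  fix t assume "t \<in> fracs n d M N"
  then obtain M' N' f where t: "t = (M', N', f)" and c: "cotors_sub n d M M'" "tors_sub n d N N'"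
    and f: "f \<in> mod_homs (weyl n) (M\<lparr>carrier := M'\<rparr>) (quot_mod N N')"
    unfolding fracs_def by blast
  note c' = c(1)[unfolded cotors_iff[OF M]] c(2)[unfolded tors_iff[OF N]]
  note R = hom_frac_rel[OF euler0D(1)[OF M] euler0D(1)[OF N] conjunct1[OF c'(1)] conjunct1[OF c'(2)] f]
  have "Domain (frac_rel t) = M'" "frac_rel t `` {\<zero>\<^bsub>M\<^esub>} = N'"
    using R(2) unfolding t rel_frac_def by auto
  then have "good_rel n d M N (frac_rel t)"
    using R(1) c' unfolding good_rel_def t by auto
  then show "t \<in> rel_frac M ` {R. good_rel n d M N R}" using R(2) t by (intro image_eqI[of _ _ "frac_rel t"]) auto
next
  fix t assume "t \<in> rel_frac M ` {R. good_rel n d M N R}"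
  then obtain R where t: "t = rel_frac M R" and R: "good_rel n d M N R" by blast
  note s = good_relD(1)[OF R]
  note MN = euler0D(1)[OF M] euler0D(1)[OF N]
  show "t \<in> fracs n d M N"
    unfolding t fracs_def rel_frac_def
    using rel_frac_hom[OF MN s] subrel_Domain[OF MN(1) s] subrel_Image0[OF MN s] R
    by (auto simp: cotors_iff[OF M] tors_iff[OF N] good_rel_def)
qed

lemma frac_comp_rel_frac:
  "frac_comp M (rel_frac N S) (rel_frac M R) = rel_frac M (R O S)" if "\<zero>\<^bsub>M\<^esub> \<in> Domain R"
proof -
  have 1: "{x \<in> Domain R. (\<lambda>x\<in>Domain R. R `` {x}) x \<inter> Domain S \<noteq> {}} = Domain (R O S)" by auto
  have 2: "(\<Union>y\<in>R `` {\<zero>\<^bsub>M\<^esub>} \<inter> Domain S. (\<lambda>x\<in>Domain S. S `` {x}) y) = (R O S) `` {\<zero>\<^bsub>M\<^esub>}" by auto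
  have 3: "(\<lambda>x\<in>Domain (R O S). \<Union>y\<in>(\<lambda>x\<in>Domain R. R `` {x}) x \<inter> Domain S. (\<lambda>x\<in>Domain S. S `` {x}) y) =
      (\<lambda>x\<in>Domain (R O S). (R O S) `` {x})"
    by (rule restrict_ext) auto
  show ?thesis unfolding rel_frac_def frac_comp.simps Let_def 1 2 3 ..
qed

text \<open>An intermediate element may be replaced by its component of weight k, so the conditions
  on \<open>R\<close> and \<open>S\<close>, which concern weight vectors only, can be
  chained.\<close>

lemma good_rel_comp:
  assumes M: "euler0 n d (M :: ('k::field_char_0, 'u) dmod)" and N: "euler0 n d N" and P: "euler0 n d P"
    and R: "good_rel n d M N R" and S: "good_rel n d N P S"
  shows "good_rel n d M P (R O S)"
  unfolding good_rel_def
proof (intro conjI allI impI subsetI)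
  note R' = good_relD[OF R] and S' = good_relD[OF S]
  interpret M: graded_group M "eig n d M" by (rule euler0D[OF M])
  interpret N: graded_group N "eig n d N" by (rule euler0D[OF N])
  interpret P: graded_group P "eig n d P" by (rule euler0D[OF P])
  show "subrel n M P (R O S)" by (rule subrel_comp[OF R'(1) S'(1)])
  fix k :: int assume k: "k \<ge> 0"
  show "x \<in> Domain (R O S)" if x: "x \<in> eig n d M k" for x
  proof -
    obtain y where y: "(x, y) \<in> R" using R'(2)[OF k x] by blast
    then have "(wt n d M x k, wt n d N y k) \<in> R" by (rule subrel_wt[OF M N R'(1)])
    then have "(x, wt n d N y k) \<in> R" using M.gcomp_V[OF x] by simp
    moreover have "wt n d N y k \<in> Domain S"
      using S'(2)[OF k N.gcomp_in] subrelD(2)[OF R'(1) y] by blast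
    ultimately show ?thesis by blast
  qed
  show "z \<in> {\<zero>\<^bsub>P\<^esub>}" if z: "z \<in> eig n d P k \<inter> (R O S) `` {\<zero>\<^bsub>M\<^esub>}" for z
  proof -
    obtain y where y: "(\<zero>\<^bsub>M\<^esub>, y) \<in> R" "(y, z) \<in> S" using z by blast
    have yc: "y \<in> carrier N" using subrelD(2)[OF R'(1) y(1)] .
    have "(\<zero>\<^bsub>M\<^esub>, wt n d N y k) \<in> R" using subrel_wt[OF M N R'(1) y(1), of k] by (simp add: M.gcomp_zero)
    then have "wt n d N y k = \<zero>\<^bsub>N\<^esub>" using R'(3)[OF k N.gcomp_in[OF yc]] by blast
    then have "(\<zero>\<^bsub>N\<^esub>, z) \<in> S" using subrel_wt[OF N P S'(1) y(2), of k] P.gcomp_V[of z k k] z by simp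
    then show ?thesis using S'(3)[OF k] z by blast
  qed
qed

subsection \<open>Homomorphisms in a set of degrees\<close>

definition J_dom :: "int set \<Rightarrow> ('k::field_char_0, 'u) dmod \<Rightarrow> 'u set" where
  "J_dom J M = (\<Union>j\<in>J. eig n d M j)"

text \<open>Homomorphisms of modules that are defined in the degrees \<open>J\<close> only.
  \<open>J = {0..}\<close> describes the arrows of the quotient category, \<open>J = {0}\<close> the
  homomorphisms of degree zero parts.\<close>

definition J_homs :: "int set \<Rightarrow> ('k::field_char_0, 'u) dmod \<Rightarrow> ('k, 'v) dmod \<Rightarrow> ('u \<Rightarrow> 'v) set" where
  "J_homs J M N = {h \<in> extensional (J_dom J M).
     (\<forall>j\<in>J. \<forall>x\<in>eig n d M j. h x \<in> eig n d N j) \<and>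
     (\<forall>j\<in>J. \<forall>x\<in>eig n d M j. \<forall>y\<in>eig n d M j. h (x \<oplus>\<^bsub>M\<^esub> y) = h x \<oplus>\<^bsub>N\<^esub> h y) \<and>
     (\<forall>j\<in>J. \<forall>q. q + j \<in> J \<longrightarrow> (\<forall>P\<in>weyl_part n d q. \<forall>x\<in>eig n d M j. h (P \<odot>\<^bsub>M\<^esub> x) = P \<odot>\<^bsub>N\<^esub> h x))}"

text \<open>A relation determines its value at \<open>x\<close> only up to the fibre over zero;
  asking for a value of the same weight as \<open>x\<close> removes this ambiguity.\<close>

definition rel_hom :: "int set \<Rightarrow> ('k::field_char_0, 'u) dmod \<Rightarrow> ('k, 'u) dmod \<Rightarrow> ('u \<times> 'u) set \<Rightarrow> 'u \<Rightarrow> 'u" where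
  "rel_hom J M N R = (\<lambda>x\<in>J_dom J M. THE y. (x, y) \<in> R \<and> (\<exists>j\<in>J. x \<in> eig n d M j \<and> y \<in> eig n d N j))"

text \<open>The largest relation that \<open>h\<close> allows: \<open>x\<close> and \<open>y\<close>
  are related when no operator followed by projection to a degree in \<open>J\<close> tells them
  apart.\<close>

definition hom_rel :: "int set \<Rightarrow> ('k::field_char_0, 'u) dmod \<Rightarrow> ('k, 'u) dmod \<Rightarrow> ('u \<Rightarrow> 'u) \<Rightarrow> ('u \<times> 'u) set" where
  "hom_rel J M N h = {(x, y). x \<in> carrier M \<and> y \<in> carrier N \<and>
     (\<forall>j\<in>J. \<forall>P\<in>carrier (weyl n). h (wt n d M (P \<odot>\<^bsub>M\<^esub> x) j) = wt n d N (P \<odot>\<^bsub>N\<^esub> y) j)}"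

text \<open>The next two properties say that nothing in degrees \<open>k \<ge> 0\<close> is lost when only the degrees in
  \<open>J\<close> are kept.\<close>

definition J_separates :: "int set \<Rightarrow> ('k::field_char_0, 'u) dmod \<Rightarrow> bool" where
  "J_separates J M \<longleftrightarrow> (\<forall>k\<ge>0. \<forall>y\<in>eig n d M k.
     (\<forall>j\<in>J. \<forall>P\<in>weyl_part n d (j - k). P \<odot>\<^bsub>M\<^esub> y = \<zero>\<^bsub>M\<^esub>) \<longrightarrow> y = \<zero>\<^bsub>M\<^esub>)"

definition J_generates :: "int set \<Rightarrow> ('k::field_char_0, 'u) dmod \<Rightarrow> bool" where
  "J_generates J M \<longleftrightarrow> (\<forall>H. submodule H (weyl n) M \<longrightarrow> (\<forall>j\<in>J. eig n d M j \<subseteq> H) \<longrightarrow> (\<forall>k\<ge>0. eig n d M k \<subseteq> H))"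

lemma J_homsD:
  assumes "h \<in> J_homs J M N"
  shows "h \<in> extensional (J_dom J M)" "\<lbrakk>j \<in> J; x \<in> eig n d M j\<rbrakk> \<Longrightarrow> h x \<in> eig n d N j"
    "\<lbrakk>j \<in> J; x \<in> eig n d M j; y \<in> eig n d M j\<rbrakk> \<Longrightarrow> h (x \<oplus>\<^bsub>M\<^esub> y) = h x \<oplus>\<^bsub>N\<^esub> h y"
    "\<lbrakk>j \<in> J; q + j \<in> J; P \<in> weyl_part n d q; x \<in> eig n d M j\<rbrakk> \<Longrightarrow> h (P \<odot>\<^bsub>M\<^esub> x) = P \<odot>\<^bsub>N\<^esub> h x"
  using assms unfolding J_homs_def by auto

context
  fixes J :: "int set" and M N :: "('k::field_char_0, 'u) dmod"
  assumes M: "euler0 n d M" and N: "euler0 n d N" and J: "J \<subseteq> {0..}"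
begin

interpretation M: graded_group M "eig n d M" by (rule euler0D[OF M])
interpretation N: graded_group N "eig n d N" by (rule euler0D[OF N])
interpretation Ml: left_module "weyl n" M by (rule euler0D[OF M])
interpretation Nl: left_module "weyl n" N by (rule euler0D[OF N])

text \<open>The difference of the two values has weight k and lies in the fibre over zero.\<close>

lemma good_rel_unique:
  assumes R: "good_rel n d M N R" and k: "k \<ge> 0" and y: "(x, y) \<in> R" "y \<in> eig n d N k" "(x, y') \<in> R" "y' \<in> eig n d N k"
  shows "y = y'"
proof -
  note R' = good_relD[OF R]
  have c: "x \<in> carrier M" "y \<in> carrier N" "y' \<in> carrier N" using subrelD(1,2)[OF R'(1)] y by auto
  have "(x \<oplus>\<^bsub>M\<^esub> \<ominus>\<^bsub>M\<^esub> x, y \<oplus>\<^bsub>N\<^esub> \<ominus>\<^bsub>N\<^esub> y') \<in> R"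
    using subrelD(4)[OF R'(1) y(1) subrel_minus[OF euler0D(1)[OF M] euler0D(1)[OF N] R'(1) y(3)]] .
  then have "(\<zero>\<^bsub>M\<^esub>, y \<oplus>\<^bsub>N\<^esub> \<ominus>\<^bsub>N\<^esub> y') \<in> R" using c by (simp add: M.r_neg)
  moreover have "y \<oplus>\<^bsub>N\<^esub> \<ominus>\<^bsub>N\<^esub> y' \<in> eig n d N k"
    using y additive_subgroup.a_inv_closed[OF N.subgroup_V] by (intro N.V_add) auto
  ultimately have "y \<oplus>\<^bsub>N\<^esub> \<ominus>\<^bsub>N\<^esub> y' = \<zero>\<^bsub>N\<^esub>" using R'(3)[OF k] by blast
  then show ?thesis using c by (metis N.minus_equality N.minus_minus N.a_inv_closed N.a_comm)
qed

text \<open>Any value of \<open>x\<close> may be replaced by its component of weight k.\<close>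

lemma good_rel_ex:
  assumes R: "good_rel n d M N R" and k: "k \<ge> 0" and x: "x \<in> eig n d M k"
  shows "\<exists>y\<in>eig n d N k. (x, y) \<in> R"
proof -
  note R' = good_relD[OF R]
  obtain y where y: "(x, y) \<in> R" using R'(2)[OF k x] by blast
  have "(wt n d M x k, wt n d N y k) \<in> R" by (rule subrel_wt[OF M N R'(1) y])
  then show ?thesis using M.gcomp_V[OF x, of k] N.gcomp_in subrelD(2)[OF R'(1) y] by auto
qed

lemma rel_hom_eq:
  assumes R: "good_rel n d M N R" and j: "j \<in> J" "x \<in> eig n d M j"
  shows "rel_hom J M N R x \<in> eig n d N j" "(x, rel_hom J M N R x) \<in> R"
    "\<lbrakk>(x, y) \<in> R; y \<in> eig n d N j\<rbrakk> \<Longrightarrow> rel_hom J M N R x = y"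
proof -
  have j0: "j \<ge> 0" using j J by auto
  obtain y where y: "y \<in> eig n d N j" "(x, y) \<in> R" using good_rel_ex[OF R j0 j(2)] by blast
  have "(THE y. (x, y) \<in> R \<and> (\<exists>j\<in>J. x \<in> eig n d M j \<and> y \<in> eig n d N j)) = y"
  proof (rule the_equality)
    show "(x, y) \<in> R \<and> (\<exists>j\<in>J. x \<in> eig n d M j \<and> y \<in> eig n d N j)" using y j by blast
  next
    fix z assume z: "(x, z) \<in> R \<and> (\<exists>j\<in>J. x \<in> eig n d M j \<and> z \<in> eig n d N j)"
    then obtain i where i: "i \<in> J" "x \<in> eig n d M i" "z \<in> eig n d N i" by blast
    show "z = y"
    proof (cases "i = j")
      case True
      then show ?thesis using good_rel_unique[OF R j0 _ _ y(2,1)] z i by blast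
    next
      \<comment> \<open>Only the zero vector has two weights, and its value is zero in either
        degree.\<close>
      case False
      then have x0: "x = \<zero>\<^bsub>M\<^esub>" using eig_disjoint[OF euler0D(1)[OF M] j(2) i(2)] by simp
      have "z = \<zero>\<^bsub>N\<^esub>" using good_relD(3)[OF R, of i z] i J z x0 by auto
      moreover have "y = \<zero>\<^bsub>N\<^esub>" using good_relD(3)[OF R j0 y(1)] y(2) x0 by auto
      ultimately show ?thesis by simp
    qed
  qed
  moreover have "x \<in> J_dom J M" using j by (auto simp: J_dom_def)
  ultimately have e: "rel_hom J M N R x = y" by (simp add: rel_hom_def)
  show "rel_hom J M N R x \<in> eig n d N j" "(x, rel_hom J M N R x) \<in> R" using e y by auto
  show "rel_hom J M N R x = y'" if "(x, y') \<in> R" "y' \<in> eig n d N j" for y'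
    using good_rel_unique[OF R j0 y(2,1) that] e by simp
qed

lemma rel_hom_J_homs:
  assumes R: "good_rel n d M N R"
  shows "rel_hom J M N R \<in> J_homs J M N"
proof -
  note R' = subrelD[OF good_relD(1)[OF R]] and e = rel_hom_eq[OF R]
  have "rel_hom J M N R (x \<oplus>\<^bsub>M\<^esub> y) = rel_hom J M N R x \<oplus>\<^bsub>N\<^esub> rel_hom J M N R y"
    if "j \<in> J" "x \<in> eig n d M j" "y \<in> eig n d M j" for j x y
    using that e M.V_add N.V_add R'(4) by (intro e(3)[of j]) auto
  moreover have "rel_hom J M N R (P \<odot>\<^bsub>M\<^esub> x) = P \<odot>\<^bsub>N\<^esub> rel_hom J M N R x"
    if "j \<in> J" "q + j \<in> J" "P \<in> weyl_part n d q" "x \<in> eig n d M j" for j q P x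
    using that(1,2) e eig_part[OF euler0D(1)[OF M] that(3,4)] eig_part[OF euler0D(1)[OF N] that(3) e(1)[OF that(1,4)]]
      R'(5)[OF weyl_part_carrier[OF that(3)] e(2)[OF that(1,4)]]
    by (intro e(3)[of "q + j"]) auto
  ultimately show ?thesis
    unfolding J_homs_def using e(1) by (auto simp: rel_hom_def)
qed

lemma J_homs_add:
  assumes "h \<in> J_homs J M N" "j \<in> J" "x \<in> carrier M" "y \<in> carrier M"
  shows "h (wt n d M (x \<oplus>\<^bsub>M\<^esub> y) j) = h (wt n d M x j) \<oplus>\<^bsub>N\<^esub> h (wt n d M y j)"
  using assms(2-) J_homsD(3)[OF assms(1,2)] M.gcomp_in by (simp add: M.gcomp_add)

lemma J_homs_zero:
  assumes "h \<in> J_homs J M N" "j \<in> J"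
  shows "h \<zero>\<^bsub>M\<^esub> = \<zero>\<^bsub>N\<^esub>"
proof -
  have "h \<zero>\<^bsub>M\<^esub> \<oplus>\<^bsub>N\<^esub> h \<zero>\<^bsub>M\<^esub> = h \<zero>\<^bsub>M\<^esub>"
    using J_homsD(3)[OF assms M.V_zero M.V_zero] by simp
  moreover have "h \<zero>\<^bsub>M\<^esub> \<in> carrier N" using J_homsD(2)[OF assms M.V_zero] N.V_carrier by blast
  ultimately show ?thesis using N.add.l_cancel_one' by metis
qed

lemma hom_rel_subrel:
  assumes h: "h \<in> J_homs J M N"
  shows "subrel n M N (hom_rel J M N h)"
proof (rule subrelI)
  show "hom_rel J M N h \<subseteq> carrier M \<times> carrier N" by (auto simp: hom_rel_def)
  show "(\<zero>\<^bsub>M\<^esub>, \<zero>\<^bsub>N\<^esub>) \<in> hom_rel J M N h"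
    using J_homs_zero[OF h] by (auto simp: hom_rel_def M.gcomp_zero N.gcomp_zero)
qed (auto simp: hom_rel_def J_homs_add[OF h] N.gcomp_add Ml.smult_r_distr Nl.smult_r_distr
      simp flip: Ml.smult_assoc1 Nl.smult_assoc1)

lemma hom_rel_graph:
  assumes h: "h \<in> J_homs J M N" and j: "j \<in> J" "x \<in> eig n d M j"
  shows "(x, h x) \<in> hom_rel J M N h"
proof -
  have x: "x \<in> carrier M" "h x \<in> carrier N" "h x \<in> eig n d N j"
    using j J_homsD(2)[OF h j] M.V_carrier N.V_carrier by auto
  have "h (wt n d M (P \<odot>\<^bsub>M\<^esub> x) i) = wt n d N (P \<odot>\<^bsub>N\<^esub> h x) i" if i: "i \<in> J" and "P \<in> carrier (weyl n)" for i P
    using that(2)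
  proof (induction P rule: weyl_induct_part[where d = d])
    case (part q P)
    have "P \<odot>\<^bsub>M\<^esub> x \<in> eig n d M (q + j)" "P \<odot>\<^bsub>N\<^esub> h x \<in> eig n d N (q + j)"
      using eig_part[OF euler0D(1)[OF M] part j(2)] eig_part[OF euler0D(1)[OF N] part x(3)] by auto
    then show ?case
      using M.gcomp_V[of "P \<odot>\<^bsub>M\<^esub> x" "q + j" i] N.gcomp_V[of "P \<odot>\<^bsub>N\<^esub> h x" "q + j" i]
        J_homs_zero[OF h i] J_homsD(4)[OF h j(1) _ part j(2)] i by auto
  next
    case (add P P')
    then show ?case using x J_homs_add[OF h i]
      by (simp add: Ml.smult_l_distr Nl.smult_l_distr N.gcomp_add)
  qed
  then show ?thesis using x by (auto simp: hom_rel_def)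
qed

text \<open>Generation makes the domain large enough, separation makes the fibre over zero torsion,
  and since the relation contains the graph of \<open>h\<close>, the map \<open>h\<close> is
  recovered from it.\<close>

lemma hom_rel_good:
  assumes h: "h \<in> J_homs J M N" and gen: "J_generates J M" and sep: "J_separates J N"
  shows "good_rel n d M N (hom_rel J M N h)" "rel_hom J M N (hom_rel J M N h) = h"
proof -
  note s = hom_rel_subrel[OF h]
  have "\<forall>j\<in>J. eig n d M j \<subseteq> Domain (hom_rel J M N h)" using hom_rel_graph[OF h] by blast
  then have dom: "\<forall>k\<ge>0. eig n d M k \<subseteq> Domain (hom_rel J M N h)"
    using gen subrel_Domain[OF euler0D(1)[OF M] s] unfolding J_generates_def by blast
  have "y = \<zero>\<^bsub>N\<^esub>" if k: "k \<ge> 0" and y: "y \<in> eig n d N k" "(\<zero>\<^bsub>M\<^esub>, y) \<in> hom_rel J M N h" for k y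
  proof -
    have "P \<odot>\<^bsub>N\<^esub> y = \<zero>\<^bsub>N\<^esub>" if P: "j \<in> J" "P \<in> weyl_part n d (j - k)" for j P
    proof -
      have "P \<odot>\<^bsub>N\<^esub> y \<in> eig n d N j" using eig_part[OF euler0D(1)[OF N] P(2) y(1)] by simp
      then have "P \<odot>\<^bsub>N\<^esub> y = wt n d N (P \<odot>\<^bsub>N\<^esub> y) j" using N.gcomp_V by simp
      also have "\<dots> = h (wt n d M (P \<odot>\<^bsub>M\<^esub> \<zero>\<^bsub>M\<^esub>) j)"
        using y(2) P weyl_part_carrier[OF P(2)] unfolding hom_rel_def by force
      also have "\<dots> = \<zero>\<^bsub>N\<^esub>"
        using J_homs_zero[OF h P(1)] weyl_part_carrier[OF P(2)] by (simp add: M.gcomp_zero)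
      finally show ?thesis .
    qed
    then show ?thesis using sep k y unfolding J_separates_def by blast
  qed
  then show good: "good_rel n d M N (hom_rel J M N h)" unfolding good_rel_def using s dom by blast
  show "rel_hom J M N (hom_rel J M N h) = h"
  proof (rule extensionalityI)
    show "rel_hom J M N (hom_rel J M N h) \<in> extensional (J_dom J M)" by (simp add: rel_hom_def)
    show "h \<in> extensional (J_dom J M)" by (rule J_homsD[OF h])
    show "rel_hom J M N (hom_rel J M N h) x = h x" if "x \<in> J_dom J M" for x
      using that rel_hom_eq(3)[OF good] hom_rel_graph[OF h] J_homsD(2)[OF h] by (auto simp: J_dom_def)
  qed
qed

text \<open>If two fractions agree in the colimit, their values in a degree of \<open>J\<close>
  differ by a torsion vector of nonnegative weight, hence not at all. Conversely separation spreads
  agreement from \<open>J\<close> to all nonnegative degrees, and differences of values then lie in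
  a torsion submodule.\<close>

lemma rel_hom_eq_iff:
  assumes R: "good_rel n d M N R" and S: "good_rel n d M N S" and sep: "J_separates J N"
  shows "(rel_frac M R, rel_frac M S) \<in> frac_eq n d M N \<longleftrightarrow> rel_hom J M N R = rel_hom J M N S"
proof
  note R' = good_relD[OF R] and S' = good_relD[OF S]
  have fr: "rel_frac M R \<in> fracs n d M N" "rel_frac M S \<in> fracs n d M N"
    using R S by (auto simp: rel_frac_fracs[OF M N])
  note MN = euler0D(1)[OF M] euler0D(1)[OF N]
  {
    assume "(rel_frac M R, rel_frac M S) \<in> frac_eq n d M N"
    then obtain M3 N3 where c: "cotors_sub n d M M3" "tors_sub n d N N3" "M3 \<subseteq> Domain R \<inter> Domain S"
        "R `` {\<zero>\<^bsub>M\<^esub>} \<union> S `` {\<zero>\<^bsub>M\<^esub>} \<subseteq> N3"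
      and eq: "\<And>x. x \<in> M3 \<Longrightarrow> N3 <+>\<^bsub>N\<^esub> (\<lambda>x\<in>Domain R. R `` {x}) x = N3 <+>\<^bsub>N\<^esub> (\<lambda>x\<in>Domain S. S `` {x}) x"
      unfolding frac_eq_def rel_frac_def by auto
    note c' = c(1)[unfolded cotors_iff[OF M]] c(2)[unfolded tors_iff[OF N]]
    note H = submodule_facts[OF MN(2) conjunct1[OF c'(2)]]
    interpret abelian_subgroup N3 N by (rule H(6))
    show "rel_hom J M N R = rel_hom J M N S"
    proof (rule extensionalityI)
      show "rel_hom J M N R \<in> extensional (J_dom J M)" "rel_hom J M N S \<in> extensional (J_dom J M)"
        by (auto simp: rel_hom_def)
      fix x assume "x \<in> J_dom J M"
      then obtain j where j: "j \<in> J" "x \<in> eig n d M j" by (auto simp: J_dom_def)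
      then have j0: "j \<ge> 0" using J by auto
      let ?y = "rel_hom J M N R x" and ?z = "rel_hom J M N S x"
      note y = rel_hom_eq[OF R j] and z = rel_hom_eq[OF S j]
      have yc: "?y \<in> carrier N" "?z \<in> carrier N" using N.V_carrier[OF y(1)] N.V_carrier[OF z(1)] by auto
      have x3: "x \<in> M3" using conjunct2[OF c'(1)] j0 j by blast
      have "\<zero>\<^bsub>N\<^esub> \<oplus>\<^bsub>N\<^esub> ?y \<in> N3 <+>\<^bsub>N\<^esub> (R `` {x})"
        using y(2) H(2) by (auto simp: set_add_def')
      moreover have "x \<in> Domain R" "x \<in> Domain S" using x3 c(3) by auto
      ultimately have "?y \<in> N3 <+>\<^bsub>N\<^esub> (S `` {x})" using eq[OF x3] yc by (simp add: restrict_apply')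
      then obtain v w where v: "v \<in> N3" "(x, w) \<in> S" "?y = v \<oplus>\<^bsub>N\<^esub> w" by (auto simp: set_add_def')
      have "w \<in> S `` {\<zero>\<^bsub>M\<^esub>} +>\<^bsub>N\<^esub> ?z" using subrel_Image[OF MN S'(1) z(2)] v(2) by blast
      then obtain u where u: "u \<in> N3" "w = u \<oplus>\<^bsub>N\<^esub> ?z" using c(4) by (auto simp: a_r_coset_def')
      have vu: "v \<oplus>\<^bsub>N\<^esub> u \<in> N3" using v u H(3) by blast
      have uv: "u \<in> carrier N" "v \<in> carrier N" using u v H(1) by auto
      have e: "?y = (v \<oplus>\<^bsub>N\<^esub> u) \<oplus>\<^bsub>N\<^esub> ?z" using v u uv yc by (simp add: N.a_assoc)
      have "?y \<oplus>\<^bsub>N\<^esub> \<ominus>\<^bsub>N\<^esub> ?z = v \<oplus>\<^bsub>N\<^esub> u" unfolding e using uv yc by (simp add: N.a_assoc N.r_neg)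
      moreover have "?y \<oplus>\<^bsub>N\<^esub> \<ominus>\<^bsub>N\<^esub> ?z \<in> eig n d N j"
        using y(1) z(1) additive_subgroup.a_inv_closed[OF N.subgroup_V] by (intro N.V_add) auto
      ultimately have "v \<oplus>\<^bsub>N\<^esub> u = \<zero>\<^bsub>N\<^esub>" using c'(2) j0 vu by auto
      then show "?y = ?z" using e yc by simp
    qed
  next
    assume eq: "rel_hom J M N R = rel_hom J M N S"
    \<comment> \<open>Operators from degree k to degrees in \<open>J\<close> cannot distinguish
      \<open>y\<close> from \<open>z\<close>, so separation identifies them.\<close>
    have agree: "y = z" if k: "k \<ge> 0" and x: "x \<in> eig n d M k" and y: "y \<in> eig n d N k" "(x, y) \<in> R"
      and z: "z \<in> eig n d N k" "(x, z) \<in> S" for k x y z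
    proof -
      have c: "y \<in> carrier N" "z \<in> carrier N" using y z N.V_carrier by auto
      have mz: "\<ominus>\<^bsub>N\<^esub> z \<in> eig n d N k" using z additive_subgroup.a_inv_closed[OF N.subgroup_V] by auto
      have "P \<odot>\<^bsub>N\<^esub> (y \<oplus>\<^bsub>N\<^esub> \<ominus>\<^bsub>N\<^esub> z) = \<zero>\<^bsub>N\<^esub>" if P: "j \<in> J" "P \<in> weyl_part n d (j - k)" for j P
      proof -
        have Pc: "P \<in> carrier (weyl n)" by (rule weyl_part_carrier[OF P(2)])
        have Px: "P \<odot>\<^bsub>M\<^esub> x \<in> eig n d M j" using eig_part[OF MN(1) P(2) x] by simp
        have "P \<odot>\<^bsub>N\<^esub> y \<in> eig n d N j" "P \<odot>\<^bsub>N\<^esub> z \<in> eig n d N j"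
          using eig_part[OF MN(2) P(2) y(1)] eig_part[OF MN(2) P(2) z(1)] by auto
        then have "rel_hom J M N R (P \<odot>\<^bsub>M\<^esub> x) = P \<odot>\<^bsub>N\<^esub> y" "rel_hom J M N S (P \<odot>\<^bsub>M\<^esub> x) = P \<odot>\<^bsub>N\<^esub> z"
          using rel_hom_eq(3)[OF R P(1) Px subrelD(5)[OF R'(1) Pc y(2)]]
            rel_hom_eq(3)[OF S P(1) Px subrelD(5)[OF S'(1) Pc z(2)]] by auto
        then have "P \<odot>\<^bsub>N\<^esub> y = P \<odot>\<^bsub>N\<^esub> z" using eq by simp
        then show ?thesis using Pc c by (simp add: Nl.smult_r_distr Nl.smult_r_minus N.r_neg)
      qed
      then have "y \<oplus>\<^bsub>N\<^esub> \<ominus>\<^bsub>N\<^esub> z = \<zero>\<^bsub>N\<^esub>"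
        using sep k N.V_add[OF y(1) mz] unfolding J_separates_def by blast
      then show ?thesis using c by (metis N.minus_equality N.minus_minus N.a_inv_closed N.a_comm)
    qed
    \<comment> \<open>The largest torsion submodule of \<open>N\<close>: the elements none of whose
      multiples has a component of nonnegative weight. It serves as common denominator.\<close>
    define T where "T = {y \<in> carrier N. \<forall>k\<ge>0. \<forall>P\<in>carrier (weyl n). wt n d N (P \<odot>\<^bsub>N\<^esub> y) k = \<zero>\<^bsub>N\<^esub>}"
    have Tsub: "submodule T (weyl n) N"
      by (rule submoduleI'[OF MN(2)])
        (auto simp: T_def N.gcomp_zero N.gcomp_add Nl.smult_r_distr simp flip: Nl.smult_assoc1)
    have "y = \<zero>\<^bsub>N\<^esub>" if "k \<ge> 0" "y \<in> eig n d N k" "y \<in> T" for k y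
    proof -
      have "wt n d N (\<one>\<^bsub>weyl n\<^esub> \<odot>\<^bsub>N\<^esub> y) k = \<zero>\<^bsub>N\<^esub>"
        using that(1,3) weyl_part_carrier[OF weyl_part_one] unfolding T_def by blast
      then show ?thesis using N.gcomp_V[OF that(2), of k] N.V_carrier[OF that(2)] by simp
    qed
    then have Tt: "tors_sub n d N T" unfolding tors_iff[OF N] using Tsub by blast
    note H = submodule_facts[OF MN(2) Tsub]
    interpret abelian_subgroup T N by (rule H(6))
    have diff: "y \<oplus>\<^bsub>N\<^esub> \<ominus>\<^bsub>N\<^esub> z \<in> T" if y: "(x, y) \<in> R" and z: "(x, z) \<in> S" for x y z
    proof -
      have c: "y \<in> carrier N" "z \<in> carrier N" "x \<in> carrier M" using subrelD(1,2)[OF R'(1) y] subrelD(2)[OF S'(1) z] by auto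
      have "wt n d N (P \<odot>\<^bsub>N\<^esub> (y \<oplus>\<^bsub>N\<^esub> \<ominus>\<^bsub>N\<^esub> z)) k = \<zero>\<^bsub>N\<^esub>" if k: "k \<ge> 0" and P: "P \<in> carrier (weyl n)" for k P
      proof -
        have "wt n d N (P \<odot>\<^bsub>N\<^esub> y) k = wt n d N (P \<odot>\<^bsub>N\<^esub> z) k"
          by (rule agree[OF k M.gcomp_in N.gcomp_in subrel_wt[OF M N R'(1) subrelD(5)[OF R'(1) P y]]
                N.gcomp_in subrel_wt[OF M N S'(1) subrelD(5)[OF S'(1) P z]]]) (use c P in \<open>auto\<close>)
        moreover have "wt n d N (P \<odot>\<^bsub>N\<^esub> (y \<oplus>\<^bsub>N\<^esub> \<ominus>\<^bsub>N\<^esub> z)) k \<oplus>\<^bsub>N\<^esub> wt n d N (P \<odot>\<^bsub>N\<^esub> z) k = wt n d N (P \<odot>\<^bsub>N\<^esub> y) k"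
          using c P by (simp add: N.a_assoc N.l_neg flip: N.gcomp_add Nl.smult_r_distr)
        ultimately show ?thesis using c P N.gcomp_carrier[of "P \<odot>\<^bsub>N\<^esub> z" k] N.gcomp_carrier[of "P \<odot>\<^bsub>N\<^esub> (y \<oplus>\<^bsub>N\<^esub> \<ominus>\<^bsub>N\<^esub> z)" k]
          by simp
      qed
      moreover have "y \<oplus>\<^bsub>N\<^esub> \<ominus>\<^bsub>N\<^esub> z \<in> carrier N" using c by simp
      ultimately show ?thesis unfolding T_def by blast
    qed
    let ?M3 = "Domain R \<inter> Domain S"
    note DR = submodule_facts[OF MN(1) subrel_Domain[OF MN(1) R'(1)]] and DS = submodule_facts[OF MN(1) subrel_Domain[OF MN(1) S'(1)]]
    have "submodule ?M3 (weyl n) M"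
      using DR DS by (intro submoduleI'[OF MN(1)]) auto
    then have c3: "cotors_sub n d M ?M3" unfolding cotors_iff[OF M] using R'(2) S'(2) by blast
    have z0: "y \<oplus>\<^bsub>N\<^esub> \<ominus>\<^bsub>N\<^esub> \<zero>\<^bsub>N\<^esub> = y" "\<ominus>\<^bsub>N\<^esub> (\<zero>\<^bsub>N\<^esub> \<oplus>\<^bsub>N\<^esub> \<ominus>\<^bsub>N\<^esub> y) = y" if "y \<in> carrier N" for y
      using that by auto
    have RT: "R `` {\<zero>\<^bsub>M\<^esub>} \<subseteq> T"
      using diff[OF _ subrelD(3)[OF S'(1)]] z0(1) subrelD(2)[OF R'(1)] by fastforce
    have ST: "S `` {\<zero>\<^bsub>M\<^esub>} \<subseteq> T"
      using H(4)[OF diff[OF subrelD(3)[OF R'(1)]]] z0(2) subrelD(2)[OF S'(1)] by fastforce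
    have plus: "T <+>\<^bsub>N\<^esub> (Q `` {\<zero>\<^bsub>M\<^esub>} +>\<^bsub>N\<^esub> y) = T +>\<^bsub>N\<^esub> y"
      if Q: "Q `` {\<zero>\<^bsub>M\<^esub>} \<subseteq> T" "\<zero>\<^bsub>N\<^esub> \<in> Q `` {\<zero>\<^bsub>M\<^esub>}" and y: "y \<in> carrier N" for Q y
    proof
      show "T <+>\<^bsub>N\<^esub> (Q `` {\<zero>\<^bsub>M\<^esub>} +>\<^bsub>N\<^esub> y) \<subseteq> T +>\<^bsub>N\<^esub> y"
      proof
        fix z assume "z \<in> T <+>\<^bsub>N\<^esub> (Q `` {\<zero>\<^bsub>M\<^esub>} +>\<^bsub>N\<^esub> y)"
        then obtain a b where ab: "a \<in> T" "b \<in> T" "z = a \<oplus>\<^bsub>N\<^esub> (b \<oplus>\<^bsub>N\<^esub> y)"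
          using Q by (auto simp: set_add_def' a_r_coset_def')
        then have "z = (a \<oplus>\<^bsub>N\<^esub> b) \<oplus>\<^bsub>N\<^esub> y" using y H(1) by (auto simp: N.a_assoc)
        then show "z \<in> T +>\<^bsub>N\<^esub> y" using H(3)[OF ab(1,2)] by (auto simp: a_r_coset_def')
      qed
      show "T +>\<^bsub>N\<^esub> y \<subseteq> T <+>\<^bsub>N\<^esub> (Q `` {\<zero>\<^bsub>M\<^esub>} +>\<^bsub>N\<^esub> y)"
        using Q(2) y by (force simp: set_add_def' a_r_coset_def')
    qed
    have "T <+>\<^bsub>N\<^esub> (\<lambda>x\<in>Domain R. R `` {x}) x = T <+>\<^bsub>N\<^esub> (\<lambda>x\<in>Domain S. S `` {x}) x" if x: "x \<in> ?M3" for x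
    proof -
      obtain y z where yz: "(x, y) \<in> R" "(x, z) \<in> S" using x by blast
      have c: "y \<in> carrier N" "z \<in> carrier N" using subrelD(2)[OF R'(1) yz(1)] subrelD(2)[OF S'(1) yz(2)] by auto
      have "y = (y \<oplus>\<^bsub>N\<^esub> \<ominus>\<^bsub>N\<^esub> z) \<oplus>\<^bsub>N\<^esub> z" using c by (simp add: N.a_assoc N.l_neg)
      then have "y \<in> T +>\<^bsub>N\<^esub> z" using diff[OF yz] unfolding a_r_coset_def' by blast
      then have "T +>\<^bsub>N\<^esub> y = T +>\<^bsub>N\<^esub> z" using N.a_repr_independence[OF _ c(2) a_subgroup] by metis
      moreover have "T <+>\<^bsub>N\<^esub> (\<lambda>x\<in>Domain R. R `` {x}) x = T +>\<^bsub>N\<^esub> y"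
        using x plus[OF RT _ c(1)] subrel_Image[OF MN R'(1) yz(1)] subrelD(3)[OF R'(1)] by auto
      moreover have "T <+>\<^bsub>N\<^esub> (\<lambda>x\<in>Domain S. S `` {x}) x = T +>\<^bsub>N\<^esub> z"
        using x plus[OF ST _ c(2)] subrel_Image[OF MN S'(1) yz(2)] subrelD(3)[OF S'(1)] by auto
      ultimately show ?thesis by simp
    qed
    then show "(rel_frac M R, rel_frac M S) \<in> frac_eq n d M N"
      unfolding frac_eq_def using fr c3 Tt RT ST unfolding rel_frac_def by blast
  }
qed

end

end

section \<open>The quotient category\<close>

lemma mod_homsD:
  assumes "f \<in> mod_homs R M N"
  shows "x \<in> carrier M \<Longrightarrow> f x \<in> carrier N" "f \<in> extensional (carrier M)"
    "\<lbrakk>x \<in> carrier M; y \<in> carrier M\<rbrakk> \<Longrightarrow> f (x \<oplus>\<^bsub>M\<^esub> y) = f x \<oplus>\<^bsub>N\<^esub> f y"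
    "\<lbrakk>r \<in> carrier R; x \<in> carrier M\<rbrakk> \<Longrightarrow> f (r \<odot>\<^bsub>M\<^esub> x) = r \<odot>\<^bsub>N\<^esub> f x"
  using assms unfolding mod_homs_def by (auto simp: PiE_def)

lemma mod_homsI:
  assumes "f \<in> extensional (carrier M)" "\<And>x. x \<in> carrier M \<Longrightarrow> f x \<in> carrier N"
    "\<And>x y. \<lbrakk>x \<in> carrier M; y \<in> carrier M\<rbrakk> \<Longrightarrow> f (x \<oplus>\<^bsub>M\<^esub> y) = f x \<oplus>\<^bsub>N\<^esub> f y"
    "\<And>r x. \<lbrakk>r \<in> carrier R; x \<in> carrier M\<rbrakk> \<Longrightarrow> f (r \<odot>\<^bsub>M\<^esub> x) = r \<odot>\<^bsub>N\<^esub> f x"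
  shows "f \<in> mod_homs R M N"
  using assms unfolding mod_homs_def by (auto simp: PiE_def)

lemma mod_homs_compose:
  assumes "f \<in> mod_homs R M N" "g \<in> mod_homs R N P" "left_module R M"
  shows "compose (carrier M) g f \<in> mod_homs R M P"
proof -
  interpret left_module R M by fact
  show ?thesis
    using mod_homsD[OF assms(1)] mod_homsD[OF assms(2)]
    by (intro mod_homsI) (auto simp: compose_def)
qed

lemma is_category_full_mod_cat:
  assumes "\<And>M. M \<in> Ms \<Longrightarrow> left_module R M"
  shows "is_category (full_mod_cat R Ms)"
  unfolding is_category_def full_mod_cat_def cat.simps
proof (intro conjI ballI)
  fix M assume "M \<in> Ms"
  then interpret left_module R M by (rule assms)
  show "(\<lambda>x\<in>carrier M. x) \<in> mod_homs R M M" by (intro mod_homsI) auto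
next
  fix M N f assume "f \<in> mod_homs R M N"
  note f = mod_homsD[OF this]
  show "compose (carrier M) (\<lambda>x\<in>carrier N. x) f = f" "compose (carrier M) f (\<lambda>x\<in>carrier M. x) = f"
    using f(1,2) by (auto simp: compose_def fun_eq_iff extensional_def)
next
  fix L M N P f g h assume "f \<in> mod_homs R L M"
  note f = mod_homsD[OF this]
  show "compose (carrier L) h (compose (carrier L) g f) = compose (carrier L) (compose (carrier M) h g) f"
    using f(1) by (auto simp: compose_def fun_eq_iff)
qed (use mod_homs_compose assms in blast)

lemma is_category_grmod0: "is_category (grmod0 n d :: (('k::field_char_0, 'u) dmod, 'u \<Rightarrow> 'u) cat)"
  unfolding grmod0_def by (rule is_category_full_mod_cat) (simp add: euler0_def)

lemma is_category_mod_cat: "is_category (mod_cat R)"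
  unfolding mod_cat_def by (rule is_category_full_mod_cat) simp

lemma grmod0_simps:
  "Obj (grmod0 n d) = {M. euler0 n d M}" "Hom (grmod0 n d) = mod_homs (weyl n)"
  "Id (grmod0 n d) M = (\<lambda>x\<in>carrier M. x)" "Comp (grmod0 n d) M N P g f = compose (carrier M) g f"
  by (simp_all add: grmod0_def full_mod_cat_def)

lemma mod_cat_simps:
  "Obj (mod_cat R) = {M. left_module R M}" "Hom (mod_cat R) = mod_homs R"
  "Id (mod_cat R) M = (\<lambda>x\<in>carrier M. x)" "Comp (mod_cat R) M N P g f = compose (carrier M) g f"
  by (simp_all add: mod_cat_def full_mod_cat_def)

lemma qcoh_simps:
  "Obj (qcoh n d) = {M. euler0 n d M}" "Hom (qcoh n d) M N = fracs n d M N // frac_eq n d M N"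
  "Id (qcoh n d) M = frac_eq n d M M `` {frac_of_hom M M (\<lambda>x. x)}"
  "Comp (qcoh n d) M N P G F = (\<Union>g\<in>G. \<Union>f\<in>F. frac_eq n d M P `` {frac_comp M g f})"
  by (simp_all add: qcoh_def)

section \<open>Arrows of the quotient category as families of maps in the degrees
  \<open>J\<close>\<close>

context weights
begin

abbreviation nonneg :: "int set" where "nonneg \<equiv> {0..}"

lemma nonneg_separates: "left_module (weyl n) M \<Longrightarrow> J_separates nonneg (M :: ('k::field_char_0, 'u) dmod)"
  unfolding J_separates_def
proof (intro allI ballI impI)
  fix k y
  assume M: "left_module (weyl n) M" and k: "0 \<le> k" and y: "y \<in> eig n d M k"
    and z: "\<forall>j\<in>nonneg. \<forall>P\<in>weyl_part n d (j - k). P \<odot>\<^bsub>M\<^esub> y = \<zero>\<^bsub>M\<^esub>"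
  interpret left_module "weyl n" M by fact
  have "\<one>\<^bsub>weyl n\<^esub> \<odot>\<^bsub>M\<^esub> y = \<zero>\<^bsub>M\<^esub>" using bspec[OF bspec[OF z, of k], of "\<one>\<^bsub>weyl n\<^esub>"] k
    by (simp add: weyl_part_one)
  then show "y = \<zero>\<^bsub>M\<^esub>" using y by (simp add: eig_iff)
qed

lemma nonneg_generates: "J_generates nonneg M"
  by (auto simp: J_generates_def)

definition frac_hom :: "int set \<Rightarrow> ('k::field_char_0, 'u) dmod \<Rightarrow> ('k, 'u) dmod \<Rightarrow> 'u frac \<Rightarrow> 'u \<Rightarrow> 'u" where
  "frac_hom J M N t = rel_hom J M N (frac_rel t)"

text \<open>The common value of \<open>frac_hom\<close> on a class; it exists when \<open>J\<close>
  separates \<open>N\<close>, by \<open>frac_eq_kernel\<close>.\<close>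

definition qhom :: "int set \<Rightarrow> ('k::field_char_0, 'u) dmod \<Rightarrow> ('k, 'u) dmod \<Rightarrow> 'u frac set \<Rightarrow> 'u \<Rightarrow> 'u" where
  "qhom J M N C = the_elem (frac_hom J M N ` C)"

lemma fracs_cases:
  assumes "euler0 n d (M :: ('k::field_char_0, 'u) dmod)" "euler0 n d N" "t \<in> fracs n d M N"
  obtains R where "good_rel n d M N R" "t = rel_frac M R" "frac_rel t = R"
  using assms by (auto simp: rel_frac_fracs)

text \<open>As the kernel of a map, \<open>frac_eq\<close> is visibly an equivalence relation, and
  classes can be compared through the values of that map.\<close>

lemma frac_eq_kernel:
  assumes "euler0 n d (M :: ('k::field_char_0, 'u) dmod)" "euler0 n d N" "J \<subseteq> nonneg" "J_separates J N"
  shows "frac_eq n d M N = {(s, t). s \<in> fracs n d M N \<and> t \<in> fracs n d M N \<and> frac_hom J M N s = frac_hom J M N t}"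
proof -
  have "frac_eq n d M N \<subseteq> fracs n d M N \<times> fracs n d M N" by (auto simp: frac_eq_def)
  moreover have "(s, t) \<in> frac_eq n d M N \<longleftrightarrow> frac_hom J M N s = frac_hom J M N t"
    if "s \<in> fracs n d M N" "t \<in> fracs n d M N" for s t
    using that rel_hom_eq_iff[OF assms(1-3) _ _ assms(4)]
    by (elim fracs_cases[OF assms(1,2)]) (auto simp: frac_hom_def)
  ultimately show ?thesis by blast
qed

lemma qhom_class:
  assumes "euler0 n d (M :: ('k::field_char_0, 'u) dmod)" "euler0 n d N" "J \<subseteq> nonneg" "J_separates J N"
    and "t \<in> fracs n d M N"
  shows "qhom J M N (frac_eq n d M N `` {t}) = frac_hom J M N t"
proof -
  have "frac_hom J M N ` (frac_eq n d M N `` {t}) = {frac_hom J M N t}"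
    using assms(5) by (auto simp: frac_eq_kernel[OF assms(1-4)])
  then show ?thesis by (simp add: qhom_def)
qed

lemma qcoh_Hom_cases:
  assumes "F \<in> Hom (qcoh n d) M N"
  obtains t where "t \<in> fracs n d M N" "F = frac_eq n d M N `` {t}"
  using assms by (auto simp: qcoh_simps elim: quotientE)

lemma qcoh_Hom_class: "t \<in> fracs n d M N \<Longrightarrow> frac_eq n d M N `` {t} \<in> Hom (qcoh n d) M N"
  by (auto simp: qcoh_simps intro: quotientI)

text \<open>Separation and generation hold automatically for \<open>J = {0..}\<close>, which gives
  the working description of arrows; for \<open>J = {0}\<close> they are supplied by
  coprimality.\<close>

lemma qhom_bij:
  assumes "euler0 n d (M :: ('k::field_char_0, 'u) dmod)" "euler0 n d N" "J \<subseteq> nonneg" "J_separates J N" "J_generates J M"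
  shows "bij_betw (qhom J M N) (Hom (qcoh n d) M N) (J_homs J M N)"
  unfolding bij_betw_def
proof (intro conjI inj_onI)
  note cl = qhom_class[OF assms(1-4)] and ker = frac_eq_kernel[OF assms(1-4)]
  fix F G assume FG: "F \<in> Hom (qcoh n d) M N" "G \<in> Hom (qcoh n d) M N" and eq: "qhom J M N F = qhom J M N G"
  obtain s t where s: "s \<in> fracs n d M N" "F = frac_eq n d M N `` {s}" and t: "t \<in> fracs n d M N" "G = frac_eq n d M N `` {t}"
    using FG qcoh_Hom_cases by metis
  then have "frac_hom J M N s = frac_hom J M N t" using eq cl by simp
  then show "F = G" using s t unfolding ker by auto
next
  note cl = qhom_class[OF assms(1-4)]
  show "qhom J M N ` Hom (qcoh n d) M N = J_homs J M N"
  proof (intro equalityI subsetI)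
    fix h assume "h \<in> qhom J M N ` Hom (qcoh n d) M N"
    then obtain t where t: "t \<in> fracs n d M N" "h = frac_hom J M N t"
      using cl by (auto elim!: qcoh_Hom_cases)
    then show "h \<in> J_homs J M N"
      by (auto simp: frac_hom_def elim!: fracs_cases[OF assms(1,2)] intro: rel_hom_J_homs[OF assms(1-3)])
  next
    fix h assume h: "h \<in> J_homs J M N"
    note g = hom_rel_good[OF assms(1-3) h assms(5,4)]
    have t: "rel_frac M (hom_rel J M N h) \<in> fracs n d M N" using g(1) by (simp add: rel_frac_fracs[OF assms(1,2)])
    have "qhom J M N (frac_eq n d M N `` {rel_frac M (hom_rel J M N h)}) = h"
      using cl[OF t] g(2) by (simp add: frac_hom_def)
    then show "h \<in> qhom J M N ` Hom (qcoh n d) M N" using qcoh_Hom_class[OF t] by (metis image_eqI)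
  qed
qed

lemma frac_comp_closed:
  assumes "euler0 n d (M :: ('k::field_char_0, 'u) dmod)" "euler0 n d N" "euler0 n d P"
    and f: "f \<in> fracs n d M N" and g: "g \<in> fracs n d N P"
  shows "frac_comp M g f \<in> fracs n d M P"
    and "J \<subseteq> nonneg \<Longrightarrow> frac_hom J M P (frac_comp M g f) = compose (J_dom J M) (frac_hom J N P g) (frac_hom J M N f)"
proof -
  obtain R where R: "good_rel n d M N R" "f = rel_frac M R" using fracs_cases[OF assms(1,2) f] by metis
  obtain S where S: "good_rel n d N P S" "g = rel_frac N S" using fracs_cases[OF assms(2,3) g] by metis
  note RS = good_rel_comp[OF assms(1-3) R(1) S(1)]
  have "\<zero>\<^bsub>M\<^esub> \<in> Domain R" using subrelD(3)[OF good_relD(1)[OF R(1)]] by blast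
  then have c: "frac_comp M g f = rel_frac M (R O S)" unfolding R(2) S(2) by (rule frac_comp_rel_frac)
  show "frac_comp M g f \<in> fracs n d M P" unfolding c rel_frac_fracs[OF assms(1,3)] using RS by blast
  assume J: "J \<subseteq> nonneg"
  have "rel_hom J M P (R O S) = compose (J_dom J M) (rel_hom J N P S) (rel_hom J M N R)"
  proof (rule extensionalityI)
    show "rel_hom J M P (R O S) \<in> extensional (J_dom J M)" by (simp add: rel_hom_def)
    fix x assume x: "x \<in> J_dom J M"
    then obtain j where j: "j \<in> J" "x \<in> eig n d M j" by (auto simp: J_dom_def)
    note r = rel_hom_eq[OF assms(1,2) J R(1) j]
    note s = rel_hom_eq[OF assms(2,3) J S(1) j(1) r(1)]
    have "rel_hom J M P (R O S) x = rel_hom J N P S (rel_hom J M N R x)"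
      by (rule rel_hom_eq(3)[OF assms(1,3) J RS j relcompI[OF r(2) s(2)] s(1)])
    then show "rel_hom J M P (R O S) x = compose (J_dom J M) (rel_hom J N P S) (rel_hom J M N R) x"
      using x by (simp add: compose_def)
  qed (simp add: compose_extensional)
  then show "frac_hom J M P (frac_comp M g f) = compose (J_dom J M) (frac_hom J N P g) (frac_hom J M N f)"
    unfolding frac_hom_def c by (simp add: R(2) S(2))
qed

text \<open>Composition in \<open>qcoh\<close> is a union over all pairs of representatives; their
  composites induce the same map in degrees j \<ge> 0, so the union is a single class.\<close>

lemma qcoh_Comp:
  assumes "euler0 n d (M :: ('k::field_char_0, 'u) dmod)" "euler0 n d N" "euler0 n d P"
    and F: "F \<in> Hom (qcoh n d) M N" and G: "G \<in> Hom (qcoh n d) N P"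
  shows "Comp (qcoh n d) M N P G F \<in> Hom (qcoh n d) M P"
    and "\<lbrakk>J \<subseteq> nonneg; J_separates J N; J_separates J P\<rbrakk> \<Longrightarrow>
      qhom J M P (Comp (qcoh n d) M N P G F) = compose (J_dom J M) (qhom J N P G) (qhom J M N F)"
proof -
  obtain f where f: "f \<in> fracs n d M N" "F = frac_eq n d M N `` {f}" using F qcoh_Hom_cases by metis
  obtain g where g: "g \<in> fracs n d N P" "G = frac_eq n d N P `` {g}" using G qcoh_Hom_cases by metis
  note sep = nonneg_separates[OF euler0D(1)[OF assms(2)]] nonneg_separates[OF euler0D(1)[OF assms(3)]]
  note kN = frac_eq_kernel[OF assms(1,2) subset_refl sep(1)] and kP = frac_eq_kernel[OF assms(2,3) subset_refl sep(2)]
    and k = frac_eq_kernel[OF assms(1,3) subset_refl sep(2)]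
  note c = frac_comp_closed[OF assms(1-3)]
  have "frac_eq n d M P `` {frac_comp M g' f'} = frac_eq n d M P `` {frac_comp M g f}"
    if "g' \<in> G" "f' \<in> F" for g' f'
  proof -
    have "f' \<in> fracs n d M N" "frac_hom nonneg M N f' = frac_hom nonneg M N f"
      using that(2) unfolding f(2) kN by auto
    moreover have "g' \<in> fracs n d N P" "frac_hom nonneg N P g' = frac_hom nonneg N P g"
      using that(1) unfolding g(2) kP by auto
    ultimately have "frac_hom nonneg M P (frac_comp M g' f') = frac_hom nonneg M P (frac_comp M g f)"
      "frac_comp M g' f' \<in> fracs n d M P"
      using c f(1) g(1) by auto
    then show ?thesis using c(1)[OF f(1) g(1)] unfolding k by auto
  qed
  moreover have "g \<in> G" "f \<in> F" using f g unfolding kN kP by auto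
  ultimately have e: "Comp (qcoh n d) M N P G F = frac_eq n d M P `` {frac_comp M g f}"
    unfolding qcoh_simps by blast
  show "Comp (qcoh n d) M N P G F \<in> Hom (qcoh n d) M P"
    unfolding e by (rule qcoh_Hom_class[OF c(1)[OF f(1) g(1)]])
  show "qhom J M P (Comp (qcoh n d) M N P G F) = compose (J_dom J M) (qhom J N P G) (qhom J M N F)"
    if J: "J \<subseteq> nonneg" "J_separates J N" "J_separates J P"
    unfolding e unfolding f(2) g(2)
    using qhom_class[OF assms(1,3) J(1,3) c(1)[OF f(1) g(1)]] qhom_class[OF assms(1,2) J(1,2) f(1)]
      qhom_class[OF assms(2,3) J(1,3) g(1)] c(2)[OF f(1) g(1) J(1)] by simp
qed

lemma frac_of_hom:
  assumes M: "euler0 n d (M :: ('k::field_char_0, 'u) dmod)" and N: "euler0 n d N"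
    and f: "\<And>x. x \<in> carrier M \<Longrightarrow> f x \<in> carrier N"
    "\<And>x y. \<lbrakk>x \<in> carrier M; y \<in> carrier M\<rbrakk> \<Longrightarrow> f (x \<oplus>\<^bsub>M\<^esub> y) = f x \<oplus>\<^bsub>N\<^esub> f y"
    "\<And>r x. \<lbrakk>r \<in> carrier (weyl n); x \<in> carrier M\<rbrakk> \<Longrightarrow> f (r \<odot>\<^bsub>M\<^esub> x) = r \<odot>\<^bsub>N\<^esub> f x"
  shows "frac_of_hom M N f \<in> fracs n d M N"
    and "J \<subseteq> nonneg \<Longrightarrow> frac_hom J M N (frac_of_hom M N f) = restrict f (J_dom J M)"
proof -
  interpret M: graded_group M "eig n d M" by (rule euler0D[OF M])
  interpret N: graded_group N "eig n d N" by (rule euler0D[OF N])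
  interpret Ml: left_module "weyl n" M by (rule euler0D[OF M])
  interpret Nl: left_module "weyl n" N by (rule euler0D[OF N])
  let ?R = "{(x, f x) | x. x \<in> carrier M}"
  have "f (\<zero>\<^bsub>weyl n\<^esub> \<odot>\<^bsub>M\<^esub> \<zero>\<^bsub>M\<^esub>) = \<zero>\<^bsub>weyl n\<^esub> \<odot>\<^bsub>N\<^esub> f \<zero>\<^bsub>M\<^esub>" by (rule f(3)) auto
  then have f0: "f \<zero>\<^bsub>M\<^esub> = \<zero>\<^bsub>N\<^esub>" using f(1)[of "\<zero>\<^bsub>M\<^esub>"] by simp
  have s: "subrel n M N ?R"
    by (rule subrelI) (use f f0 in \<open>auto simp flip: f(2,3)\<close>)
  have R: "good_rel n d M N ?R"
    unfolding good_rel_def using s f0 M.V_carrier by auto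
  have e: "frac_of_hom M N f = rel_frac M ?R"
    unfolding frac_of_hom_def rel_frac_def using f0 by (auto simp: fun_eq_iff restrict_def Domain_iff)
  show "frac_of_hom M N f \<in> fracs n d M N" unfolding e rel_frac_fracs[OF M N] using R by blast
  assume J: "J \<subseteq> nonneg"
  have fe: "f x \<in> eig n d N j" if "x \<in> eig n d M j" for x j
    using that f by (simp add: eig_iff euler_closed weyl_const_closed flip: f(3))
  have "rel_hom J M N ?R = restrict f (J_dom J M)"
  proof (rule extensionalityI)
    show "rel_hom J M N ?R \<in> extensional (J_dom J M)" by (simp add: rel_hom_def)
    fix x assume x: "x \<in> J_dom J M"
    then obtain j where j: "j \<in> J" "x \<in> eig n d M j" by (auto simp: J_dom_def)
    show "rel_hom J M N ?R x = restrict f (J_dom J M) x"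
      using rel_hom_eq(3)[OF M N J R j, of "f x"] fe[OF j(2)] M.V_carrier[OF j(2)] x by auto
  qed simp
  then show "frac_hom J M N (frac_of_hom M N f) = restrict f (J_dom J M)"
    by (simp add: frac_hom_def e)
qed

lemma qcoh_Id:
  assumes M: "euler0 n d (M :: ('k::field_char_0, 'u) dmod)"
  shows "Id (qcoh n d) M \<in> Hom (qcoh n d) M M"
    and "\<lbrakk>J \<subseteq> nonneg; J_separates J M\<rbrakk> \<Longrightarrow> qhom J M M (Id (qcoh n d) M) = (\<lambda>x\<in>J_dom J M. x)"
proof -
  note f = frac_of_hom[OF M M, of "\<lambda>x. x"]
  show "Id (qcoh n d) M \<in> Hom (qcoh n d) M M"
    unfolding qcoh_simps(3) using f(1) by (intro qcoh_Hom_class) auto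
  show "qhom J M M (Id (qcoh n d) M) = (\<lambda>x\<in>J_dom J M. x)" if J: "J \<subseteq> nonneg" "J_separates J M"
    unfolding qcoh_simps(3) using f qhom_class[OF M M J] J by simp
qed

lemma J_homs_dom:
  assumes "h \<in> J_homs J M N" "x \<in> J_dom J M"
  shows "h x \<in> J_dom J N"
  using assms J_homsD(2)[OF assms(1)] by (auto simp: J_dom_def)

lemma J_homs_compose_id:
  assumes "h \<in> J_homs J M N"
  shows "compose (J_dom J M) (\<lambda>x\<in>J_dom J N. x) h = h" "compose (J_dom J M) h (\<lambda>x\<in>J_dom J M. x) = h"
  using J_homs_dom[OF assms] J_homsD(1)[OF assms]
  by (auto simp: compose_def fun_eq_iff extensional_def)

text \<open>Arrows are faithfully represented by functions in nonnegative degrees, so associativity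
  and the unit laws are inherited from functions.\<close>

lemma is_category_qcoh: "is_category (qcoh n d :: (('k::field_char_0, 'u) dmod, 'u frac set) cat)"
proof -
  have sep: "J_separates nonneg M" if "euler0 n d M" for M :: "('k, 'u) dmod"
    by (rule nonneg_separates[OF euler0D(1)[OF that]])
  have bij: "bij_betw (qhom nonneg M N) (Hom (qcoh n d) M N) (J_homs nonneg M N)"
    if "euler0 n d M" "euler0 n d N" for M N :: "('k, 'u) dmod"
    by (rule qhom_bij[OF that subset_refl sep[OF that(2)] nonneg_generates])
  have inj: "F = G" if "euler0 n d M" "euler0 n d N" "F \<in> Hom (qcoh n d) M N" "G \<in> Hom (qcoh n d) M N"
    "qhom nonneg M N F = qhom nonneg M N G" for M N :: "('k, 'u) dmod" and F G
    using bij[OF that(1,2)] that(3-5) by (auto simp: bij_betw_def inj_on_def)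
  have hom: "qhom nonneg M N F \<in> J_homs nonneg M N"
    if "euler0 n d M" "euler0 n d N" "F \<in> Hom (qcoh n d) M N" for M N :: "('k, 'u) dmod" and F
    using bij[OF that(1,2)] that(3) by (auto simp: bij_betw_def)
  note comp = qcoh_Comp(2)[OF _ _ _ _ _ subset_refl sep sep]
  show ?thesis
    unfolding is_category_def
  proof (intro conjI ballI)
    fix M N F assume "M \<in> Obj (qcoh n d :: (('k, 'u) dmod, _) cat)" "N \<in> Obj (qcoh n d :: (('k, 'u) dmod, _) cat)"
      and F: "F \<in> Hom (qcoh n d) M N"
    then have O: "euler0 n d M" "euler0 n d N" by (auto simp: qcoh_simps)
    note i = qcoh_Id[OF O(1)] qcoh_Id[OF O(2)]
    show "Comp (qcoh n d) M N N (Id (qcoh n d) N) F = F"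
      using qcoh_Comp(1)[OF O(1,2,2) F i(3)] F comp[OF O(1,2,2) F i(3) O(2,2)] i(4)[OF subset_refl sep[OF O(2)]]
        J_homs_compose_id[OF hom[OF O F]] by (intro inj[OF O]) simp_all
    show "Comp (qcoh n d) M M N F (Id (qcoh n d) M) = F"
      using qcoh_Comp(1)[OF O(1,1,2) i(1) F] F comp[OF O(1,1,2) i(1) F O(1,2)] i(2)[OF subset_refl sep[OF O(1)]]
        J_homs_compose_id[OF hom[OF O F]] by (intro inj[OF O]) simp_all
  next
    fix L M N P F G H
    assume "L \<in> Obj (qcoh n d :: (('k, 'u) dmod, _) cat)" "M \<in> Obj (qcoh n d :: (('k, 'u) dmod, _) cat)"
      "N \<in> Obj (qcoh n d :: (('k, 'u) dmod, _) cat)" "P \<in> Obj (qcoh n d :: (('k, 'u) dmod, _) cat)"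
      and f: "F \<in> Hom (qcoh n d) L M" "G \<in> Hom (qcoh n d) M N" "H \<in> Hom (qcoh n d) N P"
    then have O: "euler0 n d L" "euler0 n d M" "euler0 n d N" "euler0 n d P" by (auto simp: qcoh_simps)
    note c = qcoh_Comp(1)[OF O(1,2,3) f(1,2)] qcoh_Comp(1)[OF O(2,3,4) f(2,3)]
    have "compose (J_dom nonneg L) (qhom nonneg N P H) (compose (J_dom nonneg L) (qhom nonneg M N G) (qhom nonneg L M F))
      = compose (J_dom nonneg L) (compose (J_dom nonneg M) (qhom nonneg N P H) (qhom nonneg M N G)) (qhom nonneg L M F)"
      using J_homs_dom[OF hom[OF O(1,2) f(1)]] by (auto simp: compose_def fun_eq_iff)
    then show "Comp (qcoh n d) L N P H (Comp (qcoh n d) L M N G F) = Comp (qcoh n d) L M P (Comp (qcoh n d) M N P H G) F"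
      using qcoh_Comp(1)[OF O(1,3,4) c(1) f(3)] qcoh_Comp(1)[OF O(1,2,4) f(1) c(2)]
        comp[OF O(1,3,4) c(1) f(3) O(3,4)] comp[OF O(1,2,4) f(1) c(2) O(2,4)]
        comp[OF O(1,2,3) f(1,2) O(2,3)] comp[OF O(2,3,4) f(2,3) O(3,4)]
      by (intro inj[OF O(1,4)]) simp_all
  qed (use qcoh_Id(1) qcoh_Comp(1) in \<open>auto simp: qcoh_simps(1)\<close>)
qed

lemma qcoh_inj:
  assumes "euler0 n d (M :: ('k::field_char_0, 'u) dmod)" "euler0 n d N" "F \<in> Hom (qcoh n d) M N" "G \<in> Hom (qcoh n d) M N"
    "qhom nonneg M N F = qhom nonneg M N G"
  shows "F = G"
  using qhom_bij[OF assms(1,2) subset_refl nonneg_separates[OF euler0D(1)[OF assms(2)]] nonneg_generates] assms(3-5)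
  by (auto simp: bij_betw_def inj_on_def)

lemma pi0_hom:
  assumes M: "euler0 n d (M :: ('k::field_char_0, 'u) dmod)" and N: "euler0 n d N" and f: "f \<in> mod_homs (weyl n) M N"
  shows "amap (pi0 n d) M N f \<in> Hom (qcoh n d) M N"
    and "\<lbrakk>J \<subseteq> nonneg; J_separates J N\<rbrakk> \<Longrightarrow> qhom J M N (amap (pi0 n d) M N f) = restrict f (J_dom J M)"
proof -
  note fr = frac_of_hom[OF M N, of f, OF mod_homsD(1)[OF f] mod_homsD(3)[OF f] mod_homsD(4)[OF f], simplified]
  show "amap (pi0 n d) M N f \<in> Hom (qcoh n d) M N"
    unfolding pi0_def func.simps by (rule qcoh_Hom_class[OF fr(1)])
  show "qhom J M N (amap (pi0 n d) M N f) = restrict f (J_dom J M)" if "J \<subseteq> nonneg" "J_separates J N"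
    unfolding pi0_def func.simps using qhom_class[OF M N that fr(1)] fr(2)[OF that(1)] by simp
qed

lemma omap_pi0: "omap (pi0 n d) M = M"
  by (simp add: pi0_def)

lemma J_dom_carrier: "J_dom J M \<subseteq> carrier M"
  by (auto simp: J_dom_def eig_iff)

lemma mod_homs_eig:
  assumes "f \<in> mod_homs (weyl n) M N" "x \<in> eigenspace n d M \<mu>"
  shows "f x \<in> eigenspace n d N \<mu>"
  using assms mod_homsD(1)[OF assms(1)]
  by (simp add: eig_iff euler_closed weyl_const_closed flip: mod_homsD(4)[OF assms(1)])

lemma is_functor_pi0:
  "is_functor (grmod0 n d) (qcoh n d :: (('k::field_char_0, 'u) dmod, 'u frac set) cat) (pi0 n d)"
  unfolding is_functor_def omap_pi0
proof (intro conjI ballI)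
  fix M assume "M \<in> Obj (grmod0 n d :: (('k, 'u) dmod, _) cat)"
  then have M: "euler0 n d M" by (simp add: grmod0_simps)
  interpret left_module "weyl n" M by (rule euler0D[OF M])
  have i: "(\<lambda>x\<in>carrier M. x) \<in> mod_homs (weyl n) M M" by (intro mod_homsI) auto
  note sep = nonneg_separates[OF euler0D(1)[OF M]]
  show "amap (pi0 n d) M M (Id (grmod0 n d) M) = Id (qcoh n d) M"
    using pi0_hom[OF M M i] qcoh_Id[OF M] sep J_dom_carrier[of nonneg M]
    by (intro qcoh_inj[OF M M]) (auto simp: grmod0_simps fun_eq_iff restrict_def subset_iff)
next
  fix M N P f g assume "M \<in> Obj (grmod0 n d :: (('k, 'u) dmod, _) cat)" "N \<in> Obj (grmod0 n d :: (('k, 'u) dmod, _) cat)"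
    "P \<in> Obj (grmod0 n d :: (('k, 'u) dmod, _) cat)" and "f \<in> Hom (grmod0 n d) M N" "g \<in> Hom (grmod0 n d) N P"
  then have O: "euler0 n d M" "euler0 n d N" "euler0 n d P" and f: "f \<in> mod_homs (weyl n) M N" "g \<in> mod_homs (weyl n) N P"
    by (auto simp: grmod0_simps)
  note sep = nonneg_separates[OF euler0D(1)[OF O(2)]] nonneg_separates[OF euler0D(1)[OF O(3)]]
  note gf = mod_homs_compose[OF f euler0D(1)[OF O(1)]]
  note p = pi0_hom[OF O(1,2) f(1)] pi0_hom[OF O(2,3) f(2)] pi0_hom[OF O(1,3) gf]
  have "restrict (compose (carrier M) g f) (J_dom nonneg M) =
      compose (J_dom nonneg M) (restrict g (J_dom nonneg N)) (restrict f (J_dom nonneg M))"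
    using J_dom_carrier[of nonneg M] mod_homs_eig[OF f(1)]
    by (auto simp: fun_eq_iff compose_def restrict_def J_dom_def)
  then show "amap (pi0 n d) M P (Comp (grmod0 n d) M N P g f) =
      Comp (qcoh n d) M N P (amap (pi0 n d) N P g) (amap (pi0 n d) M N f)"
    using p sep qcoh_Comp[OF O p(1,3)]
    by (intro qcoh_inj[OF O(1,3)]) (simp_all add: grmod0_simps)
qed (auto simp: is_category_grmod0 is_category_qcoh pi0_hom(1) grmod0_simps qcoh_simps(1))

text \<open>The degreewise inverses are glued to one function on the union of the weight spaces, and
  \<open>qhom_bij\<close> realizes it by an arrow.\<close>

lemma qcoh_isoI:
  assumes M: "euler0 n d (M :: ('k::field_char_0, 'u) dmod)" and N: "euler0 n d N" and F: "F \<in> Hom (qcoh n d) M N"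
    and bij: "\<And>j. j \<ge> 0 \<Longrightarrow> bij_betw (qhom nonneg M N F) (eig n d M j) (eig n d N j)"
  shows "is_iso (qcoh n d) M N F"
proof -
  interpret M: graded_group M "eig n d M" by (rule euler0D[OF M])
  interpret N: graded_group N "eig n d N" by (rule euler0D[OF N])
  note sepM = nonneg_separates[OF euler0D(1)[OF M]] and sepN = nonneg_separates[OF euler0D(1)[OF N]]
  let ?f = "qhom nonneg M N F"
  note bM = qhom_bij[OF M N subset_refl sepN nonneg_generates] and bN = qhom_bij[OF N M subset_refl sepM nonneg_generates]
  have f: "?f \<in> J_homs nonneg M N" using bM F by (auto simp: bij_betw_def)
  have inj: "inj_on ?f (J_dom nonneg M)"
  proof
    fix x y assume "x \<in> J_dom nonneg M" "y \<in> J_dom nonneg M" and eq: "?f x = ?f y"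
    then obtain i j where i: "i \<in> nonneg" "x \<in> eig n d M i" and j: "j \<in> nonneg" "y \<in> eig n d M j"
      by (auto simp: J_dom_def)
    show "x = y"
    proof (cases "i = j")
      case True
      then show ?thesis using bij[of i] i j eq by (auto simp: bij_betw_def inj_on_def)
    next
      \<comment> \<open>Vectors of different weights can only have a common image if it is zero, and
        then both vectors are zero.\<close>
      case False
      have "?f x \<in> eig n d N i" "?f x \<in> eig n d N j"
        using J_homsD(2)[OF f i] J_homsD(2)[OF f j] eq by auto
      then have z: "?f x = \<zero>\<^bsub>N\<^esub>" "?f y = \<zero>\<^bsub>N\<^esub>" using eig_disjoint[OF euler0D(1)[OF N]] False eq by auto
      have "?f \<zero>\<^bsub>M\<^esub> = \<zero>\<^bsub>N\<^esub>" by (rule J_homs_zero[OF M N subset_refl f i(1)])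
      then have "x = \<zero>\<^bsub>M\<^esub>" "y = \<zero>\<^bsub>M\<^esub>"
        using bij[of i] bij[of j] i j z M.V_zero[of i] M.V_zero[of j] by (auto simp: bij_betw_def inj_on_def)
      then show ?thesis by simp
    qed
  qed
  have surj: "?f ` J_dom nonneg M = J_dom nonneg N"
    using bij by (auto simp: J_dom_def bij_betw_def image_UN)
  define g where "g = (\<lambda>y\<in>J_dom nonneg N. inv_into (J_dom nonneg M) ?f y)"
  have gf: "g (?f x) = x" if "x \<in> J_dom nonneg M" for x
    using that inj surj by (auto simp: g_def)
  have ge: "\<exists>x\<in>eig n d M j. y = ?f x" if "j \<ge> 0" "y \<in> eig n d N j" for j y
    using bij[OF that(1)] that(2) by (auto simp: bij_betw_def)
  have eJ: "x \<in> J_dom nonneg M" if "j \<ge> 0" "x \<in> eig n d M j" for x j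
    using that by (auto simp: J_dom_def)
  have "g \<in> J_homs nonneg N M"
    unfolding J_homs_def
  proof (intro CollectI conjI ballI allI impI)
    show "g \<in> extensional (J_dom nonneg N)" by (simp add: g_def)
    fix j y assume j: "j \<in> nonneg" and y: "y \<in> eig n d N j"
    then obtain x where x: "x \<in> eig n d M j" "y = ?f x" using ge by auto
    show "g y \<in> eig n d M j" using gf[OF eJ[of j x]] x j by auto
    show "g (y \<oplus>\<^bsub>N\<^esub> z) = g y \<oplus>\<^bsub>M\<^esub> g z" if z: "z \<in> eig n d N j" for z
    proof -
      obtain w where w: "w \<in> eig n d M j" "z = ?f w" using ge[of j z] z j by auto
      have "y \<oplus>\<^bsub>N\<^esub> z = ?f (x \<oplus>\<^bsub>M\<^esub> w)" using J_homsD(3)[OF f j x(1) w(1)] x w by simp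
      then show ?thesis using gf eJ[of j] x w j M.V_add[OF x(1) w(1)] by simp
    qed
    show "g (P \<odot>\<^bsub>N\<^esub> y) = P \<odot>\<^bsub>M\<^esub> g y" if "q + j \<in> nonneg" "P \<in> weyl_part n d q" for q P
    proof -
      have "P \<odot>\<^bsub>N\<^esub> y = ?f (P \<odot>\<^bsub>M\<^esub> x)" using J_homsD(4)[OF f j that x(1)] x by simp
      then show ?thesis
        using gf eJ[of j x] eJ[of "q + j" "P \<odot>\<^bsub>M\<^esub> x"] x j that eig_part[OF euler0D(1)[OF M] that(2) x(1)] by simp
    qed
  qed
  then obtain G where G: "G \<in> Hom (qcoh n d) N M" "qhom nonneg N M G = g"
    using bij_betw_ex[OF bN] by blast
  have "Comp (qcoh n d) M N M G F = Id (qcoh n d) M"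
  proof (rule qcoh_inj[OF M M])
    have "compose (J_dom nonneg M) g ?f = (\<lambda>x\<in>J_dom nonneg M. x)"
      using gf by (auto simp: compose_def fun_eq_iff)
    then show "qhom nonneg M M (Comp (qcoh n d) M N M G F) = qhom nonneg M M (Id (qcoh n d) M)"
      using qcoh_Comp(2)[OF M N M F G(1) subset_refl sepN sepM] qcoh_Id(2)[OF M subset_refl sepM] G(2) by simp
  qed (use qcoh_Comp(1)[OF M N M F G(1)] qcoh_Id(1)[OF M] in auto)
  moreover have "Comp (qcoh n d) N M N F G = Id (qcoh n d) N"
  proof (rule qcoh_inj[OF N N])
    have "compose (J_dom nonneg N) ?f g = (\<lambda>x\<in>J_dom nonneg N. x)"
      using surj by (auto simp: compose_def fun_eq_iff g_def f_inv_into_f)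
    then show "qhom nonneg N N (Comp (qcoh n d) N M N F G) = qhom nonneg N N (Id (qcoh n d) N)"
      using qcoh_Comp(2)[OF N M N G(1) F subset_refl sepM sepN] qcoh_Id(2)[OF N subset_refl sepN] G(2) by simp
  qed (use qcoh_Comp(1)[OF N M N G(1) F] qcoh_Id(1)[OF N] in auto)
  ultimately show ?thesis unfolding is_iso_def using F G(1) by blast
qed

end

section \<open>Embeddings into the universe\<close>

text \<open>Says that the cardinality of \<open>A\<close> is at most that of the universe; this is
  what a module needs in order to have a copy with carrier in \<open>'u\<close>.\<close>

definition embeds :: "'u itself \<Rightarrow> 'a set \<Rightarrow> bool" where
  "embeds U A \<longleftrightarrow> (\<exists>f :: 'a \<Rightarrow> 'u. inj_on f A)"

lemma embeds_inj:
  assumes "embeds U B" "inj_on f A" "f ` A \<subseteq> B"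
  shows "embeds U A"
  using assms unfolding embeds_def by (meson comp_inj_on inj_on_subset)

lemma embeds_image: "embeds U A \<Longrightarrow> embeds U (f ` A)"
  by (rule embeds_inj[of U A "inv_into A f"]) (auto simp: inj_on_inv_into inv_into_into)

lemma embeds_subset: "\<lbrakk>embeds U B; A \<subseteq> B\<rbrakk> \<Longrightarrow> embeds U A"
  unfolding embeds_def using inj_on_subset by blast

lemma inj_pair_ex:
  assumes "infinite (UNIV :: 'u set)"
  shows "\<exists>p :: 'u \<times> 'u \<Rightarrow> 'u. inj p"
proof -
  have "(card_of ((UNIV :: 'u set) \<times> (UNIV :: 'u set)), card_of (UNIV :: 'u set)) \<in> ordLeq"
    by (rule ordIso_imp_ordLeq[OF card_of_Times_same_infinite[OF assms]])
  then show ?thesis by (auto simp flip: card_of_ordLeq)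
qed

lemma embeds_Times:
  assumes "infinite (UNIV :: 'u set)" "embeds TYPE('u) A" "embeds TYPE('u) B"
  shows "embeds TYPE('u) (A \<times> B)"
proof -
  obtain p :: "'u \<times> 'u \<Rightarrow> 'u" where p: "inj p" using inj_pair_ex[OF assms(1)] by blast
  obtain f where f: "inj_on (f :: _ \<Rightarrow> 'u) A" using assms(2) by (auto simp: embeds_def)
  obtain g where g: "inj_on (g :: _ \<Rightarrow> 'u) B" using assms(3) by (auto simp: embeds_def)
  have "inj_on (p \<circ> map_prod f g) (A \<times> B)"
    using map_prod_inj_on[OF f g] inj_on_subset[OF p] by (intro comp_inj_on) auto
  then show ?thesis unfolding embeds_def by blast
qed

lemma embeds_countable:
  assumes "infinite (UNIV :: 'u set)" "countable A"
  shows "embeds TYPE('u) A"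
proof -
  obtain f :: "nat \<Rightarrow> 'u" where "inj f" using infinite_countable_subset[OF assms(1)] by blast
  moreover obtain g :: "_ \<Rightarrow> nat" where "inj_on g A" using assms(2) by (auto simp: countable_def)
  ultimately have "inj_on (f \<circ> g) A" by (simp add: comp_inj_on inj_on_subset)
  then show ?thesis unfolding embeds_def by blast
qed

lemma inj_list_ex:
  assumes "infinite (UNIV :: 'u set)"
  shows "\<exists>p :: 'u list \<Rightarrow> 'u. inj p"
proof -
  obtain p :: "'u \<times> 'u \<Rightarrow> 'u" where p: "inj p" using inj_pair_ex[OF assms] by blast
  obtain c :: "nat \<Rightarrow> 'u" where c: "inj c" using infinite_countable_subset[OF assms] by blast
  \<comment> \<open>Nested pairs code lists of one given length injectively; the code does not
    reveal the length, which is therefore stored in front of it.\<close>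
  define q where "q xs = foldr (\<lambda>x y. p (x, y)) xs undefined" for xs :: "'u list"
  have q: "xs = ys" if "length xs = length ys" "q xs = q ys" for xs ys
    using that
  proof (induction xs ys rule: list_induct2)
    case (Cons x xs y ys)
    then have "p (x, q xs) = p (y, q ys)" by (simp add: q_def)
    then show ?case using injD[OF p] Cons by blast
  qed simp
  have "inj (\<lambda>xs. p (c (length xs), q xs))"
  proof
    fix xs ys assume "p (c (length xs), q xs) = p (c (length ys), q ys)"
    then have "c (length xs) = c (length ys)" "q xs = q ys" using injD[OF p] by blast+
    then show "xs = ys" using injD[OF c] q by blast
  qed
  then show ?thesis by blast
qed

lemma embeds_lists:
  assumes "infinite (UNIV :: 'u set)" "embeds TYPE('u) A"
  shows "embeds TYPE('u) (lists A)"
proof -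
  obtain p :: "'u list \<Rightarrow> 'u" where p: "inj p" using inj_list_ex[OF assms(1)] by blast
  obtain f :: "_ \<Rightarrow> 'u" where f: "inj_on f A" using assms(2) by (auto simp: embeds_def)
  have "inj_on (p \<circ> map f) (lists A)"
  proof (rule comp_inj_on)
    show "inj_on (map f) (lists A)" using f by (simp add: inj_on_map_lists)
    show "inj_on p (map f ` lists A)" using p by (rule inj_on_subset) simp
  qed
  then show ?thesis unfolding embeds_def by blast
qed

lemma embeds_finite_subsets:
  assumes "infinite (UNIV :: 'u set)" "embeds TYPE('u) A"
  shows "embeds TYPE('u) {F. F \<subseteq> A \<and> finite F}"
proof -
  have "{F. F \<subseteq> A \<and> finite F} \<subseteq> set ` lists A"
  proof
    fix F assume F: "F \<in> {F. F \<subseteq> A \<and> finite F}"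
    then obtain xs where "set xs = F" using finite_list by blast
    then show "F \<in> set ` lists A" using F by (intro image_eqI[of _ _ xs]) auto
  qed
  then show ?thesis using embeds_subset embeds_image embeds_lists[OF assms] by metis
qed

text \<open>A finitely supported coefficient function is recorded by the finite set of its nonzero
  values together with their words, and the Weyl algebra is an image of the set of such
  functions.\<close>

lemma embeds_weyl:
  fixes \<iota> :: "'k::field \<Rightarrow> 'u"
  assumes "infinite (UNIV :: 'u set)" "inj \<iota>"
  shows "embeds TYPE('u) (carrier (weyl n :: 'k weyl ring))"
proof -
  have "countable (UNIV :: letter set)"
  proof -
    have "(UNIV :: letter set) = range Lx \<union> range Ld" by (auto intro: letter.exhaust)
    then show ?thesis by (metis countable_Un countable_image countableI_type)
  qed
  then have "countable (lists (UNIV :: letter set))" by (rule countable_lists)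
  then have "embeds TYPE('u) (UNIV :: letter list set)"
    using embeds_countable[OF assms(1)] by (simp add: lists_UNIV)
  moreover have "embeds TYPE('u) (UNIV :: 'k set)" using assms(2) by (auto simp: embeds_def)
  ultimately have "embeds TYPE('u) {F. F \<subseteq> (UNIV :: letter list set) \<times> (UNIV :: 'k set) \<and> finite F}"
    by (intro embeds_finite_subsets embeds_Times assms(1))
  then have "embeds TYPE('u) (carrier (free_alg n :: (letter list \<Rightarrow> 'k) ring))"
  proof (rule embeds_inj)
    let ?g = "\<lambda>f. (\<lambda>w. (w, f w)) ` {w. f w \<noteq> (0 :: 'k)}"
    show "inj_on ?g (carrier (free_alg n))"
    proof
      fix f f' assume eq: "?g f = ?g f'"
      show "f = f'"
      proof
        fix w
        have "(w, f w) \<in> ?g f \<longleftrightarrow> (w, f w) \<in> ?g f'" "(w, f' w) \<in> ?g f \<longleftrightarrow> (w, f' w) \<in> ?g f'" using eq by auto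
        then show "f w = f' w" by auto
      qed
    qed
  qed (auto simp: free_alg_carrier)
  then have "embeds TYPE('u) (weyl_class n ` carrier (free_alg n :: (letter list \<Rightarrow> 'k) ring))"
    by (rule embeds_image)
  then show ?thesis by (rule embeds_subset) (auto elim: weyl_class_surj)
qed

section \<open>Submodules spanned by weight vectors\<close>

lemma gspan_carrier:
  assumes "left_module (weyl n) (M :: ('k::field_char_0, 'u) dmod)"
  shows "gspan M (eig n d M) \<subseteq> carrier M"
proof
  interpret left_module "weyl n" M by fact
  fix m assume "m \<in> gspan M (eig n d M)"
  then show "m \<in> carrier M" by induction (auto simp: eig_iff)
qed

lemma gspan_submodule:
  assumes M: "left_module (weyl n) (M :: ('k::field_char_0, 'u) dmod)"
  shows "submodule (gspan M (eig n d M)) (weyl n) M"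
proof (rule submoduleI'[OF M gspan_carrier[OF M] gspan.zero gspan.add])
  interpret left_module "weyl n" M by fact
  fix r :: "'k weyl" and x assume r: "r \<in> carrier (weyl n)" and x: "x \<in> gspan M (eig n d M)"
  from r show "r \<odot>\<^bsub>M\<^esub> x \<in> gspan M (eig n d M)"
  proof (induction r rule: weyl_induct_part[where d = d])
    case (part q P)
    from x show ?case
    proof induction
      case zero
      then show ?case using gspan.zero[of M] weyl_part_carrier[OF part] by simp
    next
      case (part v k)
      then show ?case using eig_part[OF M \<open>P \<in> weyl_part n d q\<close>] gspan.part by metis
    next
      case (add x y)
      then show ?case using gspan.add[OF add(3,4)] gspan_carrier[OF M] weyl_part_carrier[OF part]
        by (auto simp: smult_r_distr subset_iff)
    qed
  next
    case (add P P')
    have "x \<in> carrier M" using x gspan_carrier[OF M] by blast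
    then show ?case using gspan.add[OF add(3,4)] add(1,2) by (simp add: smult_l_distr)
  qed
qed auto

text \<open>This cuts the Euler part out of an arbitrary module. Coinduced modules are defined
  without any finiteness condition and become objects of the category in this way.\<close>

lemma euler0_gspan:
  assumes M: "left_module (weyl n) (M :: ('k::field_char_0, 'u) dmod)"
  shows "euler0 n d (M\<lparr>carrier := gspan M (eig n d M)\<rparr>)"
proof (rule euler0I)
  let ?M = "M\<lparr>carrier := gspan M (eig n d M)\<rparr>"
  show "left_module (weyl n) ?M" by (rule left_module_restrict[OF M gspan_submodule[OF M]])
  have e: "eig n d ?M k = eig n d M k" for k
    using gspan.part[of _ "eig n d M" k M] by (auto simp: eig_restrict[OF gspan_carrier[OF M]])
  fix m assume "m \<in> carrier ?M"
  then have "m \<in> gspan M (eig n d M)" by simp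
  then show "m \<in> gspan ?M (eig n d ?M)"
  proof induction
    case zero
    then show ?case using gspan.zero[of ?M] by simp
  next
    case (part v k)
    then show ?case using e gspan.part by metis
  next
    case (add x y)
    then show ?case using gspan.add[OF add(3,4)] by simp
  qed
qed

lemma euler0_sub_gspan:
  assumes M: "left_module (weyl n) (M :: ('k::field_char_0, 'u) dmod)"
    and H: "submodule H (weyl n) M" "H \<subseteq> gspan M (eig n d M)"
  shows "euler0 n d (M\<lparr>carrier := H\<rparr>)"
proof -
  have "submodule H (weyl n) (M\<lparr>carrier := gspan M (eig n d M)\<rparr>)"
    using submodule_facts[OF M H(1)] H(2)
    by (intro submoduleI' left_module_restrict[OF M gspan_submodule[OF M]]) auto
  from euler0_restrict[OF euler0_gspan[OF M] this] show ?thesis by simp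
qed

text \<open>A bound on the cardinality is enough to move a module into the universe: the structure
  is carried along an injection of its carrier.\<close>

lemma transport_module:
  assumes M: "left_module (weyl n) (M :: ('k::field_char_0, 'v) dmod)" and "euler0 n d M" and "embeds TYPE('u) (carrier M)"
  obtains T :: "('k::field_char_0, 'u) dmod" and s where "euler0 n d T" "bij_betw s (carrier T) (carrier M)"
    "\<And>x y. \<lbrakk>x \<in> carrier T; y \<in> carrier T\<rbrakk> \<Longrightarrow> s (x \<oplus>\<^bsub>T\<^esub> y) = s x \<oplus>\<^bsub>M\<^esub> s y"
    "\<And>r x. \<lbrakk>r \<in> carrier (weyl n); x \<in> carrier T\<rbrakk> \<Longrightarrow> s (r \<odot>\<^bsub>T\<^esub> x) = r \<odot>\<^bsub>M\<^esub> s x"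
    "\<And>k x. x \<in> eig n d T k \<longleftrightarrow> x \<in> carrier T \<and> s x \<in> eig n d M k" "s \<zero>\<^bsub>T\<^esub> = \<zero>\<^bsub>M\<^esub>"
proof -
  interpret left_module "weyl n" M by fact
  obtain e :: "'v \<Rightarrow> 'u" where e: "inj_on e (carrier M)" using assms(3) by (auto simp: embeds_def)
  define s where "s = inv_into (carrier M) e"
  have se: "s (e x) = x" if "x \<in> carrier M" for x using e that by (simp add: s_def)
  define T :: "('k, 'u) dmod" where "T = \<lparr>carrier = e ` carrier M, mult = undefined, one = undefined, zero = e \<zero>\<^bsub>M\<^esub>,
    add = (\<lambda>x y. e (s x \<oplus>\<^bsub>M\<^esub> s y)), smult = (\<lambda>r x. e (r \<odot>\<^bsub>M\<^esub> s x))\<rparr>"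
  have T: "carrier T = e ` carrier M" "\<zero>\<^bsub>T\<^esub> = e \<zero>\<^bsub>M\<^esub>" "\<And>x y. x \<oplus>\<^bsub>T\<^esub> y = e (s x \<oplus>\<^bsub>M\<^esub> s y)"
    "\<And>r x. r \<odot>\<^bsub>T\<^esub> x = e (r \<odot>\<^bsub>M\<^esub> s x)"
    by (simp_all add: T_def)
  have lm: "left_module (weyl n) T"
  proof (intro left_module.intro left_module_axioms.intro R.ring_axioms)
    show "abelian_group T"
    proof (rule abelian_groupI, goal_cases)
      case (6 x)
      then obtain v where v: "v \<in> carrier M" "x = e v" by (auto simp: T)
      then show ?case by (intro bexI[of _ "e (\<ominus>\<^bsub>M\<^esub> v)"]) (auto simp: T se M.l_neg)
    qed (auto simp: T se M.a_ac)
  qed (auto simp: T se smult_l_distr smult_r_distr smult_assoc1)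
  have eigT: "x \<in> eig n d T k \<longleftrightarrow> x \<in> carrier T \<and> s x \<in> eig n d M k" for x k
    using e by (auto simp: eig_iff T se euler_closed weyl_const_closed dest: inj_onD)
  interpret gM: graded_group M "eig n d M" by (rule euler0D[OF assms(2)])
  have "e x \<in> gspan T (eig n d T)" if "x \<in> carrier M" for x
    using that
  proof (induction x rule: gM.graded_induct)
    case zero
    then show ?case using gspan.zero[of T] by (simp add: T)
  next
    case (part k v)
    then have "e v \<in> eig n d T k" using gM.V_carrier[OF part] by (simp add: eigT T se)
    then show ?case by (rule gspan.part)
  next
    case (add x y)
    then show ?case using gspan.add[OF add(3,4)] by (simp add: T se)
  qed
  then have "euler0 n d T" by (intro euler0I[OF lm]) (auto simp: T)
  then show thesis
  proof (rule that[of T s, OF _ _ _ _ eigT])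
    show "bij_betw s (carrier T) (carrier M)"
      unfolding T s_def by (rule inj_on_imp_bij_betw[OF e, THEN bij_betw_inv_into])
  qed (auto simp: T se)
qed

section \<open>Coinduced modules\<close>

text \<open>\<open>V\<close> is a module that is defined in the degrees \<open>J\<close> only. It is coinduced to a module over the
  whole Weyl algebra, whose elements \<open>z\<close> are recorded by the functions
  \<open>(P, j) \<mapsto> (P z)\<^sub>j\<close>, \<open>j \<in> J\<close>.\<close>

locale partial_module = weights n d + abelian_group G
  for n d and G (structure) +
  fixes J :: "int set" and V :: "int \<Rightarrow> 'v set" and act :: "'k::field_char_0 weyl \<Rightarrow> 'v \<Rightarrow> 'v"
  assumes sub: "j \<in> J \<Longrightarrow> additive_subgroup (V j) G"
    and act_closed: "\<lbrakk>j \<in> J; q + j \<in> J; P \<in> weyl_part n d q; y \<in> V j\<rbrakk> \<Longrightarrow> act P y \<in> V (q + j)"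
    and act_add_r: "\<lbrakk>j \<in> J; q + j \<in> J; P \<in> weyl_part n d q; y \<in> V j; z \<in> V j\<rbrakk> \<Longrightarrow> act P (y \<oplus> z) = act P y \<oplus> act P z"
    and act_add_l: "\<lbrakk>j \<in> J; q + j \<in> J; P \<in> weyl_part n d q; P' \<in> weyl_part n d q; y \<in> V j\<rbrakk> \<Longrightarrow>
      act (P \<oplus>\<^bsub>weyl n\<^esub> P') y = act P y \<oplus> act P' y"
    and act_mult: "\<lbrakk>j \<in> J; q + j \<in> J; r + (q + j) \<in> J; P \<in> weyl_part n d q; Q \<in> weyl_part n d r; y \<in> V j\<rbrakk> \<Longrightarrow>
      act (Q \<otimes>\<^bsub>weyl n\<^esub> P) y = act Q (act P y)"
    and act_one: "\<lbrakk>j \<in> J; y \<in> V j\<rbrakk> \<Longrightarrow> act \<one>\<^bsub>weyl n\<^esub> y = y"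
    and act_euler: "\<lbrakk>j \<in> J; y \<in> V j\<rbrakk> \<Longrightarrow> act (euler n d) y = act (weyl_const n (of_int j)) y"
begin

abbreviation D :: "'k weyl ring" where "D \<equiv> weyl n"

sublocale D: ring D by (rule ring_weyl)
sublocale gD: graded_group D "weyl_part n d" by (rule graded_weyl)

lemma V_carrier: "\<lbrakk>j \<in> J; y \<in> V j\<rbrakk> \<Longrightarrow> y \<in> carrier G"
  using additive_subgroup.a_subset[OF sub] by blast

lemma V_zero: "j \<in> J \<Longrightarrow> \<zero> \<in> V j"
  using additive_subgroup.zero_closed[OF sub] .

lemma V_add: "\<lbrakk>j \<in> J; y \<in> V j; z \<in> V j\<rbrakk> \<Longrightarrow> y \<oplus> z \<in> V j"
  using additive_subgroup.a_closed[OF sub] .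

lemma V_minus: "\<lbrakk>j \<in> J; y \<in> V j\<rbrakk> \<Longrightarrow> \<ominus> y \<in> V j"
  using additive_subgroup.a_inv_closed[OF sub] .

lemma act_const_closed: "\<lbrakk>j \<in> J; y \<in> V j\<rbrakk> \<Longrightarrow> act (weyl_const n c) y \<in> V j"
  using act_closed[OF _ _ weyl_part_const, of j y c] by simp

lemma act_zero_r: "\<lbrakk>j \<in> J; q + j \<in> J; P \<in> weyl_part n d q\<rbrakk> \<Longrightarrow> act P \<zero> = \<zero>"
proof -
  assume a: "j \<in> J" "q + j \<in> J" "P \<in> weyl_part n d q"
  have "act P \<zero> \<oplus> act P \<zero> = act P \<zero>" using act_add_r[OF a V_zero[OF a(1)] V_zero[OF a(1)]] by simp
  moreover have "act P \<zero> \<in> carrier G" using V_carrier[OF a(2) act_closed[OF a V_zero[OF a(1)]]] .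
  ultimately show ?thesis using add.l_cancel_one' by metis
qed

lemma act_const_inj:
  assumes j: "j \<in> J" "y \<in> V j" and eq: "act (weyl_const n a) y = act (weyl_const n b) y" and "a \<noteq> b"
  shows "y = \<zero>"
proof -
  have "weyl_const n a = weyl_const n (a - b) \<oplus>\<^bsub>D\<^esub> weyl_const n b" by (simp flip: weyl_const_add)
  then have "act (weyl_const n a) y = act (weyl_const n (a - b)) y \<oplus> act (weyl_const n b) y"
    using act_add_l[OF j(1) _ weyl_part_const weyl_part_const j(2), of "a - b" b] j(1) by simp
  moreover have c: "act (weyl_const n c) y \<in> carrier G" for c using V_carrier[OF j(1) act_const_closed[OF j]] .
  ultimately have "act (weyl_const n (a - b)) y \<oplus> act (weyl_const n b) y = \<zero> \<oplus> act (weyl_const n b) y"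
    using eq by simp
  then have z: "act (weyl_const n (a - b)) y = \<zero>" using c add.right_cancel by blast
  have "y = act (weyl_const n (inverse (a - b)) \<otimes>\<^bsub>D\<^esub> weyl_const n (a - b)) y"
    using act_one[OF j] assms(4) by (simp add: weyl_const_inverse)
  also have "\<dots> = act (weyl_const n (inverse (a - b))) \<zero>"
    using act_mult[OF j(1) _ _ weyl_part_const weyl_part_const j(2), of "inverse (a - b)" "a - b"] j(1) z by simp
  also have "\<dots> = \<zero>" using act_zero_r[OF j(1) _ weyl_part_const] j(1) by simp
  finally show ?thesis .
qed

text \<open>The homomorphisms, of modules in the degrees \<open>J\<close>, from the Weyl algebra to
  \<open>V\<close>; operators act on them by right multiplication of the argument. Values outside
  the carrier and outside \<open>J\<close> are fixed to zero so that equal elements are equal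
  functions.\<close>

definition coind_set :: "('k weyl \<Rightarrow> int \<Rightarrow> 'v) set" where
  "coind_set = {Z. (\<forall>P j. P \<notin> carrier D \<or> j \<notin> J \<longrightarrow> Z P j = \<zero>) \<and>
     (\<forall>P\<in>carrier D. \<forall>j\<in>J. Z P j \<in> V j) \<and>
     (\<forall>P\<in>carrier D. \<forall>P'\<in>carrier D. \<forall>j\<in>J. Z (P \<oplus>\<^bsub>D\<^esub> P') j = Z P j \<oplus> Z P' j) \<and>
     (\<forall>j\<in>J. \<forall>q. q + j \<in> J \<longrightarrow> (\<forall>Q\<in>weyl_part n d q. \<forall>P\<in>carrier D. Z (Q \<otimes>\<^bsub>D\<^esub> P) (q + j) = act Q (Z P j)))}"

definition coind :: "('k weyl, 'k weyl \<Rightarrow> int \<Rightarrow> 'v) module" where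
  "coind = \<lparr>carrier = coind_set, mult = undefined, one = undefined, zero = (\<lambda>P j. \<zero>),
     add = (\<lambda>Z Z' P j. Z P j \<oplus> Z' P j),
     smult = (\<lambda>R Z P j. if P \<in> carrier D \<and> j \<in> J then Z (P \<otimes>\<^bsub>D\<^esub> R) j else \<zero>)\<rparr>"

lemma coind_simps:
  "carrier coind = coind_set" "\<zero>\<^bsub>coind\<^esub> = (\<lambda>P j. \<zero>)" "Z \<oplus>\<^bsub>coind\<^esub> Z' = (\<lambda>P j. Z P j \<oplus> Z' P j)"
  "R \<odot>\<^bsub>coind\<^esub> Z = (\<lambda>P j. if P \<in> carrier D \<and> j \<in> J then Z (P \<otimes>\<^bsub>D\<^esub> R) j else \<zero>)"
  by (simp_all add: coind_def)

lemma coindD: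
  assumes "Z \<in> coind_set"
  shows "P \<notin> carrier D \<Longrightarrow> Z P j = \<zero>" "j \<notin> J \<Longrightarrow> Z P j = \<zero>"
    "\<lbrakk>P \<in> carrier D; j \<in> J\<rbrakk> \<Longrightarrow> Z P j \<in> V j"
    "\<lbrakk>P \<in> carrier D; P' \<in> carrier D; j \<in> J\<rbrakk> \<Longrightarrow> Z (P \<oplus>\<^bsub>D\<^esub> P') j = Z P j \<oplus> Z P' j"
    "\<lbrakk>j \<in> J; q + j \<in> J; Q \<in> weyl_part n d q; P \<in> carrier D\<rbrakk> \<Longrightarrow> Z (Q \<otimes>\<^bsub>D\<^esub> P) (q + j) = act Q (Z P j)"
    "Z P j \<in> carrier G"
proof -
  show 1: "P \<notin> carrier D \<Longrightarrow> Z P j = \<zero>" "j \<notin> J \<Longrightarrow> Z P j = \<zero>"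
    "\<lbrakk>P \<in> carrier D; j \<in> J\<rbrakk> \<Longrightarrow> Z P j \<in> V j"
    "\<lbrakk>P \<in> carrier D; P' \<in> carrier D; j \<in> J\<rbrakk> \<Longrightarrow> Z (P \<oplus>\<^bsub>D\<^esub> P') j = Z P j \<oplus> Z P' j"
    "\<lbrakk>j \<in> J; q + j \<in> J; Q \<in> weyl_part n d q; P \<in> carrier D\<rbrakk> \<Longrightarrow> Z (Q \<otimes>\<^bsub>D\<^esub> P) (q + j) = act Q (Z P j)"
    for P P' Q j q
    using assms unfolding coind_set_def by auto
  show "Z P j \<in> carrier G"
    using 1(1)[of P j] 1(2)[of j P] 1(3)[of P j] V_carrier[of j "Z P j"] by (cases "P \<in> carrier D \<and> j \<in> J") auto
qed

lemma coindI:
  assumes "\<And>P j. P \<notin> carrier D \<or> j \<notin> J \<Longrightarrow> Z P j = \<zero>"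
    "\<And>P j. \<lbrakk>P \<in> carrier D; j \<in> J\<rbrakk> \<Longrightarrow> Z P j \<in> V j"
    "\<And>P P' j. \<lbrakk>P \<in> carrier D; P' \<in> carrier D; j \<in> J\<rbrakk> \<Longrightarrow> Z (P \<oplus>\<^bsub>D\<^esub> P') j = Z P j \<oplus> Z P' j"
    "\<And>j q Q P. \<lbrakk>j \<in> J; q + j \<in> J; Q \<in> weyl_part n d q; P \<in> carrier D\<rbrakk> \<Longrightarrow> Z (Q \<otimes>\<^bsub>D\<^esub> P) (q + j) = act Q (Z P j)"
  shows "Z \<in> coind_set"
  using assms unfolding coind_set_def by auto

lemma left_module_coind: "left_module D coind"
proof (intro left_module.intro left_module_axioms.intro D.ring_axioms)
  show "abelian_group coind"
  proof (rule abelian_groupI, goal_cases)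
    case (1 Z Z')
    then have Z: "Z \<in> coind_set" "Z' \<in> coind_set" by (auto simp: coind_simps)
    note c = coindD[OF Z(1)] coindD[OF Z(2)]
    show ?case unfolding coind_simps
    proof (rule coindI)
      show "Z (P \<oplus>\<^bsub>D\<^esub> P') j \<oplus> Z' (P \<oplus>\<^bsub>D\<^esub> P') j = (Z P j \<oplus> Z' P j) \<oplus> (Z P' j \<oplus> Z' P' j)"
        if "P \<in> carrier D" "P' \<in> carrier D" "j \<in> J" for P P' :: "'k weyl" and j
        using that c(4,10) c(6,12) by (simp add: a_ac)
    qed (use c V_add act_add_r in auto)
  next
    case 2
    show ?case unfolding coind_simps by (rule coindI) (use V_zero act_zero_r in auto)
  next
    case (6 Z)
    then have Z: "Z \<in> coind_set" by (auto simp: coind_simps)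
    note c = coindD[OF Z]
    have "(\<lambda>P j. \<ominus> Z P j) \<in> coind_set"
    proof (rule coindI)
      fix j q and Q P :: "'k weyl" assume a: "j \<in> J" "q + j \<in> J" "Q \<in> weyl_part n d q" "P \<in> carrier D"
      have "act Q (\<ominus> Z P j) \<oplus> act Q (Z P j) = \<zero>"
        using act_add_r[OF a(1-3) V_minus[OF a(1) c(3)[OF a(4,1)]] c(3)[OF a(4,1)]] act_zero_r[OF a(1-3)] c(6)
        by (simp add: l_neg)
      then have "\<ominus> act Q (Z P j) = act Q (\<ominus> Z P j)"
        using V_carrier[OF a(2) act_closed[OF a(1-3)]] c(3)[OF a(4,1)] V_minus[OF a(1)] by (intro minus_equality) auto
      then show "\<ominus> Z (Q \<otimes>\<^bsub>D\<^esub> P) (q + j) = act Q (\<ominus> Z P j)" using c(5)[OF a] by simp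
    qed (use c V_minus in \<open>auto simp: minus_add\<close>)
    then show ?case using c(6) by (intro bexI[of _ "\<lambda>P j. \<ominus> Z P j"]) (auto simp: coind_simps l_neg)
  qed (auto simp: coind_simps a_ac coindD(6) fun_eq_iff)
  fix R Z assume R: "R \<in> carrier D" and "Z \<in> carrier coind"
  then have Z: "Z \<in> coind_set" by (simp add: coind_simps)
  note c = coindD[OF Z]
  show "R \<odot>\<^bsub>coind\<^esub> Z \<in> carrier coind"
    unfolding coind_simps
  proof (rule coindI)
    fix j q and Q P :: "'k weyl" assume a: "j \<in> J" "q + j \<in> J" "Q \<in> weyl_part n d q" "P \<in> carrier D"
    then show "(if Q \<otimes>\<^bsub>D\<^esub> P \<in> carrier D \<and> q + j \<in> J then Z (Q \<otimes>\<^bsub>D\<^esub> P \<otimes>\<^bsub>D\<^esub> R) (q + j) else \<zero>) =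
        act Q (if P \<in> carrier D \<and> j \<in> J then Z (P \<otimes>\<^bsub>D\<^esub> R) j else \<zero>)"
      using c(5)[OF a(1-3), of "P \<otimes>\<^bsub>D\<^esub> R"] R weyl_part_carrier[OF a(3)] by (simp add: D.m_assoc)
  qed (use R c in \<open>auto simp: D.l_distr\<close>)
  fix R' assume R': "R' \<in> carrier D"
  show "(R \<oplus>\<^bsub>D\<^esub> R') \<odot>\<^bsub>coind\<^esub> Z = R \<odot>\<^bsub>coind\<^esub> Z \<oplus>\<^bsub>coind\<^esub> R' \<odot>\<^bsub>coind\<^esub> Z"
    unfolding coind_simps using R R' c by (auto simp: fun_eq_iff D.r_distr)
  show "(R \<otimes>\<^bsub>D\<^esub> R') \<odot>\<^bsub>coind\<^esub> Z = R \<odot>\<^bsub>coind\<^esub> (R' \<odot>\<^bsub>coind\<^esub> Z)"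
    unfolding coind_simps using R R' c by (auto simp: fun_eq_iff D.m_assoc)
next
  fix Z assume "Z \<in> carrier coind"
  then show "\<one>\<^bsub>D\<^esub> \<odot>\<^bsub>coind\<^esub> Z = Z" using coindD(1,2)[of Z] by (auto simp: coind_simps fun_eq_iff)
qed (auto simp: coind_simps fun_eq_iff coindD)

lemma coind_smult: "\<lbrakk>R \<in> carrier D; j \<in> J\<rbrakk> \<Longrightarrow> (R \<odot>\<^bsub>coind\<^esub> Z) \<one>\<^bsub>D\<^esub> j = Z R j"
  by (simp add: coind_simps)

text \<open>On a value in degree i the Euler field acts by i, while moving it past P to
  \<open>Z\<close> gives q + k.\<close>

lemma coind_eig_zero:
  assumes Z: "Z \<in> eig n d coind k" and P: "P \<in> weyl_part n d q" and i: "i \<noteq> q + k"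
  shows "Z P i = \<zero>"
proof (cases "i \<in> J")
  case True
  have Zc: "Z \<in> coind_set" using Z by (simp add: eig_iff coind_simps)
  note c = coindD[OF Zc] and Pc = weyl_part_carrier[OF P]
  have "(euler n d \<odot>\<^bsub>coind\<^esub> Z) P i = (weyl_const n (of_int k) \<odot>\<^bsub>coind\<^esub> Z) P i"
    using Z by (simp add: eig_iff)
  then have e: "Z (P \<otimes>\<^bsub>D\<^esub> euler n d) i = Z (P \<otimes>\<^bsub>D\<^esub> weyl_const n (of_int k)) i"
    using True Pc by (simp add: coind_simps)
  have cst: "Z (weyl_const n a \<otimes>\<^bsub>D\<^esub> P) i = act (weyl_const n a) (Z P i)" for a
    using c(5)[OF True _ weyl_part_const Pc, of a] True by simp
  have "act (weyl_const n (of_int i)) (Z P i) = act (euler n d) (Z P i)"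
    using act_euler[OF True c(3)[OF Pc True]] by simp
  also have "\<dots> = Z (euler n d \<otimes>\<^bsub>D\<^esub> P) i" using c(5)[OF True _ euler_part Pc] True by simp
  also have "\<dots> = Z (P \<otimes>\<^bsub>D\<^esub> euler n d) i \<oplus> Z (weyl_const n (of_int q) \<otimes>\<^bsub>D\<^esub> P) i"
    unfolding euler_comm[OF P] using Pc True by (simp add: c(4) euler_closed weyl_const_closed)
  also have "Z (P \<otimes>\<^bsub>D\<^esub> euler n d) i = Z (weyl_const n (of_int k) \<otimes>\<^bsub>D\<^esub> P) i"
    unfolding e weyl_const_comm[OF Pc, symmetric] ..
  finally have "act (weyl_const n (of_int i)) (Z P i) = act (weyl_const n (of_int k) \<oplus>\<^bsub>D\<^esub> weyl_const n (of_int q)) (Z P i)"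
    unfolding cst using act_add_l[OF True _ weyl_part_const weyl_part_const c(3)[OF Pc True]] True by simp
  then have "act (weyl_const n (of_int i)) (Z P i) = act (weyl_const n (of_int (q + k))) (Z P i)"
    by (simp add: add.commute flip: weyl_const_add)
  moreover have "of_int i \<noteq> (of_int (q + k) :: 'k)" using i by (simp only: of_int_eq_iff not_False_eq_True)
  ultimately show ?thesis by (rule act_const_inj[OF True c(3)[OF Pc True]])
qed (use Z in \<open>simp add: eig_iff coind_simps coindD\<close>)

lemma coind_eig_value:
  assumes "Z \<in> eig n d coind k" "P \<in> weyl_part n d q" "k \<in> J" "q + k \<in> J"
  shows "Z P (q + k) = act P (Z \<one>\<^bsub>D\<^esub> k)"
proof -
  have "Z \<in> coind_set" using assms(1) by (simp add: eig_iff coind_simps)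
  from coindD(5)[OF this assms(3,4,2) D.one_closed] show ?thesis using weyl_part_carrier[OF assms(2)] by simp
qed

lemma coind_ext:
  assumes "Z \<in> coind_set" "Z' \<in> coind_set" "\<And>q P j. \<lbrakk>P \<in> weyl_part n d q; j \<in> J\<rbrakk> \<Longrightarrow> Z P j = Z' P j"
  shows "Z = Z'"
proof (intro ext)
  fix P j
  have "Z P j = Z' P j" if "P \<in> carrier D" "j \<in> J"
    using that(1) by (induction P rule: weyl_induct_part[where d = d]) (auto simp: assms(3) that(2) coindD(4)[OF assms(1)] coindD(4)[OF assms(2)])
  then show "Z P j = Z' P j" using coindD(1)[OF assms(1), of P j] coindD(2)[OF assms(1), of j P]
      coindD(1)[OF assms(2), of P j] coindD(2)[OF assms(2), of j P]
    by (cases "P \<in> carrier D"; cases "j \<in> J") simp_all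
qed

text \<open>Coinduction does not change the degrees in \<open>J\<close>: evaluation at the unit is
  inverted by sending \<open>y\<close> to the function whose value at P in degree j is the part of P
  of degree j - k applied to \<open>y\<close>.\<close>

lemma coind_eig_bij:
  assumes k: "k \<in> J"
  shows "bij_betw (\<lambda>Z. Z \<one>\<^bsub>D\<^esub> k) (eig n d coind k) (V k)"
  unfolding bij_betw_def
proof (intro conjI inj_onI equalityI subsetI)
  fix Z Z' assume Z: "Z \<in> eig n d coind k" "Z' \<in> eig n d coind k" and eq: "Z \<one>\<^bsub>D\<^esub> k = Z' \<one>\<^bsub>D\<^esub> k"
  show "Z = Z'"
  proof (rule coind_ext)
    fix q j and P :: "'k weyl" assume P: "P \<in> weyl_part n d q" and j: "j \<in> J"
    show "Z P j = Z' P j"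
      using coind_eig_zero[OF Z(1) P] coind_eig_zero[OF Z(2) P] coind_eig_value[OF Z(1) P k] coind_eig_value[OF Z(2) P k] eq j
      by (cases "j = q + k") auto
  qed (use Z in \<open>auto simp: eig_iff coind_simps\<close>)
next
  fix y assume "y \<in> (\<lambda>Z. Z \<one>\<^bsub>D\<^esub> k) ` eig n d coind k"
  then show "y \<in> V k" using k by (auto simp: eig_iff coind_simps coindD)
next
  fix y assume y: "y \<in> V k"
  let ?c = "gcomp D (weyl_part n d)"
  let ?Z = "\<lambda>(P :: 'k weyl) j. if P \<in> carrier D \<and> j \<in> J then act (?c P (j - k)) y else \<zero>"
  have kj: "j - k + k \<in> J" if "j \<in> J" for j using that by simp
  have Z: "?Z \<in> coind_set"
  proof (rule coindI)
    show "?Z P j \<in> V j" if "P \<in> carrier D" "j \<in> J" for P :: "'k weyl" and j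
      using act_closed[OF k kj[OF that(2)] gD.gcomp_in[OF that(1)] y] that by simp
    show "?Z (P \<oplus>\<^bsub>D\<^esub> P') j = ?Z P j \<oplus> ?Z P' j" if "P \<in> carrier D" "P' \<in> carrier D" "j \<in> J" for P P' :: "'k weyl" and j
      using act_add_l[OF k kj[OF that(3)] gD.gcomp_in[OF that(1)] gD.gcomp_in[OF that(2)] y] that
      by (simp add: gD.gcomp_add)
    fix j q and Q P :: "'k weyl" assume a: "j \<in> J" "q + j \<in> J" "Q \<in> weyl_part n d q" "P \<in> carrier D"
    note Qc = weyl_part_carrier[OF a(3)]
    have "?c (Q \<otimes>\<^bsub>D\<^esub> P) (q + (j - k)) = Q \<otimes>\<^bsub>D\<^esub> ?c P (j - k)"
      using a Qc weyl_part_mult[OF a(3)]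
      by (intro gcomp_map gD.graded_group_axioms) (auto simp: D.r_distr)
    then show "?Z (Q \<otimes>\<^bsub>D\<^esub> P) (q + j) = act Q (?Z P j)"
      using act_mult[OF k kj[OF a(1)] _ gD.gcomp_in[OF a(4)] a(3) y] a Qc by (simp add: add_diff_eq)
  qed auto
  \<comment> \<open>Operators of degree 0 act on this function through their action on
    \<open>y\<close>, where the Euler field and the constant k agree.\<close>
  have "\<And>R :: 'k weyl. \<lbrakk>R \<in> weyl_part n d 0\<rbrakk> \<Longrightarrow> R \<odot>\<^bsub>coind\<^esub> ?Z = (\<lambda>P j. if P \<in> carrier D \<and> j \<in> J then act (?c P (j - k)) (act R y) else \<zero>)"
  proof (intro ext)
    fix R P :: "'k weyl" and j assume R: "R \<in> weyl_part n d 0"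
    note Rc = weyl_part_carrier[OF R]
    have "?c (P \<otimes>\<^bsub>D\<^esub> R) (0 + (j - k)) = ?c P (j - k) \<otimes>\<^bsub>D\<^esub> R" if "P \<in> carrier D"
      using that Rc weyl_part_mult[OF _ R]
      by (intro gcomp_map gD.graded_group_axioms) (auto simp: D.l_distr)
    then show "(R \<odot>\<^bsub>coind\<^esub> ?Z) P j = (if P \<in> carrier D \<and> j \<in> J then act (?c P (j - k)) (act R y) else \<zero>)"
      using act_mult[OF k _ _ R gD.gcomp_in[of P "j - k"] y] k Rc by (simp add: coind_simps)
  qed
  then have Ze: "?Z \<in> eig n d coind k"
    using Z act_euler[OF k y] by (simp add: eig_iff coind_simps(1) euler_part weyl_part_const cong: if_cong)
  have Z1: "?Z \<one>\<^bsub>D\<^esub> k = y"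
    using k gD.gcomp_V[OF weyl_part_one, of 0] act_one[OF k y] by simp
  show "y \<in> (\<lambda>Z. Z \<one>\<^bsub>D\<^esub> k) ` eig n d coind k"
    by (rule image_eqI[of y "\<lambda>Z. Z \<one>\<^bsub>D\<^esub> k" ?Z, OF Z1[symmetric] Ze])
qed

end

section \<open>The right adjoint of the quotient functor\<close>

context weights
begin

text \<open>In the last clause \<partial>_i raises the order by at most one, because exchanging it
  with x_j costs no more than the vector itself.\<close>

lemma xnil_facts:
  assumes M: "left_module (weyl n) (M :: ('k::field, 'u) dmod)"
  shows "xnil n M N \<subseteq> carrier M" "xnil n M N \<subseteq> xnil n M (Suc N)"
    "\<lbrakk>x \<in> xnil n M N; y \<in> xnil n M N\<rbrakk> \<Longrightarrow> x \<oplus>\<^bsub>M\<^esub> y \<in> xnil n M N"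
    "x \<in> xnil n M N \<Longrightarrow> weyl_const n c \<odot>\<^bsub>M\<^esub> x \<in> xnil n M N"
    "\<lbrakk>x \<in> xnil n M N; i \<le> n\<rbrakk> \<Longrightarrow> weyl_x n i \<odot>\<^bsub>M\<^esub> x \<in> xnil n M N"
    "\<lbrakk>x \<in> xnil n M N; i \<le> n\<rbrakk> \<Longrightarrow> weyl_d n i \<odot>\<^bsub>M\<^esub> x \<in> xnil n M (Suc N)"
proof -
  interpret left_module "weyl n" M by fact
  have x0: "weyl_x n i \<odot>\<^bsub>M\<^esub> \<zero>\<^bsub>M\<^esub> = \<zero>\<^bsub>M\<^esub>" if "i \<le> n" for i using that by (simp add: weyl_x_closed)
  show sub: "xnil n M N \<subseteq> carrier M" for N by (cases N) auto
  show mono: "xnil n M N \<subseteq> xnil n M (Suc N)" for N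
    by (induction N) (auto simp: x0)
  show add: "\<lbrakk>x \<in> xnil n M N; y \<in> xnil n M N\<rbrakk> \<Longrightarrow> x \<oplus>\<^bsub>M\<^esub> y \<in> xnil n M N" for x y N
    by (induction N arbitrary: x y) (auto simp: smult_r_distr weyl_x_closed)
  have const: "x \<in> xnil n M N \<Longrightarrow> weyl_const n c \<odot>\<^bsub>M\<^esub> x \<in> xnil n M N" for x N c
  proof (induction N arbitrary: x)
    case (Suc N)
    then show ?case
      by (auto simp: weyl_const_closed const_smult_comm[OF M weyl_x_closed])
  qed (simp add: weyl_const_closed)
  then show "x \<in> xnil n M N \<Longrightarrow> weyl_const n c \<odot>\<^bsub>M\<^esub> x \<in> xnil n M N" .
  show x: "\<lbrakk>x \<in> xnil n M N; i \<le> n\<rbrakk> \<Longrightarrow> weyl_x n i \<odot>\<^bsub>M\<^esub> x \<in> xnil n M N" for x N i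
    using mono by (cases N) (auto simp: x0)
  show "\<lbrakk>x \<in> xnil n M N; i \<le> n\<rbrakk> \<Longrightarrow> weyl_d n i \<odot>\<^bsub>M\<^esub> x \<in> xnil n M (Suc N)" for x N i
  proof (induction N arbitrary: x)
    case 0
    then show ?case by (simp add: weyl_d_closed weyl_x_closed)
  next
    case (Suc N)
    have xc: "x \<in> carrier M" using Suc.prems by simp
    have "weyl_x n j \<odot>\<^bsub>M\<^esub> (weyl_d n i \<odot>\<^bsub>M\<^esub> x) \<in> xnil n M (Suc N)" if j: "j \<le> n" for j
    proof -
      let ?b = "if i = j then x else \<zero>\<^bsub>M\<^esub>"
      have c: "weyl_x n j \<odot>\<^bsub>M\<^esub> (weyl_d n i \<odot>\<^bsub>M\<^esub> x) \<in> carrier M" "?b \<in> carrier M"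
        using xc Suc.prems j by (auto simp: weyl_d_closed weyl_x_closed)
      have 1: "weyl_d n i \<odot>\<^bsub>M\<^esub> (weyl_x n j \<odot>\<^bsub>M\<^esub> x) \<in> xnil n M (Suc N)"
        using Suc.prems j by (intro Suc.IH) auto
      have "\<zero>\<^bsub>M\<^esub> \<in> xnil n M (Suc N)" using const[OF Suc.prems(1), of 0] xc by (simp add: weyl_const_0)
      then have 2: "?b \<in> xnil n M (Suc N)" using Suc.prems by auto
      have "weyl_x n j \<odot>\<^bsub>M\<^esub> (weyl_d n i \<odot>\<^bsub>M\<^esub> x) = weyl_d n i \<odot>\<^bsub>M\<^esub> (weyl_x n j \<odot>\<^bsub>M\<^esub> x) \<oplus>\<^bsub>M\<^esub> \<ominus>\<^bsub>M\<^esub> ?b"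
        unfolding dx_smult[OF M xc Suc.prems(2) j] using c by (simp add: M.a_assoc M.r_neg)
      also have "\<ominus>\<^bsub>M\<^esub> ?b = weyl_const n (- 1) \<odot>\<^bsub>M\<^esub> ?b" by (rule minus_smult[OF M c(2)])
      finally show ?thesis using add[OF 1 const[OF 2]] by simp
    qed
    then show ?case using xc Suc.prems by (simp add: weyl_d_closed)
  qed
qed

lemma xnil_le:
  assumes "left_module (weyl n) (M :: ('k::field, 'u) dmod)" "x \<in> xnil n M N" "N \<le> N'"
  shows "x \<in> xnil n M N'"
  using assms(3,2) by (induction rule: dec_induct) (use xnil_facts(2)[OF assms(1)] in auto)

text \<open>Constants and the x_i keep the order of nilpotence and each \<partial>_i adds at most
  one, so homogeneous operators preserve x-nilpotence.\<close>

lemma xnil_smult: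
  assumes M: "left_module (weyl n) (M :: ('k::field, 'u) dmod)" and x: "x \<in> xnil n M N" and "P \<in> weyl_part n d q"
  shows "\<exists>N'. P \<odot>\<^bsub>M\<^esub> x \<in> xnil n M N'"
proof -
  interpret left_module "weyl n" M by fact
  have xc: "x \<in> carrier M" using x xnil_facts(1)[OF M] by blast
  show ?thesis using assms(3)
  proof (induction rule: weyl_part_induct)
    case (zero k)
    then show ?case using xnil_facts(4)[OF M x, of 0] by (auto simp: weyl_const_0)
  next
    case (const c)
    then show ?case using xnil_facts(4)[OF M x] by blast
  next
    case (letter l k a)
    then obtain N' where N': "a \<odot>\<^bsub>M\<^esub> x \<in> xnil n M N'" by blast
    have "(wl n l \<otimes>\<^bsub>weyl n\<^esub> a) \<odot>\<^bsub>M\<^esub> x = wl n l \<odot>\<^bsub>M\<^esub> (a \<odot>\<^bsub>M\<^esub> x)"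
      using xc weyl_part_carrier[OF letter(2)] by (simp add: smult_assoc1 wl_closed[OF letter(1)])
    moreover from letter(1) have "wl n l \<odot>\<^bsub>M\<^esub> (a \<odot>\<^bsub>M\<^esub> x) \<in> xnil n M (Suc N')"
    proof (cases rule: letters_cases)
      case (1 i)
      then show ?thesis using xnil_facts(5)[OF M N' 1(1)] xnil_facts(2)[OF M, of N'] by (auto simp: weyl_x_def)
    next
      case (2 i)
      then show ?thesis using xnil_facts(6)[OF M N' 2(1)] by (simp add: weyl_d_def)
    qed
    ultimately show ?case by metis
  next
    case (add k a b)
    then obtain N1 N2 where "a \<odot>\<^bsub>M\<^esub> x \<in> xnil n M N1" "b \<odot>\<^bsub>M\<^esub> x \<in> xnil n M N2" by blast
    then have "a \<odot>\<^bsub>M\<^esub> x \<in> xnil n M (max N1 N2)" "b \<odot>\<^bsub>M\<^esub> x \<in> xnil n M (max N1 N2)"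
      using xnil_le[OF M] by (meson max.cobounded1 max.cobounded2)+
    then have "a \<odot>\<^bsub>M\<^esub> x \<oplus>\<^bsub>M\<^esub> b \<odot>\<^bsub>M\<^esub> x \<in> xnil n M (max N1 N2)" by (rule xnil_facts(3)[OF M])
    then show ?case using xc weyl_part_carrier[OF add(1)] weyl_part_carrier[OF add(2)] by (auto simp: smult_l_distr)
  qed
qed

end

locale nonneg_module = partial_module n d G "{0..}" V act for n d and G (structure) and V and act :: "'k::field_char_0 weyl \<Rightarrow> 'v \<Rightarrow> 'v"
begin

text \<open>All homogeneous multiples of \<open>Z\<close> are x-nilpotent, so those of nonnegative
  weight vanish; evaluated at the unit, these multiples give the values that \<open>Z\<close>
  records.\<close>

lemma coind_torsion_free:
  assumes Z: "Z \<in> eig n d coind k" and x: "\<And>i. i \<le> n \<Longrightarrow> weyl_x n i \<odot>\<^bsub>coind\<^esub> Z = \<zero>\<^bsub>coind\<^esub>"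
  shows "Z = \<zero>\<^bsub>coind\<^esub>"
proof (rule coind_ext)
  note M = left_module_coind
  interpret M: left_module D coind by (rule M)
  show "Z \<in> coind_set" "\<zero>\<^bsub>coind\<^esub> \<in> coind_set" using Z M.M.zero_closed by (auto simp: eig_iff coind_simps)
  have nil: "Z \<in> xnil n coind 1" using Z x by (simp add: eig_iff)
  fix q j :: int and P :: "'k weyl" assume P: "P \<in> weyl_part n d q" and j: "j \<in> {0..}"
  have "Z P j = \<zero>"
  proof (cases "j = q + k")
    case True
    obtain N where "P \<odot>\<^bsub>coind\<^esub> Z \<in> xnil n coind N" using xnil_smult[OF M nil P] by blast
    then have "P \<odot>\<^bsub>coind\<^esub> Z = \<zero>\<^bsub>coind\<^esub>"
      using xnil_weight[OF M pos[of 0] eig_part[OF M P Z]] True j by simp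
    moreover have "Z P j = (P \<odot>\<^bsub>coind\<^esub> Z) \<one>\<^bsub>D\<^esub> j"
      using coind_smult[OF weyl_part_carrier[OF P] j] by simp
    ultimately show ?thesis by (simp add: coind_simps)
  next
    case False
    then show ?thesis by (rule coind_eig_zero[OF Z P])
  qed
  then show "Z P j = \<zero>\<^bsub>coind\<^esub> P j" by (simp add: coind_simps)
qed

text \<open>In a negative weight \<open>Z\<close> is determined by the tuple of all x_i Z, whose
  weights are strictly larger; the recursion ends in nonnegative weights, where the coinduced module
  is \<open>V\<close>.\<close>

lemma embeds_coind_eig:
  assumes inf: "infinite (UNIV :: 'u set)" and V: "\<And>j. j \<ge> 0 \<Longrightarrow> embeds TYPE('u) (V j)"
  shows "embeds TYPE('u) (eig n d coind k)"
proof (induction "nat (- k)" arbitrary: k rule: less_induct)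
  case less
  show ?case
  proof (cases "k \<ge> 0")
    case True
    then have "bij_betw (\<lambda>Z. Z \<one>\<^bsub>D\<^esub> k) (eig n d coind k) (V k)" by (intro coind_eig_bij) simp
    then show ?thesis using embeds_inj[OF V[OF True]] by (auto simp: bij_betw_def)
  next
    case False
    interpret M: left_module D coind by (rule left_module_coind)
    interpret E: additive_subgroup "eig n d coind k" coind by (rule eig_subgroup[OF left_module_coind])
    have "\<exists>f :: _ \<Rightarrow> 'u. inj_on f (eig n d coind (int (d i) + k))" if "i \<le> n" for i
      using less(1)[of "int (d i) + k"] False pos[OF that] unfolding embeds_def by auto
    then obtain f :: "nat \<Rightarrow> _ \<Rightarrow> 'u" where f: "\<And>i. i \<le> n \<Longrightarrow> inj_on (f i) (eig n d coind (int (d i) + k))"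
      by metis
    let ?g = "\<lambda>Z. map (\<lambda>i. f i (weyl_x n i \<odot>\<^bsub>coind\<^esub> Z)) [0..<Suc n]"
    have "embeds TYPE('u) (lists (UNIV :: 'u set))"
      by (rule embeds_lists[OF inf]) (auto simp: embeds_def intro: inj_on_id)
    then show ?thesis
    proof (rule embeds_inj)
      show "inj_on ?g (eig n d coind k)"
      proof
        fix Z Z' assume Z: "Z \<in> eig n d coind k" "Z' \<in> eig n d coind k" and eq: "?g Z = ?g Z'"
        have c: "Z \<in> carrier coind" "Z' \<in> carrier coind" using Z by (auto simp: eig_iff)
        have x: "weyl_x n i \<odot>\<^bsub>coind\<^esub> Z = weyl_x n i \<odot>\<^bsub>coind\<^esub> Z'" if i: "i \<le> n" for i
        proof -
          have "f i (weyl_x n i \<odot>\<^bsub>coind\<^esub> Z) = f i (weyl_x n i \<odot>\<^bsub>coind\<^esub> Z')"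
            using eq i by (auto simp: map_eq_conv simp del: upt_Suc)
          then show ?thesis
            using f[OF i] eig_part[OF left_module_coind weyl_part_x[OF i] Z(1)] eig_part[OF left_module_coind weyl_part_x[OF i] Z(2)]
            by (auto dest: inj_onD)
        qed
        have "Z \<oplus>\<^bsub>coind\<^esub> \<ominus>\<^bsub>coind\<^esub> Z' = \<zero>\<^bsub>coind\<^esub>"
        proof (rule coind_torsion_free)
          show "Z \<oplus>\<^bsub>coind\<^esub> \<ominus>\<^bsub>coind\<^esub> Z' \<in> eig n d coind k" using Z by blast
          show "weyl_x n i \<odot>\<^bsub>coind\<^esub> (Z \<oplus>\<^bsub>coind\<^esub> \<ominus>\<^bsub>coind\<^esub> Z') = \<zero>\<^bsub>coind\<^esub>" if "i \<le> n" for i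
            using c x[OF that] by (simp add: M.smult_r_distr M.smult_r_minus weyl_x_closed[OF that] M.M.r_neg)
        qed
        then show "Z = Z'" using c by (metis M.M.minus_equality M.M.minus_minus M.M.a_inv_closed M.M.a_comm)
      qed
    qed auto
  qed
qed

text \<open>An element is recorded by the finite set of its weights paired with the codes of the
  nonzero components.\<close>

lemma embeds_coind:
  assumes inf: "infinite (UNIV :: 'u set)" and V: "\<And>j. j \<ge> 0 \<Longrightarrow> embeds TYPE('u) (V j)"
  shows "embeds TYPE('u) (gspan coind (eig n d coind))"
proof -
  let ?S = "gspan coind (eig n d coind)" and ?M = "coind\<lparr>carrier := gspan coind (eig n d coind)\<rparr>"
  note E = euler0_gspan[OF left_module_coind]
  interpret g: graded_group ?M "eig n d ?M" by (rule euler0D[OF E])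
  have e: "eig n d ?M k \<subseteq> eig n d coind k" for k
    by (simp add: eig_restrict[OF gspan_carrier[OF left_module_coind]])
  have "\<exists>f :: _ \<Rightarrow> 'u. inj_on f (eig n d coind k)" for k
    using embeds_coind_eig[OF assms] by (simp add: embeds_def)
  then obtain f :: "int \<Rightarrow> _ \<Rightarrow> 'u" where f: "\<And>k. inj_on (f k) (eig n d coind k)" by metis
  let ?w = "wt n d ?M"
  let ?F = "\<lambda>Z. (\<lambda>k. (k, f k (?w Z k))) ` {k. ?w Z k \<noteq> \<zero>\<^bsub>coind\<^esub>}"
  have "embeds TYPE('u) {F. F \<subseteq> (UNIV :: int set) \<times> (UNIV :: 'u set) \<and> finite F}"
    by (intro embeds_finite_subsets embeds_Times[OF _ embeds_countable] inf)
      (auto simp: embeds_def intro: inj_on_id countableI_type)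
  then show ?thesis
  proof (rule embeds_inj)
    show "?F ` ?S \<subseteq> {F. F \<subseteq> (UNIV :: int set) \<times> (UNIV :: 'u set) \<and> finite F}"
      using g.finite_gcomp by auto
    show "inj_on ?F ?S"
    proof
      fix Z Z' assume Z: "Z \<in> ?S" "Z' \<in> ?S" and eq: "?F Z = ?F Z'"
      have sym: "?w Z1 k = ?w Z2 k" if "Z1 \<in> ?S" "Z2 \<in> ?S" "?F Z1 = ?F Z2" "?w Z1 k \<noteq> \<zero>\<^bsub>coind\<^esub>" for Z1 Z2 k
      proof -
        have "(k, f k (?w Z1 k)) \<in> ?F Z2" using that(3,4) by blast
        then have "f k (?w Z1 k) = f k (?w Z2 k)" by auto
        moreover have "?w Z1 k \<in> eig n d coind k" "?w Z2 k \<in> eig n d coind k"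
          using g.gcomp_in[of Z1 k] g.gcomp_in[of Z2 k] e that(1,2) by auto
        ultimately show ?thesis using f[of k] by (auto dest: inj_onD)
      qed
      have w: "?w Z k = ?w Z' k" for k
        using sym[OF Z eq] sym[OF Z(2,1) eq[symmetric]] by metis
      show "Z = Z'" by (rule g.gcomp_inject[OF _ _ w]) (use Z in \<open>auto\<close>)
    qed
  qed
qed

end

section \<open>Existence of the right adjoint\<close>

context weights
begin

lemma euler0_nonneg_module:
  assumes "euler0 n d (Y :: ('k::field_char_0, 'u) dmod)"
  shows "nonneg_module n d Y (eig n d Y) (smult Y)"
proof -
  note Y = euler0D[OF assms]
  interpret left_module "weyl n" Y by (rule Y)
  show ?thesis
  proof (intro nonneg_module.intro partial_module.intro partial_module_axioms.intro weights_axioms M.abelian_group_axioms)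
    show "P \<odot>\<^bsub>Y\<^esub> y \<in> eig n d Y (q + j)" if "P \<in> weyl_part n d q" "y \<in> eig n d Y j" for P q y j
      by (rule eig_part[OF Y(1) that])
  qed (auto simp: eig_subgroup[OF Y(1)] weyl_part_carrier eig_iff smult_r_distr smult_l_distr smult_assoc1)
qed

text \<open>\<open>T\<close> is a copy, in the universe, of the Euler part of the module coinduced
  from the nonnegative degrees of \<open>Y\<close>, and \<open>U\<close> is evaluation at the unit.
  It is bijective in nonnegative degrees, hence invertible in the quotient; couniversality is the
  adjunction between restriction to these degrees and coinduction.\<close>

lemma couniversal_ex:
  assumes inf: "infinite (UNIV :: 'u set)" and Y: "euler0 n d (Y :: ('k::field_char_0, 'u) dmod)"
  shows "\<exists>w u. couniversal (grmod0 n d) (qcoh n d) (pi0 n d) Y w u \<and> is_iso (qcoh n d) w Y u"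
proof -
  interpret nonneg_module n d Y "eig n d Y" "smult Y" by (rule euler0_nonneg_module[OF Y])
  interpret Y: graded_group Y "eig n d Y" by (rule euler0D[OF Y])
  interpret Yl: left_module D Y by (rule euler0D[OF Y])
  let ?S = "gspan coind (eig n d coind)" and ?M = "coind\<lparr>carrier := gspan coind (eig n d coind)\<rparr>"
  note E = euler0_gspan[OF left_module_coind] and cl = left_module_coind
  have S: "?S \<subseteq> coind_set" using gspan_carrier[OF cl] by (simp add: coind_simps)
  have eS: "eig n d ?M k = eig n d coind k" for k
    using gspan.part[of _ "eig n d coind" k coind] by (auto simp: eig_restrict[OF gspan_carrier[OF cl]])
  have "embeds TYPE('u) (carrier ?M)"
    using embeds_coind[OF inf] by (simp add: embeds_def inj_on_id) (use inj_on_id in blast)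
  from transport_module[OF euler0D(1)[OF E] E this]
  obtain T :: "('k, 'u) dmod" and s where T: "euler0 n d T" and s: "bij_betw s (carrier T) ?S"
    and sa: "\<And>x y. \<lbrakk>x \<in> carrier T; y \<in> carrier T\<rbrakk> \<Longrightarrow> s (x \<oplus>\<^bsub>T\<^esub> y) = s x \<oplus>\<^bsub>coind\<^esub> s y"
    and sm: "\<And>r x. \<lbrakk>r \<in> carrier D; x \<in> carrier T\<rbrakk> \<Longrightarrow> s (r \<odot>\<^bsub>T\<^esub> x) = r \<odot>\<^bsub>coind\<^esub> s x"
    and se: "\<And>k x. x \<in> eig n d T k \<longleftrightarrow> x \<in> carrier T \<and> s x \<in> eig n d coind k"
    and s0: "s \<zero>\<^bsub>T\<^esub> = \<zero>\<^bsub>coind\<^esub>"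
    by (auto simp: eS)
  interpret T: graded_group T "eig n d T" by (rule euler0D[OF T])
  interpret Tl: left_module D T by (rule euler0D[OF T])
  have sc: "s x \<in> coind_set" if "x \<in> carrier T" for x
    using s S that by (auto simp: bij_betw_def)
  have sinj: "x = y" if "x \<in> carrier T" "y \<in> carrier T" "s x = s y" for x y
    using s that by (auto simp: bij_betw_def inj_on_def)
  \<comment> \<open>The function is evaluated in the degree of \<open>x\<close>; for the zero vector
    any degree gives the value zero.\<close>
  define u where "u x = s x \<one>\<^bsub>D\<^esub> (SOME j. j \<ge> 0 \<and> x \<in> eig n d T j)" for x
  have u: "u x = s x \<one>\<^bsub>D\<^esub> j" if j: "j \<ge> 0" "x \<in> eig n d T j" for x j
  proof -
    let ?i = "SOME j. j \<ge> 0 \<and> x \<in> eig n d T j"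
    have i: "?i \<ge> 0 \<and> x \<in> eig n d T ?i" by (rule someI[of _ j]) (use j in simp)
    show ?thesis
    proof (cases "?i = j")
      case False
      then have "x = \<zero>\<^bsub>T\<^esub>" using eig_disjoint[OF euler0D(1)[OF T] conjunct2[OF i] j(2)] by simp
      then have "s x = \<zero>\<^bsub>coind\<^esub>" using s0 by simp
      then show ?thesis by (simp add: u_def coind_simps)
    qed (simp add: u_def)
  qed
  \<comment> \<open>Evaluation at the unit in degree j only sees the component of weight j.\<close>
  have uS: "s x \<one>\<^bsub>D\<^esub> j = u (wt n d T x j)" if "x \<in> carrier T" "j \<ge> 0" for x j
    using that(1)
  proof (induction x rule: T.graded_induct)
    case zero
    then show ?case using u[OF that(2) T.V_zero] by (simp add: T.gcomp_zero s0 coind_simps)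
  next
    case (part k v)
    then show ?case
      using u[OF that(2)] T.gcomp_V[OF part] u[OF that(2) T.V_zero] coind_eig_zero[OF _ weyl_part_one, of "s v" k j]
      by (cases "j = k") (auto simp: se s0 coind_simps)
  next
    case (add x y)
    have "u (wt n d T x j \<oplus>\<^bsub>T\<^esub> wt n d T y j) = u (wt n d T x j) \<oplus>\<^bsub>Y\<^esub> u (wt n d T y j)"
      using u[OF that(2)] T.gcomp_in add(1,2) T.V_add T.gcomp_carrier by (simp add: sa coind_simps)
    then show ?case using add by (simp add: sa T.gcomp_add coind_simps)
  qed
  have uval: "s x P j = u (wt n d T (P \<odot>\<^bsub>T\<^esub> x) j)" if "x \<in> carrier T" "P \<in> carrier D" "j \<ge> 0" for x P j
    using uS[of "P \<odot>\<^bsub>T\<^esub> x" j] that coind_smult[of P j "s x"] by (simp add: sm)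
  define uh where "uh = restrict u (J_dom nonneg T)"
  have uhJ: "uh \<in> J_homs nonneg T Y"
    unfolding J_homs_def
  proof (intro CollectI conjI ballI allI impI)
    show "uh \<in> extensional (J_dom nonneg T)" by (simp add: uh_def)
    have uh: "uh x = s x \<one>\<^bsub>D\<^esub> j" if "j \<in> nonneg" "x \<in> eig n d T j" for x j
      using that u by (auto simp: uh_def J_dom_def)
    fix j x assume j: "j \<in> nonneg" and x: "x \<in> eig n d T j"
    show "uh x \<in> eig n d Y j" using uh[OF j x] coindD(3)[OF sc, of x "\<one>\<^bsub>D\<^esub>" j] j x by (simp add: se)
    show "uh (x \<oplus>\<^bsub>T\<^esub> y) = uh x \<oplus>\<^bsub>Y\<^esub> uh y" if "y \<in> eig n d T j" for y
      using uh[OF j x] uh[OF j that] uh[OF j T.V_add[OF x that]] T.V_carrier[OF x] T.V_carrier[OF that]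
      by (simp add: sa coind_simps)
    show "uh (P \<odot>\<^bsub>T\<^esub> x) = P \<odot>\<^bsub>Y\<^esub> uh x" if q: "q + j \<in> nonneg" and P: "P \<in> weyl_part n d q" for q P
    proof -
      have sx: "s x \<in> eig n d coind j" using x by (simp add: se)
      have "uh (P \<odot>\<^bsub>T\<^esub> x) = (P \<odot>\<^bsub>coind\<^esub> s x) \<one>\<^bsub>D\<^esub> (q + j)"
        using uh[OF q eig_part[OF euler0D(1)[OF T] P x]] sm[OF weyl_part_carrier[OF P] T.V_carrier[OF x]] by simp
      also have "\<dots> = s x P (q + j)" by (rule coind_smult[OF weyl_part_carrier[OF P] q])
      also have "\<dots> = P \<odot>\<^bsub>Y\<^esub> uh x" using coind_eig_value[OF sx P j q] uh[OF j x] by simp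
      finally show ?thesis .
    qed
  qed
  note sepY = nonneg_separates[OF euler0D(1)[OF Y]] and sepT = nonneg_separates[OF euler0D(1)[OF T]]
  obtain U where U: "U \<in> Hom (qcoh n d) T Y" "qhom nonneg T Y U = uh"
    using bij_betw_ex[OF qhom_bij[OF T Y subset_refl sepY nonneg_generates] uhJ] by blast
  have iso: "is_iso (qcoh n d) T Y U"
  proof (rule qcoh_isoI[OF T Y U(1)])
    fix j :: int assume j: "j \<ge> 0"
    have "bij_betw s (eig n d T j) (eig n d coind j)"
      unfolding bij_betw_def
    proof (intro conjI equalityI subsetI)
      show "inj_on s (eig n d T j)" using sinj by (auto simp: inj_on_def se)
      fix Z assume Z: "Z \<in> eig n d coind j"
      then have "Z \<in> ?S" by (rule gspan.part)
      then obtain x where "x \<in> carrier T" "s x = Z" using bij_betw_ex[OF s] by blast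
      then show "Z \<in> s ` eig n d T j" using Z by (auto simp: se)
    qed (auto simp: se)
    from bij_betw_trans[OF this coind_eig_bij] j
    have b: "bij_betw ((\<lambda>Z. Z \<one>\<^bsub>D\<^esub> j) \<circ> s) (eig n d T j) (eig n d Y j)" by simp
    have "uh x = ((\<lambda>Z. Z \<one>\<^bsub>D\<^esub> j) \<circ> s) x" if "x \<in> eig n d T j" for x
      using that u[OF j that] j by (auto simp: uh_def J_dom_def)
    then show "bij_betw (qhom nonneg T Y U) (eig n d T j) (eig n d Y j)"
      unfolding U(2) by (rule bij_betw_cong[THEN iffD2, OF _ b])
  qed
  have "\<exists>!h. h \<in> mod_homs D X T \<and> Comp (qcoh n d) X T Y U (amap (pi0 n d) X T h) = F"
    if X: "euler0 n d X" and F: "F \<in> Hom (qcoh n d) X Y" for X :: "('k, 'u) dmod" and F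
  proof -
    interpret X: graded_group X "eig n d X" by (rule euler0D[OF X])
    interpret Xl: left_module D X by (rule euler0D[OF X])
    define h where "h = qhom nonneg X Y F"
    have h: "h \<in> J_homs nonneg X Y"
      using qhom_bij[OF X Y subset_refl sepY nonneg_generates] F by (auto simp: bij_betw_def h_def)
    note h0 = J_homs_zero[OF X Y subset_refl h]
    \<comment> \<open>Arrows of the quotient are compared in nonnegative degrees, where the
      composite becomes \<open>u\<close> after \<open>g\<close>.\<close>
    have hcomp: "Comp (qcoh n d) X T Y U (amap (pi0 n d) X T g) = F \<longleftrightarrow> (\<forall>j\<ge>0. \<forall>x\<in>eig n d X j. u (g x) = h x)"
      if g: "g \<in> mod_homs D X T" for g
    proof -
      note p = pi0_hom[OF X T g]
      have "Comp (qcoh n d) X T Y U (amap (pi0 n d) X T g) = F \<longleftrightarrow>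
        qhom nonneg X Y (Comp (qcoh n d) X T Y U (amap (pi0 n d) X T g)) = h"
        using qcoh_inj[OF X Y qcoh_Comp(1)[OF X T Y p(1) U(1)] F] unfolding h_def by blast
      also have "\<dots> \<longleftrightarrow> compose (J_dom nonneg X) uh (restrict g (J_dom nonneg X)) = h"
        using qcoh_Comp(2)[OF X T Y p(1) U(1) subset_refl sepT sepY] p(2)[OF subset_refl sepT] U(2) by simp
      also have "\<dots> \<longleftrightarrow> (\<forall>x\<in>J_dom nonneg X. uh (g x) = h x)"
        using J_homsD(1)[OF h] by (auto simp: compose_def fun_eq_iff extensional_def)
      also have "\<dots> \<longleftrightarrow> (\<forall>j\<ge>0. \<forall>x\<in>eig n d X j. u (g x) = h x)"
      proof -
        have "uh (g x) = u (g x)" if "x \<in> J_dom nonneg X" for x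
          using mod_homs_eig[OF g] that by (auto simp: uh_def J_dom_def)
        then show ?thesis by (auto simp: J_dom_def)
      qed
      finally show ?thesis .
    qed
    \<comment> \<open>The transpose of \<open>h\<close>: the element of the coinduced module that
      records what \<open>h\<close> sees of all multiples of \<open>x\<close>.\<close>
    define Z where "Z x = (\<lambda>P j. if P \<in> carrier D \<and> j \<in> nonneg then h (wt n d X (P \<odot>\<^bsub>X\<^esub> x) j) else \<zero>\<^bsub>Y\<^esub>)" for x
    note hadd = J_homs_add[OF X Y subset_refl h]
    have Zc: "Z x \<in> coind_set" if x: "x \<in> carrier X" for x
    proof (rule coindI)
      show "Z x P j \<in> eig n d Y j" if "P \<in> carrier D" "j \<in> nonneg" for P j
        using J_homsD(2)[OF h that(2) X.gcomp_in[of "P \<odot>\<^bsub>X\<^esub> x"]] that x by (simp add: Z_def)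
      show "Z x (P \<oplus>\<^bsub>D\<^esub> P') j = Z x P j \<oplus>\<^bsub>Y\<^esub> Z x P' j" if "P \<in> carrier D" "P' \<in> carrier D" "j \<in> nonneg" for P P' j
        using hadd[OF that(3), of "P \<odot>\<^bsub>X\<^esub> x" "P' \<odot>\<^bsub>X\<^esub> x"] that x by (simp add: Z_def Xl.smult_l_distr)
      fix j q and Q P :: "'k weyl" assume a: "j \<in> nonneg" "q + j \<in> nonneg" "Q \<in> weyl_part n d q" "P \<in> carrier D"
      have Qc: "Q \<in> carrier D" by (rule weyl_part_carrier[OF a(3)])
      have "wt n d X (Q \<odot>\<^bsub>X\<^esub> (P \<odot>\<^bsub>X\<^esub> x)) (q + j) = Q \<odot>\<^bsub>X\<^esub> wt n d X (P \<odot>\<^bsub>X\<^esub> x) j"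
        using a x by (intro wt_smult[OF X a(3)]) auto
      then show "Z x (Q \<otimes>\<^bsub>D\<^esub> P) (q + j) = Q \<odot>\<^bsub>Y\<^esub> Z x P j"
        using J_homsD(4)[OF h a(1-3) X.gcomp_in[of "P \<odot>\<^bsub>X\<^esub> x"]] a x Qc by (simp add: Z_def Xl.smult_assoc1)
    qed (auto simp: Z_def)
    have Za: "Z (x \<oplus>\<^bsub>X\<^esub> y) = Z x \<oplus>\<^bsub>coind\<^esub> Z y" if "x \<in> carrier X" "y \<in> carrier X" for x y
      using that by (auto simp: fun_eq_iff coind_simps Z_def Xl.smult_r_distr hadd)
    have Zs: "Z (r \<odot>\<^bsub>X\<^esub> x) = r \<odot>\<^bsub>coind\<^esub> Z x" if "x \<in> carrier X" "r \<in> carrier D" for x r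
      using that by (auto simp: fun_eq_iff coind_simps Z_def Xl.smult_assoc1)
    have Zg: "Z x \<in> ?S" if "x \<in> carrier X" for x
      using that
    proof (induction x rule: X.graded_induct)
      case zero
      have "Z \<zero>\<^bsub>X\<^esub> = \<zero>\<^bsub>coind\<^esub>" using h0 by (auto simp: Z_def fun_eq_iff coind_simps X.gcomp_zero)
      then show ?case using gspan.zero by metis
    next
      case (part k v)
      have "Z v \<in> eig n d coind k"
        using part X.V_carrier[OF part] Zc
        by (simp add: eig_iff coind_simps(1) euler_closed weyl_const_closed flip: Zs)
      then show ?case by (rule gspan.part)
    next
      case (add x y)
      then show ?case using gspan.add[OF add(3,4)] Za by simp
    qed
    define g where "g = (\<lambda>x\<in>carrier X. inv_into (carrier T) s (Z x))"
    have gc: "g x \<in> carrier T" "s (g x) = Z x" if "x \<in> carrier X" for x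
      using s Zg[OF that] that by (auto simp: g_def bij_betw_def inv_into_into f_inv_into_f)
    have g: "g \<in> mod_homs D X T"
    proof (rule mod_homsI)
      show "g \<in> extensional (carrier X)" by (simp add: g_def)
      show "g (x \<oplus>\<^bsub>X\<^esub> y) = g x \<oplus>\<^bsub>T\<^esub> g y" if "x \<in> carrier X" "y \<in> carrier X" for x y
        using that gc by (intro sinj) (auto simp: sa Za)
      show "g (r \<odot>\<^bsub>X\<^esub> x) = r \<odot>\<^bsub>T\<^esub> g x" if "r \<in> carrier D" "x \<in> carrier X" for r x
        using that gc by (intro sinj) (auto simp: sm Zs)
    qed (rule gc)
    have "u (g x) = h x" if "j \<ge> 0" "x \<in> eig n d X j" for j x
      using u[OF that(1) mod_homs_eig[OF g that(2)]] gc[OF X.V_carrier[OF that(2)]] X.gcomp_V[OF that(2)] X.V_carrier[OF that(2)] that(1)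
      by (simp add: Z_def)
    then have gF: "Comp (qcoh n d) X T Y U (amap (pi0 n d) X T g) = F" using hcomp[OF g] by blast
    \<comment> \<open>The values recorded by \<open>g' x\<close> are those of \<open>h\<close> on
      the weight components of multiples of \<open>x\<close>, so they are forced.\<close>
    have unique: "g' = g" if g': "g' \<in> mod_homs D X T" and eq: "\<forall>j\<ge>0. \<forall>x\<in>eig n d X j. u (g' x) = h x" for g'
    proof (rule extensionalityI)
      show "g' \<in> extensional (carrier X)" "g \<in> extensional (carrier X)" using mod_homsD(2) g g' by auto
      fix x assume x: "x \<in> carrier X"
      note xc = mod_homsD(1)[OF g' x]
      have "s (g' x) P j = s (g x) P j" for P j
      proof (cases "P \<in> carrier D \<and> j \<ge> 0")
        case True
        have "wt n d T (P \<odot>\<^bsub>T\<^esub> g' x) (0 + j) = g' (wt n d X (P \<odot>\<^bsub>X\<^esub> x) j)"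
          unfolding mod_homsD(4)[OF g' conjunct1[OF True] x, symmetric]
          using True x mod_homsD[OF g'] mod_homs_eig[OF g']
          by (intro gcomp_map X.graded_group_axioms T.graded_group_axioms) auto
        then have "s (g' x) P j = u (g' (wt n d X (P \<odot>\<^bsub>X\<^esub> x) j))"
          using uval[OF xc] True by simp
        also have "\<dots> = h (wt n d X (P \<odot>\<^bsub>X\<^esub> x) j)"
          using eq True X.gcomp_in[of "P \<odot>\<^bsub>X\<^esub> x" j] x by auto
        finally show ?thesis using True gc(2)[OF x] by (simp add: Z_def)
      next
        case False
        then show ?thesis using coindD(1,2)[OF sc[OF xc]] coindD(1,2)[OF sc[OF gc(1)[OF x]]] by auto
      qed
      then show "g' x = g x" using gc x xc by (intro sinj) auto
    qed
    show ?thesis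
    proof (rule ex1I[of _ g])
      show "g \<in> mod_homs D X T \<and> Comp (qcoh n d) X T Y U (amap (pi0 n d) X T g) = F" using g gF by simp
      fix g' assume g': "g' \<in> mod_homs D X T \<and> Comp (qcoh n d) X T Y U (amap (pi0 n d) X T g') = F"
      then show "g' = g" using hcomp[OF conjunct1[OF g']] by (intro unique) simp_all
    qed
  qed
  then have "couniversal (grmod0 n d) (qcoh n d) (pi0 n d) Y T U"
    unfolding couniversal_def omap_pi0 using T U(1) by (simp add: grmod0_simps qcoh_simps(1))
  then show ?thesis using iso by blast
qed

lemma omega0_adjoint:
  assumes "infinite (UNIV :: 'u set)"
  shows "is_right_adjoint (grmod0 n d) (qcoh n d :: (('k::field_char_0, 'u) dmod, 'u frac set) cat) (pi0 n d) (omega0 n d)"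
proof -
  interpret functr "grmod0 n d" "qcoh n d :: (('k, 'u) dmod, 'u frac set) cat" "pi0 n d"
    by unfold_locales (rule is_functor_pi0)
  have "\<exists>G. is_right_adjoint (grmod0 n d) (qcoh n d :: (('k, 'u) dmod, 'u frac set) cat) (pi0 n d) G"
    by (rule right_adjointI) (use couniversal_ex[OF assms] in \<open>simp add: qcoh_simps(1), blast\<close>)
  then show ?thesis unfolding omega0_def by (rule someI_ex)
qed

text \<open>The explicit couniversal arrows are invertible, and the counit of whichever adjoint
  \<open>omega0\<close> picks differs from them by isomorphisms.\<close>

lemma omega0_counit:
  assumes "infinite (UNIV :: 'u set)"
  shows "\<exists>\<epsilon>. nat_iso (qcoh n d) (qcoh n d :: (('k::field_char_0, 'u) dmod, 'u frac set) cat)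
    (comp_func (pi0 n d) (omega0 n d)) id_func \<epsilon>"
proof -
  interpret functr "grmod0 n d" "qcoh n d :: (('k, 'u) dmod, 'u frac set) cat" "pi0 n d"
    by unfold_locales (rule is_functor_pi0)
  show ?thesis
    by (rule counit_iso[OF omega0_adjoint[OF assms]])
      (use couniversal_ex[OF assms] in \<open>auto simp: qcoh_simps(1) omap_pi0\<close>)
qed

end

section \<open>Global sections\<close>

lemma weyl0_simps:
  "carrier (weyl0 n d) = weyl_part n d 0" "mult (weyl0 n d) = mult (weyl n)" "one (weyl0 n d) = one (weyl n)"
  "zero (weyl0 n d) = zero (weyl n)" "add (weyl0 n d) = add (weyl n)"
  by (simp_all add: weyl0_def)

lemma ring_weyl0: "ring (weyl0 n d :: 'k::field weyl ring)"
proof -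
  interpret D: ring "weyl n :: 'k weyl ring" by (rule ring_weyl)
  note c = weyl_part_carrier[of _ n d 0, where 'k = 'k]
  show ?thesis
  proof (rule ringI)
    show "abelian_group (weyl0 n d :: 'k weyl ring)"
    proof (rule abelian_groupI, goal_cases)
      case (6 x)
      then show ?case
        using c weyl_part_minus by (auto simp: weyl0_simps intro!: bexI[of _ "\<ominus>\<^bsub>weyl n\<^esub> x"] D.l_neg)
    qed (auto simp: weyl0_simps weyl_part_add weyl_part_zero c D.a_ac)
    show "Group.monoid (weyl0 n d :: 'k weyl ring)"
      using weyl_part_mult[of _ n d 0 _ 0, where 'k = 'k]
      by (intro monoidI) (auto simp: weyl0_simps weyl_part_one c D.m_assoc)
  qed (auto simp: weyl0_simps c D.l_distr D.r_distr)
qed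

lemma euler_central:
  assumes "P \<in> weyl_part n d 0"
  shows "euler n d \<otimes>\<^bsub>weyl n\<^esub> P = P \<otimes>\<^bsub>weyl n\<^esub> (euler n d :: 'k::field weyl)"
proof -
  interpret D: ring "weyl n :: 'k weyl ring" by (rule ring_weyl)
  show ?thesis using euler_comm[OF assms] weyl_part_carrier[OF assms] by (simp add: weyl_const_0 euler_closed)
qed

abbreviation euler_ideal :: "nat \<Rightarrow> (nat \<Rightarrow> nat) \<Rightarrow> 'k::field weyl set" where
  "euler_ideal n d \<equiv> PIdl\<^bsub>weyl0 n d\<^esub> (euler n d)"

lemma euler_ideal_eq: "euler_ideal n d = (\<lambda>P. P \<otimes>\<^bsub>weyl n\<^esub> (euler n d :: 'k::field weyl)) ` weyl_part n d 0"
  by (auto simp: cgenideal_def weyl0_simps)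

lemma ideal_euler_ideal: "ideal (euler_ideal n d) (weyl0 n d :: 'k::field weyl ring)"
proof (rule idealI[OF ring_weyl0])
  interpret D: ring "weyl n :: 'k weyl ring" by (rule ring_weyl)
  interpret D0: ring "weyl0 n d :: 'k weyl ring" by (rule ring_weyl0)
  note c = weyl_part_carrier[of _ n d 0, where 'k = 'k] and E = euler_closed[of n d, where 'k = 'k]
  have "additive_subgroup (euler_ideal n d) (weyl0 n d :: 'k weyl ring)"
  proof (rule additive_subgroupI'[OF D0.abelian_group_axioms])
    show "euler_ideal n d \<subseteq> carrier (weyl0 n d :: 'k weyl ring)"
      using weyl_part_mult[OF _ euler_part, of _ n d 0] by (auto simp: euler_ideal_eq weyl0_simps)
    show "\<zero>\<^bsub>weyl0 n d\<^esub> \<in> (euler_ideal n d :: 'k weyl set)"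
      unfolding euler_ideal_eq weyl0_simps using weyl_part_zero E by (intro image_eqI[of _ _ "\<zero>\<^bsub>weyl n\<^esub>"]) auto
    fix x y :: "'k weyl" assume xy: "x \<in> euler_ideal n d"
    then obtain P where P: "P \<in> weyl_part n d 0" "x = P \<otimes>\<^bsub>weyl n\<^esub> euler n d" by (auto simp: euler_ideal_eq)
    have "\<ominus>\<^bsub>weyl0 n d\<^esub> x = (\<ominus>\<^bsub>weyl n\<^esub> P) \<otimes>\<^bsub>weyl n\<^esub> euler n d"
      using P c[OF P(1)] E weyl_part_mult[OF _ euler_part, of _ n d 0] weyl_part_minus[OF P(1)]
      by (intro D0.minus_equality) (auto simp: weyl0_simps simp flip: D.l_distr simp: D.l_neg)
    then show "\<ominus>\<^bsub>weyl0 n d\<^esub> x \<in> euler_ideal n d" using weyl_part_minus[OF P(1)] by (auto simp: euler_ideal_eq)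
    assume "y \<in> euler_ideal n d"
    then obtain Q where Q: "Q \<in> weyl_part n d 0" "y = Q \<otimes>\<^bsub>weyl n\<^esub> euler n d" by (auto simp: euler_ideal_eq)
    have "x \<oplus>\<^bsub>weyl0 n d\<^esub> y = (P \<oplus>\<^bsub>weyl n\<^esub> Q) \<otimes>\<^bsub>weyl n\<^esub> euler n d"
      using P Q c E by (simp add: weyl0_simps D.l_distr)
    then show "x \<oplus>\<^bsub>weyl0 n d\<^esub> y \<in> euler_ideal n d" using weyl_part_add[OF P(1) Q(1)] by (auto simp: euler_ideal_eq)
  qed
  then show "subgroup (euler_ideal n d) (add_monoid (weyl0 n d :: 'k weyl ring))" by (simp add: additive_subgroup_def)
  fix a x :: "'k weyl" assume "a \<in> euler_ideal n d" and "x \<in> carrier (weyl0 n d)"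
  then obtain P where P: "P \<in> weyl_part n d 0" "a = P \<otimes>\<^bsub>weyl n\<^esub> euler n d" and x: "x \<in> weyl_part n d 0"
    by (auto simp: euler_ideal_eq weyl0_simps)
  have "x \<otimes>\<^bsub>weyl0 n d\<^esub> a = (x \<otimes>\<^bsub>weyl n\<^esub> P) \<otimes>\<^bsub>weyl n\<^esub> euler n d"
    using P c x E by (simp add: weyl0_simps D.m_assoc)
  then show "x \<otimes>\<^bsub>weyl0 n d\<^esub> a \<in> euler_ideal n d" using weyl_part_mult[OF x P(1)] by (auto simp: euler_ideal_eq)
  have "a \<otimes>\<^bsub>weyl0 n d\<^esub> x = (P \<otimes>\<^bsub>weyl n\<^esub> x) \<otimes>\<^bsub>weyl n\<^esub> euler n d"
    using P c x E euler_central[OF x] by (simp add: weyl0_simps D.m_assoc)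
  then show "a \<otimes>\<^bsub>weyl0 n d\<^esub> x \<in> euler_ideal n d" using weyl_part_mult[OF P(1) x] by (auto simp: euler_ideal_eq)
qed

lemma ring_weyl0_mod_euler: "ring (weyl0_mod_euler n d :: 'k::field weyl set ring)"
  unfolding weyl0_mod_euler_def by (rule ideal.quotient_is_ring[OF ideal_euler_ideal])

definition coset0 :: "nat \<Rightarrow> (nat \<Rightarrow> nat) \<Rightarrow> 'k::field weyl \<Rightarrow> 'k weyl set" where
  "coset0 n d P = euler_ideal n d +>\<^bsub>weyl0 n d\<^esub> P"

lemma coset0_hom: "coset0 n d \<in> ring_hom (weyl0 n d) (weyl0_mod_euler n d :: 'k::field weyl set ring)"
  unfolding weyl0_mod_euler_def coset0_def[abs_def] by (rule ideal.rcos_ring_hom[OF ideal_euler_ideal])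

lemma coset0_facts:
  shows "P \<in> weyl_part n d 0 \<Longrightarrow> coset0 n d P \<in> carrier (weyl0_mod_euler n d :: 'k::field weyl set ring)"
    "\<lbrakk>P \<in> weyl_part n d 0; Q \<in> weyl_part n d 0\<rbrakk> \<Longrightarrow> coset0 n d (P \<oplus>\<^bsub>weyl n\<^esub> Q) = coset0 n d P \<oplus>\<^bsub>weyl0_mod_euler n d\<^esub> (coset0 n d Q :: 'k weyl set)"
    "\<lbrakk>P \<in> weyl_part n d 0; Q \<in> weyl_part n d 0\<rbrakk> \<Longrightarrow> coset0 n d (P \<otimes>\<^bsub>weyl n\<^esub> Q) = coset0 n d P \<otimes>\<^bsub>weyl0_mod_euler n d\<^esub> (coset0 n d Q :: 'k weyl set)"
    "coset0 n d \<one>\<^bsub>weyl n\<^esub> = (\<one>\<^bsub>weyl0_mod_euler n d\<^esub> :: 'k weyl set)"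
    "coset0 n d \<zero>\<^bsub>weyl n\<^esub> = (\<zero>\<^bsub>weyl0_mod_euler n d\<^esub> :: 'k weyl set)"
    "coset0 n d (euler n d) = (\<zero>\<^bsub>weyl0_mod_euler n d\<^esub> :: 'k weyl set)"
  using ring_hom_closed[OF coset0_hom, of P n d] ring_hom_add[OF coset0_hom, of P n d Q] ring_hom_mult[OF coset0_hom, of P n d Q]
    ring_hom_one[OF coset0_hom, of n d] ring_hom_zero[OF coset0_hom ring_weyl0 ring_weyl0_mod_euler, of n d]
proof -
  interpret D: ring "weyl n :: 'k weyl ring" by (rule ring_weyl)
  interpret I: ideal "euler_ideal n d" "weyl0 n d :: 'k weyl ring" by (rule ideal_euler_ideal)
  have "euler n d = \<one>\<^bsub>weyl n\<^esub> \<otimes>\<^bsub>weyl n\<^esub> (euler n d :: 'k weyl)" by (simp add: euler_closed)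
  then have "euler n d \<in> (euler_ideal n d :: 'k weyl set)" unfolding euler_ideal_eq using weyl_part_one by blast
  then show "coset0 n d (euler n d) = (\<zero>\<^bsub>weyl0_mod_euler n d\<^esub> :: 'k weyl set)"
    unfolding coset0_def weyl0_mod_euler_def by (simp add: FactRing_def I.a_rcos_const)
qed (simp_all add: weyl0_simps)

lemma weyl0_mod_euler_cases:
  assumes "S \<in> carrier (weyl0_mod_euler n d :: 'k::field weyl set ring)"
  obtains P where "P \<in> weyl_part n d 0" "S = coset0 n d P"
  using assms unfolding weyl0_mod_euler_def coset0_def
  by (auto simp: FactRing_def A_RCOSETS_def' weyl0_simps)

lemma deg0_simps:
  "carrier (deg0_mod n d M) = eigenspace n d M 0" "\<zero>\<^bsub>deg0_mod n d M\<^esub> = \<zero>\<^bsub>M\<^esub>" "add (deg0_mod n d M) = add M"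
  by (simp_all add: deg0_mod_def)

text \<open>Representatives of a coset differ by a multiple Q E, which kills vectors of weight zero,
  so the choice made in \<open>deg0_mod\<close> is harmless.\<close>

lemma deg0_smult:
  assumes M: "left_module (weyl n) (M :: ('k::field, 'u) dmod)" and P: "P \<in> weyl_part n d 0" and m: "m \<in> eigenspace n d M 0"
  shows "coset0 n d P \<odot>\<^bsub>deg0_mod n d M\<^esub> m = P \<odot>\<^bsub>M\<^esub> m"
proof -
  interpret left_module "weyl n" M by fact
  interpret I: ideal "euler_ideal n d" "weyl0 n d :: 'k weyl ring" by (rule ideal_euler_ideal)
  have mc: "m \<in> carrier M" "euler n d \<odot>\<^bsub>M\<^esub> m = \<zero>\<^bsub>M\<^esub>" using m by (auto simp: eig_iff weyl_const_0)
  have *: "r \<odot>\<^bsub>M\<^esub> m = P \<odot>\<^bsub>M\<^esub> m" if r: "r \<in> coset0 n d P" for r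
  proof -
    obtain Q where Q: "Q \<in> weyl_part n d 0" "r = Q \<otimes>\<^bsub>weyl n\<^esub> euler n d \<oplus>\<^bsub>weyl n\<^esub> P"
      using r unfolding coset0_def a_r_coset_def' euler_ideal_eq weyl0_simps by blast
    then show ?thesis
      using mc weyl_part_carrier[OF P] weyl_part_carrier[OF Q(1)] by (simp add: smult_l_distr smult_assoc1 euler_closed)
  qed
  have "P \<in> coset0 n d P" unfolding coset0_def using P by (intro I.a_rcos_self) (simp add: weyl0_simps)
  then have "(SOME r. r \<in> coset0 n d P) \<in> coset0 n d P" by (rule someI)
  then show ?thesis unfolding deg0_mod_def by (simp add: *)
qed

lemma eig0_closed:
  assumes "left_module (weyl n) (M :: ('k::field_char_0, 'u) dmod)" "P \<in> weyl_part n d 0" "m \<in> eigenspace n d M 0"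
  shows "P \<odot>\<^bsub>M\<^esub> m \<in> eigenspace n d M 0"
  using eig_part[OF assms(1,2), of m 0] assms(3) by simp

lemma left_module_deg0:
  assumes M: "left_module (weyl n) (M :: ('k::field_char_0, 'u) dmod)"
  shows "left_module (weyl0_mod_euler n d) (deg0_mod n d M)"
proof -
  interpret M: left_module "weyl n" M by fact
  interpret V: additive_subgroup "eigenspace n d M 0" M by (rule eig_subgroup[OF M])
  note c = V.a_Hcarr and s = deg0_smult[OF M] and cl = eig0_closed[OF M] and cc = weyl_part_carrier[of _ n d 0, where 'k = 'k]
  show ?thesis
  proof (intro left_module.intro left_module_axioms.intro ring_weyl0_mod_euler)
    show "abelian_group (deg0_mod n d M)"
    proof (rule abelian_groupI, goal_cases)
      case (6 x)
      then show ?case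
        using V.a_inv_closed by (auto simp: deg0_simps c intro!: bexI[of _ "\<ominus>\<^bsub>M\<^esub> x"] M.M.l_neg)
    qed (auto simp: deg0_simps c M.M.a_ac)
  next
    fix S T :: "'k weyl set" and x y assume S: "S \<in> carrier (weyl0_mod_euler n d)" and x: "x \<in> carrier (deg0_mod n d M)"
    obtain P where P: "P \<in> weyl_part n d 0" "S = coset0 n d P" using weyl0_mod_euler_cases[OF S] .
    have x: "x \<in> eigenspace n d M 0" using x by (simp add: deg0_simps)
    show "S \<odot>\<^bsub>deg0_mod n d M\<^esub> x \<in> carrier (deg0_mod n d M)" using P x s cl by (simp add: deg0_simps)
    show "S \<odot>\<^bsub>deg0_mod n d M\<^esub> (x \<oplus>\<^bsub>deg0_mod n d M\<^esub> y) = S \<odot>\<^bsub>deg0_mod n d M\<^esub> x \<oplus>\<^bsub>deg0_mod n d M\<^esub> S \<odot>\<^bsub>deg0_mod n d M\<^esub> y"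
      if "y \<in> carrier (deg0_mod n d M)"
      using that P x s c cc by (simp add: deg0_simps M.smult_r_distr)
    assume "T \<in> carrier (weyl0_mod_euler n d)"
    then obtain Q where Q: "Q \<in> weyl_part n d 0" "T = coset0 n d Q" using weyl0_mod_euler_cases by metis
    show "(S \<oplus>\<^bsub>weyl0_mod_euler n d\<^esub> T) \<odot>\<^bsub>deg0_mod n d M\<^esub> x = S \<odot>\<^bsub>deg0_mod n d M\<^esub> x \<oplus>\<^bsub>deg0_mod n d M\<^esub> T \<odot>\<^bsub>deg0_mod n d M\<^esub> x"
      using P Q x s c cc weyl_part_add[OF P(1) Q(1)] by (simp add: deg0_simps M.smult_l_distr flip: coset0_facts(2))
    show "(S \<otimes>\<^bsub>weyl0_mod_euler n d\<^esub> T) \<odot>\<^bsub>deg0_mod n d M\<^esub> x = S \<odot>\<^bsub>deg0_mod n d M\<^esub> (T \<odot>\<^bsub>deg0_mod n d M\<^esub> x)"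
      using P Q x s c cc cl weyl_part_mult[OF P(1) Q(1)] by (simp add: deg0_simps M.smult_assoc1 flip: coset0_facts(3))
  next
    fix x assume x: "x \<in> carrier (deg0_mod n d M)"
    then show "\<one>\<^bsub>weyl0_mod_euler n d\<^esub> \<odot>\<^bsub>deg0_mod n d M\<^esub> x = x"
      using s[OF weyl_part_one, of x] c by (simp add: deg0_simps flip: coset0_facts(4))
  qed
qed

section \<open>The functor of degree zero parts\<close>

context weights
begin

lemma J_dom_0: "J_dom {0} M = eigenspace n d M 0"
  by (simp add: J_dom_def)

text \<open>Within degree 0 only the operators of degree 0 act, and they act through the quotient by
  the ideal of E.\<close>

lemma J_homs_0:
  assumes M: "left_module (weyl n) (M :: ('k::field_char_0, 'u) dmod)" and N: "left_module (weyl n) (N :: ('k, 'u) dmod)"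
  shows "J_homs {0} M N = mod_homs (weyl0_mod_euler n d) (deg0_mod n d M) (deg0_mod n d N)"
proof (intro equalityI subsetI)
  fix h assume h: "h \<in> J_homs {0} M N"
  note h' = J_homsD[OF h]
  show "h \<in> mod_homs (weyl0_mod_euler n d) (deg0_mod n d M) (deg0_mod n d N)"
  proof (rule mod_homsI)
    fix S x assume "S \<in> carrier (weyl0_mod_euler n d :: 'k weyl set ring)" and x: "x \<in> carrier (deg0_mod n d M)"
    then obtain P where P: "P \<in> weyl_part n d 0" "S = coset0 n d P" using weyl0_mod_euler_cases by metis
    have x: "x \<in> eigenspace n d M 0" using x by (simp add: deg0_simps)
    have "h x \<in> eigenspace n d N 0" using h'(2)[of 0 x] x by simp
    then show "h (S \<odot>\<^bsub>deg0_mod n d M\<^esub> x) = S \<odot>\<^bsub>deg0_mod n d N\<^esub> h x"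
      using h'(4)[of 0 0 P x] P x by (simp add: deg0_smult[OF M] deg0_smult[OF N])
  qed (use h'(1) h'(2)[of 0] h'(3)[of 0] in \<open>auto simp: deg0_simps J_dom_0\<close>)
next
  fix h assume h: "h \<in> mod_homs (weyl0_mod_euler n d) (deg0_mod n d M) (deg0_mod n d N)"
  note h' = mod_homsD[OF h]
  have "h (P \<odot>\<^bsub>M\<^esub> x) = P \<odot>\<^bsub>N\<^esub> h x" if "P \<in> weyl_part n d 0" "x \<in> eigenspace n d M 0" for P x
    using h'(4)[OF coset0_facts(1)[OF that(1)], of x] h'(1)[of x] that
    by (simp add: deg0_simps deg0_smult[OF M] deg0_smult[OF N])
  then show "h \<in> J_homs {0} M N"
    unfolding J_homs_def using h' by (auto simp: deg0_simps J_dom_0)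
qed

text \<open>The functor M \<mapsto> M_0, defined directly on the quotient category, since an arrow
  has well-defined values in nonnegative degrees. It does not mention \<open>omega0\<close>, which
  is only known up to isomorphism.\<close>

definition delta :: "(('k::field_char_0, 'u) dmod, 'u frac set, ('k weyl set, 'u) module, 'u \<Rightarrow> 'u) func" where
  "delta = \<lparr>omap = deg0_mod n d, amap = (\<lambda>M N F. restrict (qhom nonneg M N F) (eigenspace n d M 0))\<rparr>"

lemma delta_simps:
  "omap delta M = deg0_mod n d M" "amap delta M N F = restrict (qhom nonneg M N F) (eigenspace n d M 0)"
  by (simp_all add: delta_def)

lemma qhom_J_homs:
  assumes "euler0 n d (M :: ('k::field_char_0, 'u) dmod)" "euler0 n d N" "F \<in> Hom (qcoh n d) M N"
  shows "qhom nonneg M N F \<in> J_homs nonneg M N"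
  using qhom_bij[OF assms(1,2) subset_refl nonneg_separates[OF euler0D(1)[OF assms(2)]] nonneg_generates] assms(3)
  by (auto simp: bij_betw_def)

lemma delta_hom:
  assumes "euler0 n d (M :: ('k::field_char_0, 'u) dmod)" "euler0 n d N" "F \<in> Hom (qcoh n d) M N"
  shows "amap delta M N F \<in> J_homs {0} M N"
proof -
  note h = J_homsD[OF qhom_J_homs[OF assms]]
  interpret M: graded_group M "eig n d M" by (rule euler0D[OF assms(1)])
  have e: "eigenspace n d M 0 = eig n d M 0" "eigenspace n d N 0 = eig n d N 0" by simp_all
  show ?thesis
    unfolding J_homs_def delta_simps J_dom_0 e
    using h(2)[of 0] h(3)[of 0] h(4)[of 0 0] M.V_add[of _ 0] eig_part[OF euler0D(1)[OF assms(1)], of _ d 0 _ 0]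
    by auto
qed

lemma is_functor_delta:
  "is_functor (qcoh n d :: (('k::field_char_0, 'u) dmod, 'u frac set) cat) (mod_cat (weyl0_mod_euler n d)) delta"
  unfolding is_functor_def
proof (intro conjI ballI)
  fix M :: "('k, 'u) dmod" assume "M \<in> Obj (qcoh n d :: (('k, 'u) dmod, 'u frac set) cat)"
  then have M: "euler0 n d M" by (simp add: qcoh_simps)
  show "omap delta M \<in> Obj (mod_cat (weyl0_mod_euler n d))"
    by (simp add: mod_cat_simps delta_simps left_module_deg0[OF euler0D(1)[OF M]])
  have "eigenspace n d M 0 \<subseteq> J_dom nonneg M" using J_dom_def[of nonneg M] by force
  then show "amap delta M M (Id (qcoh n d) M) = Id (mod_cat (weyl0_mod_euler n d)) (omap delta M)"
    using qcoh_Id(2)[OF M subset_refl nonneg_separates[OF euler0D(1)[OF M]]]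
    by (auto simp: delta_simps mod_cat_simps deg0_simps fun_eq_iff restrict_def)
next
  fix M N :: "('k, 'u) dmod" and F
  assume "M \<in> Obj (qcoh n d :: (('k, 'u) dmod, 'u frac set) cat)" "N \<in> Obj (qcoh n d :: (('k, 'u) dmod, 'u frac set) cat)"
    and F: "F \<in> Hom (qcoh n d) M N"
  then have O: "euler0 n d M" "euler0 n d N" by (auto simp: qcoh_simps)
  show "amap delta M N F \<in> Hom (mod_cat (weyl0_mod_euler n d)) (omap delta M) (omap delta N)"
    using delta_hom[OF O F] J_homs_0[OF euler0D(1)[OF O(1)] euler0D(1)[OF O(2)]] by (simp add: mod_cat_simps delta_simps(1))
next
  fix M N P :: "('k, 'u) dmod" and F G
  assume "M \<in> Obj (qcoh n d :: (('k, 'u) dmod, 'u frac set) cat)" "N \<in> Obj (qcoh n d :: (('k, 'u) dmod, 'u frac set) cat)"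
    "P \<in> Obj (qcoh n d :: (('k, 'u) dmod, 'u frac set) cat)"
    and F: "F \<in> Hom (qcoh n d) M N" "G \<in> Hom (qcoh n d) N P"
  then have O: "euler0 n d M" "euler0 n d N" "euler0 n d P" by (auto simp: qcoh_simps)
  have "eigenspace n d M 0 \<subseteq> J_dom nonneg M" using J_dom_def[of nonneg M] by force
  moreover have "qhom nonneg M N F x \<in> eigenspace n d N 0" if "x \<in> eigenspace n d M 0" for x
    using J_homsD(2)[OF qhom_J_homs[OF O(1,2) F(1)], of 0 x] that by simp
  ultimately show "amap delta M P (Comp (qcoh n d) M N P G F) =
      Comp (mod_cat (weyl0_mod_euler n d)) (omap delta M) (omap delta N) (omap delta P) (amap delta N P G) (amap delta M N F)"
    using qcoh_Comp(2)[OF O F subset_refl nonneg_separates[OF euler0D(1)[OF O(2)]] nonneg_separates[OF euler0D(1)[OF O(3)]]]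
    by (auto simp: delta_simps mod_cat_simps deg0_simps fun_eq_iff compose_def restrict_def)
qed (auto simp: is_category_qcoh is_category_mod_cat)

lemma omega0_functor:
  assumes "infinite (UNIV :: 'u set)"
  shows "is_functor (qcoh n d :: (('k::field_char_0, 'u) dmod, 'u frac set) cat) (grmod0 n d) (omega0 n d)"
  using omega0_adjoint[OF assms] by (auto simp: is_right_adjoint_def)

text \<open>\<open>gamma0\<close> is \<open>delta\<close> after \<open>pi0\<close> after
  \<open>omega0\<close>: a homomorphism and its class in the quotient have the same values in degree
  0.\<close>

lemma gamma0_amap:
  assumes inf: "infinite (UNIV :: 'u set)" and O: "euler0 n d (M :: ('k::field_char_0, 'u) dmod)" "euler0 n d N"
    and F: "F \<in> Hom (qcoh n d) M N"
  shows "amap (gamma0 n d) M N F = amap delta (omap (omega0 n d) M) (omap (omega0 n d) N)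
    (amap (pi0 n d) (omap (omega0 n d) M) (omap (omega0 n d) N) (amap (omega0 n d) M N F))"
proof -
  interpret w: functr "qcoh n d :: (('k, 'u) dmod, 'u frac set) cat" "grmod0 n d" "omega0 n d"
    by unfold_locales (rule omega0_functor[OF inf])
  let ?M = "omap (omega0 n d) M" and ?N = "omap (omega0 n d) N"
  have O': "euler0 n d ?M" "euler0 n d ?N" using w.obj O by (auto simp: qcoh_simps(1) grmod0_simps)
  have "amap (omega0 n d) M N F \<in> mod_homs (weyl n) ?M ?N"
    using w.hom[OF _ _ F] O by (simp add: qcoh_simps(1) grmod0_simps)
  from pi0_hom(2)[OF O' this subset_refl nonneg_separates[OF euler0D(1)[OF O'(2)]]]
  have "qhom nonneg ?M ?N (amap (pi0 n d) ?M ?N (amap (omega0 n d) M N F)) = restrict (amap (omega0 n d) M N F) (J_dom nonneg ?M)" .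
  moreover have "eigenspace n d ?M 0 \<subseteq> J_dom nonneg ?M" using J_dom_def[of nonneg ?M] by force
  ultimately show ?thesis by (auto simp: gamma0_def delta_simps fun_eq_iff restrict_def)
qed

text \<open>Since \<open>gamma0\<close> factors as \<open>delta\<close> after \<open>pi0\<close>
  after \<open>omega0\<close>, applying \<open>delta\<close> to the invertible counit gives the
  isomorphism.\<close>

lemma gamma0_nat_iso:
  assumes inf: "infinite (UNIV :: 'u set)"
  shows "is_functor (qcoh n d :: (('k::field_char_0, 'u) dmod, 'u frac set) cat) (mod_cat (weyl0_mod_euler n d)) (gamma0 n d)"
    and "\<exists>\<alpha>. nat_iso (qcoh n d :: (('k::field_char_0, 'u) dmod, 'u frac set) cat) (mod_cat (weyl0_mod_euler n d)) (gamma0 n d) delta \<alpha>"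
proof -
  let ?Q = "qcoh n d :: (('k, 'u) dmod, 'u frac set) cat"
  interpret w: functr ?Q "grmod0 n d" "omega0 n d" by unfold_locales (rule omega0_functor[OF inf])
  interpret p: functr "grmod0 n d" ?Q "pi0 n d" by unfold_locales (rule is_functor_pi0)
  interpret dl: functr ?Q "mod_cat (weyl0_mod_euler n d)" delta by unfold_locales (rule is_functor_delta)
  let ?w = "omega0 n d :: (('k, 'u) dmod, 'u frac set, ('k, 'u) dmod, 'u \<Rightarrow> 'u) func"
  have om: "omap (gamma0 n d) M = omap delta (omap ?w M)" for M :: "('k, 'u) dmod"
    by (simp add: gamma0_def delta_simps)
  have po: "omap ?w M \<in> Obj ?Q" if "M \<in> Obj ?Q" for M using p.obj[OF w.obj[OF that]] by (simp add: omap_pi0)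
  note ph = p.hom[OF w.obj w.obj, unfolded omap_pi0]
  have am: "amap (gamma0 n d) M N F = amap delta (omap ?w M) (omap ?w N) (amap (pi0 n d) (omap ?w M) (omap ?w N) (amap ?w M N F))"
    if "M \<in> Obj ?Q" "N \<in> Obj ?Q" "F \<in> Hom ?Q M N" for M N F
    using gamma0_amap[OF inf _ _ that(3)] that(1,2) by (simp add: qcoh_simps(1))
  show "is_functor ?Q (mod_cat (weyl0_mod_euler n d)) (gamma0 n d)"
    unfolding is_functor_def om
  proof (intro conjI ballI)
    fix M assume M: "M \<in> Obj ?Q"
    show "amap (gamma0 n d) M M (Id ?Q M) = Id (mod_cat (weyl0_mod_euler n d)) (omap delta (omap ?w M))"
      using am[OF M M w.C.id_hom[OF M]] w.map_id[OF M] p.map_id[OF w.obj[OF M]] dl.map_id[OF po[OF M]]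
      by (simp add: omap_pi0)
  next
    fix M N P F G assume O: "M \<in> Obj ?Q" "N \<in> Obj ?Q" "P \<in> Obj ?Q" and F: "F \<in> Hom ?Q M N" "G \<in> Hom ?Q N P"
    show "amap (gamma0 n d) M P (Comp ?Q M N P G F) = Comp (mod_cat (weyl0_mod_euler n d)) (omap delta (omap ?w M)) (omap delta (omap ?w N))
        (omap delta (omap ?w P)) (amap (gamma0 n d) N P G) (amap (gamma0 n d) M N F)"
      using am[OF O(1,3) w.C.comp_hom[OF O F]] am[OF O(1,2) F(1)] am[OF O(2,3) F(2)] w.map_comp[OF O F]
        p.map_comp[OF w.obj[OF O(1)] w.obj[OF O(2)] w.obj[OF O(3)] w.hom[OF O(1,2) F(1)] w.hom[OF O(2,3) F(2)]]
        dl.map_comp[OF po[OF O(1)] po[OF O(2)] po[OF O(3)] ph[OF O(1,2) w.hom[OF O(1,2) F(1)]] ph[OF O(2,3) w.hom[OF O(2,3) F(2)]]]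
      by (simp add: omap_pi0)
  qed (use po dl.obj dl.hom ph w.hom am w.C.is_category dl.D.is_category in auto)
  obtain \<epsilon> where \<epsilon>: "nat_iso ?Q ?Q (comp_func (pi0 n d) ?w) id_func \<epsilon>" using omega0_counit[OF inf] by blast
  have \<epsilon>i: "is_iso ?Q (omap ?w M) M (\<epsilon> M)" if "M \<in> Obj ?Q" for M
    using \<epsilon> that by (simp add: nat_iso_def comp_func_def id_func_def omap_pi0)
  have \<epsilon>n: "Comp ?Q (omap ?w M) (omap ?w N) N (\<epsilon> N) (amap (pi0 n d) (omap ?w M) (omap ?w N) (amap ?w M N F)) = Comp ?Q (omap ?w M) M N F (\<epsilon> M)"
    if "M \<in> Obj ?Q" "N \<in> Obj ?Q" "F \<in> Hom ?Q M N" for M N F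
    using \<epsilon> that by (simp add: nat_iso_def comp_func_def id_func_def omap_pi0)
  have "nat_iso ?Q (mod_cat (weyl0_mod_euler n d)) (gamma0 n d) delta (\<lambda>M. amap delta (omap ?w M) M (\<epsilon> M))"
    unfolding nat_iso_def om
  proof (intro conjI ballI)
    fix M assume M: "M \<in> Obj ?Q"
    show "is_iso (mod_cat (weyl0_mod_euler n d)) (omap delta (omap ?w M)) (omap delta M) (amap delta (omap ?w M) M (\<epsilon> M))"
      by (rule dl.map_iso[OF po[OF M] M \<epsilon>i[OF M]])
  next
    fix M N F assume O: "M \<in> Obj ?Q" "N \<in> Obj ?Q" and F: "F \<in> Hom ?Q M N"
    note wF = ph[OF O w.hom[OF O F]]
    show "Comp (mod_cat (weyl0_mod_euler n d)) (omap delta (omap ?w M)) (omap delta (omap ?w N)) (omap delta N)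
        (amap delta (omap ?w N) N (\<epsilon> N)) (amap (gamma0 n d) M N F) =
      Comp (mod_cat (weyl0_mod_euler n d)) (omap delta (omap ?w M)) (omap delta M) (omap delta N) (amap delta M N F) (amap delta (omap ?w M) M (\<epsilon> M))"
      unfolding am[OF O F] dl.map_comp[OF po[OF O(1)] po[OF O(2)] O(2) wF w.C.isoD[OF \<epsilon>i[OF O(2)]], symmetric]
        dl.map_comp[OF po[OF O(1)] O w.C.isoD[OF \<epsilon>i[OF O(1)]] F, symmetric] \<epsilon>n[OF O F] ..
  qed
  then show "\<exists>\<alpha>. nat_iso ?Q (mod_cat (weyl0_mod_euler n d)) (gamma0 n d) delta \<alpha>" by blast
qed

text \<open>The map that a fraction induces in degree 0 alone is the restriction of the map it
  induces in all nonnegative degrees, so \<open>delta\<close> on arrows is \<open>qhom\<close> for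
  \<open>J = {0}\<close>.\<close>

lemma delta_bij:
  assumes O: "euler0 n d (M :: ('k::field_char_0, 'u) dmod)" "euler0 n d N" and sep: "J_separates {0} N" and gen: "J_generates {0} M"
  shows "bij_betw (amap delta M N) (Hom (qcoh n d) M N)
    (mod_homs (weyl0_mod_euler n d) (deg0_mod n d M) (deg0_mod n d N))"
proof -
  have J0: "{0} \<subseteq> nonneg" by simp
  have eq: "qhom {0} M N F = amap delta M N F" if F: "F \<in> Hom (qcoh n d) M N" for F
  proof -
    obtain t where t: "t \<in> fracs n d M N" "F = frac_eq n d M N `` {t}" using qcoh_Hom_cases[OF F] .
    obtain R where R: "good_rel n d M N R" "frac_rel t = R" using fracs_cases[OF O t(1)] by metis
    have "rel_hom {0} M N R = restrict (rel_hom nonneg M N R) (eigenspace n d M 0)"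
    proof (rule extensionalityI)
      show "rel_hom {0} M N R \<in> extensional (eigenspace n d M 0)" by (simp add: rel_hom_def J_dom_0)
      fix x assume x: "x \<in> eigenspace n d M 0"
      then have x0: "x \<in> eig n d M 0" by simp
      have 0: "0 \<in> nonneg" "0 \<in> {0 :: int}" by simp_all
      note r = rel_hom_eq(1,2)[OF O subset_refl R(1) 0(1) x0]
      show "rel_hom {0} M N R x = restrict (rel_hom nonneg M N R) (eigenspace n d M 0) x"
        unfolding restrict_apply'[OF x] by (rule rel_hom_eq(3)[OF O J0 R(1) 0(2) x0 r(2,1)])
    qed simp
    then show ?thesis
      using qhom_class[OF O J0 sep t(1)] qhom_class[OF O subset_refl nonneg_separates[OF euler0D(1)[OF O(2)]] t(1)] t(2) R(2)
      by (simp add: frac_hom_def delta_simps)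
  qed
  have "bij_betw (qhom {0} M N) (Hom (qcoh n d) M N) (mod_homs (weyl0_mod_euler n d) (deg0_mod n d M) (deg0_mod n d N))"
    using qhom_bij[OF O J0 sep gen] J_homs_0[OF euler0D(1)[OF O(1)] euler0D(1)[OF O(2)]] by simp
  then show ?thesis by (rule bij_betw_cong[THEN iffD1, rotated]) (erule eq)
qed

end

section \<open>Coprime weights\<close>

lemma bezout_weights:
  fixes d :: "nat \<Rightarrow> nat"
  shows "\<exists>v :: nat \<Rightarrow> int. (\<Sum>i\<le>n. int (d i) * v i) = int (Gcd (d ` {..n}))"
proof (induction n)
  case 0
  show ?case by (intro exI[of _ "\<lambda>_. 1"]) simp
next
  case (Suc n)
  then obtain v :: "nat \<Rightarrow> int" where v: "(\<Sum>i\<le>n. int (d i) * v i) = int (Gcd (d ` {..n}))" by blast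
  obtain a b where ab: "a * int (d (Suc n)) + b * int (Gcd (d ` {..n})) = gcd (int (d (Suc n))) (int (Gcd (d ` {..n})))"
    using bezout_int by metis
  let ?v = "\<lambda>i. if i = Suc n then a else b * v i"
  have "(\<Sum>i\<le>Suc n. int (d i) * ?v i) = (\<Sum>i\<le>n. int (d i) * (b * v i)) + int (d (Suc n)) * a"
    by simp
  also have "(\<Sum>i\<le>n. int (d i) * (b * v i)) = b * int (Gcd (d ` {..n}))"
    unfolding v[symmetric] sum_distrib_left by (intro sum.cong) auto
  also have "b * int (Gcd (d ` {..n})) + int (d (Suc n)) * a = int (gcd (d (Suc n)) (Gcd (d ` {..n})))"
    using ab by (simp add: algebra_simps)
  also have "gcd (d (Suc n)) (Gcd (d ` {..n})) = Gcd (d ` {..Suc n})"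
    by (simp add: atMost_Suc)
  finally show ?case by (intro exI[of _ ?v])
qed

text \<open>The constraints cut out a cone; a vector in the kernel of \<open>v \<mapsto> \<Sum>\<^sub>i d\<^sub>i v\<^sub>i\<close> pointing
  into it moves any solution of the equation into the cone.\<close>

lemma avoiding_vector:
  fixes d :: "nat \<Rightarrow> nat" and t :: "nat \<Rightarrow> int"
  assumes gcd1: "Gcd (d ` {..n}) = 1" and pos: "\<And>i. i \<le> n \<Longrightarrow> 0 < d i" and k: "k \<ge> 0"
    and A: "A \<subseteq> {..n}" and full: "A = {..n} \<Longrightarrow> (\<Sum>i\<le>n. int (d i) * t i) = k"
  obtains v :: "nat \<Rightarrow> int" where "(\<Sum>i\<le>n. int (d i) * v i) = k"
    "\<And>i. \<lbrakk>i \<in> A; t i \<ge> 0\<rbrakk> \<Longrightarrow> v i \<le> t i" "\<And>i. \<lbrakk>i \<in> A; t i < 0\<rbrakk> \<Longrightarrow> v i > t i"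
proof -
  note found = that
  let ?P = "{i \<in> A. t i \<ge> 0}" and ?Q = "{i \<in> A. t i < 0}"
  have fin: "finite A" using A finite_subset by blast
  have from_kernel: thesis if u: "(\<Sum>i\<le>n. int (d i) * u i) = 0" "\<And>i. i \<in> ?P \<Longrightarrow> u i < 0" "\<And>i. i \<in> ?Q \<Longrightarrow> u i > 0" for u
  proof -
    obtain w :: "nat \<Rightarrow> int" where w: "(\<Sum>i\<le>n. int (d i) * w i) = 1" using bezout_weights[of d n] gcd1 by auto
    \<comment> \<open>The factor is chosen so large that N u_i outweighs both k w_i and t_i at every
      constrained index.\<close>
    define N where "N = (\<Sum>i\<le>n. \<bar>k * w i\<bar> + \<bar>t i\<bar>) + 1"
    have N: "\<bar>k * w i\<bar> + \<bar>t i\<bar> < N" if "i \<in> A" for i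
    proof -
      have "\<bar>k * w i\<bar> + \<bar>t i\<bar> \<le> (\<Sum>i\<le>n. \<bar>k * w i\<bar> + \<bar>t i\<bar>)"
        using that A by (intro member_le_sum) auto
      then show ?thesis by (simp add: N_def)
    qed
    show thesis
    proof (rule found[of "\<lambda>i. k * w i + N * u i"])
      have "(\<Sum>i\<le>n. int (d i) * (k * w i + N * u i)) = k * (\<Sum>i\<le>n. int (d i) * w i) + N * (\<Sum>i\<le>n. int (d i) * u i)"
        by (simp add: sum_distrib_left sum.distrib algebra_simps)
      then show "(\<Sum>i\<le>n. int (d i) * (k * w i + N * u i)) = k" using w u by simp
      fix i assume i: "i \<in> A"
      have N0: "N \<ge> 0" using N[OF i] by linarith
      {
        assume "t i \<ge> 0"
        then have "N * u i \<le> N * (- 1)" using u(2)[of i] i N0 by (intro mult_left_mono) auto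
        then show "k * w i + N * u i \<le> t i" using N[OF i] by linarith
      next
        assume "t i < 0"
        then have "N * 1 \<le> N * u i" using u(3)[of i] i N0 by (intro mult_left_mono) auto
        then show "k * w i + N * u i > t i" using N[OF i] by linarith
      }
    qed
  qed
  have sumPQ: "(\<Sum>i\<le>n. int (d i) * (if i \<in> ?P then a else if i \<in> ?Q then b else 0)) = a * (\<Sum>i\<in>?P. int (d i)) + b * (\<Sum>i\<in>?Q. int (d i))"
    for a b :: int
  proof -
    have "(\<Sum>i\<le>n. int (d i) * (if i \<in> ?P then a else if i \<in> ?Q then b else 0))
        = (\<Sum>i\<le>n. if i \<in> ?P then int (d i) * a else 0) + (\<Sum>i\<le>n. if i \<in> ?Q then int (d i) * b else 0)"
      unfolding sum.distrib[symmetric] by (intro sum.cong) auto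
    also have "\<dots> = (\<Sum>i\<in>{..n} \<inter> ?P. int (d i) * a) + (\<Sum>i\<in>{..n} \<inter> ?Q. int (d i) * b)"
      by (simp only: sum.inter_restrict[symmetric] finite_atMost)
    also have "{..n} \<inter> ?P = ?P" using A by auto
    also have "{..n} \<inter> ?Q = ?Q" using A by auto
    finally show ?thesis by (simp add: sum_distrib_left mult.commute)
  qed
  show thesis
  proof (cases "A = {..n}")
    case False
    then obtain r where r: "r \<le> n" "r \<notin> A" using A by blast
    \<comment> \<open>The unconstrained index \<open>r\<close> absorbs the imbalance: entries -d_r
      on \<open>?P\<close> and d_r on \<open>?Q\<close> are compensated by the difference of the two
      sums of weights at \<open>r\<close>.\<close>
    let ?u = "\<lambda>i. (if i \<in> ?P then - int (d r) else if i \<in> ?Q then int (d r) else 0)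
        + (if i = r then (\<Sum>i\<in>?P. int (d i)) - (\<Sum>i\<in>?Q. int (d i)) else 0)"
    show thesis
    proof (rule from_kernel[of ?u])
      have "(\<Sum>i\<le>n. int (d i) * (if i = r then c else 0)) = int (d r) * c" for c :: int
        using r by (simp add: if_distrib[of "\<lambda>x. _ * x"] cong: if_cong)
      then show "(\<Sum>i\<le>n. int (d i) * ?u i) = 0"
        unfolding distrib_left sum.distrib sumPQ by (simp add: algebra_simps)
    qed (use r pos in auto)
  next
    case True
    \<comment> \<open>When every index is constrained, \<open>t\<close> itself works if it has no
      negative entry; it cannot be negative throughout, because its weighted sum is k \<ge> 0;
      otherwise the two sign classes balance each other.\<close>
    consider "?Q = {}" | "?P = {}" | "?P \<noteq> {}" "?Q \<noteq> {}" by blast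
    then show thesis
    proof cases
      case 1
      then show thesis using full[OF True] by (intro found[of t]) auto
    next
      case 2
      have "(\<Sum>i\<le>n. int (d i) * t i) < (\<Sum>i\<le>n. 0)"
        using 2 True pos by (intro sum_strict_mono mult_pos_neg) auto
      then show thesis using full[OF True] k by simp
    next
      case 3
      have s: "(\<Sum>i\<in>?P. int (d i)) > 0" "(\<Sum>i\<in>?Q. int (d i)) > 0"
        using 3 pos A fin by (intro sum_pos; auto)+
      let ?u = "\<lambda>i. if i \<in> ?P then - (\<Sum>i\<in>?Q. int (d i)) else if i \<in> ?Q then (\<Sum>i\<in>?P. int (d i)) else 0"
      show thesis
        by (rule from_kernel[of ?u]) (use s in \<open>auto simp only: sumPQ, auto\<close>)
    qed
  qed
qed

section \<open>Products of words with their duals\<close>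

definition ind :: "nat \<Rightarrow> nat \<Rightarrow> nat" where
  "ind i = (\<lambda>j. if j = i then 1 else 0)"

text \<open>The Euler field of the indicator weights is \<open>x\<^sub>i\<partial>\<^sub>i\<close>, and the commutation rule of Euler
  fields then says how it moves past words.\<close>

abbreviation theta :: "nat \<Rightarrow> nat \<Rightarrow> 'k::field weyl" where
  "theta n i \<equiv> euler n (ind i)"

lemma theta_eq: "i \<le> n \<Longrightarrow> theta n i = weyl_x n i \<otimes>\<^bsub>weyl n\<^esub> (weyl_d n i :: 'k::field weyl)"
proof -
  assume i: "i \<le> n"
  interpret D: ring "weyl n :: 'k weyl ring" by (rule ring_weyl)
  have "theta n i = (\<Oplus>\<^bsub>weyl n\<^esub>j\<in>{..n}. if i = j then weyl_x n j \<otimes>\<^bsub>weyl n\<^esub> weyl_d n j else \<zero>\<^bsub>weyl n :: 'k weyl ring\<^esub>)"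
    unfolding euler_def
    by (intro D.finsum_cong') (auto simp: ind_def weyl_const_1 weyl_const_0 weyl_x_closed weyl_d_closed)
  also have "\<dots> = weyl_x n i \<otimes>\<^bsub>weyl n\<^esub> weyl_d n i"
    using i by (intro D.finsum_singleton) (auto simp: weyl_x_closed weyl_d_closed)
  finally show ?thesis .
qed

lemma theta_part: "i \<le> n \<Longrightarrow> theta n i \<in> (weyl_part n d 0 :: 'k::field weyl set)"
  using weyl_part_mult[OF weyl_part_x[of i n d] weyl_part_d[of i n d]] by (simp add: theta_eq)

lemma theta_theta:
  assumes "i \<le> n" "j \<le> n"
  shows "theta n i \<otimes>\<^bsub>weyl n\<^esub> theta n j = theta n j \<otimes>\<^bsub>weyl n\<^esub> (theta n i :: 'k::field weyl)"
  using euler_central[OF theta_part[OF assms(2), of "ind i"]] .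

abbreviation wd :: "nat \<Rightarrow> letter list \<Rightarrow> 'k::field weyl" where
  "wd n u \<equiv> weyl_class n (mono 1 u)"

fun swap :: "letter \<Rightarrow> letter" where
  "swap (Lx i) = Ld i"
| "swap (Ld i) = Lx i"

fun index :: "letter \<Rightarrow> nat" where
  "index (Lx i) = i"
| "index (Ld i) = i"

text \<open>The factor \<open>x\<^sub>i\<partial>\<^sub>i - root\<close> splits off when the letter \<open>l\<close>, with \<open>r\<close> to its right, meets its
  dual.\<close>

fun root :: "letter \<Rightarrow> letter list \<Rightarrow> int" where
  "root (Lx i) r = - 1 - word_deg (ind i) r"
| "root (Ld i) r = - word_deg (ind i) r"

lemma wd_append:
  "\<lbrakk>u \<in> lists (letters n); v \<in> lists (letters n)\<rbrakk> \<Longrightarrow> wd n (u @ v) = wd n u \<otimes>\<^bsub>weyl n\<^esub> (wd n v :: 'k::field weyl)"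
  by (simp add: mono_mult mono_carrier flip: weyl_class_mult)

lemma wd_closed: "u \<in> lists (letters n) \<Longrightarrow> wd n u \<in> carrier (weyl n :: 'k::field weyl ring)"
  by (intro weyl_class_closed mono_carrier)

lemma wd_Nil: "wd n [] = (\<one>\<^bsub>weyl n\<^esub> :: 'k::field weyl)"
  by (simp add: weyl_const_1 flip: weyl_const_eq)

lemma wd_single: "wd n [l] = (wl n l :: 'k::field weyl)"
  by (simp add: word_eq_mono)

lemma swap_letters: "l \<in> letters n \<Longrightarrow> swap l \<in> letters n"
  by (cases l) (auto simp: letters_def)

lemma index_letters: "l \<in> letters n \<Longrightarrow> index l \<le> n"
  by (auto simp: letters_def)

lemma swap_mult:
  assumes "l \<in> letters n"
  shows "wl n (swap l) \<otimes>\<^bsub>weyl n\<^esub> wl n l =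
    theta n (index l) \<oplus>\<^bsub>weyl n\<^esub> (weyl_const n (case l of Lx i \<Rightarrow> 1 | Ld i \<Rightarrow> 0) :: 'k::field weyl)"
proof -
  interpret D: ring "weyl n :: 'k weyl ring" by (rule ring_weyl)
  show ?thesis
    using assms
  proof (cases rule: letters_cases)
    case (1 i)
    then show ?thesis using weyl_dx[OF 1(1) 1(1), where 'k = 'k] by (simp add: theta_eq weyl_x_def weyl_d_def)
  next
    case (2 i)
    then show ?thesis
      by (simp add: theta_eq[symmetric] weyl_const_0 euler_closed flip: weyl_x_def weyl_d_def)
  qed
qed

text \<open>The innermost pair is x_i\<partial>_i or x_i\<partial>_i + 1, where i is the index of
  \<open>l\<close>. Moving it to the right past \<open>r\<close> shifts it by the degree of
  \<open>r\<close> in that variable, and \<open>root\<close> records the result. Iterated, the dual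
  word times the word becomes a product of factors x_i\<partial>_i - root.\<close>

lemma dual_word_mult:
  assumes "l \<in> letters n" "r \<in> lists (letters n)"
  shows "wd n (rev (map swap (l # r))) \<otimes>\<^bsub>weyl n\<^esub> wd n (l # r) =
    (wd n (rev (map swap r)) \<otimes>\<^bsub>weyl n\<^esub> wd n r) \<otimes>\<^bsub>weyl n\<^esub>
      (theta n (index l) \<oplus>\<^bsub>weyl n\<^esub> (weyl_const n (- of_int (root l r)) :: 'k::field weyl))"
proof -
  interpret D: ring "weyl n :: 'k weyl ring" by (rule ring_weyl)
  let ?D = "weyl n :: 'k weyl ring" and ?th = "theta n (index l) :: 'k weyl"
  let ?e = "case l of Lx i \<Rightarrow> 1 | Ld i \<Rightarrow> (0 :: 'k)" and ?w = "word_deg (ind (index l)) r"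
  have sr: "rev (map swap r) \<in> lists (letters n)" using assms(2) swap_letters by auto
  note c = wd_closed[OF sr, where 'k = 'k] wd_closed[OF assms(2), where 'k = 'k] wl_closed[OF assms(1), where 'k = 'k]
    wl_closed[OF swap_letters[OF assms(1)], where 'k = 'k] euler_closed[of n "ind (index l)", where 'k = 'k]
  have "wd n (rev (map swap (l # r))) = wd n (rev (map swap r)) \<otimes>\<^bsub>?D\<^esub> wl n (swap l)"
    using wd_append[OF sr, of "[swap l]"] swap_letters[OF assms(1)] by (simp add: wd_single)
  moreover have "wd n (l # r) = wl n l \<otimes>\<^bsub>?D\<^esub> wd n r" by (rule mono_Cons[OF assms])
  ultimately have "wd n (rev (map swap (l # r))) \<otimes>\<^bsub>?D\<^esub> wd n (l # r)
      = wd n (rev (map swap r)) \<otimes>\<^bsub>?D\<^esub> ((wl n (swap l) \<otimes>\<^bsub>?D\<^esub> wl n l) \<otimes>\<^bsub>?D\<^esub> wd n r)"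
    using c by (simp add: D.m_assoc)
  also have "(wl n (swap l) \<otimes>\<^bsub>?D\<^esub> wl n l) \<otimes>\<^bsub>?D\<^esub> wd n r = ?th \<otimes>\<^bsub>?D\<^esub> wd n r \<oplus>\<^bsub>?D\<^esub> weyl_const n ?e \<otimes>\<^bsub>?D\<^esub> wd n r"
    unfolding swap_mult[OF assms(1)] using c by (simp add: D.l_distr weyl_const_closed)
  also have "?th \<otimes>\<^bsub>?D\<^esub> wd n r = wd n r \<otimes>\<^bsub>?D\<^esub> ?th \<oplus>\<^bsub>?D\<^esub> weyl_const n (of_int ?w) \<otimes>\<^bsub>?D\<^esub> wd n r"
    by (rule euler_comm[OF mono_part[OF assms(2)]])
  also have "wd n r \<otimes>\<^bsub>?D\<^esub> ?th \<oplus>\<^bsub>?D\<^esub> weyl_const n (of_int ?w) \<otimes>\<^bsub>?D\<^esub> wd n r \<oplus>\<^bsub>?D\<^esub> weyl_const n ?e \<otimes>\<^bsub>?D\<^esub> wd n r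
      = wd n r \<otimes>\<^bsub>?D\<^esub> (?th \<oplus>\<^bsub>?D\<^esub> weyl_const n (of_int ?w + ?e))"
    using c weyl_const_comm[OF c(2)] by (simp add: D.r_distr D.a_assoc weyl_const_closed weyl_const_add)
  also have "of_int ?w + ?e = - of_int (root l r)" by (cases l) auto
  finally show ?thesis using c by (simp add: D.m_assoc weyl_const_closed)
qed

text \<open>The factors of the dual word times the word are applied to \<open>m\<close> one at a
  time; the first one that yields zero kills a nonzero vector, which has stayed in \<open>S\<close>
  because \<open>S\<close> is stable under such factors.\<close>

lemma factor_kills:
  assumes M: "left_module (weyl n) (M :: ('k::field, 'u) dmod)" and u: "u \<in> lists (letters n)"
    and S: "S \<subseteq> carrier M" "\<And>i c m. \<lbrakk>i \<le> n; m \<in> S\<rbrakk> \<Longrightarrow> (theta n i \<oplus>\<^bsub>weyl n\<^esub> weyl_const n c) \<odot>\<^bsub>M\<^esub> m \<in> S"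
    and m: "m \<in> S" "m \<noteq> \<zero>\<^bsub>M\<^esub>" "wd n (rev (map swap u)) \<odot>\<^bsub>M\<^esub> (wd n u \<odot>\<^bsub>M\<^esub> m) = \<zero>\<^bsub>M\<^esub>"
  shows "\<exists>p l r m'. u = p @ l # r \<and> m' \<in> S \<and> m' \<noteq> \<zero>\<^bsub>M\<^esub> \<and>
    (theta n (index l) \<oplus>\<^bsub>weyl n\<^esub> weyl_const n (- of_int (root l r))) \<odot>\<^bsub>M\<^esub> m' = \<zero>\<^bsub>M\<^esub>"
  using u m
proof (induction u arbitrary: m rule: list.induct)
  case Nil
  interpret left_module "weyl n" M by fact
  show ?case using Nil S(1) by (auto simp: wd_Nil)
next
  case (Cons l r)
  interpret left_module "weyl n" M by fact
  have lr: "l \<in> letters n" "r \<in> lists (letters n)" using Cons.prems(1) by auto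
  have sr: "rev (map swap r) \<in> lists (letters n)" "rev (map swap (l # r)) \<in> lists (letters n)"
    using lr swap_letters by auto
  let ?f = "theta n (index l) \<oplus>\<^bsub>weyl n\<^esub> (weyl_const n (- of_int (root l r)) :: 'k weyl)"
  let ?m = "?f \<odot>\<^bsub>M\<^esub> m"
  have mc: "m \<in> carrier M" and mS: "?m \<in> S" using S Cons.prems(2) index_letters[OF lr(1)] by auto
  have fc: "?f \<in> carrier (weyl n)" by (simp add: euler_closed weyl_const_closed)
  show ?case
  proof (cases "?m = \<zero>\<^bsub>M\<^esub>")
    case True
    then show ?thesis using Cons.prems by (intro exI[of _ "[]"] exI[of _ l] exI[of _ r] exI[of _ m]) simp
  next
    case False
    have "wd n (rev (map swap r)) \<odot>\<^bsub>M\<^esub> (wd n r \<odot>\<^bsub>M\<^esub> ?m) =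
        ((wd n (rev (map swap r)) \<otimes>\<^bsub>weyl n\<^esub> wd n r) \<otimes>\<^bsub>weyl n\<^esub> ?f) \<odot>\<^bsub>M\<^esub> m"
      using mc fc lr sr by (simp add: smult_assoc1 wd_closed)
    also have "\<dots> = wd n (rev (map swap (l # r))) \<odot>\<^bsub>M\<^esub> (wd n (l # r) \<odot>\<^bsub>M\<^esub> m)"
      unfolding dual_word_mult[OF lr, symmetric] using mc Cons.prems(1) sr(2)
      by (intro smult_assoc1 wd_closed)
    finally have "wd n (rev (map swap r)) \<odot>\<^bsub>M\<^esub> (wd n r \<odot>\<^bsub>M\<^esub> ?m) = \<zero>\<^bsub>M\<^esub>" using Cons.prems(4) by simp
    from Cons.IH[OF lr(2) mS False this] obtain p l' r' m' where
      "r = p @ l' # r'" "m' \<in> S" "m' \<noteq> \<zero>\<^bsub>M\<^esub>"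
      "(theta n (index l') \<oplus>\<^bsub>weyl n\<^esub> weyl_const n (- of_int (root l' r'))) \<odot>\<^bsub>M\<^esub> m' = \<zero>\<^bsub>M\<^esub>" by blast
    then show ?thesis by (intro exI[of _ "l # p"] exI[of _ l'] exI[of _ r'] exI[of _ m']) simp
  qed
qed

text \<open>Positive entries become powers of \<partial>_i and negative ones powers of x_i, so that
  the resulting word lowers the weight by the sum of all d_i v_i.\<close>

definition letter_block :: "(nat \<Rightarrow> int) \<Rightarrow> nat \<Rightarrow> letter list" where
  "letter_block v i = (if v i \<ge> 0 then replicate (nat (v i)) (Ld i) else replicate (nat (- v i)) (Lx i))"

definition vector_word :: "nat \<Rightarrow> (nat \<Rightarrow> int) \<Rightarrow> letter list" where
  "vector_word n v = concat (map (letter_block v) [0..<Suc n])"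

lemma word_deg_simps:
  "word_deg d [] = 0" "word_deg d (l # u) = letter_deg d l + word_deg d u"
  "word_deg d (u @ w) = word_deg d u + word_deg d w" "word_deg d (replicate m l) = int m * letter_deg d l"
  by (simp_all add: word_deg_def sum_list_replicate)

lemma word_deg_vector_word: "word_deg d (vector_word n v) = - (\<Sum>i\<le>n. int (d i) * v i)"
proof -
  have "word_deg d (concat (map (letter_block v) xs)) = sum_list (map (\<lambda>i. - (int (d i) * v i)) xs)" for xs
    by (induction xs) (auto simp: word_deg_simps letter_block_def)
  then have "word_deg d (vector_word n v) = (\<Sum>i\<in>{0..<Suc n}. - (int (d i) * v i))"
    unfolding vector_word_def by (simp only: interv_sum_list_conv_sum_set_nat) simp
  then show ?thesis by (simp add: sum_negf atLeast0LessThan lessThan_Suc_atMost)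
qed

lemma vector_word_letters: "vector_word n v \<in> lists (letters n)"
  by (auto simp: vector_word_def letter_block_def letters_def split: if_splits)

lemma count_vector_word:
  "count_list (vector_word n v) (Ld i) = (if i \<le> n \<and> v i \<ge> 0 then nat (v i) else 0)"
  "count_list (vector_word n v) (Lx i) = (if i \<le> n \<and> v i < 0 then nat (- v i) else 0)"
proof -
  have rep: "count_list (replicate m a) b = (if a = b then m else 0)" for m and a b :: letter
    by (induction m) auto
  have "count_list (concat (map (letter_block v) xs)) l = sum_list (map (\<lambda>j. count_list (letter_block v j) l) xs)" for xs l
    by (induction xs) auto
  then have s: "count_list (vector_word n v) l = (\<Sum>j\<in>{..n}. count_list (letter_block v j) l)" for l
    unfolding vector_word_def by (simp only: interv_sum_list_conv_sum_set_nat set_upt atLeast0LessThan lessThan_Suc_atMost)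
  have "count_list (letter_block v j) (Ld i) = (if j = i then (if v i \<ge> 0 then nat (v i) else 0) else 0)"
    "count_list (letter_block v j) (Lx i) = (if j = i then (if v i < 0 then nat (- v i) else 0) else 0)" for j
    by (auto simp: letter_block_def rep)
  then show "count_list (vector_word n v) (Ld i) = (if i \<le> n \<and> v i \<ge> 0 then nat (v i) else 0)"
    "count_list (vector_word n v) (Lx i) = (if i \<le> n \<and> v i < 0 then nat (- v i) else 0)"
    unfolding s by (auto simp: sum.delta)
qed

lemma word_deg_ind: "word_deg (ind i) r = int (count_list r (Lx i)) - int (count_list r (Ld i))"
proof (induction r)
  case (Cons l r)
  then show ?case by (cases l) (auto simp: word_deg_simps ind_def)
qed (simp add: word_deg_simps)

text \<open>These are the roots of x^m \<partial>^m, namely 0, ..., m - 1, and of \<partial>^m x^m,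
  namely -m, ..., -1. The inequalities of \<open>avoiding_vector\<close> are made to keep t_i out of
  this range.\<close>

lemma root_vector_word:
  assumes "vector_word n v = p @ l # r"
  shows "(0 \<le> root l r \<and> root l r < v (index l)) \<or> (v (index l) \<le> root l r \<and> root l r < 0)"
proof -
  have c: "count_list (vector_word n v) a = count_list p a + (if l = a then 1 else 0) + count_list r a" for a
    by (simp add: assms)
  show ?thesis
  proof (cases l)
    case (Lx i)
    have "v i < 0" "nat (- v i) = count_list p (Lx i) + 1 + count_list r (Lx i)"
      using c[of "Lx i"] count_vector_word(2)[of n v i] Lx by (auto split: if_splits)
    moreover from this have "count_list r (Ld i) = 0"
      using c[of "Ld i"] count_vector_word(1)[of n v i] by auto
    ultimately show ?thesis using Lx by (simp add: word_deg_ind)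
  next
    case (Ld i)
    have "v i \<ge> 0" "nat (v i) = count_list p (Ld i) + 1 + count_list r (Ld i)"
      using c[of "Ld i"] count_vector_word(1)[of n v i] Ld by (auto split: if_splits)
    moreover from this have "count_list r (Lx i) = 0"
      using c[of "Lx i"] count_vector_word(2)[of n v i] by auto
    ultimately show ?thesis using Ld by (simp add: word_deg_ind)
  qed
qed

section \<open>Separation and generation by degree zero\<close>

locale coprime_weights = weights +
  assumes coprime: "Gcd (d ` {..n}) = 1"
begin

text \<open>Otherwise one finds, one index after the other, joint eigenvectors of the \<open>x\<^sub>i\<partial>\<^sub>i\<close> with integer
  eigenvalues \<open>t\<^sub>i\<close>, and for a suitable word of degree \<open>-k\<close> the product with its dual acts by a nonzero
  scalar.\<close>

lemma killed_eig_zero: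
  assumes M: "left_module (weyl n) (M :: ('k::field_char_0, 'u) dmod)" and k: "k \<ge> 0"
    and "A \<subseteq> {..n}" "m \<in> eig n d M k" "\<And>P. P \<in> weyl_part n d (- k) \<Longrightarrow> P \<odot>\<^bsub>M\<^esub> m = \<zero>\<^bsub>M\<^esub>"
    and "\<And>i. i \<in> A \<Longrightarrow> theta n i \<odot>\<^bsub>M\<^esub> m = weyl_const n (of_int (t i)) \<odot>\<^bsub>M\<^esub> m"
  shows "m = \<zero>\<^bsub>M\<^esub>"
  using assms(3-)
proof (induction "card ({..n} - A)" arbitrary: A t m rule: less_induct)
  \<comment> \<open>\<open>A\<close> is the set of indices whose eigenvalue is known; it grows
    during the induction. New eigenvalues arise only as roots of factors and are therefore
    integers.\<close>
  case less
  interpret left_module "weyl n" M by fact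
  show ?case
  proof (rule ccontr)
    assume m0: "m \<noteq> \<zero>\<^bsub>M\<^esub>"
    have mc: "m \<in> carrier M" using less.prems(2) by (simp add: eig_iff)
    \<comment> \<open>Once all eigenvalues are known, they determine the weight of \<open>m\<close>,
      which is k because \<open>m\<close> is nonzero.\<close>
    have full: "(\<Sum>i\<le>n. int (d i) * t i) = k" if "A = {..n}"
    proof -
      have csum: "finsum M (\<lambda>i. weyl_const n (f i) \<odot>\<^bsub>M\<^esub> m) B = weyl_const n (sum f B) \<odot>\<^bsub>M\<^esub> m"
        if "finite B" for f :: "nat \<Rightarrow> 'k" and B
        using that
      proof (induction B rule: finite_induct)
        case (insert a B)
        then show ?case using mc by (simp add: weyl_const_add smult_l_distr weyl_const_closed Pi_def)
      qed (use mc in \<open>simp add: weyl_const_0\<close>)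
      have "euler n d \<odot>\<^bsub>M\<^esub> m = finsum M (\<lambda>i. weyl_const n (of_int (int (d i) * t i)) \<odot>\<^bsub>M\<^esub> m) {..n}"
        unfolding euler_smult[OF M mc]
      proof (intro M.finsum_cong')
        fix i assume "i \<in> {..n}"
        then have i: "i \<le> n" "i \<in> A" using that by auto
        have "weyl_x n i \<odot>\<^bsub>M\<^esub> (weyl_d n i \<odot>\<^bsub>M\<^esub> m) = weyl_const n (of_int (t i)) \<odot>\<^bsub>M\<^esub> m"
          using less.prems(4)[OF i(2)] mc theta_eq[OF i(1), where 'k = 'k]
          by (simp add: smult_assoc1 weyl_x_closed[OF i(1)] weyl_d_closed[OF i(1)])
        then show "weyl_const n (of_nat (d i)) \<odot>\<^bsub>M\<^esub> (weyl_x n i \<odot>\<^bsub>M\<^esub> (weyl_d n i \<odot>\<^bsub>M\<^esub> m)) = weyl_const n (of_int (int (d i) * t i)) \<odot>\<^bsub>M\<^esub> m"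
          using mc by (simp add: smult_assoc1 weyl_const_closed weyl_const_mult)
      qed (use mc in \<open>auto simp: weyl_const_closed\<close>)
      also have "\<dots> = weyl_const n (of_int (\<Sum>i\<le>n. int (d i) * t i)) \<odot>\<^bsub>M\<^esub> m"
        by (subst csum) (simp_all only: finite_atMost of_int_sum)
      finally have "m \<in> eig n d M (\<Sum>i\<le>n. int (d i) * t i)" using mc by (simp add: eig_iff del: of_int_sum)
      then show ?thesis using eig_disjoint[OF M less.prems(2)] m0 by metis
    qed
    obtain v where v: "(\<Sum>i\<le>n. int (d i) * v i) = k"
      "\<And>i. \<lbrakk>i \<in> A; t i \<ge> 0\<rbrakk> \<Longrightarrow> v i \<le> t i" "\<And>i. \<lbrakk>i \<in> A; t i < 0\<rbrakk> \<Longrightarrow> v i > t i"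
      using avoiding_vector[OF coprime pos k less.prems(1), of t] full by blast
    \<comment> \<open>The hypotheses on \<open>m\<close>, collected as a set. It is stable under the
      factors because these have degree 0 and the x_i\<partial>_i commute with each other.\<close>
    define S where "S = {m \<in> eig n d M k. (\<forall>P\<in>weyl_part n d (- k). P \<odot>\<^bsub>M\<^esub> m = \<zero>\<^bsub>M\<^esub>) \<and>
      (\<forall>i\<in>A. theta n i \<odot>\<^bsub>M\<^esub> m = weyl_const n (of_int (t i)) \<odot>\<^bsub>M\<^esub> m)}"
    have "wd n (vector_word n v) \<in> (weyl_part n d (- k) :: 'k weyl set)"
      using mono_part[OF vector_word_letters[of n v], of 1 d] by (simp add: word_deg_vector_word v(1))
    then have "wd n (vector_word n v) \<odot>\<^bsub>M\<^esub> m = \<zero>\<^bsub>M\<^esub>" by (rule less.prems(3))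
    moreover have "wd n (rev (map swap (vector_word n v))) \<in> carrier (weyl n :: 'k weyl ring)"
      using vector_word_letters[of n v] swap_letters by (intro wd_closed) auto
    ultimately have z: "wd n (rev (map swap (vector_word n v))) \<odot>\<^bsub>M\<^esub> (wd n (vector_word n v) \<odot>\<^bsub>M\<^esub> m) = \<zero>\<^bsub>M\<^esub>"
      by simp
    have Sclosed: "(theta n i \<oplus>\<^bsub>weyl n\<^esub> weyl_const n c) \<odot>\<^bsub>M\<^esub> w \<in> S" if i: "i \<le> n" and w: "w \<in> S" for i c w
    proof -
      let ?f = "theta n i \<oplus>\<^bsub>weyl n\<^esub> (weyl_const n c :: 'k weyl)"
      have wS: "w \<in> eig n d M k" "w \<in> carrier M" "\<And>P. P \<in> weyl_part n d (- k) \<Longrightarrow> P \<odot>\<^bsub>M\<^esub> w = \<zero>\<^bsub>M\<^esub>"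
        "\<And>j. j \<in> A \<Longrightarrow> theta n j \<odot>\<^bsub>M\<^esub> w = weyl_const n (of_int (t j)) \<odot>\<^bsub>M\<^esub> w"
        using w by (auto simp: S_def eig_iff)
      have f: "?f \<in> weyl_part n d 0" by (rule weyl_part_add[OF theta_part[OF i] weyl_part_const])
      note fc = weyl_part_carrier[OF f]
      have "?f \<odot>\<^bsub>M\<^esub> w \<in> eig n d M k" using eig_part[OF M f wS(1)] by simp
      moreover have "P \<odot>\<^bsub>M\<^esub> (?f \<odot>\<^bsub>M\<^esub> w) = \<zero>\<^bsub>M\<^esub>" if P: "P \<in> weyl_part n d (- k)" for P
        using wS(3)[of "P \<otimes>\<^bsub>weyl n\<^esub> ?f"] weyl_part_mult[OF P f] weyl_part_carrier[OF P] fc wS(2) by (simp add: smult_assoc1)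
      moreover have "theta n j \<odot>\<^bsub>M\<^esub> (?f \<odot>\<^bsub>M\<^esub> w) = weyl_const n (of_int (t j)) \<odot>\<^bsub>M\<^esub> (?f \<odot>\<^bsub>M\<^esub> w)" if j: "j \<in> A" for j
      proof -
        have jn: "j \<le> n" using j less.prems(1) by auto
        have "theta n j \<otimes>\<^bsub>weyl n\<^esub> ?f = ?f \<otimes>\<^bsub>weyl n\<^esub> theta n j"
          using theta_theta[OF jn i, where 'k = 'k] weyl_const_comm[OF euler_closed[of n "ind j"], where 'k = 'k]
          by (simp add: R.r_distr R.l_distr euler_closed weyl_const_closed)
        then have "theta n j \<odot>\<^bsub>M\<^esub> (?f \<odot>\<^bsub>M\<^esub> w) = ?f \<odot>\<^bsub>M\<^esub> (theta n j \<odot>\<^bsub>M\<^esub> w)"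
          using fc wS(2) by (simp add: euler_closed flip: smult_assoc1)
        also have "\<dots> = weyl_const n (of_int (t j)) \<odot>\<^bsub>M\<^esub> (?f \<odot>\<^bsub>M\<^esub> w)"
          unfolding wS(4)[OF j] by (rule const_smult_comm[OF M fc wS(2)])
        finally show ?thesis .
      qed
      ultimately show ?thesis by (simp add: S_def)
    qed
    have "m \<in> S" using less.prems by (simp add: S_def)
    moreover have "S \<subseteq> carrier M" by (auto simp: S_def eig_iff)
    ultimately obtain p l r w where plr: "vector_word n v = p @ l # r" and w: "w \<in> S" "w \<noteq> \<zero>\<^bsub>M\<^esub>"
      and kill: "(theta n (index l) \<oplus>\<^bsub>weyl n\<^esub> weyl_const n (- of_int (root l r))) \<odot>\<^bsub>M\<^esub> w = \<zero>\<^bsub>M\<^esub>"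
      using factor_kills[OF M vector_word_letters _ Sclosed _ m0 z] by blast
    let ?i = "index l" and ?c = "root l r"
    have wS: "w \<in> eig n d M k" "w \<in> carrier M" "\<And>P. P \<in> weyl_part n d (- k) \<Longrightarrow> P \<odot>\<^bsub>M\<^esub> w = \<zero>\<^bsub>M\<^esub>"
      "\<And>j. j \<in> A \<Longrightarrow> theta n j \<odot>\<^bsub>M\<^esub> w = weyl_const n (of_int (t j)) \<odot>\<^bsub>M\<^esub> w"
      using w(1) by (auto simp: S_def eig_iff)
    have "l \<in> letters n" using vector_word_letters[of n v] unfolding plr by simp
    then have i: "?i \<le> n" by (rule index_letters)
    have ev: "theta n ?i \<odot>\<^bsub>M\<^esub> w = weyl_const n (of_int ?c) \<odot>\<^bsub>M\<^esub> w"
    proof -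
      have "theta n ?i \<odot>\<^bsub>M\<^esub> w \<oplus>\<^bsub>M\<^esub> weyl_const n (- of_int ?c) \<odot>\<^bsub>M\<^esub> w = \<zero>\<^bsub>M\<^esub>"
        using kill wS(2) by (simp add: smult_l_distr euler_closed weyl_const_closed)
      moreover have "weyl_const n (of_int ?c) \<odot>\<^bsub>M\<^esub> w \<oplus>\<^bsub>M\<^esub> weyl_const n (- of_int ?c) \<odot>\<^bsub>M\<^esub> w = \<zero>\<^bsub>M\<^esub>"
        using wS(2) by (simp add: weyl_const_closed weyl_const_0 flip: smult_l_distr weyl_const_add)
      ultimately show ?thesis
        using wS(2) M.add.right_cancel[of "weyl_const n (- of_int ?c) \<odot>\<^bsub>M\<^esub> w" "theta n ?i \<odot>\<^bsub>M\<^esub> w" "weyl_const n (of_int ?c) \<odot>\<^bsub>M\<^esub> w"]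
        by (simp add: euler_closed weyl_const_closed)
    qed
    \<comment> \<open>At a known index the root would be a second eigenvalue, which the choice of
      \<open>v\<close> excludes; at a new index \<open>w\<close> satisfies the hypotheses for a
      larger set.\<close>
    show False
    proof (cases "?i \<in> A")
      case True
      have "?c \<noteq> t ?i" using root_vector_word[OF plr] v(2,3)[OF True] by linarith
      then have ne: "of_int (t ?i - ?c) \<noteq> (0 :: 'k)" by (metis eq_iff_diff_eq_0 of_int_eq_0_iff)
      have "weyl_const n (of_int (t ?i - ?c)) \<odot>\<^bsub>M\<^esub> w \<oplus>\<^bsub>M\<^esub> weyl_const n (of_int ?c) \<odot>\<^bsub>M\<^esub> w = weyl_const n (of_int (t ?i)) \<odot>\<^bsub>M\<^esub> w"
        using wS(2) by (simp add: weyl_const_closed flip: smult_l_distr weyl_const_add)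
      also have "\<dots> = \<zero>\<^bsub>M\<^esub> \<oplus>\<^bsub>M\<^esub> weyl_const n (of_int ?c) \<odot>\<^bsub>M\<^esub> w"
        using ev wS(4)[OF True] wS(2) by (simp add: weyl_const_closed)
      finally have "weyl_const n (of_int (t ?i - ?c)) \<odot>\<^bsub>M\<^esub> w = \<zero>\<^bsub>M\<^esub>"
        using wS(2) by (subst (asm) M.add.right_cancel) (auto simp: weyl_const_closed)
      then show False using const_smult_cancel[OF M wS(2) ne] w(2) by blast
    next
      case False
      have "card ({..n} - insert ?i A) < card ({..n} - A)"
        using i False by (intro psubset_card_mono) auto
      then have "w = \<zero>\<^bsub>M\<^esub>"
      proof (rule less.hyps)
        show "insert ?i A \<subseteq> {..n}" using less.prems(1) i by simp
        show "theta n j \<odot>\<^bsub>M\<^esub> w = weyl_const n (of_int ((t(?i := ?c)) j)) \<odot>\<^bsub>M\<^esub> w" if "j \<in> insert ?i A" for j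
        proof (cases "j = ?i")
          case True
          show ?thesis unfolding True using ev by simp
        next
          case False
          then show ?thesis using wS(4)[of j] that by simp
        qed
      qed (rule wS)+
      then show False using w(2) by simp
    qed
  qed
qed

lemma zero_separates: "left_module (weyl n) (M :: ('k::field_char_0, 'u) dmod) \<Longrightarrow> J_separates {0} M"
  unfolding J_separates_def using killed_eig_zero[where A = "{}"] by fastforce

text \<open>Generation is separation in the quotient by \<open>H\<close>: operators of degree -k
  send \<open>x\<close> into M_0, hence into \<open>H\<close>, so they kill the class of
  \<open>x\<close>.\<close>

lemma zero_generates:
  assumes M: "euler0 n d (M :: ('k::field_char_0, 'u) dmod)"
  shows "J_generates {0} M"
  unfolding J_generates_def
proof (intro allI impI subsetI)
  fix H k x assume H: "submodule H (weyl n) M" and 0: "\<forall>j\<in>{0}. eig n d M j \<subseteq> H" and k: "(k :: int) \<ge> 0" and x: "x \<in> eig n d M k"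
  note Ml = euler0D(1)[OF M]
  note Hf = submodule_facts[OF Ml H]
  interpret left_module "weyl n" M by (rule Ml)
  interpret abelian_subgroup H M by (rule Hf(6))
  have xc: "x \<in> carrier M" using x by (simp add: eig_iff)
  have "H +>\<^bsub>M\<^esub> x = \<zero>\<^bsub>quot_mod M H\<^esub>"
  proof (rule killed_eig_zero[OF left_module_quot[OF Ml H] k, where A = "{}"])
    show "H +>\<^bsub>M\<^esub> x \<in> eig n d (quot_mod M H) k" by (rule eig_quot[OF Ml H x])
    fix P :: "'k weyl" assume P: "P \<in> weyl_part n d (- k)"
    have "P \<odot>\<^bsub>M\<^esub> x \<in> H" using eig_part[OF Ml P x] 0 by auto
    then have "H +>\<^bsub>M\<^esub> (P \<odot>\<^bsub>M\<^esub> x) = H" by (rule a_rcos_const)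
    then show "P \<odot>\<^bsub>quot_mod M H\<^esub> (H +>\<^bsub>M\<^esub> x) = \<zero>\<^bsub>quot_mod M H\<^esub>"
      using quot_smult[OF Ml H weyl_part_carrier[OF P] xc] by (simp add: quot_mod_simps(2))
  qed auto
  then show "x \<in> H" using a_rcos_self[OF xc] by (simp add: quot_mod_simps(2))
qed

end

section \<open>Small submodules\<close>

text \<open>The elements of the submodule generated by \<open>B\<close> are values of finite lists
  of operators and generators, which bounds its size.\<close>

lemma small_span:
  assumes M: "left_module (weyl n) (M :: ('k::field_char_0, 'v) dmod)" and B: "B \<subseteq> eig n d M k"
    and inf: "infinite (UNIV :: 'u set)" and "embeds TYPE('u) (carrier (weyl n :: 'k weyl ring))" "embeds TYPE('u) B"
  obtains H where "submodule H (weyl n) M" "B \<subseteq> H" "H \<subseteq> gspan M (eig n d M)" "embeds TYPE('u) H"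
proof -
  interpret left_module "weyl n" M by fact
  define ev where "ev xs = foldr (\<lambda>(P, b) y. P \<odot>\<^bsub>M\<^esub> b \<oplus>\<^bsub>M\<^esub> y) xs \<zero>\<^bsub>M\<^esub>" for xs :: "('k weyl \<times> 'v) list"
  let ?L = "lists (carrier (weyl n :: 'k weyl ring) \<times> B)"
  have ev_simps: "ev [] = \<zero>\<^bsub>M\<^esub>" "ev ((P, b) # xs) = P \<odot>\<^bsub>M\<^esub> b \<oplus>\<^bsub>M\<^esub> ev xs" for P b xs
    by (simp_all add: ev_def)
  have Bc: "b \<in> carrier M" if "b \<in> B" for b using that B by (auto simp: eig_iff)
  have evc: "ev xs \<in> carrier M" if "xs \<in> ?L" for xs
    using that by (induction xs) (auto simp: ev_simps Bc)
  have eva: "ev (xs @ ys) = ev xs \<oplus>\<^bsub>M\<^esub> ev ys" if "xs \<in> ?L" "ys \<in> ?L" for xs ys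
    using that(1)
  proof (induction xs)
    case Nil
    then show ?case using evc[OF that(2)] by (simp add: ev_simps)
  next
    case (Cons a xs)
    then show ?case using evc[OF that(2)] evc[of xs] by (cases a) (auto simp: ev_simps Bc M.a_assoc)
  qed
  have evs: "r \<odot>\<^bsub>M\<^esub> ev xs = ev (map (\<lambda>(P, b). (r \<otimes>\<^bsub>weyl n\<^esub> P, b)) xs)" if "xs \<in> ?L" "r \<in> carrier (weyl n)" for xs r
    using that(1)
  proof (induction xs)
    case (Cons a xs)
    then show ?case using that(2) evc[of xs] by (cases a) (auto simp: ev_simps Bc smult_r_distr smult_assoc1)
  qed (use that(2) in \<open>simp add: ev_simps\<close>)
  have "submodule (ev ` ?L) (weyl n) M"
  proof (rule submoduleI'[OF M])
    show "ev ` ?L \<subseteq> carrier M" using evc by blast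
    show "\<zero>\<^bsub>M\<^esub> \<in> ev ` ?L" using ev_simps(1) by (intro image_eqI[of _ _ "[]"]) auto
    show "x \<oplus>\<^bsub>M\<^esub> y \<in> ev ` ?L" if xy: "x \<in> ev ` ?L" "y \<in> ev ` ?L" for x y
    proof -
      obtain xs ys where "xs \<in> ?L" "ys \<in> ?L" "x = ev xs" "y = ev ys" using xy by blast
      then show ?thesis using eva by (intro image_eqI[of _ _ "xs @ ys"]) auto
    qed
    show "r \<odot>\<^bsub>M\<^esub> x \<in> ev ` ?L" if r: "r \<in> carrier (weyl n)" and x: "x \<in> ev ` ?L" for r x
    proof -
      obtain xs where xs: "xs \<in> ?L" "x = ev xs" using x by blast
      have "map (\<lambda>(P, b). (r \<otimes>\<^bsub>weyl n\<^esub> P, b)) xs \<in> ?L" using xs(1) r by (induction xs) auto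
      then show ?thesis using evs[OF xs(1) r] xs(2) by blast
    qed
  qed
  moreover have "B \<subseteq> ev ` ?L"
  proof
    fix b assume b: "b \<in> B"
    then have "ev [(\<one>\<^bsub>weyl n\<^esub>, b)] = b" using Bc[OF b] by (simp add: ev_simps)
    then show "b \<in> ev ` ?L" using b by (intro image_eqI[of _ _ "[(\<one>\<^bsub>weyl n\<^esub>, b)]"]) auto
  qed
  moreover have "ev ` ?L \<subseteq> gspan M (eig n d M)"
  proof
    note g = submodule_facts[OF M gspan_submodule[OF M, of d]]
    have Bg: "b \<in> gspan M (eig n d M)" if "b \<in> B" for b by (rule gspan.part[where V = "eig n d M" and k = k]) (rule subsetD[OF B that])
    fix x assume "x \<in> ev ` ?L"
    then obtain xs where "xs \<in> ?L" "x = ev xs" by blast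
    moreover have "ev xs \<in> gspan M (eig n d M)" if "xs \<in> ?L" for xs
      using that
    proof (induction xs)
      case (Cons a xs)
      obtain P b where a: "a = (P, b)" "P \<in> carrier (weyl n)" "b \<in> B" using Cons.hyps(1) by auto
      show ?case unfolding a(1) ev_simps by (rule g(3)[OF g(5)[OF a(2) Bg[OF a(3)]] Cons.IH])
    qed (use g(2) in \<open>simp add: ev_simps\<close>)
    ultimately show "x \<in> gspan M (eig n d M)" by simp
  qed
  moreover have "embeds TYPE('u) (ev ` ?L)"
    by (intro embeds_image embeds_lists embeds_Times inf assms(4,5))
  ultimately show thesis by (rule that)
qed

text \<open>From a module of arbitrary size only the submodule generated by \<open>B\<close> is
  kept. Its weight spaces are intersections with those of \<open>M\<close>, so a whole weight space
  taken as \<open>B\<close> survives unchanged, and a weight space that is zero stays zero.\<close>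

lemma small_module:
  assumes M: "left_module (weyl n) (M :: ('k::field_char_0, 'v) dmod)" and B: "B \<subseteq> eig n d M k"
    and inf: "infinite (UNIV :: 'u set)" and D: "embeds TYPE('u) (carrier (weyl n :: 'k weyl ring))" and "embeds TYPE('u) B"
  obtains T :: "('k::field_char_0, 'u) dmod" and s where "euler0 n d T" "inj_on s (carrier T)" "B \<subseteq> s ` carrier T"
    "\<And>x y. \<lbrakk>x \<in> carrier T; y \<in> carrier T\<rbrakk> \<Longrightarrow> s (x \<oplus>\<^bsub>T\<^esub> y) = s x \<oplus>\<^bsub>M\<^esub> s y"
    "\<And>r x. \<lbrakk>r \<in> carrier (weyl n); x \<in> carrier T\<rbrakk> \<Longrightarrow> s (r \<odot>\<^bsub>T\<^esub> x) = r \<odot>\<^bsub>M\<^esub> s x"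
    "\<And>j x. x \<in> eig n d T j \<longleftrightarrow> x \<in> carrier T \<and> s x \<in> eig n d M j" "s \<zero>\<^bsub>T\<^esub> = \<zero>\<^bsub>M\<^esub>"
proof -
  obtain H where H: "submodule H (weyl n) M" "B \<subseteq> H" "H \<subseteq> gspan M (eig n d M)" "embeds TYPE('u) H"
    using small_span[OF assms] .
  let ?M = "M\<lparr>carrier := H\<rparr>"
  have E: "euler0 n d ?M" by (rule euler0_sub_gspan[OF M H(1,3)])
  have "embeds TYPE('u) (carrier ?M)" using H(4) by simp
  then show thesis
  proof (rule transport_module[OF euler0D(1)[OF E] E])
    fix T :: "('k, 'u) dmod" and s
    assume T: "euler0 n d T" and s: "bij_betw s (carrier T) (carrier ?M)"
      and sa: "\<And>x y. \<lbrakk>x \<in> carrier T; y \<in> carrier T\<rbrakk> \<Longrightarrow> s (x \<oplus>\<^bsub>T\<^esub> y) = s x \<oplus>\<^bsub>?M\<^esub> s y"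
      and sm: "\<And>r x. \<lbrakk>r \<in> carrier (weyl n); x \<in> carrier T\<rbrakk> \<Longrightarrow> s (r \<odot>\<^bsub>T\<^esub> x) = r \<odot>\<^bsub>?M\<^esub> s x"
      and se: "\<And>k x. x \<in> eig n d T k \<longleftrightarrow> x \<in> carrier T \<and> s x \<in> eig n d ?M k"
      and s0: "s \<zero>\<^bsub>T\<^esub> = \<zero>\<^bsub>?M\<^esub>"
    have sH: "s x \<in> H" if "x \<in> carrier T" for x using s that by (auto simp: bij_betw_def)
    show thesis
    proof (rule that[OF T])
      show "inj_on s (carrier T)" using s by (simp add: bij_betw_def)
      show "B \<subseteq> s ` carrier T" using s H(2) by (simp add: bij_betw_def)
      show "x \<in> eig n d T j \<longleftrightarrow> x \<in> carrier T \<and> s x \<in> eig n d M j" for j x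
        using se[of x j] sH[of x] by (auto simp: eig_restrict[OF submodule_facts(1)[OF M H(1)]])
    qed (use sa sm s0 in simp_all)
  qed
qed

context weights
begin

lemma mod_cat_isoI:
  assumes M: "left_module R M" and N: "left_module R N" and f: "f \<in> mod_homs R M N" and bij: "bij_betw f (carrier M) (carrier N)"
  shows "is_iso (mod_cat R) M N f"
proof -
  interpret M: left_module R M by fact
  interpret N: left_module R N by fact
  note f' = mod_homsD[OF f]
  define g where "g = (\<lambda>y\<in>carrier N. inv_into (carrier M) f y)"
  have gf: "g (f x) = x" if "x \<in> carrier M" for x
    using that bij f'(1) by (auto simp: g_def bij_betw_def)
  have ex: "\<exists>x\<in>carrier M. y = f x" if "y \<in> carrier N" for y
    using bij_betw_ex[OF bij that] by auto
  have "g \<in> mod_homs R N M"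
  proof (rule mod_homsI)
    fix y z assume y: "y \<in> carrier N" and z: "z \<in> carrier N"
    obtain x where x: "x \<in> carrier M" "y = f x" using ex[OF y] by blast
    obtain w where w: "w \<in> carrier M" "z = f w" using ex[OF z] by blast
    show "g (y \<oplus>\<^bsub>N\<^esub> z) = g y \<oplus>\<^bsub>M\<^esub> g z"
      using gf[of "x \<oplus>\<^bsub>M\<^esub> w"] gf x w by (simp add: f'(3))
  next
    fix y assume y: "y \<in> carrier N"
    obtain x where x: "x \<in> carrier M" "y = f x" using ex[OF y] by blast
    show "g y \<in> carrier M" using x gf by simp
    show "g (r \<odot>\<^bsub>N\<^esub> y) = r \<odot>\<^bsub>M\<^esub> g y" if "r \<in> carrier R" for r
      using gf[of "r \<odot>\<^bsub>M\<^esub> x"] gf x that by (simp add: f'(4))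
  qed (simp add: g_def)
  moreover have "compose (carrier M) g f = (\<lambda>x\<in>carrier M. x)" using gf by (auto simp: compose_def fun_eq_iff)
  moreover have "f (g y) = y" if "y \<in> carrier N" for y
    using ex[OF that] gf by auto
  then have "compose (carrier N) f g = (\<lambda>x\<in>carrier N. x)" by (auto simp: compose_def fun_eq_iff)
  ultimately show ?thesis unfolding is_iso_def mod_cat_simps using f by blast
qed

text \<open>Coinduction from degree 0 gives a module with degree zero part \<open>N\<close>; the
  submodule generated by this part has the same degree zero part and fits into the universe.\<close>

lemma delta_eso:
  assumes inf: "infinite (UNIV :: 'u set)" and D: "embeds TYPE('u) (carrier (weyl n :: 'k::field_char_0 weyl ring))"
    and N: "left_module (weyl0_mod_euler n d) (N :: ('k weyl set, 'u) module)"
  shows "\<exists>T f. euler0 n d T \<and> is_iso (mod_cat (weyl0_mod_euler n d)) (deg0_mod n d T) N f"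
proof -
  interpret N: left_module "weyl0_mod_euler n d" N by fact
  let ?act = "\<lambda>P. smult N (coset0 n d P)"
  note c0 = coset0_facts[where n = n and d = d and 'k = 'k]
  \<comment> \<open>With degree 0 as the only degree, the condition on the Euler field says that it
    acts as zero, which holds because its coset is zero.\<close>
  interpret c: partial_module n d N "{0}" "\<lambda>j. carrier N" ?act
  proof (intro partial_module.intro partial_module_axioms.intro weights_axioms N.M.abelian_group_axioms)
    show "additive_subgroup (carrier N) N"
      by (intro additive_subgroupI' N.M.abelian_group_axioms) auto
    fix j y assume j: "j \<in> {0 :: int}" and y: "y \<in> carrier N"
    have "coset0 n d (weyl_const n (of_int j)) = (\<zero>\<^bsub>weyl0_mod_euler n d\<^esub> :: 'k weyl set)"
      using j c0(5) by (simp add: weyl_const_0)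
    then show "?act (euler n d) y = ?act (weyl_const n (of_int j)) y" using c0(6) by simp
  qed (auto simp: c0 N.smult_r_distr N.smult_l_distr N.smult_assoc1)
  note M = c.left_module_coind
  have bij: "bij_betw (\<lambda>Z. Z \<one>\<^bsub>weyl n\<^esub> 0) (eig n d c.coind 0) (carrier N)" by (rule c.coind_eig_bij) simp
  have "embeds TYPE('u) (eig n d c.coind 0)"
    using bij unfolding embeds_def bij_betw_def by blast
  note small = small_module[OF M subset_refl inf D this]
  obtain T :: "('k, 'u) dmod" and s where T: "euler0 n d T" and s: "inj_on s (carrier T)" "eig n d c.coind 0 \<subseteq> s ` carrier T"
    and sa: "\<And>x y. \<lbrakk>x \<in> carrier T; y \<in> carrier T\<rbrakk> \<Longrightarrow> s (x \<oplus>\<^bsub>T\<^esub> y) = s x \<oplus>\<^bsub>c.coind\<^esub> s y"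
    and sm: "\<And>r x. \<lbrakk>r \<in> carrier (weyl n); x \<in> carrier T\<rbrakk> \<Longrightarrow> s (r \<odot>\<^bsub>T\<^esub> x) = r \<odot>\<^bsub>c.coind\<^esub> s x"
    and se: "\<And>k x. x \<in> eig n d T k \<longleftrightarrow> x \<in> carrier T \<and> s x \<in> eig n d c.coind k" and "s \<zero>\<^bsub>T\<^esub> = \<zero>\<^bsub>c.coind\<^esub>"
  proof (rule small, goal_cases)
    case (1 T s)
    show ?case by (rule that) (fact 1)+
  qed
  have se0: "x \<in> eigenspace n d T 0 \<longleftrightarrow> x \<in> carrier T \<and> s x \<in> eig n d c.coind 0" for x
    using se[of x 0] by simp
  have bs: "bij_betw s (eigenspace n d T 0) (eig n d c.coind 0)"
    unfolding bij_betw_def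
  proof (intro conjI equalityI subsetI)
    show "inj_on s (eigenspace n d T 0)" using s(1) by (rule inj_on_subset) (auto simp: se0)
    fix Z assume Z: "Z \<in> eig n d c.coind 0"
    then obtain x where "x \<in> carrier T" "s x = Z" using s(2) by blast
    then show "Z \<in> s ` eigenspace n d T 0" using Z by (auto simp: se0)
  qed (auto simp: se0)
  define f where "f = (\<lambda>x\<in>eigenspace n d T 0. s x \<one>\<^bsub>weyl n\<^esub> 0)"
  have fbij: "bij_betw f (carrier (deg0_mod n d T)) (carrier N)"
  proof -
    have b: "bij_betw ((\<lambda>Z. Z \<one>\<^bsub>weyl n\<^esub> 0) \<circ> s) (eigenspace n d T 0) (carrier N)" by (rule bij_betw_trans[OF bs bij])
    have "f x = ((\<lambda>Z. Z \<one>\<^bsub>weyl n\<^esub> 0) \<circ> s) x" if "x \<in> eigenspace n d T 0" for x using that by (simp add: f_def)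
    then show ?thesis unfolding deg0_simps by (rule bij_betw_cong[THEN iffD2, OF _ b])
  qed
  note Tl = euler0D(1)[OF T]
  interpret T: graded_group T "eig n d T" by (rule euler0D[OF T])
  have "f \<in> mod_homs (weyl0_mod_euler n d) (deg0_mod n d T) N"
  proof (rule mod_homsI)
    show "f \<in> extensional (carrier (deg0_mod n d T))" by (simp add: f_def deg0_simps)
    show "f x \<in> carrier N" if "x \<in> carrier (deg0_mod n d T)" for x using fbij that by (auto simp: bij_betw_def)
    show "f (x \<oplus>\<^bsub>deg0_mod n d T\<^esub> y) = f x \<oplus>\<^bsub>N\<^esub> f y"
      if "x \<in> carrier (deg0_mod n d T)" "y \<in> carrier (deg0_mod n d T)" for x y
      using that T.V_add[of x 0 y] by (simp add: f_def deg0_simps se0 sa c.coind_simps)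
    fix S x assume S: "S \<in> carrier (weyl0_mod_euler n d :: 'k weyl set ring)" and "x \<in> carrier (deg0_mod n d T)"
    then have x: "x \<in> eigenspace n d T 0" by (simp add: deg0_simps)
    obtain P where P: "P \<in> weyl_part n d 0" "S = coset0 n d P" using weyl0_mod_euler_cases[OF S] .
    have sx: "s x \<in> eig n d c.coind 0" "x \<in> carrier T" using x by (auto simp: se0)
    have "f (S \<odot>\<^bsub>deg0_mod n d T\<^esub> x) = (P \<odot>\<^bsub>c.coind\<^esub> s x) \<one>\<^bsub>weyl n\<^esub> 0"
      using eig0_closed[OF Tl P(1) x] sm[OF weyl_part_carrier[OF P(1)] sx(2)] by (simp add: P(2) deg0_smult[OF Tl P(1) x] f_def)
    also have "\<dots> = s x P 0" by (rule c.coind_smult[OF weyl_part_carrier[OF P(1)]]) simp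
    also have "\<dots> = S \<odot>\<^bsub>N\<^esub> f x" using c.coind_eig_value[OF sx(1) P(1)] x by (simp add: P(2) f_def)
    finally show "f (S \<odot>\<^bsub>deg0_mod n d T\<^esub> x) = S \<odot>\<^bsub>N\<^esub> f x" .
  qed
  then have "is_iso (mod_cat (weyl0_mod_euler n d)) (deg0_mod n d T) N f"
    using fbij by (intro mod_cat_isoI left_module_deg0 Tl N)
  then show ?thesis using T by blast
qed

end

lemma (in coprime_weights) D_affine_coprime:
  assumes inf: "infinite (UNIV :: 'u set)" and D: "embeds TYPE('u) (carrier (weyl n :: 'k::field_char_0 weyl ring))"
  shows "D_affine TYPE('k) TYPE('u) n d"
proof -
  obtain \<alpha> where \<alpha>: "nat_iso (qcoh n d :: (('k, 'u) dmod, 'u frac set) cat) (mod_cat (weyl0_mod_euler n d)) (gamma0 n d) delta \<alpha>"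
    using gamma0_nat_iso(2)[OF inf] by blast
  show ?thesis
    unfolding D_affine_def
  proof (rule nat_iso_equivalence[OF gamma0_nat_iso(1)[OF inf] is_functor_delta \<alpha>])
    fix M N :: "('k, 'u) dmod"
    assume "M \<in> Obj (qcoh n d :: (('k, 'u) dmod, 'u frac set) cat)" "N \<in> Obj (qcoh n d :: (('k, 'u) dmod, 'u frac set) cat)"
    then have O: "euler0 n d M" "euler0 n d N" by (auto simp: qcoh_simps)
    show "bij_betw (amap delta M N) (Hom (qcoh n d) M N) (Hom (mod_cat (weyl0_mod_euler n d)) (omap delta M) (omap delta N))"
      using delta_bij[OF O zero_separates[OF euler0D(1)[OF O(2)]] zero_generates[OF O(1)]] by (simp add: mod_cat_simps delta_simps(1))
  next
    fix N :: "('k weyl set, 'u) module" assume "N \<in> Obj (mod_cat (weyl0_mod_euler n d))"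
    then have "left_module (weyl0_mod_euler n d) N" by (simp add: mod_cat_simps)
    from delta_eso[OF inf D this]
    show "\<exists>M\<in>Obj (qcoh n d :: (('k, 'u) dmod, 'u frac set) cat). \<exists>e. is_iso (mod_cat (weyl0_mod_euler n d)) (omap delta M) N e"
      by (auto simp: qcoh_simps(1) delta_simps(1))
  qed
qed

section \<open>Weyl algebra modules with non-integral monomials\<close>

text \<open>The operators of multiplication by \<open>x\<^sub>i\<close> and of differentiation on formal sums
  \<open>\<Sum>\<^sub>a v a x\<^bsup>a + \<mu>\<^esup>\<close>, \<open>a\<close> ranging over integral exponents.\<close>

fun lact :: "(nat \<Rightarrow> 'k::field) \<Rightarrow> letter \<Rightarrow> ((nat \<Rightarrow> int) \<Rightarrow> 'k) \<Rightarrow> (nat \<Rightarrow> int) \<Rightarrow> 'k" where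
  "lact \<mu> (Lx i) v = (\<lambda>a. v (a(i := a i - 1)))"
| "lact \<mu> (Ld i) v = (\<lambda>a. (of_int (a i) + 1 + \<mu> i) * v (a(i := a i + 1)))"

abbreviation wact :: "(nat \<Rightarrow> 'k::field) \<Rightarrow> letter list \<Rightarrow> ((nat \<Rightarrow> int) \<Rightarrow> 'k) \<Rightarrow> (nat \<Rightarrow> int) \<Rightarrow> 'k" where
  "wact \<mu> w v \<equiv> foldr (lact \<mu>) w v"

lemma wact_add: "wact \<mu> w (\<lambda>a. u a + v a) = (\<lambda>a. wact \<mu> w u a + wact \<mu> w v a)"
proof (induction w)
  case (Cons l w)
  then show ?case by (cases l) (simp_all add: distrib_left)
qed simp

lemma wact_scale: "wact \<mu> w (\<lambda>a. c * v a) = (\<lambda>a. c * wact \<mu> w v a)"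
proof (induction w)
  case (Cons l w)
  then show ?case by (cases l) (simp_all add: mult.left_commute)
qed simp

definition free_act :: "(nat \<Rightarrow> 'k::field) \<Rightarrow> (letter list \<Rightarrow> 'k) \<Rightarrow> ((nat \<Rightarrow> int) \<Rightarrow> 'k) \<Rightarrow> (nat \<Rightarrow> int) \<Rightarrow> 'k" where
  "free_act \<mu> f v = (\<lambda>a. \<Sum>w | f w \<noteq> 0. f w * wact \<mu> w v a)"

lemma free_act_eq:
  assumes "finite A" "{w. f w \<noteq> 0} \<subseteq> A"
  shows "free_act \<mu> f v a = (\<Sum>w\<in>A. f w * wact \<mu> w v a)"
  unfolding free_act_def by (rule sum.mono_neutral_left) (use assms in auto)

lemma free_act_zero: "free_act \<mu> (\<lambda>w. 0) v = (\<lambda>a. 0)"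
  by (simp add: free_act_def)

lemma free_act_add:
  assumes "f \<in> carrier (free_alg n)" "g \<in> carrier (free_alg n)"
  shows "free_act \<mu> (\<lambda>w. f w + g w) v = (\<lambda>a. free_act \<mu> f v a + free_act \<mu> g v a)"
proof
  fix a
  have "free_act \<mu> h v a = (\<Sum>w\<in>{w. f w \<noteq> 0} \<union> {w. g w \<noteq> 0}. h w * wact \<mu> w v a)"
    if "{w. h w \<noteq> 0} \<subseteq> {w. f w \<noteq> 0} \<union> {w. g w \<noteq> 0}" for h
    using assms that by (intro free_act_eq) (auto simp: free_alg_carrier)
  note this[of f] this[of g]
  moreover have "free_act \<mu> (\<lambda>w. f w + g w) v a = (\<Sum>w\<in>{w. f w \<noteq> 0} \<union> {w. g w \<noteq> 0}. (f w + g w) * wact \<mu> w v a)"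
    using assms by (intro free_act_eq) (auto simp: free_alg_carrier)
  ultimately show "free_act \<mu> (\<lambda>w. f w + g w) v a = free_act \<mu> f v a + free_act \<mu> g v a"
    by (simp add: distrib_right sum.distrib)
qed

lemma free_act_mono: "free_act \<mu> (mono c w) v = (\<lambda>a. c * wact \<mu> w v a)"
proof
  fix a
  have "free_act \<mu> (mono c w) v a = (\<Sum>u\<in>{w}. mono c w u * wact \<mu> u v a)"
    by (rule free_act_eq) (auto simp: mono_def)
  then show "free_act \<mu> (mono c w) v a = c * wact \<mu> w v a" by (simp add: mono_def)
qed

lemma free_act_vadd: "free_act \<mu> f (\<lambda>a. u a + v a) = (\<lambda>a. free_act \<mu> f u a + free_act \<mu> f v a)"
  by (simp add: free_act_def wact_add distrib_left sum.distrib)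

lemma free_act_mult:
  assumes f: "f \<in> carrier (free_alg n)" and g: "g \<in> carrier (free_alg n)"
  shows "free_act \<mu> (f \<otimes>\<^bsub>free_alg n\<^esub> g) v = free_act \<mu> f (free_act \<mu> g v)"
proof -
  interpret ring "free_alg n :: (letter list \<Rightarrow> 'k::field) ring" by (rule ring_free_alg)
  have m: "free_act \<mu> (mono c u \<otimes>\<^bsub>free_alg n\<^esub> g) v = free_act \<mu> (mono c u) (free_act \<mu> g v)" if u: "u \<in> lists (letters n)" for c u
    using g
  proof (induction g rule: free_alg_induct)
    case zero
    have "mono c u \<otimes>\<^bsub>free_alg n\<^esub> (\<lambda>w. 0) = (\<lambda>w. 0)"
      using r_null[OF mono_carrier[OF u]] by (simp add: free_alg_simps)
    then show ?case using wact_scale[of \<mu> u 0] by (simp add: free_act_zero free_act_mono)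
  next
    case (add w h)
    note c = mono_carrier[OF u, of c] mono_carrier[OF add(1), of "g w"] add(3)
    have "free_act \<mu> (mono c u \<otimes>\<^bsub>free_alg n\<^esub> (mono (g w) w \<oplus>\<^bsub>free_alg n\<^esub> h)) v
        = (\<lambda>a. free_act \<mu> (mono c u \<otimes>\<^bsub>free_alg n\<^esub> mono (g w) w) v a + free_act \<mu> (mono c u \<otimes>\<^bsub>free_alg n\<^esub> h) v a)"
      unfolding r_distr[OF c(2,3,1)] unfolding free_alg_simps(4) by (rule free_act_add[OF m_closed[OF c(1,2)] m_closed[OF c(1,3)]])
    also have "free_act \<mu> (mono c u \<otimes>\<^bsub>free_alg n\<^esub> mono (g w) w) v = free_act \<mu> (mono c u) (free_act \<mu> (mono (g w) w) v)"
      by (simp add: mono_mult free_act_mono wact_scale mult.assoc)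
    finally show ?case unfolding add(5) free_alg_simps(4) free_act_add[OF c(2,3)] free_act_vadd .
  qed
  show ?thesis
    using f
  proof (induction f rule: free_alg_induct)
    case zero
    have "(\<lambda>w. 0) \<otimes>\<^bsub>free_alg n\<^esub> g = (\<lambda>w. 0)"
      using l_null[OF g] by (simp add: free_alg_simps)
    then show ?case by (simp add: free_act_zero)
  next
    case (add w h)
    note c = mono_carrier[OF add(1), of "f w"] add(3)
    show ?case
      unfolding l_distr[OF c g] unfolding free_alg_simps(4) free_act_add[OF c] free_act_add[OF m_closed[OF c(1) g] m_closed[OF c(2) g]] m[OF add(1)] add(5) ..
  qed
qed

lemma weyl_rels_act:
  assumes "r \<in> weyl_rels n"
  shows "free_act \<mu> r v = (\<lambda>a. 0)"
proof -
  \<comment> \<open>All three families of relations have this shape; \<open>b\<close> switches the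
    constant term on.\<close>
  have d: "free_act \<mu> (\<lambda>w. word u w - word u' w - (if b then word [] w else 0)) v a
      = wact \<mu> u v a - wact \<mu> u' v a - (if b then v a else 0)" for u u' b a
  proof -
    have "free_act \<mu> (\<lambda>w. word u w - word u' w - (if b then word [] w else 0)) v a
        = (\<Sum>w\<in>{u, u', []}. (word u w - word u' w - (if b then word [] w else 0)) * wact \<mu> w v a)"
      by (rule free_act_eq) (auto simp: word_def split: if_splits)
    also have "\<dots> = (\<Sum>w\<in>{u, u', []}. (if w = u then wact \<mu> w v a else 0) - (if w = u' then wact \<mu> w v a else 0)
        - (if w = [] then if b then wact \<mu> w v a else 0 else 0))"
      by (intro sum.cong refl) (auto simp: word_def algebra_simps)
    finally show ?thesis by (simp only: sum_subtractf) (simp add: sum.delta' del: sum.insert)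
  qed
  consider (xx) i j where "r = (\<lambda>w. word [Lx i, Lx j] w - word [Lx j, Lx i] w - (if False then word [] w else 0))"
    | (dd) i j where "r = (\<lambda>w. word [Ld i, Ld j] w - word [Ld j, Ld i] w - (if False then word [] w else 0))"
    | (dx) i j where "r = (\<lambda>w. word [Ld i, Lx j] w - word [Lx j, Ld i] w - (if i = j then word [] w else 0))"
    using assms unfolding weyl_rels_def by auto
  then show ?thesis
  proof cases
    case xx
    then show ?thesis unfolding xx d by (cases "i = j") (auto simp: fun_eq_iff fun_upd_twist)
  next
    case dd
    then show ?thesis unfolding dd d by (cases "i = j") (auto simp: fun_eq_iff fun_upd_twist mult.left_commute)
  next
    case dx
    then show ?thesis unfolding dx d by (cases "i = j") (auto simp: fun_eq_iff fun_upd_twist algebra_simps)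
  qed
qed

text \<open>The elements that act as zero form a two-sided ideal containing the relations.\<close>

lemma weyl_ideal_act:
  assumes "f \<in> (weyl_ideal n :: (letter list \<Rightarrow> 'k::field) set)"
  shows "free_act \<mu> f v = (\<lambda>a. 0)"
proof -
  interpret ring "free_alg n :: (letter list \<Rightarrow> 'k) ring" by (rule ring_free_alg)
  let ?I = "{f \<in> carrier (free_alg n). \<forall>v. free_act \<mu> f v = (\<lambda>a. 0)}"
  have scale: "free_act \<mu> f (\<lambda>a. 0) = (\<lambda>a. 0)" for f
    using wact_scale[of \<mu> _ 0] by (simp add: free_act_def)
  have "ideal ?I (free_alg n)"
  proof (rule idealI[OF ring_axioms])
    show "subgroup ?I (add_monoid (free_alg n))"
    proof (rule additive_subgroup.a_subgroup, rule additive_subgroupI'[OF abelian_group_axioms])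
      show "\<zero>\<^bsub>free_alg n\<^esub> \<in> ?I" using zero_closed by (simp add: free_alg_simps free_act_zero)
      show "f \<oplus>\<^bsub>free_alg n\<^esub> g \<in> ?I" if "f \<in> ?I" "g \<in> ?I" for f g
        using that add.m_closed[of f g] free_act_add[of f n g] by (simp add: free_alg_simps)
      show "\<ominus>\<^bsub>free_alg n\<^esub> f \<in> ?I" if f: "f \<in> ?I" for f
      proof -
        have c: "f \<in> carrier (free_alg n)" "\<ominus>\<^bsub>free_alg n\<^esub> f \<in> carrier (free_alg n)" using f by auto
        have "(\<lambda>w. f w + (\<ominus>\<^bsub>free_alg n\<^esub> f) w) = (\<lambda>w. 0)" using r_neg[OF c(1)] by (simp add: free_alg_simps)
        then have "(\<lambda>a. free_act \<mu> f v a + free_act \<mu> (\<ominus>\<^bsub>free_alg n\<^esub> f) v a) = (\<lambda>a. 0)" for v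
          using free_act_add[OF c, of \<mu> v] by (simp add: free_act_zero)
        then show ?thesis using f c(2) by simp
      qed
    qed auto
  qed (auto simp: free_act_mult scale)
  moreover have "weyl_rels n \<subseteq> ?I" using weyl_rels_carrier weyl_rels_act by blast
  ultimately have "weyl_ideal n \<subseteq> ?I" unfolding weyl_ideal_def by (rule genideal_minimal)
  then show ?thesis using assms by blast
qed

definition lmod :: "nat \<Rightarrow> (nat \<Rightarrow> 'k) \<Rightarrow> ('k::field, (nat \<Rightarrow> int) \<Rightarrow> 'k) dmod" where
  "lmod n \<mu> = \<lparr>carrier = UNIV, mult = undefined, one = undefined, zero = (\<lambda>a. 0), add = (\<lambda>u v a. u a + v a),
    smult = (\<lambda>P. free_act \<mu> (SOME f. f \<in> carrier (free_alg n) \<and> P = weyl_class n f))\<rparr>"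

lemma lmod_simps:
  "carrier (lmod n \<mu>) = UNIV" "\<zero>\<^bsub>lmod n \<mu>\<^esub> = (\<lambda>a. 0)" "u \<oplus>\<^bsub>lmod n \<mu>\<^esub> v = (\<lambda>a. u a + v a)"
  by (simp_all add: lmod_def)

lemma lmod_smult:
  assumes f: "f \<in> carrier (free_alg n)"
  shows "weyl_class n f \<odot>\<^bsub>lmod n \<mu>\<^esub> v = free_act \<mu> f v"
proof -
  define g where "g = (SOME g. g \<in> carrier (free_alg n) \<and> weyl_class n f = weyl_class n g)"
  have g: "g \<in> carrier (free_alg n)" "weyl_class n f = weyl_class n g"
    using someI[of "\<lambda>g. g \<in> carrier (free_alg n) \<and> weyl_class n f = weyl_class n g"] f unfolding g_def by auto
  then have I: "(\<lambda>w. f w - g w) \<in> weyl_ideal n" using weyl_class_eq_iff[OF f g(1)] by simp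
  then have "(\<lambda>w. f w - g w) \<in> carrier (free_alg n)"
    using ideal.Icarr[OF ideal_weyl_ideal] by blast
  from free_act_add[OF this g(1), of \<mu> v] have "free_act \<mu> f v = free_act \<mu> g v"
    by (simp add: weyl_ideal_act[OF I])
  then show ?thesis by (simp add: lmod_def g_def)
qed

lemma left_module_lmod: "left_module (weyl n) (lmod n \<mu>)"
proof (intro left_module.intro left_module_axioms.intro ring_weyl)
  show "abelian_group (lmod n \<mu>)"
  proof (rule abelian_groupI)
    fix x assume "x \<in> carrier (lmod n \<mu>)"
    show "\<exists>y\<in>carrier (lmod n \<mu>). y \<oplus>\<^bsub>lmod n \<mu>\<^esub> x = \<zero>\<^bsub>lmod n \<mu>\<^esub>"
      by (rule bexI[of _ "\<lambda>a. - x a"]) (simp_all add: lmod_simps)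
  qed (simp_all add: lmod_simps add_ac)
  fix P Q :: "'a weyl" and x y assume P: "P \<in> carrier (weyl n)"
  obtain f where f: "f \<in> carrier (free_alg n)" "P = weyl_class n f" using weyl_class_surj[OF P] .
  show "P \<odot>\<^bsub>lmod n \<mu>\<^esub> x \<in> carrier (lmod n \<mu>)" by (simp add: lmod_simps)
  show "P \<odot>\<^bsub>lmod n \<mu>\<^esub> (x \<oplus>\<^bsub>lmod n \<mu>\<^esub> y) = P \<odot>\<^bsub>lmod n \<mu>\<^esub> x \<oplus>\<^bsub>lmod n \<mu>\<^esub> P \<odot>\<^bsub>lmod n \<mu>\<^esub> y"
    unfolding f(2) lmod_smult[OF f(1)] lmod_simps by (rule free_act_vadd)
  assume Q: "Q \<in> carrier (weyl n)"
  obtain g where g: "g \<in> carrier (free_alg n)" "Q = weyl_class n g" using weyl_class_surj[OF Q] .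
  interpret F: ring "free_alg n :: (letter list \<Rightarrow> 'a) ring" by (rule ring_free_alg)
  show "(P \<oplus>\<^bsub>weyl n\<^esub> Q) \<odot>\<^bsub>lmod n \<mu>\<^esub> x = P \<odot>\<^bsub>lmod n \<mu>\<^esub> x \<oplus>\<^bsub>lmod n \<mu>\<^esub> Q \<odot>\<^bsub>lmod n \<mu>\<^esub> x"
    using lmod_smult[OF F.a_closed[OF f(1) g(1)], of \<mu> x] weyl_class_add[OF f(1) g(1)] free_act_add[OF f(1) g(1), of \<mu> x]
    by (simp add: f(2) g(2) lmod_smult f(1) g(1) lmod_simps free_alg_simps)
  show "P \<otimes>\<^bsub>weyl n\<^esub> Q \<odot>\<^bsub>lmod n \<mu>\<^esub> x = P \<odot>\<^bsub>lmod n \<mu>\<^esub> (Q \<odot>\<^bsub>lmod n \<mu>\<^esub> x)"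
    using lmod_smult[OF F.m_closed[OF f(1) g(1)], of \<mu> x] weyl_class_mult[OF f(1) g(1)] free_act_mult[OF f(1) g(1), of \<mu> x]
    by (simp add: f(2) g(2) lmod_smult f(1) g(1))
next
  fix x
  show "\<one>\<^bsub>weyl n\<^esub> \<odot>\<^bsub>lmod n \<mu>\<^esub> x = x"
    using lmod_smult[OF mono_carrier[of "[]" n 1], of \<mu> x] free_act_mono[of \<mu> 1 "[]" x]
    by (simp flip: weyl_const_1 add: weyl_const_eq)
qed

text \<open>The monomial with exponent a + \<mu> is an eigenvector of every x_i\<partial>_i, with
  eigenvalue a_i + \<mu>_i.\<close>

lemma lmod_euler:
  "euler n d \<odot>\<^bsub>lmod n \<mu>\<^esub> v = (\<lambda>a. (\<Sum>i\<le>n. of_nat (d i) * (of_int (a i) + \<mu> i)) * v a)"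
proof -
  interpret left_module "weyl n" "lmod n \<mu>" by (rule left_module_lmod)
  have fs: "finsum (lmod n \<mu>) g A = (\<lambda>a. \<Sum>i\<in>A. g i a)" if "finite A" for g and A :: "nat set"
    using that by (induction A rule: finite_induct) (simp_all add: M.finsum_insert lmod_simps)
  have t: "weyl_const n (of_nat (d i)) \<odot>\<^bsub>lmod n \<mu>\<^esub> (weyl_x n i \<odot>\<^bsub>lmod n \<mu>\<^esub> (weyl_d n i \<odot>\<^bsub>lmod n \<mu>\<^esub> v))
      = (\<lambda>a. of_nat (d i) * (of_int (a i) + \<mu> i) * v a)" if i: "i \<in> {..n}" for i
  proof -
    have l: "[Lx i] \<in> lists (letters n)" "[Ld i] \<in> lists (letters n)" using i by (auto simp: letters_def)
    show ?thesis
      unfolding weyl_const_eq weyl_x_def weyl_d_def word_eq_mono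
        lmod_smult[OF mono_carrier[OF l(1)]] lmod_smult[OF mono_carrier[OF l(2)]] lmod_smult[OF mono_carrier[OF lists.Nil]] free_act_mono
      by (simp add: mult.assoc)
  qed
  have v: "v \<in> carrier (lmod n \<mu>)" by (simp add: lmod_simps)
  have "euler n d \<odot>\<^bsub>lmod n \<mu>\<^esub> v = finsum (lmod n \<mu>) (\<lambda>i a. of_nat (d i) * (of_int (a i) + \<mu> i) * v a) {..n}"
    unfolding euler_smult[OF left_module_lmod v]
    by (intro M.finsum_cong' refl) (simp_all add: lmod_simps t)
  then show ?thesis by (simp add: fs sum_distrib_right)
qed

section \<open>Failure of D-affinity for weights with a common factor\<close>

context weights
begin

lemma no_weight_zero_ex:
  assumes g: "Gcd (d ` {..n}) \<noteq> 1"
  obtains M :: "('k::field_char_0, (nat \<Rightarrow> int) \<Rightarrow> 'k) dmod" and e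
  where "left_module (weyl n) M" "eig n d M 0 = {\<zero>\<^bsub>M\<^esub>}" "e \<in> eig n d M 1" "e \<noteq> \<zero>\<^bsub>M\<^esub>"
proof -
  define \<mu> :: "nat \<Rightarrow> 'k" where "\<mu> i = (if i = 0 then 1 / of_nat (d 0) else 0)" for i
  have \<mu>: "of_nat (d i) * \<mu> i = (if i = 0 then 1 else 0)" for i
    using pos[of 0] by (simp add: \<mu>_def)
  have sum: "(\<Sum>i\<le>n. of_nat (d i) * (of_int (a i) + \<mu> i)) = of_int ((\<Sum>i\<le>n. int (d i) * a i) + 1)" for a
    by (simp add: distrib_left sum.distrib \<mu>)
  let ?M = "lmod n \<mu>"
  have eig: "v \<in> eig n d ?M k \<longleftrightarrow> (\<forall>a. of_int ((\<Sum>i\<le>n. int (d i) * a i) + 1) * v a = of_int k * v a)" for v k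
    unfolding eig_iff lmod_euler sum weyl_const_eq lmod_smult[OF mono_carrier[OF lists.Nil]] free_act_mono
    by (simp add: lmod_simps fun_eq_iff)
  show thesis
  proof (rule that[OF left_module_lmod])
    have ne: "(\<Sum>i\<le>n. int (d i) * a i) + 1 \<noteq> 0" for a
    proof
      assume z: "(\<Sum>i\<le>n. int (d i) * a i) + 1 = 0"
      have "int (Gcd (d ` {..n})) dvd (\<Sum>i\<le>n. int (d i) * a i)"
        by (intro dvd_sum dvd_mult2) (auto intro: Gcd_dvd)
      then have "int (Gcd (d ` {..n})) dvd 1" using z by (metis dvd_add_right_iff dvd_0_right)
      then show False using g by simp
    qed
    have "v = (\<lambda>a. 0)" if v: "v \<in> eig n d ?M 0" for v
    proof
      fix a
      have "of_int ((\<Sum>i\<le>n. int (d i) * a i) + 1) * v a = 0" using v unfolding eig by simp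
      moreover have "of_int ((\<Sum>i\<le>n. int (d i) * a i) + 1) \<noteq> (0 :: 'k)" using ne[of a] by (subst of_int_eq_0_iff)
      ultimately show "v a = 0" by (metis mult_eq_0_iff)
    qed
    moreover have "(\<lambda>a. 0) \<in> eig n d ?M 0" unfolding eig by simp
    ultimately show "eig n d ?M 0 = {\<zero>\<^bsub>?M\<^esub>}" unfolding lmod_simps by blast
    show "(\<lambda>a. if a = (\<lambda>i. 0) then 1 else 0) \<in> eig n d ?M 1" unfolding eig by simp
    show "(\<lambda>a. if a = (\<lambda>i. 0) then 1 else 0) \<noteq> \<zero>\<^bsub>?M\<^esub>" by (auto simp: lmod_simps fun_eq_iff)
  qed
qed

text \<open>If \<open>T\<^sup>0 = 0\<close> then \<open>\<Gamma>\<^sub>0\<close> identifies the identity of \<open>T\<close> with the zero morphism.\<close>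

lemma D_affine_weight_zero:
  assumes inf: "infinite (UNIV :: 'u set)" and T: "euler0 n d (T :: ('k::field_char_0, 'u) dmod)"
    and 0: "eig n d T 0 = {\<zero>\<^bsub>T\<^esub>}" and e: "e \<in> eig n d T k" "k \<ge> 0" "e \<noteq> \<zero>\<^bsub>T\<^esub>"
  shows "\<not> D_affine TYPE('k) TYPE('u) n d"
proof
  assume A: "D_affine TYPE('k) TYPE('u) n d"
  let ?Q = "qcoh n d :: (('k, 'u) dmod, 'u frac set) cat"
  have O: "T \<in> Obj ?Q" using T by (simp add: qcoh_simps)
  obtain \<alpha> where \<alpha>: "nat_iso ?Q (mod_cat (weyl0_mod_euler n d)) (gamma0 n d) delta \<alpha>"
    using gamma0_nat_iso(2)[OF inf] by blast
  have inj: "inj_on (amap delta T T) (Hom ?Q T T)"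
    by (rule nat_iso_faithful[OF gamma0_nat_iso(1)[OF inf] is_functor_delta \<alpha> O O
      equivalence_faithful[OF A[unfolded D_affine_def] O O]])
  interpret left_module "weyl n" T by (rule euler0D(1)[OF T])
  interpret graded_group T "eig n d T" by (rule euler0D(2)[OF T])
  have q: "bij_betw (qhom nonneg T T) (Hom ?Q T T) (J_homs nonneg T T)"
    by (rule qhom_bij[OF T T subset_refl nonneg_separates[OF euler0D(1)[OF T]] nonneg_generates])
  \<comment> \<open>The zero family is an arrow of the quotient. It differs from the identity at
    \<open>e\<close>, but has the same image under \<open>delta\<close>.\<close>
  have hz: "(\<lambda>x\<in>J_dom nonneg T. \<zero>\<^bsub>T\<^esub>) \<in> J_homs nonneg T T"
  proof -
    have *: "x \<in> J_dom nonneg T" if "x \<in> eig n d T j" "0 \<le> j" for x j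
      unfolding J_dom_def by (rule UN_I[of j]) (use that in simp_all)
    show ?thesis
      unfolding J_homs_def
    proof (intro CollectI conjI ballI allI impI)
      fix j q x P assume "j \<in> nonneg" "q + j \<in> nonneg" "(P :: 'k weyl) \<in> weyl_part n d q" "x \<in> eig n d T j"
      note weyl_part_carrier[OF this(3)] and P = *[OF eig_part[OF euler0D(1)[OF T] this(3,4)]] *[OF this(4)] and jq = this(1,2)
      then show "(\<lambda>x\<in>J_dom nonneg T. \<zero>\<^bsub>T\<^esub>) (P \<odot>\<^bsub>T\<^esub> x) = P \<odot>\<^bsub>T\<^esub> (\<lambda>x\<in>J_dom nonneg T. \<zero>\<^bsub>T\<^esub>) x"
        by simp
    qed (use * *[OF V_add] V_zero in \<open>auto simp del: of_int_add\<close>)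
  qed
  obtain Z where Z: "Z \<in> Hom ?Q T T" "qhom nonneg T T Z = (\<lambda>x\<in>J_dom nonneg T. \<zero>\<^bsub>T\<^esub>)"
    using bij_betw_ex[OF q hz] by metis
  note I = qcoh_Id(1)[OF T] qcoh_Id(2)[OF T subset_refl nonneg_separates[OF euler0D(1)[OF T]]]
  have "eigenspace n d T 0 = {\<zero>\<^bsub>T\<^esub>}" using 0 by simp
  then have "amap delta T T Z = amap delta T T (Id ?Q T)"
    unfolding delta_simps Z(2) I(2) by (auto simp: restrict_def)
  then have "Z = Id ?Q T" by (rule inj_onD[OF inj _ Z(1) I(1)])
  then have "(\<lambda>x\<in>J_dom nonneg T. \<zero>\<^bsub>T\<^esub>) e = (\<lambda>x\<in>J_dom nonneg T. x) e" using Z(2) I(2) by simp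
  moreover have "e \<in> J_dom nonneg T"
    unfolding J_dom_def by (rule UN_I[of k]) (use e in simp_all)
  ultimately show False using e(3) by simp
qed

text \<open>The submodule generated by the monomial of weight 1 has a copy in the universe, and its
  weight zero space is still trivial.\<close>

lemma not_D_affine:
  assumes inf: "infinite (UNIV :: 'u set)" and D: "embeds TYPE('u) (carrier (weyl n :: 'k::field_char_0 weyl ring))"
    and g: "Gcd (d ` {..n}) \<noteq> 1"
  shows "\<not> D_affine TYPE('k) TYPE('u) n d"
proof -
  obtain M :: "('k, (nat \<Rightarrow> int) \<Rightarrow> 'k) dmod" and e
    where M: "left_module (weyl n) M" and 0: "eig n d M 0 = {\<zero>\<^bsub>M\<^esub>}" and e: "e \<in> eig n d M 1" "e \<noteq> \<zero>\<^bsub>M\<^esub>"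
    using no_weight_zero_ex[OF g] .
  have B: "{e} \<subseteq> eig n d M 1" "embeds TYPE('u) {e}" using e(1) by (simp_all add: embeds_def)
  show ?thesis
  proof (rule small_module[OF M B(1) inf D B(2)])
    fix T :: "('k, 'u) dmod" and s
    assume T: "euler0 n d T" and s: "inj_on s (carrier T)" "{e} \<subseteq> s ` carrier T"
      and se: "\<And>j x. x \<in> eig n d T j \<longleftrightarrow> x \<in> carrier T \<and> s x \<in> eig n d M j" and s0: "s \<zero>\<^bsub>T\<^esub> = \<zero>\<^bsub>M\<^esub>"
    interpret T: left_module "weyl n" T by (rule euler0D(1)[OF T])
    have "x = \<zero>\<^bsub>T\<^esub>" if "x \<in> eig n d T 0" for x
      using that se[of x 0] 0 s0 inj_onD[OF s(1), of x "\<zero>\<^bsub>T\<^esub>"] by auto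
    moreover have "\<zero>\<^bsub>T\<^esub> \<in> eig n d T 0" using se[of "\<zero>\<^bsub>T\<^esub>" 0] s0 0 by auto
    ultimately have T0: "eig n d T 0 = {\<zero>\<^bsub>T\<^esub>}" by blast
    obtain x where x: "x \<in> carrier T" "s x = e" using s(2) by auto
    then have "x \<in> eig n d T 1" using se[of x 1] e(1) by simp
    then show ?thesis
      by (rule D_affine_weight_zero[OF inf T T0]) (use x s0 e(2) in auto)
  qed
qed

end

theorem corollary18:
  fixes n :: nat and d :: "nat \<Rightarrow> nat"
    and \<iota> :: "'k::{alg_closed_field, field_char_0} \<Rightarrow> 'u"
  assumes "n \<ge> 1"
    and "0 < d 0"
    and "mono_on {..n} d"
    and "inj \<iota>"
  shows "D_affine TYPE('k) TYPE('u) n d \<longleftrightarrow> Gcd (d ` {..n}) = 1"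
proof -
  \<comment> \<open>In characteristic zero the natural numbers embed into the field and hence into
    the universe, which is therefore infinite.\<close>
  have "inj (\<iota> \<circ> of_nat)" by (rule inj_compose[OF \<open>inj \<iota>\<close> inj_of_nat])
  then have inf: "infinite (UNIV :: 'u set)" using infinite_super[OF subset_UNIV range_inj_infinite] by blast
  have D: "embeds TYPE('u) (carrier (weyl n :: 'k weyl ring))" using embeds_weyl[OF inf \<open>inj \<iota>\<close>] .
  have "weights n d"
  proof
    fix i assume "i \<le> n"
    then have "d 0 \<le> d i" using mono_onD[OF \<open>mono_on {..n} d\<close>, of 0 i] by simp
    then show "0 < d i" using \<open>0 < d 0\<close> by simp
  qed
  then interpret weights n d .
  show ?thesis
  proof
    assume "Gcd (d ` {..n}) = 1"
    then interpret coprime_weights n d by unfold_locales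
    show "D_affine TYPE('k) TYPE('u) n d" by (rule D_affine_coprime[OF inf D])
  qed (use not_D_affine[OF inf D] in blast)
qed

end
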